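(* Let $R$ be a Dedekind ring, let $A$ be an $R$-algebra and let $B$ be a left $A$-module such that both $A$ and $B$ are flat over $R$. Then $B$ is flat over $A$ if and only if $B_k$ is flat over $A_k$ for $k$ being the fraction field of $R$ and for $k$ being any residue field of $R$.
   Context: Algebras are associative and unital, not necessarily commutative. For an $R$-module $M$ and $k$ the fraction field of $R$ or a residue field $R/\mathfrak m$ ($\mathfrak m$ a maximal ideal), $M_k:=M\otimes_R k$. *)

theory Defs
  imports "HOL-Algebra.Free_Abelian_Groups" "HOL-Algebra.Algebra"
begin

section \<open>Modules over noncommutative rings, and algebras\<close>

text \<open>
  The library's \<^locale>\<open>module\<close> requires a commutative ring of scalars and its \<^locale>\<open>algebra\<close>
  is commutative. As in the library, the multiplication and the unit of a module record are
  meaningless, unless the record stands for an algebra.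
\<close>

locale left_module = A?: ring A + M?: abelian_group M
  for A :: "('a, 'x) ring_scheme" (structure) and M :: "('a, 'm, 'y) module_scheme" (structure) +
  assumes lsmult_closed:
      "\<lbrakk>a \<in> carrier A; x \<in> carrier M\<rbrakk> \<Longrightarrow> a \<odot>\<^bsub>M\<^esub> x \<in> carrier M"
    and lsmult_l_distr:
      "\<lbrakk>a \<in> carrier A; b \<in> carrier A; x \<in> carrier M\<rbrakk> \<Longrightarrow>
        (a \<oplus>\<^bsub>A\<^esub> b) \<odot>\<^bsub>M\<^esub> x = a \<odot>\<^bsub>M\<^esub> x \<oplus>\<^bsub>M\<^esub> b \<odot>\<^bsub>M\<^esub> x"
    and lsmult_r_distr:
      "\<lbrakk>a \<in> carrier A; x \<in> carrier M; y \<in> carrier M\<rbrakk> \<Longrightarrow>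
        a \<odot>\<^bsub>M\<^esub> (x \<oplus>\<^bsub>M\<^esub> y) = a \<odot>\<^bsub>M\<^esub> x \<oplus>\<^bsub>M\<^esub> a \<odot>\<^bsub>M\<^esub> y"
    and lsmult_assoc:
      "\<lbrakk>a \<in> carrier A; b \<in> carrier A; x \<in> carrier M\<rbrakk> \<Longrightarrow>
        (a \<otimes>\<^bsub>A\<^esub> b) \<odot>\<^bsub>M\<^esub> x = a \<odot>\<^bsub>M\<^esub> (b \<odot>\<^bsub>M\<^esub> x)"
    and lsmult_one:
      "x \<in> carrier M \<Longrightarrow> \<one>\<^bsub>A\<^esub> \<odot>\<^bsub>M\<^esub> x = x"

text \<open>In a right module, \<open>a \<odot>\<^bsub>M\<^esub> x\<close> stands for the product usually written \<open>x a\<close>.\<close>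

locale right_module = A?: ring A + M?: abelian_group M
  for A :: "('a, 'x) ring_scheme" (structure) and M :: "('a, 'm, 'y) module_scheme" (structure) +
  assumes rsmult_closed:
      "\<lbrakk>a \<in> carrier A; x \<in> carrier M\<rbrakk> \<Longrightarrow> a \<odot>\<^bsub>M\<^esub> x \<in> carrier M"
    and rsmult_l_distr:
      "\<lbrakk>a \<in> carrier A; b \<in> carrier A; x \<in> carrier M\<rbrakk> \<Longrightarrow>
        (a \<oplus>\<^bsub>A\<^esub> b) \<odot>\<^bsub>M\<^esub> x = a \<odot>\<^bsub>M\<^esub> x \<oplus>\<^bsub>M\<^esub> b \<odot>\<^bsub>M\<^esub> x"
    and rsmult_r_distr:
      "\<lbrakk>a \<in> carrier A; x \<in> carrier M; y \<in> carrier M\<rbrakk> \<Longrightarrow>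
        a \<odot>\<^bsub>M\<^esub> (x \<oplus>\<^bsub>M\<^esub> y) = a \<odot>\<^bsub>M\<^esub> x \<oplus>\<^bsub>M\<^esub> a \<odot>\<^bsub>M\<^esub> y"
    and rsmult_assoc:
      "\<lbrakk>a \<in> carrier A; b \<in> carrier A; x \<in> carrier M\<rbrakk> \<Longrightarrow>
        (a \<otimes>\<^bsub>A\<^esub> b) \<odot>\<^bsub>M\<^esub> x = b \<odot>\<^bsub>M\<^esub> (a \<odot>\<^bsub>M\<^esub> x)"
    and rsmult_one:
      "x \<in> carrier M \<Longrightarrow> \<one>\<^bsub>A\<^esub> \<odot>\<^bsub>M\<^esub> x = x"

definition mod_hom ::
  "('a, 'x) ring_scheme \<Rightarrow> ('a, 'm, 'y) module_scheme \<Rightarrow> ('a, 'n, 'z) module_scheme \<Rightarrow> ('m \<Rightarrow> 'n) set"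
  where "mod_hom A M N =
    {f \<in> carrier M \<rightarrow> carrier N.
       (\<forall>x\<in>carrier M. \<forall>y\<in>carrier M. f (x \<oplus>\<^bsub>M\<^esub> y) = f x \<oplus>\<^bsub>N\<^esub> f y) \<and>
       (\<forall>a\<in>carrier A. \<forall>x\<in>carrier M. f (a \<odot>\<^bsub>M\<^esub> x) = a \<odot>\<^bsub>N\<^esub> f x)}"

locale assoc_algebra = module R A + ring A
  for R :: "('r, 'x) ring_scheme" (structure) and A :: "('r, 'a, 'y) module_scheme" (structure) +
  assumes smult_mult_left:
      "\<lbrakk>r \<in> carrier R; a \<in> carrier A; b \<in> carrier A\<rbrakk> \<Longrightarrow>
        (r \<odot>\<^bsub>A\<^esub> a) \<otimes>\<^bsub>A\<^esub> b = r \<odot>\<^bsub>A\<^esub> (a \<otimes>\<^bsub>A\<^esub> b)"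
    and smult_mult_right:
      "\<lbrakk>r \<in> carrier R; a \<in> carrier A; b \<in> carrier A\<rbrakk> \<Longrightarrow>
        a \<otimes>\<^bsub>A\<^esub> (r \<odot>\<^bsub>A\<^esub> b) = r \<odot>\<^bsub>A\<^esub> (a \<otimes>\<^bsub>A\<^esub> b)"

definition restrict_scalars ::
  "('r, 'a, 'y) module_scheme \<Rightarrow> ('a, 'b, 'z) module_scheme \<Rightarrow> ('r, 'b) module"
  where "restrict_scalars A B =
    \<lparr>carrier = carrier B, monoid.mult = monoid.mult B, one = \<one>\<^bsub>B\<^esub>, ring.zero = \<zero>\<^bsub>B\<^esub>, ring.add = ring.add B,
     smult = (\<lambda>r b. (r \<odot>\<^bsub>A\<^esub> \<one>\<^bsub>A\<^esub>) \<odot>\<^bsub>B\<^esub> b)\<rparr>"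

definition algebra_via :: "('k, 'x) ring_scheme \<Rightarrow> ('r \<Rightarrow> 'k) \<Rightarrow> ('r, 'k) module"
  where "algebra_via k \<phi> =
    \<lparr>carrier = carrier k, monoid.mult = monoid.mult k, one = \<one>\<^bsub>k\<^esub>, ring.zero = \<zero>\<^bsub>k\<^esub>, ring.add = ring.add k,
     smult = (\<lambda>r x. \<phi> r \<otimes>\<^bsub>k\<^esub> x)\<rparr>"


section \<open>Tensor products\<close>

text \<open>
  The tensor product of a right \<open>A\<close>-module \<open>M\<close> and a left \<open>A\<close>-module \<open>N\<close> is the free abelian group
  on \<open>M \<times> N\<close> (written additively, with \<open>frag_of\<close> for the basis vectors) modulo the usual relations.
  For a commutative ring a left module is also a right module, by means of the same record.
\<close>

definition tensor_gens ::
  "('a, 'x) ring_scheme \<Rightarrow> ('a, 'm, 'y) module_scheme \<Rightarrow> ('a, 'n, 'z) module_scheme \<Rightarrow>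
     ('m \<times> 'n \<Rightarrow>\<^sub>0 int) set"
  where "tensor_gens A M N =
    {frag_of (x \<oplus>\<^bsub>M\<^esub> x', y) - frag_of (x, y) - frag_of (x', y) | x x' y.
       x \<in> carrier M \<and> x' \<in> carrier M \<and> y \<in> carrier N} \<union>
    {frag_of (x, y \<oplus>\<^bsub>N\<^esub> y') - frag_of (x, y) - frag_of (x, y') | x y y'.
       x \<in> carrier M \<and> y \<in> carrier N \<and> y' \<in> carrier N} \<union>
    {frag_of (a \<odot>\<^bsub>M\<^esub> x, y) - frag_of (x, a \<odot>\<^bsub>N\<^esub> y) | a x y.
       a \<in> carrier A \<and> x \<in> carrier M \<and> y \<in> carrier N}"

definition tensor_rel ::
  "('a, 'x) ring_scheme \<Rightarrow> ('a, 'm, 'y) module_scheme \<Rightarrow> ('a, 'n, 'z) module_scheme \<Rightarrow>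
     ('m \<times> 'n \<Rightarrow>\<^sub>0 int) set"
  where "tensor_rel A M N =
    generate (free_Abelian_group (carrier M \<times> carrier N)) (tensor_gens A M N)"

definition tensor ::
  "('a, 'x) ring_scheme \<Rightarrow> ('a, 'm, 'y) module_scheme \<Rightarrow> ('a, 'n, 'z) module_scheme \<Rightarrow>
     ('m \<times> 'n \<Rightarrow>\<^sub>0 int) set monoid"
  where "tensor A M N = free_Abelian_group (carrier M \<times> carrier N) Mod tensor_rel A M N"

definition tensor_class ::
  "('a, 'x) ring_scheme \<Rightarrow> ('a, 'm, 'y) module_scheme \<Rightarrow> ('a, 'n, 'z) module_scheme \<Rightarrow>
     ('m \<times> 'n \<Rightarrow>\<^sub>0 int) \<Rightarrow> ('m \<times> 'n \<Rightarrow>\<^sub>0 int) set"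
  where "tensor_class A M N u =
    tensor_rel A M N #>\<^bsub>free_Abelian_group (carrier M \<times> carrier N)\<^esub> u"

text \<open>
  The map \<open>f \<otimes> B\<close> from \<open>M \<otimes>\<^sub>A B\<close> to \<open>N \<otimes>\<^sub>A B\<close>. Here and below, the value at a coset is the union
  of the cosets of the values at all representatives, as in the library's \<^const>\<open>rcoset_mult\<close>;
  these cosets coincide.
\<close>

definition tensor_map ::
  "('a, 'x) ring_scheme \<Rightarrow> ('a, 'n, 'y) module_scheme \<Rightarrow> ('a, 'b, 'z) module_scheme \<Rightarrow> ('m \<Rightarrow> 'n) \<Rightarrow>
     ('m \<times> 'b \<Rightarrow>\<^sub>0 int) set \<Rightarrow> ('n \<times> 'b \<Rightarrow>\<^sub>0 int) set"
  where "tensor_map A N B f P =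
    (\<Union>u\<in>P. tensor_class A N B (frag_extend (\<lambda>(x, b). frag_of (f x, b)) u))"

text \<open>
  \<open>B\<close> is a flat left \<open>A\<close>-module if tensoring with \<open>B\<close> preserves the injectivity of homomorphisms
  of right \<open>A\<close>-modules. A definition cannot quantify over types, so the test modules \<open>M\<close> and \<open>N\<close> live
  in the type of lists over the type of \<open>A\<close>. Every finitely generated right \<open>A\<close>-module is isomorphic
  to one in this type, since it is a quotient of some \<open>A\<^sup>n\<close>, and these suffice; see
  \<open>flat_tensor_map_inj\<close> below for test modules in arbitrary types.
\<close>

definition flat :: "('a, 'x) ring_scheme \<Rightarrow> ('a, 'b, 'z) module_scheme \<Rightarrow> bool"
  where "flat A B \<longleftrightarrow> left_module A B \<and>
    (\<forall>(M :: ('a, 'a list) module) (N :: ('a, 'a list) module) f.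
       right_module A M \<longrightarrow> right_module A N \<longrightarrow> f \<in> mod_hom A M N \<longrightarrow> inj_on f (carrier M) \<longrightarrow>
       inj_on (tensor_map A N B f) (carrier (tensor A M B)))"


section \<open>Base change\<close>

text \<open>
  For an \<open>R\<close>-algebra \<open>A\<close>, a left \<open>A\<close>-module \<open>B\<close>, and a homomorphism \<open>\<phi>\<close> from \<open>R\<close> to a commutative
  ring \<open>k\<close>: the ring \<open>A \<otimes>\<^sub>R k\<close>, with \<open>(a \<otimes> x) (b \<otimes> y) = ab \<otimes> xy\<close>, and the left module \<open>B \<otimes>\<^sub>R k\<close>
  over it, with \<open>(a \<otimes> x) (b \<otimes> y) = ab \<otimes> xy\<close> as well. Both products extend a pair of products
  \<open>\<mu>\<close> and \<open>\<nu>\<close> on the factors biadditively.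
\<close>

definition tensor_product ::
  "('r, 'x) ring_scheme \<Rightarrow> ('r, 'b, 'y) module_scheme \<Rightarrow> ('r, 'k, 'z) module_scheme \<Rightarrow>
     ('a \<Rightarrow> 'b \<Rightarrow> 'b) \<Rightarrow> ('k \<Rightarrow> 'k \<Rightarrow> 'k) \<Rightarrow>
     ('a \<times> 'k \<Rightarrow>\<^sub>0 int) set \<Rightarrow> ('b \<times> 'k \<Rightarrow>\<^sub>0 int) set \<Rightarrow> ('b \<times> 'k \<Rightarrow>\<^sub>0 int) set"
  where "tensor_product R B K \<mu> \<nu> P Q =
    (\<Union>u\<in>P. \<Union>v\<in>Q. tensor_class R B K
       (frag_extend (\<lambda>(a, x). frag_extend (\<lambda>(b, y). frag_of (\<mu> a b, \<nu> x y)) v) u))"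

definition base_change_ring ::
  "('r, 'x) ring_scheme \<Rightarrow> ('r, 'a, 'y) module_scheme \<Rightarrow> ('k, 'z) ring_scheme \<Rightarrow> ('r \<Rightarrow> 'k) \<Rightarrow>
     ('a \<times> 'k \<Rightarrow>\<^sub>0 int) set ring"
  where "base_change_ring R A k \<phi> = (let K = algebra_via k \<phi>; T = tensor R A K in
    \<lparr>carrier = carrier T,
     monoid.mult = tensor_product R A K (monoid.mult A) (monoid.mult k),
     one = tensor_class R A K (frag_of (\<one>\<^bsub>A\<^esub>, \<one>\<^bsub>k\<^esub>)),
     ring.zero = \<one>\<^bsub>T\<^esub>, ring.add = monoid.mult T\<rparr>)"

definition base_change_module ::
  "('r, 'x) ring_scheme \<Rightarrow> ('r, 'a, 'y) module_scheme \<Rightarrow> ('a, 'b, 'w) module_scheme \<Rightarrow>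
     ('k, 'z) ring_scheme \<Rightarrow> ('r \<Rightarrow> 'k) \<Rightarrow>
     (('a \<times> 'k \<Rightarrow>\<^sub>0 int) set, ('b \<times> 'k \<Rightarrow>\<^sub>0 int) set) module"
  where "base_change_module R A B k \<phi> =
    (let K = algebra_via k \<phi>; B' = restrict_scalars A B; T = tensor R B' K in
    \<lparr>carrier = carrier T, monoid.mult = undefined, one = undefined, ring.zero = \<one>\<^bsub>T\<^esub>, ring.add = monoid.mult T,
     smult = tensor_product R B' K (smult B) (monoid.mult k)\<rparr>)"


section \<open>Fraction fields and Dedekind rings\<close>

definition frac_eq :: "('r, 'x) ring_scheme \<Rightarrow> (('r \<times> 'r) \<times> ('r \<times> 'r)) set"
  where "frac_eq R = {((a, b), (c, d)).
    a \<in> carrier R \<and> b \<in> carrier R - {\<zero>\<^bsub>R\<^esub>} \<and> c \<in> carrier R \<and> d \<in> carrier R - {\<zero>\<^bsub>R\<^esub>} \<and>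
    a \<otimes>\<^bsub>R\<^esub> d = c \<otimes>\<^bsub>R\<^esub> b}"

definition fraction :: "('r, 'x) ring_scheme \<Rightarrow> 'r \<Rightarrow> 'r \<Rightarrow> ('r \<times> 'r) set"
  where "fraction R a b = frac_eq R `` {(a, b)}"

definition fraction_field :: "('r, 'x) ring_scheme \<Rightarrow> ('r \<times> 'r) set ring"
  where "fraction_field R =
    \<lparr>carrier = (carrier R \<times> (carrier R - {\<zero>\<^bsub>R\<^esub>})) // frac_eq R,
     monoid.mult = (\<lambda>P Q. \<Union>(a, b)\<in>P. \<Union>(c, d)\<in>Q. fraction R (a \<otimes>\<^bsub>R\<^esub> c) (b \<otimes>\<^bsub>R\<^esub> d)),
     one = fraction R \<one>\<^bsub>R\<^esub> \<one>\<^bsub>R\<^esub>,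
     ring.zero = fraction R \<zero>\<^bsub>R\<^esub> \<one>\<^bsub>R\<^esub>,
     ring.add = (\<lambda>P Q. \<Union>(a, b)\<in>P. \<Union>(c, d)\<in>Q.
       fraction R ((a \<otimes>\<^bsub>R\<^esub> d) \<oplus>\<^bsub>R\<^esub> (c \<otimes>\<^bsub>R\<^esub> b)) (b \<otimes>\<^bsub>R\<^esub> d))\<rparr>"

definition to_fraction_field :: "('r, 'x) ring_scheme \<Rightarrow> 'r \<Rightarrow> ('r \<times> 'r) set"
  where "to_fraction_field R r = fraction R r \<one>\<^bsub>R\<^esub>"

text \<open>Polynomials are the library's coefficient lists, with the leading coefficient first.\<close>

definition integrally_closed :: "('r, 'x) ring_scheme \<Rightarrow> bool"
  where "integrally_closed R \<longleftrightarrow>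
    (\<forall>x \<in> carrier (fraction_field R). \<forall>p.
       p \<noteq> [] \<longrightarrow> polynomial\<^bsub>fraction_field R\<^esub> (to_fraction_field R ` carrier R) p \<longrightarrow>
       lead_coeff p = \<one>\<^bsub>fraction_field R\<^esub> \<longrightarrow>
       ring.eval (fraction_field R) p x = \<zero>\<^bsub>fraction_field R\<^esub> \<longrightarrow>
       x \<in> to_fraction_field R ` carrier R)"

text \<open>Fields count as Dedekind rings.\<close>

definition dedekind_ring :: "('r, 'x) ring_scheme \<Rightarrow> bool"
  where "dedekind_ring R \<longleftrightarrow> noetherian_domain R \<and> integrally_closed R \<and>
    (\<forall>P. primeideal P R \<longrightarrow> P \<noteq> {\<zero>\<^bsub>R\<^esub>} \<longrightarrow> maximalideal P R)"


section \<open>The choice of test modules in the definition of flatness\<close>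

text \<open>
  \<open>flat_tensor_map_inj\<close>: over a flat module, the injectivity of homomorphisms is preserved for right
  modules in arbitrary types.
\<close>

lemma generate_free_props:
  assumes "H \<subseteq> carrier (free_Abelian_group S)"
  shows "0 \<in> generate (free_Abelian_group S) H"
    "u \<in> generate (free_Abelian_group S) H \<Longrightarrow> v \<in> generate (free_Abelian_group S) H \<Longrightarrow>
      u + v \<in> generate (free_Abelian_group S) H"
    "u \<in> generate (free_Abelian_group S) H \<Longrightarrow> - u \<in> generate (free_Abelian_group S) H"
    "u \<in> generate (free_Abelian_group S) H \<Longrightarrow> Poly_Mapping.keys u \<subseteq> S"
proof -
  interpret F: comm_group "free_Abelian_group S" by (rule abelian_free_Abelian_group)
  show "0 \<in> generate (free_Abelian_group S) H"
    using generate.one[of "free_Abelian_group S" H] by simp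
  show "u \<in> generate (free_Abelian_group S) H \<Longrightarrow> v \<in> generate (free_Abelian_group S) H \<Longrightarrow>
      u + v \<in> generate (free_Abelian_group S) H"
    using generate.eng[of u "free_Abelian_group S" H v] by simp
  show k: "u \<in> generate (free_Abelian_group S) H \<Longrightarrow> Poly_Mapping.keys u \<subseteq> S" for u
    using F.generate_in_carrier[OF assms, of u] by simp
  show "u \<in> generate (free_Abelian_group S) H \<Longrightarrow> - u \<in> generate (free_Abelian_group S) H"
    using F.generate_m_inv_closed[OF assms, of u] k[of u] by simp
qed

lemma tensor_gensE [consumes 1, case_names left right middle]:
  assumes "u \<in> tensor_gens A M N"
  obtains x x' y where "u = frag_of (x \<oplus>\<^bsub>M\<^esub> x', y) - frag_of (x, y) - frag_of (x', y)"
      "x \<in> carrier M" "x' \<in> carrier M" "y \<in> carrier N"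
  | x y y' where "u = frag_of (x, y \<oplus>\<^bsub>N\<^esub> y') - frag_of (x, y) - frag_of (x, y')"
      "x \<in> carrier M" "y \<in> carrier N" "y' \<in> carrier N"
  | a x y where "u = frag_of (a \<odot>\<^bsub>M\<^esub> x, y) - frag_of (x, a \<odot>\<^bsub>N\<^esub> y)"
      "a \<in> carrier A" "x \<in> carrier M" "y \<in> carrier N"
  using assms unfolding tensor_gens_def by blast

lemma tensor_gensI:
  "x \<in> carrier M \<Longrightarrow> x' \<in> carrier M \<Longrightarrow> y \<in> carrier N \<Longrightarrow>
    frag_of (x \<oplus>\<^bsub>M\<^esub> x', y) - frag_of (x, y) - frag_of (x', y) \<in> tensor_gens A M N"
  "x \<in> carrier M \<Longrightarrow> y \<in> carrier N \<Longrightarrow> y' \<in> carrier N \<Longrightarrow>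
    frag_of (x, y \<oplus>\<^bsub>N\<^esub> y') - frag_of (x, y) - frag_of (x, y') \<in> tensor_gens A M N"
  "a \<in> carrier A \<Longrightarrow> x \<in> carrier M \<Longrightarrow> y \<in> carrier N \<Longrightarrow>
    frag_of (a \<odot>\<^bsub>M\<^esub> x, y) - frag_of (x, a \<odot>\<^bsub>N\<^esub> y) \<in> tensor_gens A M N"
  unfolding tensor_gens_def by blast+

lemma tensor_gens_hom:
  assumes "f \<in> mod_hom A M N" "u \<in> tensor_gens A M B"
  shows "frag_extend (\<lambda>(x, b). frag_of (f x, b)) u \<in> tensor_gens A N B"
proof -
  have f: "x \<in> carrier M \<Longrightarrow> f x \<in> carrier N"
    "x \<in> carrier M \<Longrightarrow> y \<in> carrier M \<Longrightarrow> f (x \<oplus>\<^bsub>M\<^esub> y) = f x \<oplus>\<^bsub>N\<^esub> f y"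
    "a \<in> carrier A \<Longrightarrow> x \<in> carrier M \<Longrightarrow> f (a \<odot>\<^bsub>M\<^esub> x) = a \<odot>\<^bsub>N\<^esub> f x" for a x y
    using assms(1) by (auto simp: mod_hom_def)
  from assms(2) show ?thesis
    by (cases rule: tensor_gensE) (simp_all add: frag_extend_diff f tensor_gensI)
qed

lemma tensor_gens_carrier:
  assumes "right_module A M" "left_module A N"
  shows "tensor_gens A M N \<subseteq> carrier (free_Abelian_group (carrier M \<times> carrier N))"
proof -
  interpret M: right_module A M by fact
  interpret N: left_module A N by fact
  show ?thesis
    unfolding tensor_gens_def
    by (auto dest!: subsetD[OF keys_diff] simp: M.rsmult_closed N.lsmult_closed)
qed

lemma tensor_rel_props:
  assumes "right_module A M" "left_module A N"
  shows "0 \<in> tensor_rel A M N"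
    "u \<in> tensor_rel A M N \<Longrightarrow> v \<in> tensor_rel A M N \<Longrightarrow> u + v \<in> tensor_rel A M N"
    "u \<in> tensor_rel A M N \<Longrightarrow> - u \<in> tensor_rel A M N"
    "u \<in> tensor_rel A M N \<Longrightarrow> v \<in> tensor_rel A M N \<Longrightarrow> u - v \<in> tensor_rel A M N"
    "u \<in> tensor_rel A M N \<Longrightarrow> Poly_Mapping.keys u \<subseteq> carrier M \<times> carrier N"
    "u \<in> tensor_gens A M N \<Longrightarrow> u \<in> tensor_rel A M N"
proof -
  note g = generate_free_props[OF tensor_gens_carrier[OF assms], folded tensor_rel_def]
  show "0 \<in> tensor_rel A M N"
    "u \<in> tensor_rel A M N \<Longrightarrow> v \<in> tensor_rel A M N \<Longrightarrow> u + v \<in> tensor_rel A M N"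
    "u \<in> tensor_rel A M N \<Longrightarrow> - u \<in> tensor_rel A M N"
    "u \<in> tensor_rel A M N \<Longrightarrow> Poly_Mapping.keys u \<subseteq> carrier M \<times> carrier N"
    by (fact g)+
  show "u \<in> tensor_rel A M N \<Longrightarrow> v \<in> tensor_rel A M N \<Longrightarrow> u - v \<in> tensor_rel A M N"
    using g(2)[of u "- v"] g(3)[of v] by simp
  show "u \<in> tensor_gens A M N \<Longrightarrow> u \<in> tensor_rel A M N"
    unfolding tensor_rel_def by (rule generate.incl)
qed

lemma tensor_class_eq_image: "tensor_class A M N u = (\<lambda>h. h + u) ` tensor_rel A M N"
  unfolding tensor_class_def r_coset_def by auto

lemma tensor_class_eq_iff:
  assumes "right_module A M" "left_module A N"
  shows "tensor_class A M N u = tensor_class A M N v \<longleftrightarrow> u - v \<in> tensor_rel A M N"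
proof
  note g = tensor_rel_props[OF assms]
  assume "tensor_class A M N u = tensor_class A M N v"
  moreover have "u \<in> tensor_class A M N u" unfolding tensor_class_eq_image using g(1) by force
  ultimately show "u - v \<in> tensor_rel A M N" unfolding tensor_class_eq_image by auto
next
  note g = tensor_rel_props[OF assms]
  assume *: "u - v \<in> tensor_rel A M N"
  show "tensor_class A M N u = tensor_class A M N v"
    unfolding tensor_class_eq_image
  proof (intro equalityI subsetI; clarify)
    fix h assume h: "h \<in> tensor_rel A M N"
    show "h + u \<in> (\<lambda>h. h + v) ` tensor_rel A M N"
      by (rule image_eqI[of _ _ "h + (u - v)"]) (use g(2)[OF h *] in simp_all)
    show "h + v \<in> (\<lambda>h. h + u) ` tensor_rel A M N"
      by (rule image_eqI[of _ _ "h - (u - v)"]) (use g(4)[OF h *] in simp_all)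
  qed
qed

lemma carrier_tensor:
  "carrier (tensor A M N) =
    tensor_class A M N ` {u. Poly_Mapping.keys u \<subseteq> carrier M \<times> carrier N}"
  unfolding tensor_def tensor_class_def carrier_FactGroup by (rule image_cong) auto

lemma mem_tensor_class_iff:
  "v \<in> tensor_class A M N u \<longleftrightarrow> v - u \<in> tensor_rel A M N"
  unfolding tensor_class_eq_image by (auto intro!: image_eqI[of _ _ "v - u"])

lemma tensor_rel_induct [consumes 3, case_names zero gen add minus]:
  assumes "right_module A M" "left_module A N" "u \<in> tensor_rel A M N"
    and "P 0" "\<And>u. u \<in> tensor_gens A M N \<Longrightarrow> P u"
    and "\<And>u v. u \<in> tensor_rel A M N \<Longrightarrow> v \<in> tensor_rel A M N \<Longrightarrow> P u \<Longrightarrow> P v \<Longrightarrow> P (u + v)"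
    and "\<And>u. u \<in> tensor_rel A M N \<Longrightarrow> P u \<Longrightarrow> P (- u)"
  shows "P u"
  using assms(3) unfolding tensor_rel_def
proof (induction rule: generate.induct)
  case (inv h)
  then have "Poly_Mapping.keys h \<subseteq> carrier M \<times> carrier N"
    using tensor_gens_carrier[OF assms(1,2)] unfolding subset_iff[of "tensor_gens A M N"]
      carrier_free_Abelian_group_iff by blast
  then show ?case using inv assms(5,7) tensor_rel_props(6)[OF assms(1,2)] by simp
qed (use assms(4-) in \<open>simp_all add: tensor_rel_def\<close>)

lemma additive_tensor_rel:
  assumes "right_module A M" "left_module A N" "u \<in> tensor_rel A M N"
    and J: "0 \<in> J" "\<And>u v. u \<in> J \<Longrightarrow> v \<in> J \<Longrightarrow> u + v \<in> J" "\<And>u. u \<in> J \<Longrightarrow> - u \<in> J"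
    and "\<And>u. u \<in> tensor_gens A M N \<Longrightarrow> frag_extend b u \<in> J"
  shows "frag_extend b u \<in> J"
  using assms(1-3)
  by (induction rule: tensor_rel_induct) (auto simp: frag_extend_add frag_extend_minus assms)

lemma tensor_rel_hom:
  assumes M: "right_module A M" and N: "right_module A N" and B: "left_module A B"
    and f: "f \<in> mod_hom A M N" and u: "u \<in> tensor_rel A M B"
  shows "frag_extend (\<lambda>(x, b). frag_of (f x, b)) u \<in> tensor_rel A N B"
proof (rule additive_tensor_rel[OF M B u])
  note g = tensor_rel_props[OF N B]
  show "frag_extend (\<lambda>(x, b). frag_of (f x, b)) u \<in> tensor_rel A N B"
    if "u \<in> tensor_gens A M B" for u
    by (rule g(6)[OF tensor_gens_hom[OF f that]])
qed (use tensor_rel_props[OF N B] in auto)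

lemma keys_map_fst:
  assumes "Poly_Mapping.keys u \<subseteq> S \<times> T" "f \<in> S \<rightarrow> S'"
  shows "Poly_Mapping.keys (frag_extend (\<lambda>(x, b). frag_of (f x, b)) u) \<subseteq> S' \<times> T"
proof -
  have "Poly_Mapping.keys (frag_extend (\<lambda>(x, b). frag_of (f x, b)) u) \<subseteq>
      (\<Union>i\<in>Poly_Mapping.keys u. Poly_Mapping.keys (case i of (x, b) \<Rightarrow> frag_of (f x, b)))"
    by (rule keys_frag_extend)
  then show ?thesis using assms by fastforce
qed

lemma tensor_map_class:
  assumes M: "right_module A M" and N: "right_module A N" and B: "left_module A B"
    and f: "f \<in> mod_hom A M N"
  shows "tensor_map A N B f (tensor_class A M B u) =
    tensor_class A N B (frag_extend (\<lambda>(x, b). frag_of (f x, b)) u)"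
proof -
  have "tensor_class A N B (frag_extend (\<lambda>(x, b). frag_of (f x, b)) v) =
    tensor_class A N B (frag_extend (\<lambda>(x, b). frag_of (f x, b)) u)"
    if "v \<in> tensor_class A M B u" for v
    using that tensor_rel_hom[OF M N B f, of "v - u"]
    unfolding tensor_class_eq_iff[OF N B] mem_tensor_class_iff by (simp add: frag_extend_diff)
  moreover have "u \<in> tensor_class A M B u"
    using tensor_rel_props(1)[OF M B] by (simp add: mem_tensor_class_iff)
  ultimately show ?thesis unfolding tensor_map_def by blast
qed

lemma inj_on_tensor_map_iff:
  assumes M: "right_module A M" and N: "right_module A N" and B: "left_module A B"
    and f: "f \<in> mod_hom A M N"
  shows "inj_on (tensor_map A N B f) (carrier (tensor A M B)) \<longleftrightarrow>
    (\<forall>u. Poly_Mapping.keys u \<subseteq> carrier M \<times> carrier B \<longrightarrow>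
       frag_extend (\<lambda>(x, b). frag_of (f x, b)) u \<in> tensor_rel A N B \<longrightarrow> u \<in> tensor_rel A M B)"
    (is "?L \<longleftrightarrow> ?R")
proof
  assume L: ?L
  show ?R
  proof (intro allI impI)
    fix u assume u: "Poly_Mapping.keys u \<subseteq> carrier M \<times> carrier B"
      "frag_extend (\<lambda>(x, b). frag_of (f x, b)) u \<in> tensor_rel A N B"
    have "tensor_class A M B u = tensor_class A M B 0"
    proof (rule inj_onD[OF L])
      show "tensor_map A N B f (tensor_class A M B u) = tensor_map A N B f (tensor_class A M B 0)"
        unfolding tensor_map_class[OF assms] tensor_class_eq_iff[OF N B] using u by simp
    qed (use u in \<open>auto simp: carrier_tensor\<close>)
    then show "u \<in> tensor_rel A M B" unfolding tensor_class_eq_iff[OF M B] by simp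
  qed
next
  assume R: ?R
  show ?L
  proof (rule inj_onI)
    fix P Q assume "P \<in> carrier (tensor A M B)" "Q \<in> carrier (tensor A M B)"
      and eq: "tensor_map A N B f P = tensor_map A N B f Q"
    then obtain u v where u: "Poly_Mapping.keys u \<subseteq> carrier M \<times> carrier B" "P = tensor_class A M B u"
      and v: "Poly_Mapping.keys v \<subseteq> carrier M \<times> carrier B" "Q = tensor_class A M B v"
      by (auto simp: carrier_tensor)
    have "u - v \<in> tensor_rel A M B"
    proof (rule R[rule_format])
      show "Poly_Mapping.keys (u - v) \<subseteq> carrier M \<times> carrier B"
        using keys_diff[of u v] u(1) v(1) by blast
    qed (use eq in \<open>simp add: u(2) v(2) tensor_map_class[OF assms] tensor_class_eq_iff[OF N B] frag_extend_diff\<close>)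
    then show "P = Q" by (simp add: u(2) v(2) tensor_class_eq_iff[OF M B])
  qed
qed

text \<open>The submodule \<open>H\<close> of \<open>M\<close>, renamed along an injection \<open>g\<close>.\<close>

definition transport_module ::
  "('a, 'm, 'y) module_scheme \<Rightarrow> 'm set \<Rightarrow> ('m \<Rightarrow> 'n) \<Rightarrow> ('a, 'n) module"
  where "transport_module M H g =
    \<lparr>carrier = g ` H, monoid.mult = undefined, one = undefined, ring.zero = g \<zero>\<^bsub>M\<^esub>,
     ring.add = (\<lambda>x y. g (inv_into H g x \<oplus>\<^bsub>M\<^esub> inv_into H g y)),
     smult = (\<lambda>a x. g (a \<odot>\<^bsub>M\<^esub> inv_into H g x))\<rparr>"

definition right_submodule :: "('a, 'x) ring_scheme \<Rightarrow> ('a, 'm, 'y) module_scheme \<Rightarrow> 'm set \<Rightarrow> bool"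
  where "right_submodule A M H \<longleftrightarrow> H \<subseteq> carrier M \<and> \<zero>\<^bsub>M\<^esub> \<in> H \<and>
    (\<forall>x\<in>H. \<forall>y\<in>H. x \<oplus>\<^bsub>M\<^esub> y \<in> H) \<and> (\<forall>a\<in>carrier A. \<forall>x\<in>H. a \<odot>\<^bsub>M\<^esub> x \<in> H)"

lemma (in right_module) zero_rsmult: "x \<in> carrier M \<Longrightarrow> \<zero>\<^bsub>A\<^esub> \<odot>\<^bsub>M\<^esub> x = \<zero>\<^bsub>M\<^esub>"
  using rsmult_l_distr[of "\<zero>\<^bsub>A\<^esub>" "\<zero>\<^bsub>A\<^esub>" x] rsmult_closed[of "\<zero>\<^bsub>A\<^esub>" x] M.add.l_cancel_one' by simp

lemma (in right_module) rsmult_zero: "a \<in> carrier A \<Longrightarrow> a \<odot>\<^bsub>M\<^esub> \<zero>\<^bsub>M\<^esub> = \<zero>\<^bsub>M\<^esub>"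
  using rsmult_r_distr[of a "\<zero>\<^bsub>M\<^esub>" "\<zero>\<^bsub>M\<^esub>"] rsmult_closed[of a "\<zero>\<^bsub>M\<^esub>"] M.add.l_cancel_one' by simp

lemma (in right_module) neg_one_rsmult:
  assumes x: "x \<in> carrier M" shows "(\<ominus>\<^bsub>A\<^esub> \<one>\<^bsub>A\<^esub>) \<odot>\<^bsub>M\<^esub> x \<oplus>\<^bsub>M\<^esub> x = \<zero>\<^bsub>M\<^esub>"
  using rsmult_l_distr[of "\<ominus>\<^bsub>A\<^esub> \<one>\<^bsub>A\<^esub>" "\<one>\<^bsub>A\<^esub>" x] zero_rsmult[OF x] rsmult_one[OF x] x
  by (simp add: A.l_neg)

lemma transport_right_module:
  assumes M: "right_module A M" and H: "right_submodule A M H" and g: "inj_on g H"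
  shows "right_module A (transport_module M H g)"
    "g \<in> mod_hom A (M\<lparr>carrier := H\<rparr>) (transport_module M H g)"
    "inv_into H g \<in> mod_hom A (transport_module M H g) M"
proof -
  interpret M: right_module A M by fact
  note [simp] = inv_into_f_f[OF g]
  have Hc: "x \<in> H \<Longrightarrow> x \<in> carrier M" "\<zero>\<^bsub>M\<^esub> \<in> H" "x \<in> H \<Longrightarrow> y \<in> H \<Longrightarrow> x \<oplus>\<^bsub>M\<^esub> y \<in> H"
    "a \<in> carrier A \<Longrightarrow> x \<in> H \<Longrightarrow> a \<odot>\<^bsub>M\<^esub> x \<in> H" for a x y
    using H unfolding right_submodule_def by auto
  let ?T = "transport_module M H g"
  have "abelian_group ?T"
  proof (rule abelian_groupI)
    fix x assume "x \<in> carrier ?T"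
    then obtain x' where x': "x' \<in> H" "x = g x'" by (auto simp: transport_module_def)
    show "\<exists>y\<in>carrier ?T. y \<oplus>\<^bsub>?T\<^esub> x = \<zero>\<^bsub>?T\<^esub>"
      by (rule bexI[of _ "g ((\<ominus>\<^bsub>A\<^esub> \<one>\<^bsub>A\<^esub>) \<odot>\<^bsub>M\<^esub> x')"])
        (use x' Hc in \<open>auto simp: transport_module_def M.neg_one_rsmult\<close>)
  qed (auto simp: transport_module_def Hc M.add.m_ac)
  then show "right_module A ?T"
    by (intro right_module.intro right_module_axioms.intro M.A.ring_axioms)
       (auto simp: transport_module_def Hc M.rsmult_l_distr M.rsmult_r_distr M.rsmult_assoc M.rsmult_one)
  show "g \<in> mod_hom A (M\<lparr>carrier := H\<rparr>) ?T" "inv_into H g \<in> mod_hom A ?T M"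
    unfolding mod_hom_def by (auto simp: transport_module_def Hc)
qed

fun lincomb :: "('a, 'n, 'y) module_scheme \<Rightarrow> 'a list \<Rightarrow> 'n list \<Rightarrow> 'n" where
  "lincomb N (a # as) (x # xs) = a \<odot>\<^bsub>N\<^esub> x \<oplus>\<^bsub>N\<^esub> lincomb N as xs"
| "lincomb N as xs = \<zero>\<^bsub>N\<^esub>"

definition lspan :: "('a, 'x) ring_scheme \<Rightarrow> ('a, 'n, 'y) module_scheme \<Rightarrow> 'n list \<Rightarrow> 'n set" where
  "lspan A N xs = (\<lambda>as. lincomb N as xs) ` {as. set as \<subseteq> carrier A \<and> length as = length xs}"

lemma lspan_Nil: "lspan A N [] = {\<zero>\<^bsub>N\<^esub>}"
  unfolding lspan_def by (auto intro!: image_eqI[of _ _ "[]"])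

lemma lspan_Cons: "lspan A N (x # xs) = {a \<odot>\<^bsub>N\<^esub> x \<oplus>\<^bsub>N\<^esub> y |a y. a \<in> carrier A \<and> y \<in> lspan A N xs}"
  unfolding lspan_def
proof (intro equalityI subsetI, goal_cases)
  case (1 z)
  then obtain as where as: "set as \<subseteq> carrier A" "length as = Suc (length xs)" "z = lincomb N as (x # xs)"
    by auto
  then show ?case by (cases as) auto
next
  case (2 z)
  then obtain a as where "a \<in> carrier A" "set as \<subseteq> carrier A" "length as = length xs"
     "z = a \<odot>\<^bsub>N\<^esub> x \<oplus>\<^bsub>N\<^esub> lincomb N as xs" by auto
  then show ?case by (intro image_eqI[of _ _ "a # as"]) auto
qed

lemma (in right_module) lspan_right_submodule:
  assumes "set xs \<subseteq> carrier M"
  shows "right_submodule A M (lspan A M xs)" "set xs \<subseteq> lspan A M xs"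
proof -
  have "right_submodule A M (lspan A M xs) \<and> set xs \<subseteq> lspan A M xs"
    using assms
  proof (induction xs)
    case Nil
    then show ?case by (auto simp: right_submodule_def lspan_Nil rsmult_zero)
  next
    case (Cons x xs)
    then have IH: "right_submodule A M (lspan A M xs)" "set xs \<subseteq> lspan A M xs" and x: "x \<in> carrier M" by auto
    have Hc: "x \<in> lspan A M xs \<Longrightarrow> x \<in> carrier M" "\<zero>\<^bsub>M\<^esub> \<in> lspan A M xs"
      "x \<in> lspan A M xs \<Longrightarrow> y \<in> lspan A M xs \<Longrightarrow> x \<oplus>\<^bsub>M\<^esub> y \<in> lspan A M xs"
      "a \<in> carrier A \<Longrightarrow> x \<in> lspan A M xs \<Longrightarrow> a \<odot>\<^bsub>M\<^esub> x \<in> lspan A M xs" for a x y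
      using IH unfolding right_submodule_def by auto
    have z: "\<zero>\<^bsub>A\<^esub> \<odot>\<^bsub>M\<^esub> x \<oplus>\<^bsub>M\<^esub> y = y" if "y \<in> lspan A M xs" for y
      using that x Hc by (simp add: zero_rsmult)
    have sub: "lspan A M xs \<subseteq> lspan A M (x # xs)"
      unfolding lspan_Cons using z[symmetric] A.zero_closed by blast
    have "x = \<one>\<^bsub>A\<^esub> \<odot>\<^bsub>M\<^esub> x \<oplus>\<^bsub>M\<^esub> \<zero>\<^bsub>M\<^esub>" using x by (simp add: rsmult_one)
    then have "x \<in> lspan A M (x # xs)" unfolding lspan_Cons using Hc(2) by blast
    moreover have "y \<oplus>\<^bsub>M\<^esub> z \<in> lspan A M (x # xs)"
      if y: "y \<in> lspan A M (x # xs)" and z: "z \<in> lspan A M (x # xs)" for y z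
    proof -
      obtain a y' b z' where *: "a \<in> carrier A" "b \<in> carrier A" "y' \<in> lspan A M xs" "z' \<in> lspan A M xs"
        "y = a \<odot>\<^bsub>M\<^esub> x \<oplus>\<^bsub>M\<^esub> y'" "z = b \<odot>\<^bsub>M\<^esub> x \<oplus>\<^bsub>M\<^esub> z'"
        using y z unfolding lspan_Cons by blast
      have "y \<oplus>\<^bsub>M\<^esub> z = (a \<oplus>\<^bsub>A\<^esub> b) \<odot>\<^bsub>M\<^esub> x \<oplus>\<^bsub>M\<^esub> (y' \<oplus>\<^bsub>M\<^esub> z')"
        using * x Hc(1) by (simp add: rsmult_l_distr rsmult_closed M.add.m_ac)
      then show ?thesis unfolding lspan_Cons using * Hc(3) A.add.m_closed by blast
    qed
    moreover have "b \<odot>\<^bsub>M\<^esub> y \<in> lspan A M (x # xs)"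
      if y: "y \<in> lspan A M (x # xs)" and b: "b \<in> carrier A" for y b
    proof -
      obtain a y' where *: "a \<in> carrier A" "y' \<in> lspan A M xs" "y = a \<odot>\<^bsub>M\<^esub> x \<oplus>\<^bsub>M\<^esub> y'"
        using y unfolding lspan_Cons by blast
      have "b \<odot>\<^bsub>M\<^esub> y = (a \<otimes>\<^bsub>A\<^esub> b) \<odot>\<^bsub>M\<^esub> x \<oplus>\<^bsub>M\<^esub> b \<odot>\<^bsub>M\<^esub> y'"
        using * x b Hc(1) by (simp add: rsmult_r_distr rsmult_closed rsmult_assoc)
      then show ?thesis unfolding lspan_Cons using * b Hc(4) A.m_closed by blast
    qed
    moreover have "lspan A M (x # xs) \<subseteq> carrier M"
      unfolding lspan_Cons using x Hc(1) by (auto simp: rsmult_closed)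
    ultimately show ?case using IH sub Hc(2) unfolding right_submodule_def by auto
  qed
  then show "right_submodule A M (lspan A M xs)" "set xs \<subseteq> lspan A M xs" by auto
qed

lemma tensor_rel_finite_support:
  fixes N :: "('a, 'n, 'z) module_scheme"
  assumes N: "right_module A N" and B: "left_module A B" and u: "u \<in> tensor_rel A N B"
  shows "\<exists>S. finite S \<and> S \<subseteq> carrier N \<and>
    (\<forall>H (g :: 'n \<Rightarrow> 'p). right_submodule A N H \<longrightarrow> S \<subseteq> H \<longrightarrow> inj_on g H \<longrightarrow>
       frag_extend (\<lambda>(x, b). frag_of (g x, b)) u \<in> tensor_rel A (transport_module N H g) B)"
  (is "\<exists>S. ?P S u")
  using N B u
proof (induction rule: tensor_rel_induct)
  case zero
  show ?case by (rule exI[of _ "{}"]) (auto intro!: tensor_rel_props(1)[OF transport_right_module(1)[OF N] B])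
next
  case (minus u)
  then obtain S where S: "?P S u" by blast
  have "?P S (- u)"
    using S by (auto simp: frag_extend_minus intro!: tensor_rel_props(3)[OF transport_right_module(1)[OF N] B])
  then show ?case by blast
next
  case (add u v)
  then obtain S S' where S: "?P S u" "?P S' v" by blast
  have "?P (S \<union> S') (u + v)"
    using S by (auto simp: frag_extend_add intro!: tensor_rel_props(2)[OF transport_right_module(1)[OF N] B])
  then show ?case by blast
next
  case (gen u)
  interpret N: right_module A N by fact
  obtain S where S: "finite S" "S \<subseteq> carrier N"
    "\<And>H. right_submodule A N H \<Longrightarrow> S \<subseteq> H \<Longrightarrow> u \<in> tensor_gens A (N\<lparr>carrier := H\<rparr>) B"
  proof -
    from gen show thesis
    proof (cases rule: tensor_gensE)
      case (left x x' y)
      show thesis by (rule that[of "{x, x'}"]) (use left in \<open>auto simp: tensor_gens_def\<close>)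
    next
      case (right x y y')
      show thesis by (rule that[of "{x}"]) (use right in \<open>auto simp: tensor_gens_def\<close>)
    next
      case (middle a x y)
      show thesis by (rule that[of "{x}"]) (use middle in \<open>auto simp: tensor_gens_def\<close>)
    qed
  qed
  have "frag_extend (\<lambda>(x, b). frag_of (g x, b)) u \<in> tensor_rel A (transport_module N H g) B"
    if H: "right_submodule A N H" "S \<subseteq> H" "inj_on g H" for H and g :: "'n \<Rightarrow> 'p"
  proof (rule tensor_rel_props(6)[OF transport_right_module(1)[OF N H(1,3)] B])
    show "frag_extend (\<lambda>(x, b). frag_of (g x, b)) u \<in> tensor_gens A (transport_module N H g) B"
      by (rule tensor_gens_hom[OF transport_right_module(2)[OF N H(1,3)] S(3)[OF H(1,2)]])
  qed
  then show ?case using S(1,2) by blast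
qed

lemma frag_extend_frag_extend_id:
  assumes "\<And>p. p \<in> Poly_Mapping.keys u \<Longrightarrow> frag_extend g (f p) = frag_of p"
  shows "frag_extend g (frag_extend f u) = u"
proof -
  have "frag_extend g (frag_extend f u) =
      (\<Sum>p\<in>Poly_Mapping.keys u. frag_cmul (Poly_Mapping.lookup u p) (frag_extend g (f p)))"
    unfolding frag_extend_def[of f] by (simp add: frag_extend_sum frag_extend_cmul o_def)
  also have "\<dots> = frag_extend frag_of u" unfolding frag_extend_def[of frag_of] by (rule sum.cong) (simp_all add: assms)
  also have "\<dots> = u" by (metis frag_expansion)
  finally show ?thesis .
qed

lemma frag_extend_frag_extend:
  "frag_extend g (frag_extend f u) = frag_extend (\<lambda>p. frag_extend g (f p)) u"
  unfolding frag_extend_def[of f] frag_extend_def[of "\<lambda>p. frag_extend g (f p)"]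
  by (simp add: frag_extend_sum frag_extend_cmul o_def)

lemma flat_tensor_map_inj:
  fixes M :: "('a, 'm, 'y) module_scheme" and N :: "('a, 'n, 'z) module_scheme"
  assumes flat: "flat A B" and M: "right_module A M" and N: "right_module A N"
    and f: "f \<in> mod_hom A M N" and inj: "inj_on f (carrier M)"
  shows "inj_on (tensor_map A N B f) (carrier (tensor A M B))"
proof -
  interpret M: right_module A M by fact
  interpret N: right_module A N by fact
  have B: "left_module A B" using flat by (simp add: flat_def)
  have fc: "x \<in> carrier M \<Longrightarrow> f x \<in> carrier N" "x \<in> carrier M \<Longrightarrow> y \<in> carrier M \<Longrightarrow> f (x \<oplus>\<^bsub>M\<^esub> y) = f x \<oplus>\<^bsub>N\<^esub> f y"
    "a \<in> carrier A \<Longrightarrow> x \<in> carrier M \<Longrightarrow> f (a \<odot>\<^bsub>M\<^esub> x) = a \<odot>\<^bsub>N\<^esub> f x" for a x y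
    using f by (auto simp: mod_hom_def)
  have f0: "f \<zero>\<^bsub>M\<^esub> = \<zero>\<^bsub>N\<^esub>" using fc(3)[of "\<zero>\<^bsub>A\<^esub>" "\<zero>\<^bsub>M\<^esub>"] fc(1) by (simp add: M.zero_rsmult N.zero_rsmult)
  show ?thesis
    unfolding inj_on_tensor_map_iff[OF M N B f]
  proof (intro allI impI)
    fix u assume u: "Poly_Mapping.keys u \<subseteq> carrier M \<times> carrier B"
      and fu: "frag_extend (\<lambda>(x, b). frag_of (f x, b)) u \<in> tensor_rel A N B"
    obtain S where S: "finite S" "S \<subseteq> carrier N"
      "\<And>H (g :: 'n \<Rightarrow> 'a list). right_submodule A N H \<Longrightarrow> S \<subseteq> H \<Longrightarrow> inj_on g H \<Longrightarrow>
         frag_extend (\<lambda>(x, b). frag_of (g x, b)) (frag_extend (\<lambda>(x, b). frag_of (f x, b)) u)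
           \<in> tensor_rel A (transport_module N H g) B"
      using tensor_rel_finite_support[OF N B fu, where ?'p = "'a list"] by blast
    obtain xs where xs: "set xs = S \<union> f ` fst ` Poly_Mapping.keys u"
      using finite_list[of "S \<union> f ` fst ` Poly_Mapping.keys u"] S(1) by auto
    have xsc: "set xs \<subseteq> carrier N" unfolding xs using S(2) u fc(1) by auto
    define H where "H = lspan A N xs"
    define g where "g = inv_into {as. set as \<subseteq> carrier A \<and> length as = length xs} (\<lambda>as. lincomb N as xs)"
    have g: "inj_on g H" unfolding g_def H_def lspan_def by (rule inj_on_inv_into) simp
    have H: "right_submodule A N H" "set xs \<subseteq> H" unfolding H_def using N.lspan_right_submodule[OF xsc] by auto
    define H' where "H' = {x \<in> carrier M. f x \<in> H}"
    have H': "right_submodule A M H'" using H(1) unfolding right_submodule_def H'_def by (auto simp: fc f0 M.rsmult_closed)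
    have gf: "inj_on (g \<circ> f) H'"
      by (rule comp_inj_on[OF inj_on_subset[OF inj] inj_on_subset[OF g]]) (auto simp: H'_def)
    let ?M = "transport_module M H' (g \<circ> f)" and ?N = "transport_module N H g"
    have M': "right_module A ?M" by (rule transport_right_module[OF M H' gf])
    have N': "right_module A ?N" by (rule transport_right_module[OF N H(1) g])
    have "id \<in> mod_hom A ?M ?N"
      using H' by (auto simp: mod_hom_def transport_module_def H'_def right_submodule_def
        inv_into_f_f[OF gf, simplified H'_def, simplified] inv_into_f_f[OF g] fc)
    then have "inj_on (tensor_map A ?N B id) (carrier (tensor A ?M B))"
      using flat[unfolded flat_def, THEN conjunct2, rule_format, OF M' N', of id] by simp
    then have *: "v \<in> tensor_rel A ?M B"
      if "Poly_Mapping.keys v \<subseteq> carrier ?M \<times> carrier B" "v \<in> tensor_rel A ?N B" for v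
      using that frag_expansion[of v, symmetric]
      unfolding inj_on_tensor_map_iff[OF M' N' B \<open>id \<in> mod_hom A ?M ?N\<close>] by (simp add: case_prod_unfold)
    define v where "v = frag_extend (\<lambda>(x, b). frag_of ((g \<circ> f) x, b)) u"
    have uH: "Poly_Mapping.keys u \<subseteq> H' \<times> carrier B"
      using u H(2) xs by (force simp: H'_def)
    have "v \<in> tensor_rel A ?M B"
    proof (rule *)
      show "Poly_Mapping.keys v \<subseteq> carrier ?M \<times> carrier B"
        unfolding v_def by (rule keys_map_fst[OF uH]) (auto simp: transport_module_def)
      have "v = frag_extend (\<lambda>(x, b). frag_of (g x, b)) (frag_extend (\<lambda>(x, b). frag_of (f x, b)) u)"
        unfolding v_def frag_extend_frag_extend by (simp add: case_prod_unfold)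
      then show "v \<in> tensor_rel A ?N B" using S(3)[OF H(1) _ g] H(2) xs by auto
    qed
    then have "frag_extend (\<lambda>(x, b). frag_of (inv_into H' (g \<circ> f) x, b)) v \<in> tensor_rel A M B"
      using tensor_rel_hom[OF M' M B transport_right_module(3)[OF M H' gf]] by blast
    moreover have "frag_extend (\<lambda>(x, b). frag_of (inv_into H' (g \<circ> f) x, b)) v = u"
      unfolding v_def by (rule frag_extend_frag_extend_id) (use uH inv_into_f_f[OF gf] in auto)
    ultimately show "u \<in> tensor_rel A M B" by simp
  qed
qed


section \<open>The base change is a ring, respectively a module\<close>

lemma frag_extend_zero_fun: "frag_extend (\<lambda>_. 0) u = 0"
  by (simp add: frag_extend_def)

lemma frag_extend_add_fun: "frag_extend (\<lambda>p. f p + g p) u = frag_extend f u + frag_extend g u"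
  by (simp add: frag_extend_def frag_cmul_distrib2 sum.distrib)

lemma frag_extend_minus_fun: "frag_extend (\<lambda>p. - f p) u = - frag_extend f u"
  using frag_extend_add_fun[of f "\<lambda>p. - f p" u]
  by (simp add: frag_extend_zero_fun eq_neg_iff_add_eq_0 add.commute)

lemma frag_extend_diff_fun: "frag_extend (\<lambda>p. f p - g p) u = frag_extend f u - frag_extend g u"
  using frag_extend_add_fun[of f "\<lambda>p. - g p" u] by (simp add: frag_extend_minus_fun)

lemma frag_extend_cong:
  assumes "\<And>p. p \<in> Poly_Mapping.keys u \<Longrightarrow> f p = g p"
  shows "frag_extend f u = frag_extend g u"
  unfolding frag_extend_def by (rule sum.cong) (simp_all add: assms)

lemma frag_extend_mem:
  assumes f: "\<And>p. p \<in> Poly_Mapping.keys u \<Longrightarrow> f p \<in> J"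
    and J: "0 \<in> J" "\<And>u v. u \<in> J \<Longrightarrow> v \<in> J \<Longrightarrow> u - v \<in> J"
  shows "frag_extend f u \<in> J"
  by (rule frag_induction[of u "Poly_Mapping.keys u"]) (auto simp: frag_extend_diff f J)

text \<open>The extension of a pair of products underlying \<^const>\<open>tensor_product\<close>.\<close>

definition biadditive_ext :: "('a \<Rightarrow> 'b \<Rightarrow> 'c) \<Rightarrow> ('k \<Rightarrow> 'l \<Rightarrow> 'm) \<Rightarrow> ('a \<times> 'k \<Rightarrow>\<^sub>0 int) \<Rightarrow> ('b \<times> 'l \<Rightarrow>\<^sub>0 int) \<Rightarrow>
    ('c \<times> 'm \<Rightarrow>\<^sub>0 int)"
  where "biadditive_ext \<mu> \<nu> u v = frag_extend (\<lambda>(a, x). frag_extend (\<lambda>(b, y). frag_of (\<mu> a b, \<nu> x y)) v) u"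

lemma biadditive_ext_add_left: "biadditive_ext \<mu> \<nu> (u + u') v = biadditive_ext \<mu> \<nu> u v + biadditive_ext \<mu> \<nu> u' v"
  and biadditive_ext_minus_left: "biadditive_ext \<mu> \<nu> (- u) v = - biadditive_ext \<mu> \<nu> u v"
  and biadditive_ext_diff_left: "biadditive_ext \<mu> \<nu> (u - u') v = biadditive_ext \<mu> \<nu> u v - biadditive_ext \<mu> \<nu> u' v"
  and biadditive_ext_0_left: "biadditive_ext \<mu> \<nu> 0 v = 0"
  and biadditive_ext_add_right: "biadditive_ext \<mu> \<nu> u (v + v') = biadditive_ext \<mu> \<nu> u v + biadditive_ext \<mu> \<nu> u v'"
  and biadditive_ext_minus_right: "biadditive_ext \<mu> \<nu> u (- v) = - biadditive_ext \<mu> \<nu> u v"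
  and biadditive_ext_diff_right: "biadditive_ext \<mu> \<nu> u (v - v') = biadditive_ext \<mu> \<nu> u v - biadditive_ext \<mu> \<nu> u v'"
  and biadditive_ext_0_right: "biadditive_ext \<mu> \<nu> u 0 = 0"
  by (simp_all add: biadditive_ext_def frag_extend_add frag_extend_minus frag_extend_diff case_prod_unfold
      frag_extend_add_fun frag_extend_minus_fun frag_extend_diff_fun frag_extend_zero_fun)

lemma biadditive_ext_assoc:
  assumes "Poly_Mapping.keys u \<subseteq> S1 \<times> T1" "Poly_Mapping.keys v \<subseteq> S2 \<times> T2" "Poly_Mapping.keys w \<subseteq> S3 \<times> T3"
   and "\<And>a b c. a \<in> S1 \<Longrightarrow> b \<in> S2 \<Longrightarrow> c \<in> S3 \<Longrightarrow> \<mu>1 (\<mu>2 a b) c = \<mu>3 a (\<mu>4 b c)"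
   and "\<And>a b c. a \<in> T1 \<Longrightarrow> b \<in> T2 \<Longrightarrow> c \<in> T3 \<Longrightarrow> \<nu>1 (\<nu>2 a b) c = \<nu>3 a (\<nu>4 b c)"
  shows "biadditive_ext \<mu>1 \<nu>1 (biadditive_ext \<mu>2 \<nu>2 u v) w = biadditive_ext \<mu>3 \<nu>3 u (biadditive_ext \<mu>4 \<nu>4 v w)"
proof -
  have "biadditive_ext \<mu>1 \<nu>1 (biadditive_ext \<mu>2 \<nu>2 u v) w =
     frag_extend (\<lambda>p. frag_extend (\<lambda>q. frag_extend (\<lambda>r.
       frag_of (\<mu>1 (\<mu>2 (fst p) (fst q)) (fst r), \<nu>1 (\<nu>2 (snd p) (snd q)) (snd r))) w) v) u"
    unfolding biadditive_ext_def by (simp add: case_prod_unfold frag_extend_frag_extend)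
  also have "\<dots> = frag_extend (\<lambda>p. frag_extend (\<lambda>q. frag_extend (\<lambda>r.
       frag_of (\<mu>3 (fst p) (\<mu>4 (fst q) (fst r)), \<nu>3 (snd p) (\<nu>4 (snd q) (snd r)))) w) v) u"
    by (intro frag_extend_cong) (use assms in \<open>auto simp: subset_iff\<close>)
  also have "\<dots> = biadditive_ext \<mu>3 \<nu>3 u (biadditive_ext \<mu>4 \<nu>4 v w)"
    unfolding biadditive_ext_def by (simp add: case_prod_unfold frag_extend_frag_extend)
  finally show ?thesis .
qed

lemma frag_extend_frag_of: "frag_extend frag_of u = u"
  by (metis frag_expansion)

lemma biadditive_ext_one_left:
  assumes "Poly_Mapping.keys v \<subseteq> S \<times> T"
    and "\<And>b. b \<in> S \<Longrightarrow> \<mu> e b = b" "\<And>b. b \<in> T \<Longrightarrow> \<nu> e' b = b"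
  shows "biadditive_ext \<mu> \<nu> (frag_of (e, e')) v = v"
proof -
  have "biadditive_ext \<mu> \<nu> (frag_of (e, e')) v = frag_extend frag_of v"
    unfolding biadditive_ext_def by (simp, rule frag_extend_cong) (use assms in auto)
  then show ?thesis by (simp add: frag_extend_frag_of)
qed

lemma biadditive_ext_one_right:
  assumes "Poly_Mapping.keys v \<subseteq> S \<times> T"
    and "\<And>b. b \<in> S \<Longrightarrow> \<mu> b e = b" "\<And>b. b \<in> T \<Longrightarrow> \<nu> b e' = b"
  shows "biadditive_ext \<mu> \<nu> v (frag_of (e, e')) = v"
proof -
  have "biadditive_ext \<mu> \<nu> v (frag_of (e, e')) = frag_extend frag_of v"
    unfolding biadditive_ext_def by (simp, rule frag_extend_cong) (use assms in auto)
  then show ?thesis by (simp add: frag_extend_frag_of)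
qed

lemma keys_biadditive_ext:
  assumes "Poly_Mapping.keys u \<subseteq> S1 \<times> T1" "Poly_Mapping.keys v \<subseteq> S2 \<times> T2"
    and "\<And>a b. a \<in> S1 \<Longrightarrow> b \<in> S2 \<Longrightarrow> \<mu> a b \<in> S" "\<And>a b. a \<in> T1 \<Longrightarrow> b \<in> T2 \<Longrightarrow> \<nu> a b \<in> T"
  shows "Poly_Mapping.keys (biadditive_ext \<mu> \<nu> u v) \<subseteq> S \<times> T"
proof -
  have "p \<in> S \<times> T" if p: "p \<in> Poly_Mapping.keys (biadditive_ext \<mu> \<nu> u v)" for p
  proof -
    obtain a x b y where "(a, x) \<in> Poly_Mapping.keys u" "(b, y) \<in> Poly_Mapping.keys v"
      "p = (\<mu> a b, \<nu> x y)"
      using p unfolding biadditive_ext_def by (auto dest!: subsetD[OF keys_frag_extend])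
    then show ?thesis using subsetD[OF assms(1)] subsetD[OF assms(2)] assms(3,4) by blast
  qed
  then show ?thesis by blast
qed

definition bilin :: "('r, 'x) ring_scheme \<Rightarrow> ('r, 'a, 'y1) module_scheme \<Rightarrow> ('r, 'b, 'y2) module_scheme \<Rightarrow>
   ('r, 'c, 'y3) module_scheme \<Rightarrow> ('a \<Rightarrow> 'b \<Rightarrow> 'c) \<Rightarrow> bool"
  where "bilin R M N L \<mu> \<longleftrightarrow>
    (\<forall>a\<in>carrier M. \<forall>b\<in>carrier N. \<mu> a b \<in> carrier L) \<and>
    (\<forall>a\<in>carrier M. \<forall>a'\<in>carrier M. \<forall>b\<in>carrier N. \<mu> (a \<oplus>\<^bsub>M\<^esub> a') b = \<mu> a b \<oplus>\<^bsub>L\<^esub> \<mu> a' b) \<and>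
    (\<forall>a\<in>carrier M. \<forall>b\<in>carrier N. \<forall>b'\<in>carrier N. \<mu> a (b \<oplus>\<^bsub>N\<^esub> b') = \<mu> a b \<oplus>\<^bsub>L\<^esub> \<mu> a b') \<and>
    (\<forall>r\<in>carrier R. \<forall>a\<in>carrier M. \<forall>b\<in>carrier N. \<mu> (r \<odot>\<^bsub>M\<^esub> a) b = r \<odot>\<^bsub>L\<^esub> \<mu> a b) \<and>
    (\<forall>r\<in>carrier R. \<forall>a\<in>carrier M. \<forall>b\<in>carrier N. \<mu> a (r \<odot>\<^bsub>N\<^esub> b) = r \<odot>\<^bsub>L\<^esub> \<mu> a b)"

lemma bilinD:
  assumes "bilin R M N L \<mu>"
  shows "a \<in> carrier M \<Longrightarrow> b \<in> carrier N \<Longrightarrow> \<mu> a b \<in> carrier L"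
    "a \<in> carrier M \<Longrightarrow> a' \<in> carrier M \<Longrightarrow> b \<in> carrier N \<Longrightarrow> \<mu> (a \<oplus>\<^bsub>M\<^esub> a') b = \<mu> a b \<oplus>\<^bsub>L\<^esub> \<mu> a' b"
    "a \<in> carrier M \<Longrightarrow> b \<in> carrier N \<Longrightarrow> b' \<in> carrier N \<Longrightarrow> \<mu> a (b \<oplus>\<^bsub>N\<^esub> b') = \<mu> a b \<oplus>\<^bsub>L\<^esub> \<mu> a b'"
    "r \<in> carrier R \<Longrightarrow> a \<in> carrier M \<Longrightarrow> b \<in> carrier N \<Longrightarrow> \<mu> (r \<odot>\<^bsub>M\<^esub> a) b = r \<odot>\<^bsub>L\<^esub> \<mu> a b"
    "r \<in> carrier R \<Longrightarrow> a \<in> carrier M \<Longrightarrow> b \<in> carrier N \<Longrightarrow> \<mu> a (r \<odot>\<^bsub>N\<^esub> b) = r \<odot>\<^bsub>L\<^esub> \<mu> a b"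
  using assms unfolding bilin_def by auto

lemma module_left_right:
  assumes "module R M" shows "left_module R M" "right_module R M"
proof -
  interpret module R M by fact
  have "r \<odot>\<^bsub>M\<^esub> (s \<odot>\<^bsub>M\<^esub> x) = s \<odot>\<^bsub>M\<^esub> (r \<odot>\<^bsub>M\<^esub> x)"
    if "r \<in> carrier R" "s \<in> carrier R" "x \<in> carrier M" for r s x
    using that by (metis R.m_comm smult_assoc1)
  then show "left_module R M" "right_module R M"
    by (unfold_locales; auto simp: smult_l_distr smult_r_distr smult_assoc1)+
qed

context
  fixes R :: "('r, 'x) ring_scheme" and M :: "('r, 'a, 'y1) module_scheme"
    and N :: "('r, 'b, 'y2) module_scheme"
    and K :: "('r, 'k, 'y4) module_scheme" and \<mu> \<nu>
  assumes M: "module R M" and N: "module R N" and K: "module R K"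
    and mu: "bilin R M N N \<mu>" and nu: "bilin R K K K \<nu>"
begin

lemma biadditive_ext_rel_left:
  assumes u: "u \<in> tensor_rel R M K" and v: "Poly_Mapping.keys v \<subseteq> carrier N \<times> carrier K"
  shows "biadditive_ext \<mu> \<nu> u v \<in> tensor_rel R N K"
  using module_left_right(2)[OF M] module_left_right(1)[OF K] u
proof (induction rule: tensor_rel_induct)
  note g = tensor_rel_props[OF module_left_right(2)[OF N] module_left_right(1)[OF K]]
  {
    case zero
    then show ?case by (simp add: biadditive_ext_0_left g)
  next
    case (add u u')
    then show ?case by (simp add: biadditive_ext_add_left g)
  next
    case (minus u)
    then show ?case by (simp add: biadditive_ext_minus_left g)
  next
    case (gen u)
    then show ?case
    proof (cases rule: tensor_gensE)
      case (left x x' y)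
      have "biadditive_ext \<mu> \<nu> u v = frag_extend (\<lambda>p. frag_of (\<mu> (x \<oplus>\<^bsub>M\<^esub> x') (fst p), \<nu> y (snd p)) -
          frag_of (\<mu> x (fst p), \<nu> y (snd p)) - frag_of (\<mu> x' (fst p), \<nu> y (snd p))) v"
        unfolding left(1) biadditive_ext_diff_left frag_extend_diff_fun by (simp add: biadditive_ext_def case_prod_unfold)
      also have "\<dots> \<in> tensor_rel R N K"
        by (rule frag_extend_mem[OF g(6) g(1,4)])
          (use left v in \<open>auto simp: bilinD[OF mu] bilinD[OF nu] tensor_gensI dest!: subsetD\<close>)
      finally show ?thesis .
    next
      case (right x y y')
      have "biadditive_ext \<mu> \<nu> u v = frag_extend (\<lambda>p. frag_of (\<mu> x (fst p), \<nu> (y \<oplus>\<^bsub>K\<^esub> y') (snd p)) -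
          frag_of (\<mu> x (fst p), \<nu> y (snd p)) - frag_of (\<mu> x (fst p), \<nu> y' (snd p))) v"
        unfolding right(1) biadditive_ext_diff_left frag_extend_diff_fun by (simp add: biadditive_ext_def case_prod_unfold)
      also have "\<dots> \<in> tensor_rel R N K"
        by (rule frag_extend_mem[OF g(6) g(1,4)])
          (use right v in \<open>auto simp: bilinD[OF mu] bilinD[OF nu] tensor_gensI dest!: subsetD\<close>)
      finally show ?thesis .
    next
      case (middle a x y)
      have "biadditive_ext \<mu> \<nu> u v = frag_extend (\<lambda>p. frag_of (\<mu> (a \<odot>\<^bsub>M\<^esub> x) (fst p), \<nu> y (snd p)) -
          frag_of (\<mu> x (fst p), \<nu> (a \<odot>\<^bsub>K\<^esub> y) (snd p))) v"
        unfolding middle(1) biadditive_ext_diff_left frag_extend_diff_fun by (simp add: biadditive_ext_def case_prod_unfold)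
      also have "\<dots> \<in> tensor_rel R N K"
        by (rule frag_extend_mem[OF g(6) g(1,4)])
          (use middle v in \<open>auto simp: bilinD[OF mu] bilinD[OF nu] tensor_gensI dest!: subsetD\<close>)
      finally show ?thesis .
    qed
  }
qed

lemma biadditive_ext_rel_right:
  assumes u: "u \<in> tensor_rel R N K" and v: "Poly_Mapping.keys v \<subseteq> carrier M \<times> carrier K"
  shows "biadditive_ext \<mu> \<nu> v u \<in> tensor_rel R N K"
  using module_left_right(2)[OF N] module_left_right(1)[OF K] u
proof (induction rule: tensor_rel_induct)
  note g = tensor_rel_props[OF module_left_right(2)[OF N] module_left_right(1)[OF K]]
  {
    case zero
    then show ?case by (simp add: biadditive_ext_0_right g)
  next
    case (add u u')
    then show ?case by (simp add: biadditive_ext_add_right g)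
  next
    case (minus u)
    then show ?case by (simp add: biadditive_ext_minus_right g)
  next
    case (gen u)
    show ?case unfolding biadditive_ext_def
    proof (rule frag_extend_mem, goal_cases)
      case (1 p)
      obtain b z where p: "p = (b, z)" "b \<in> carrier M" "z \<in> carrier K" using 1 v by auto
      from gen show ?case
        by (cases rule: tensor_gensE)
          (simp_all add: p bilinD[OF mu] bilinD[OF nu] frag_extend_diff g(6) tensor_gensI)
    qed (auto intro: g)
  }
qed

lemma tensor_product_class:
  assumes u: "Poly_Mapping.keys u \<subseteq> carrier M \<times> carrier K" and v: "Poly_Mapping.keys v \<subseteq> carrier N \<times> carrier K"
  shows "tensor_product R N K \<mu> \<nu> (tensor_class R M K u) (tensor_class R N K v) =
    tensor_class R N K (biadditive_ext \<mu> \<nu> u v)"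
proof -
  note lr = module_left_right(2)[OF N] module_left_right(1)[OF K]
  note lrM = module_left_right(2)[OF M] module_left_right(1)[OF K]
  note lrN = module_left_right(2)[OF N] module_left_right(1)[OF K]
  have "tensor_class R N K (biadditive_ext \<mu> \<nu> u' v') = tensor_class R N K (biadditive_ext \<mu> \<nu> u v)"
    if "u' \<in> tensor_class R M K u" "v' \<in> tensor_class R N K v" for u' v'
  proof -
    have *: "u' - u \<in> tensor_rel R M K" "v' - v \<in> tensor_rel R N K"
      using that by (auto simp: mem_tensor_class_iff)
    have "Poly_Mapping.keys (v + (v' - v)) \<subseteq> carrier N \<times> carrier K"
      using v tensor_rel_props(5)[OF lrN *(2)] keys_add[of v "v' - v"] by blast
    then have "biadditive_ext \<mu> \<nu> (u' - u) v' + biadditive_ext \<mu> \<nu> u (v' - v) \<in> tensor_rel R N K"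
      using biadditive_ext_rel_left[OF *(1)] biadditive_ext_rel_right[OF *(2) u] tensor_rel_props(2)[OF lr] by auto
    then show ?thesis unfolding tensor_class_eq_iff[OF lr] biadditive_ext_diff_left biadditive_ext_diff_right by simp
  qed
  moreover have "u \<in> tensor_class R M K u" "v \<in> tensor_class R N K v"
    using tensor_rel_props(1)[OF lrM] tensor_rel_props(1)[OF lrN] by (auto simp: mem_tensor_class_iff)
  ultimately show ?thesis unfolding tensor_product_def biadditive_ext_def[symmetric] by blast
qed

end

lemma tensor_mult_class:
  assumes "right_module A M" "left_module A N"
  shows "tensor_class A M N u \<otimes>\<^bsub>tensor A M N\<^esub> tensor_class A M N v = tensor_class A M N (u + v)"
  unfolding tensor_def mult_FactGroup set_mult_def
proof (intro equalityI subsetI, goal_cases)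
  case (1 w)
  then obtain u' v' where *: "w = u' + v'" "u' - u \<in> tensor_rel A M N" "v' - v \<in> tensor_rel A M N"
    by (auto simp: mem_tensor_class_iff)
  then show ?case using tensor_rel_props(2)[OF assms *(2,3)] by (simp add: mem_tensor_class_iff algebra_simps)
next
  case (2 w)
  then have "w - v \<in> tensor_class A M N u" "v \<in> tensor_class A M N v"
    using tensor_rel_props(1)[OF assms] by (simp_all add: mem_tensor_class_iff algebra_simps)
  then have "\<exists>u'\<in>tensor_class A M N u. \<exists>v'\<in>tensor_class A M N v. w = u' + v'"
    by (metis diff_add_cancel)
  then show ?case by auto
qed

lemma tensor_one: "\<one>\<^bsub>tensor A M N\<^esub> = tensor_class A M N 0"
  by (simp add: tensor_def tensor_class_eq_image)

lemma abelian_group_tensor: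
  fixes S :: "(('m \<times> 'n \<Rightarrow>\<^sub>0 int) set, 'z) ring_scheme"
  assumes MN: "right_module A M" "left_module A N"
    and S: "carrier S = carrier (tensor A M N)" "ring.zero S = \<one>\<^bsub>tensor A M N\<^esub>"
      "ring.add S = monoid.mult (tensor A M N)"
  shows "abelian_group S"
proof (rule abelian_groupI, unfold S carrier_tensor tensor_one)
  note k = keys_add
  fix x y assume "x \<in> tensor_class A M N ` {u. Poly_Mapping.keys u \<subseteq> carrier M \<times> carrier N}"
    "y \<in> tensor_class A M N ` {u. Poly_Mapping.keys u \<subseteq> carrier M \<times> carrier N}"
  then obtain u v where "x = tensor_class A M N u" "y = tensor_class A M N v"
    "Poly_Mapping.keys u \<subseteq> carrier M \<times> carrier N" "Poly_Mapping.keys v \<subseteq> carrier M \<times> carrier N"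
    by auto
  then show "x \<otimes>\<^bsub>tensor A M N\<^esub> y \<in> tensor_class A M N ` {u. Poly_Mapping.keys u \<subseteq> carrier M \<times> carrier N}"
    using keys_add[of u v] by (auto simp: tensor_mult_class[OF MN] intro!: imageI)
next
  fix x assume "x \<in> tensor_class A M N ` {u. Poly_Mapping.keys u \<subseteq> carrier M \<times> carrier N}"
  then obtain u where "x = tensor_class A M N u" "Poly_Mapping.keys u \<subseteq> carrier M \<times> carrier N" by auto
  then show "\<exists>y\<in>tensor_class A M N ` {u. Poly_Mapping.keys u \<subseteq> carrier M \<times> carrier N}.
       y \<otimes>\<^bsub>tensor A M N\<^esub> x = tensor_class A M N 0"
    by (intro bexI[of _ "tensor_class A M N (- u)"]) (auto simp: tensor_mult_class[OF MN])
qed (auto simp: tensor_mult_class[OF MN] add_ac)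

lemma module_algebra_via:
  assumes "cring R" "cring k" "\<phi> \<in> ring_hom R k"
  shows "module R (algebra_via k \<phi>)"
proof -
  interpret R: cring R by fact
  interpret k: cring k by fact
  interpret h: ring_hom_cring R k \<phi> by unfold_locales (fact assms(3))
  have "abelian_group (algebra_via k \<phi>)"
    by (rule abelian_groupI) (auto simp: algebra_via_def k.a_ac intro: bexI[of _ "\<ominus>\<^bsub>k\<^esub> _"] k.l_neg)
  then show ?thesis
    by (intro moduleI assms(1)) (auto simp: algebra_via_def k.l_distr k.r_distr k.m_assoc)
qed

lemma bilin_algebra_via:
  assumes "cring R" "cring k" "\<phi> \<in> ring_hom R k"
  shows "bilin R (algebra_via k \<phi>) (algebra_via k \<phi>) (algebra_via k \<phi>) (monoid.mult k)"
proof -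
  interpret R: cring R by fact
  interpret k: cring k by fact
  interpret h: ring_hom_cring R k \<phi> by unfold_locales (fact assms(3))
  show ?thesis by (auto simp: bilin_def algebra_via_def k.l_distr k.r_distr k.m_ac)
qed

lemma module_restrict_scalars:
  assumes "assoc_algebra R A" "left_module A B"
  shows "module R (restrict_scalars A B)" "bilin R A (restrict_scalars A B) (restrict_scalars A B) (smult B)"
proof -
  interpret A: assoc_algebra R A by fact
  interpret B: left_module A B by fact
  have ab: "abelian_group (restrict_scalars A B)"
    by (rule abelian_groupI)
      (auto simp: restrict_scalars_def B.M.a_ac intro: bexI[of _ "\<ominus>\<^bsub>B\<^esub> _"] B.M.l_neg)
  have c: "r \<odot>\<^bsub>A\<^esub> \<one>\<^bsub>A\<^esub> \<otimes>\<^bsub>A\<^esub> a = r \<odot>\<^bsub>A\<^esub> a" "a \<otimes>\<^bsub>A\<^esub> (r \<odot>\<^bsub>A\<^esub> \<one>\<^bsub>A\<^esub>) = r \<odot>\<^bsub>A\<^esub> a"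
    if "r \<in> carrier R" "a \<in> carrier A" for r a
    using that by (auto simp: A.smult_mult_left A.smult_mult_right)
  have cc: "r \<odot>\<^bsub>A\<^esub> (s \<odot>\<^bsub>A\<^esub> a) = s \<odot>\<^bsub>A\<^esub> (r \<odot>\<^bsub>A\<^esub> a)"
    if "r \<in> carrier R" "s \<in> carrier R" "a \<in> carrier A" for r s a
    using that by (metis A.R.m_comm A.smult_assoc1)
  show "module R (restrict_scalars A B)"
    by (intro moduleI A.R.is_cring ab)
      (auto simp: restrict_scalars_def A.smult_l_distr B.lsmult_l_distr B.lsmult_r_distr
        B.lsmult_closed B.lsmult_one A.smult_assoc1 c cc simp flip: B.lsmult_assoc)
  show "bilin R A (restrict_scalars A B) (restrict_scalars A B) (smult B)"
    by (auto simp: bilin_def restrict_scalars_def B.lsmult_l_distr B.lsmult_r_distr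
        B.lsmult_closed c simp flip: B.lsmult_assoc)
qed

lemma bilin_algebra: "assoc_algebra R A \<Longrightarrow> bilin R A A A (monoid.mult A)"
proof -
  assume "assoc_algebra R A"
  then interpret A: assoc_algebra R A .
  show ?thesis by (auto simp: bilin_def A.smult_mult_left A.smult_mult_right A.l_distr A.r_distr)
qed

lemma base_change:
  assumes A: "assoc_algebra R A" and k: "cring k" and \<phi>: "\<phi> \<in> ring_hom R k"
  shows ring_base_change_ring: "ring (base_change_ring R A k \<phi>)"
    and left_module_base_change_module:
      "left_module A B \<Longrightarrow> left_module (base_change_ring R A k \<phi>) (base_change_module R A B k \<phi>)"
proof -
  interpret A: assoc_algebra R A by fact
  interpret k: cring k by fact
  define K where "K = algebra_via k \<phi>"
  have K: "module R K" "bilin R K K K (monoid.mult k)" "carrier K = carrier k"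
    unfolding K_def using module_algebra_via bilin_algebra_via A.R.is_cring k \<phi>
    by (auto simp: algebra_via_def)
  note A' = A.module_axioms bilin_algebra[OF A]
  note AK = module_left_right(2)[OF A'(1)] module_left_right(1)[OF K(1)]
  let ?C = "{u. Poly_Mapping.keys u \<subseteq> carrier A \<times> carrier k}"
  let ?A = "base_change_ring R A k \<phi>"
  let ?c = "tensor_class R A K"
  let ?e = "biadditive_ext (monoid.mult A) (monoid.mult k)"
  have Ac: "carrier ?A = ?c ` ?C"
    by (simp add: base_change_ring_def Let_def carrier_tensor K K_def[symmetric])
  have Aadd: "?c u \<oplus>\<^bsub>?A\<^esub> ?c v = ?c (u + v)" for u v
    by (simp add: base_change_ring_def Let_def K_def[symmetric] tensor_mult_class[OF AK])
  have Amult: "?c u \<otimes>\<^bsub>?A\<^esub> ?c v = ?c (?e u v)" if "u \<in> ?C" "v \<in> ?C" for u v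
    using that tensor_product_class[OF A'(1) A'(1) K(1) A'(2) K(2)]
    by (simp add: base_change_ring_def Let_def K_def[symmetric] K)
  have Aone: "\<one>\<^bsub>?A\<^esub> = ?c (frag_of (\<one>\<^bsub>A\<^esub>, \<one>\<^bsub>k\<^esub>))" "frag_of (\<one>\<^bsub>A\<^esub>, \<one>\<^bsub>k\<^esub>) \<in> ?C"
    by (simp_all add: base_change_ring_def Let_def K_def[symmetric])
  have eC: "?e u v \<in> ?C" if "u \<in> ?C" "v \<in> ?C" for u v
    using that unfolding mem_Collect_eq by (rule keys_biadditive_ext) auto
  have addC: "u + v \<in> ?C" if "u \<in> ?C" "v \<in> ?C" for u v
    using that keys_add[of u v] by blast
  have assoc: "?e (?e u v) w = ?e u (?e v w)" if "u \<in> ?C" "v \<in> ?C" "w \<in> ?C" for u v w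
    by (rule biadditive_ext_assoc[of _ "carrier A" "carrier k" _ "carrier A" "carrier k" _ "carrier A" "carrier k"])
      (use that in \<open>auto simp: A.m_assoc k.m_assoc\<close>)
  have e1: "?e (frag_of (\<one>\<^bsub>A\<^esub>, \<one>\<^bsub>k\<^esub>)) u = u" "?e u (frag_of (\<one>\<^bsub>A\<^esub>, \<one>\<^bsub>k\<^esub>)) = u" if "u \<in> ?C" for u
    using that by (auto intro!: biadditive_ext_one_left[of _ "carrier A" "carrier k"] biadditive_ext_one_right[of _ "carrier A" "carrier k"])
  have ab: "abelian_group ?A"
    by (rule abelian_group_tensor[OF AK]) (simp_all add: base_change_ring_def Let_def K_def[symmetric])
  show ring: "ring ?A"
  proof (rule ringI[OF ab monoidI])
    show "\<And>x. x \<in> carrier ?A \<Longrightarrow> \<one>\<^bsub>?A\<^esub> \<otimes>\<^bsub>?A\<^esub> x = x"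
      unfolding Ac by (elim imageE) (simp only: Aone(1) Amult[OF Aone(2)] e1)
    show "\<And>x. x \<in> carrier ?A \<Longrightarrow> x \<otimes>\<^bsub>?A\<^esub> \<one>\<^bsub>?A\<^esub> = x"
      unfolding Ac by (elim imageE) (simp only: Aone(1) Amult[OF _ Aone(2)] e1)
  qed (unfold Ac Aone(1), (rule imageI[OF Aone(2)] | elim imageE,
        simp del: mem_Collect_eq add: Aadd Amult eC addC assoc biadditive_ext_add_left biadditive_ext_add_right imageI)+)
  assume B: "left_module A B"
  interpret B: left_module A B by fact
  define B' where "B' = restrict_scalars A B"
  note B' = module_restrict_scalars[OF A B, folded B'_def]
  have B'c: "carrier B' = carrier B" by (simp add: B'_def restrict_scalars_def)
  note BK = module_left_right(2)[OF B'(1)] module_left_right(1)[OF K(1)]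
  let ?D = "{u. Poly_Mapping.keys u \<subseteq> carrier B \<times> carrier k}"
  let ?B = "base_change_module R A B k \<phi>"
  let ?d = "tensor_class R B' K"
  let ?f = "biadditive_ext (smult B) (monoid.mult k)"
  have Bc: "carrier ?B = ?d ` ?D"
    by (simp add: base_change_module_def Let_def carrier_tensor K B'c K_def[symmetric] B'_def[symmetric])
  have Badd: "?d u \<oplus>\<^bsub>?B\<^esub> ?d v = ?d (u + v)" for u v
    by (simp add: base_change_module_def Let_def K_def[symmetric] B'_def[symmetric] tensor_mult_class[OF BK])
  have Bmult: "?c u \<odot>\<^bsub>?B\<^esub> ?d v = ?d (?f u v)" if "u \<in> ?C" "v \<in> ?D" for u v
    using that tensor_product_class[OF A'(1) B'(1) K(1) B'(2) K(2)]
    by (simp add: base_change_module_def Let_def K_def[symmetric] B'_def[symmetric] K B'c)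
  have fD: "?f u v \<in> ?D" if "u \<in> ?C" "v \<in> ?D" for u v
    using that unfolding mem_Collect_eq by (rule keys_biadditive_ext) (auto simp: B.lsmult_closed)
  have addD: "u + v \<in> ?D" if "u \<in> ?D" "v \<in> ?D" for u v
    using that keys_add[of u v] by blast
  have bassoc: "?f (?e u v) w = ?f u (?f v w)" if "u \<in> ?C" "v \<in> ?C" "w \<in> ?D" for u v w
    by (rule biadditive_ext_assoc[of _ "carrier A" "carrier k" _ "carrier A" "carrier k" _ "carrier B" "carrier k"])
      (use that in \<open>auto simp: B.lsmult_assoc k.m_assoc\<close>)
  have f1: "?f (frag_of (\<one>\<^bsub>A\<^esub>, \<one>\<^bsub>k\<^esub>)) u = u" if "u \<in> ?D" for u
    using that by (auto intro!: biadditive_ext_one_left[of _ "carrier B" "carrier k"] simp: B.lsmult_one)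
  have abB: "abelian_group ?B"
    by (rule abelian_group_tensor[OF BK])
      (simp_all add: base_change_module_def Let_def K_def[symmetric] B'_def[symmetric])
  show "left_module ?A ?B"
  proof (intro left_module.intro left_module_axioms.intro ring abB)
    show "\<And>x. x \<in> carrier ?B \<Longrightarrow> \<one>\<^bsub>?A\<^esub> \<odot>\<^bsub>?B\<^esub> x = x"
      unfolding Bc by (elim imageE) (simp only: Aone(1) Bmult[OF Aone(2)] f1)
  qed (unfold Ac Bc, (elim imageE,
        simp del: mem_Collect_eq add: Aadd Badd Amult Bmult eC fD addC addD bassoc
          biadditive_ext_add_left biadditive_ext_add_right imageI)+)
qed


section \<open>The fraction field is a field\<close>

context "domain" begin

lemma frac_crossmult:
  assumes "a \<in> carrier R" "b \<in> carrier R - {\<zero>}" "c \<in> carrier R" "d \<in> carrier R - {\<zero>}"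
    "e \<in> carrier R" "f \<in> carrier R - {\<zero>}" "a \<otimes> d = c \<otimes> b" "c \<otimes> f = e \<otimes> d"
  shows "a \<otimes> f = e \<otimes> b"
proof -
  have "d \<otimes> (a \<otimes> f) = (a \<otimes> d) \<otimes> f" using assms(1-6) by (simp add: m_ac)
  also have "\<dots> = (c \<otimes> f) \<otimes> b" unfolding assms(7) using assms(1-6) by (simp add: m_ac)
  also have "\<dots> = d \<otimes> (e \<otimes> b)" unfolding assms(8) using assms(1-6) by (simp add: m_ac)
  finally show ?thesis using assms m_lcancel[of d "a \<otimes> f" "e \<otimes> b"] by simp
qed

lemma equiv_frac_eq: "equiv (carrier R \<times> (carrier R - {\<zero>})) (frac_eq R)"
proof (intro equivI refl_onI symI transI)
  fix p q r assume "(p, q) \<in> frac_eq R" "(q, r) \<in> frac_eq R"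
  then show "(p, r) \<in> frac_eq R"
    using frac_crossmult[of "fst p" "snd p" "fst q" "snd q" "fst r" "snd r"]
    unfolding frac_eq_def by (cases p; cases q; cases r) simp
qed (auto simp: frac_eq_def)

lemma frac_eq_iff:
  assumes "a \<in> carrier R" "b \<in> carrier R - {\<zero>}" "c \<in> carrier R" "d \<in> carrier R - {\<zero>}"
  shows "fraction R a b = fraction R c d \<longleftrightarrow> a \<otimes> d = c \<otimes> b"
  unfolding fraction_def using eq_equiv_class_iff[OF equiv_frac_eq, of "(a, b)" "(c, d)"] assms
  by (simp add: frac_eq_def)

lemma mem_frac_iff:
  assumes "a \<in> carrier R" "b \<in> carrier R - {\<zero>}"
  shows "(c, d) \<in> fraction R a b \<longleftrightarrow> c \<in> carrier R \<and> d \<in> carrier R - {\<zero>} \<and> a \<otimes> d = c \<otimes> b"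
  using assms by (auto simp: fraction_def frac_eq_def)

lemma carrier_fraction_field:
  "carrier (fraction_field R) = {fraction R a b |a b. a \<in> carrier R \<and> b \<in> carrier R - {\<zero>}}"
  by (auto simp: fraction_field_def quotient_def fraction_def)

lemma UN_UN_const:
  assumes "\<And>a b c d. (a, b) \<in> S \<Longrightarrow> (c, d) \<in> T \<Longrightarrow> f a b c d = w" "(a0, b0) \<in> S" "(c0, d0) \<in> T"
  shows "(\<Union>(a, b)\<in>S. \<Union>(c, d)\<in>T. f a b c d) = w"
proof -
  have "(\<Union>(a, b)\<in>S. \<Union>(c, d)\<in>T. f a b c d) = (\<Union>p\<in>S. \<Union>q\<in>T. w)"
    by (intro SUP_cong refl) (auto simp: assms(1))
  then show ?thesis using assms(2,3) by auto
qed

lemma mult_fraction_field: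
  assumes "a \<in> carrier R" "b \<in> carrier R - {\<zero>}" "c \<in> carrier R" "d \<in> carrier R - {\<zero>}"
  shows "fraction R a b \<otimes>\<^bsub>fraction_field R\<^esub> fraction R c d = fraction R (a \<otimes> c) (b \<otimes> d)"
proof -
  have "fraction R (a' \<otimes> c') (b' \<otimes> d') = fraction R (a \<otimes> c) (b \<otimes> d)"
    if *: "(a', b') \<in> fraction R a b" "(c', d') \<in> fraction R c d" for a' b' c' d'
  proof -
    have m: "a' \<in> carrier R" "b' \<in> carrier R - {\<zero>}" "c' \<in> carrier R" "d' \<in> carrier R - {\<zero>}"
      and eq: "a \<otimes> b' = a' \<otimes> b" "c \<otimes> d' = c' \<otimes> d"
      using *[unfolded mem_frac_iff[OF assms(1,2)] mem_frac_iff[OF assms(3,4)]] by blast+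
    have "(a' \<otimes> c') \<otimes> (b \<otimes> d) = (a' \<otimes> b) \<otimes> (c' \<otimes> d)" using m assms by (simp add: m_ac)
    also have "\<dots> = (a \<otimes> b') \<otimes> (c \<otimes> d')" by (simp only: eq)
    also have "\<dots> = (a \<otimes> c) \<otimes> (b' \<otimes> d')" using m assms by (simp add: m_ac)
    finally show ?thesis using m assms by (subst frac_eq_iff) (auto simp: integral_iff)
  qed
  note * = this
  have **: "(a, b) \<in> fraction R a b" "(c, d) \<in> fraction R c d"
    using assms by (auto simp: mem_frac_iff)
  show ?thesis unfolding fraction_field_def by simp (rule UN_UN_const[OF * **])
qed

lemma add_fraction_field:
  assumes "a \<in> carrier R" "b \<in> carrier R - {\<zero>}" "c \<in> carrier R" "d \<in> carrier R - {\<zero>}"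
  shows "fraction R a b \<oplus>\<^bsub>fraction_field R\<^esub> fraction R c d = fraction R (a \<otimes> d \<oplus> c \<otimes> b) (b \<otimes> d)"
proof -
  have "fraction R (a' \<otimes> d' \<oplus> c' \<otimes> b') (b' \<otimes> d') = fraction R (a \<otimes> d \<oplus> c \<otimes> b) (b \<otimes> d)"
    if *: "(a', b') \<in> fraction R a b" "(c', d') \<in> fraction R c d" for a' b' c' d'
  proof -
    have m: "a' \<in> carrier R" "b' \<in> carrier R - {\<zero>}" "c' \<in> carrier R" "d' \<in> carrier R - {\<zero>}"
      and eq: "a \<otimes> b' = a' \<otimes> b" "c \<otimes> d' = c' \<otimes> d"
      using *[unfolded mem_frac_iff[OF assms(1,2)] mem_frac_iff[OF assms(3,4)]] by blast+
    have "(a' \<otimes> d' \<oplus> c' \<otimes> b') \<otimes> (b \<otimes> d) = (a' \<otimes> b) \<otimes> (d' \<otimes> d) \<oplus> (c' \<otimes> d) \<otimes> (b' \<otimes> b)"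
      using m assms by (simp add: m_ac l_distr r_distr)
    also have "\<dots> = (a \<otimes> b') \<otimes> (d' \<otimes> d) \<oplus> (c \<otimes> d') \<otimes> (b' \<otimes> b)" by (simp only: eq)
    also have "\<dots> = (a \<otimes> d \<oplus> c \<otimes> b) \<otimes> (b' \<otimes> d')" using m assms by (simp add: m_ac l_distr r_distr)
    finally show ?thesis using m assms by (subst frac_eq_iff) (auto simp: integral_iff)
  qed
  note * = this
  have **: "(a, b) \<in> fraction R a b" "(c, d) \<in> fraction R c d"
    using assms by (auto simp: mem_frac_iff)
  show ?thesis unfolding fraction_field_def by simp (rule UN_UN_const[OF * **])
qed

lemma zero_one_fraction_field:
  "\<zero>\<^bsub>fraction_field R\<^esub> = fraction R \<zero> \<one>" "\<one>\<^bsub>fraction_field R\<^esub> = fraction R \<one> \<one>"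
  by (simp_all add: fraction_field_def)

lemma field_fraction_field: "field (fraction_field R)"
proof -
  let ?K = "fraction_field R"
  note s = mult_fraction_field add_fraction_field zero_one_fraction_field integral_iff
  have mem: "fraction R a b \<in> carrier ?K" if "a \<in> carrier R" "b \<in> carrier R" "b \<noteq> \<zero>" for a b
    using that unfolding carrier_fraction_field by blast
  have frE: "\<exists>a b. x = fraction R a b \<and> a \<in> carrier R \<and> b \<in> carrier R \<and> b \<noteq> \<zero>" if "x \<in> carrier ?K" for x
    using that unfolding carrier_fraction_field by blast
  have ab: "abelian_group ?K"
  proof (rule abelian_groupI)
    fix x y z assume "x \<in> carrier ?K" "y \<in> carrier ?K"
    note xy = frE[OF this(1)] frE[OF this(2)]
    show "x \<oplus>\<^bsub>?K\<^esub> y \<in> carrier ?K" using xy by (clarsimp simp: s mem)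
    show "x \<oplus>\<^bsub>?K\<^esub> y = y \<oplus>\<^bsub>?K\<^esub> x" using xy by (clarsimp simp: s m_ac a_ac)
    show "\<zero>\<^bsub>?K\<^esub> \<oplus>\<^bsub>?K\<^esub> x = x" using xy by (clarsimp simp: s)
    assume z: "z \<in> carrier ?K"
    show "x \<oplus>\<^bsub>?K\<^esub> y \<oplus>\<^bsub>?K\<^esub> z = x \<oplus>\<^bsub>?K\<^esub> (y \<oplus>\<^bsub>?K\<^esub> z)"
      using xy frE[OF z] by (clarsimp simp: s m_ac a_ac l_distr r_distr)
  next
    fix x assume "x \<in> carrier ?K"
    then obtain a b where x: "x = fraction R a b" "a \<in> carrier R" "b \<in> carrier R - {\<zero>}"
      unfolding carrier_fraction_field by blast
    have "\<ominus> a \<otimes> b \<oplus> a \<otimes> b = \<zero>" using x by (metis Diff_iff l_minus l_neg m_closed)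
    then show "\<exists>y\<in>carrier ?K. y \<oplus>\<^bsub>?K\<^esub> x = \<zero>\<^bsub>?K\<^esub>"
      by (intro bexI[of _ "fraction R (\<ominus> a) b"]) (use x in \<open>auto simp: s mem frac_eq_iff\<close>)
  qed (auto simp: s mem)
  have cm: "Group.comm_monoid ?K"
  proof (rule comm_monoidI)
    fix x y z assume "x \<in> carrier ?K" "y \<in> carrier ?K"
    note xy = frE[OF this(1)] frE[OF this(2)]
    show "x \<otimes>\<^bsub>?K\<^esub> y \<in> carrier ?K" using xy by (clarsimp simp: s mem)
    show "x \<otimes>\<^bsub>?K\<^esub> y = y \<otimes>\<^bsub>?K\<^esub> x" using xy by (clarsimp simp: s m_ac)
    show "\<one>\<^bsub>?K\<^esub> \<otimes>\<^bsub>?K\<^esub> x = x" using xy by (clarsimp simp: s)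
    assume z: "z \<in> carrier ?K"
    show "x \<otimes>\<^bsub>?K\<^esub> y \<otimes>\<^bsub>?K\<^esub> z = x \<otimes>\<^bsub>?K\<^esub> (y \<otimes>\<^bsub>?K\<^esub> z)"
      using xy frE[OF z] by (clarsimp simp: s m_ac)
  qed (auto simp: s mem)
  have distr: "(x \<oplus>\<^bsub>?K\<^esub> y) \<otimes>\<^bsub>?K\<^esub> z = x \<otimes>\<^bsub>?K\<^esub> z \<oplus>\<^bsub>?K\<^esub> y \<otimes>\<^bsub>?K\<^esub> z"
    if "x \<in> carrier ?K" "y \<in> carrier ?K" "z \<in> carrier ?K" for x y z
    using that unfolding carrier_fraction_field
    by (clarsimp simp: mult_fraction_field add_fraction_field integral_iff)
      (subst frac_eq_iff; simp add: integral_iff m_ac l_distr r_distr)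
  have "cring ?K" by (rule cringI[OF ab cm distr])
  then show ?thesis
  proof (rule cring.cring_fieldI2)
    show "\<zero>\<^bsub>?K\<^esub> \<noteq> \<one>\<^bsub>?K\<^esub>" by (simp add: zero_one_fraction_field frac_eq_iff)
    fix x assume x: "x \<in> carrier ?K" "x \<noteq> \<zero>\<^bsub>?K\<^esub>"
    then obtain a b where ab: "x = fraction R a b" "a \<in> carrier R" "b \<in> carrier R - {\<zero>}"
      unfolding carrier_fraction_field by blast
    then have a: "a \<in> carrier R - {\<zero>}" using x by (auto simp: zero_one_fraction_field frac_eq_iff)
    have "x \<otimes>\<^bsub>?K\<^esub> fraction R b a = \<one>\<^bsub>?K\<^esub>" "fraction R b a \<in> carrier ?K"
      using a ab by (auto simp: mem mult_fraction_field zero_one_fraction_field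
        frac_eq_iff integral_iff m_comm)
    then show "\<exists>y\<in>carrier ?K. x \<otimes>\<^bsub>?K\<^esub> y = \<one>\<^bsub>?K\<^esub>" by blast
  qed
qed

lemma to_fraction_field_hom: "to_fraction_field R \<in> ring_hom R (fraction_field R)"
proof (rule ring_hom_memI)
  show "to_fraction_field R x \<in> carrier (fraction_field R)" if "x \<in> carrier R" for x
    using that one_not_zero unfolding to_fraction_field_def carrier_fraction_field by blast
qed (simp_all add: to_fraction_field_def mult_fraction_field add_fraction_field zero_one_fraction_field)

lemma inj_to_fraction_field: "inj_on (to_fraction_field R) (carrier R)"
  by (auto simp: inj_on_def to_fraction_field_def frac_eq_iff)

end

end

theory Submission
  imports Defs
begin

text \<open>
  The direction from \<open>A\<close> to the residue fields holds because flatness is stable under base change.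
  For the converse, suppose first that an element of some \<open>N \<otimes>\<^sub>A B\<close>, with \<open>N\<close> a right ideal of \<open>A\<close>,
  vanishes in \<open>B\<close>. Flatness over the fraction field makes it an \<open>R\<close>-torsion element. On the other
  hand, \<open>N \<otimes>\<^sub>A B\<close> has no torsion at a maximal ideal \<open>\<mm> \<noteq> 0\<close>: locally \<open>\<mm>\<close> is generated by some \<open>\<pi>\<close>,
  multiplication by \<open>\<pi>\<close> is injective on \<open>N\<close>, and so the \<open>\<pi>\<close>-torsion of \<open>N \<otimes>\<^sub>A B\<close> is a quotient of
  \<open>Tor\<^sub>1\<^sup>A(N/\<pi>N, B)\<close>, which is \<open>Tor\<^sub>1\<close> of \<open>N/\<pi>N\<close> and \<open>B/\<pi>B\<close> over \<open>A/\<pi>A\<close>, because \<open>\<pi>\<close> is regular on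
  \<open>A\<close> and on \<open>B\<close>; it vanishes since \<open>B/\<pi>B\<close> is flat. Over a noetherian ring, a nonzero torsion
  element has a multiple whose annihilator is a nonzero prime ideal, hence maximal.

  The proof below carries this out with relations instead of derived functors. Let \<open>F\<close> be the free
  left \<open>A\<close>-module on the set \<open>B\<close>, with its canonical surjection onto \<open>B\<close> (\<open>presentation\<close>), and let \<open>Q\<close> be
  the kernel. By \<open>flat_imp_equational\<close> and \<open>equational_imp_flat\<close>, the module \<open>B\<close> is flat if and
  only if each \<open>q \<in> Q\<close> is killed by an endomorphism of \<open>F\<close> over \<open>B\<close>; equivalently, \<open>q\<close> is the value
  at \<open>q\<close> of a homomorphism from \<open>F\<close> to \<open>Q\<close>. The values at \<open>q\<close> of all these homomorphisms form the set
  \<open>syzygy_multiples\<close>: it is \<open>NQ\<close> for the right ideal \<open>N\<close> of the coefficients of \<open>q\<close>, and \<open>N \<otimes>\<^sub>A B\<close>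
  is the quotient by \<open>NQ\<close> of the elements of \<open>F\<close> with coefficients in \<open>N\<close>.

  Let \<open>k\<close> be the residue field of \<open>R\<close> at a prime ideal \<open>P\<close>; the fraction field is the case \<open>P = 0\<close>.
  The elements of \<open>B\<^sub>k\<close> are fractions \<open>b/s\<close> with \<open>s \<notin> P\<close>, and \<open>b/1\<close> vanishes if and only if
  \<open>s b \<in> P B\<close> for some \<open>s \<notin> P\<close> (\<open>tensor_common_denominator\<close>, \<open>tensor_rel_one_iff\<close>). Clearing
  denominators translates the criterion for \<open>B\<^sub>k\<close> over \<open>A\<^sub>k\<close> into statements on relations over \<open>A\<close>
  that hold modulo \<open>P\<close> up to factors outside \<open>P\<close>: this is \<open>equational_extension\<close> in one direction
  and \<open>equational_mod_contraction\<close> in the other.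

  The vanishing of \<open>Tor\<^sub>1\<close> becomes \<open>syzygy_multiples_cancel\<close>, which cancels \<open>\<pi>\<close> modulo
  \<open>syzygy_multiples\<close>. The element \<open>\<pi>\<close> comes from \<open>maximal_ideal_locally_principal\<close>, the only place
  where \<open>R\<close> has to be integrally closed.
\<close>

section \<open>Free left modules and linear maps\<close>

context left_module begin

lemma zero_lsmult: "x \<in> carrier M \<Longrightarrow> \<zero>\<^bsub>A\<^esub> \<odot>\<^bsub>M\<^esub> x = \<zero>\<^bsub>M\<^esub>"
  using lsmult_l_distr[of "\<zero>\<^bsub>A\<^esub>" "\<zero>\<^bsub>A\<^esub>" x] lsmult_closed[of "\<zero>\<^bsub>A\<^esub>" x] M.add.l_cancel_one' by simp

lemma lsmult_zero: "a \<in> carrier A \<Longrightarrow> a \<odot>\<^bsub>M\<^esub> \<zero>\<^bsub>M\<^esub> = \<zero>\<^bsub>M\<^esub>"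
  using lsmult_r_distr[of a "\<zero>\<^bsub>M\<^esub>" "\<zero>\<^bsub>M\<^esub>"] lsmult_closed[of a "\<zero>\<^bsub>M\<^esub>"] M.add.l_cancel_one' by simp

lemma lsmult_uminus: "a \<in> carrier A \<Longrightarrow> x \<in> carrier M \<Longrightarrow> a \<odot>\<^bsub>M\<^esub> (\<ominus>\<^bsub>M\<^esub> x) = \<ominus>\<^bsub>M\<^esub> (a \<odot>\<^bsub>M\<^esub> x)"
  by (rule M.minus_equality[symmetric])
    (simp_all add: lsmult_closed M.l_neg lsmult_zero flip: lsmult_r_distr)

lemma uminus_lsmult: "a \<in> carrier A \<Longrightarrow> x \<in> carrier M \<Longrightarrow> (\<ominus>\<^bsub>A\<^esub> a) \<odot>\<^bsub>M\<^esub> x = \<ominus>\<^bsub>M\<^esub> (a \<odot>\<^bsub>M\<^esub> x)"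
  by (rule M.minus_equality[symmetric])
    (simp_all add: lsmult_closed A.l_neg zero_lsmult flip: lsmult_l_distr)

lemma lsmult_minus:
  "a \<in> carrier A \<Longrightarrow> x \<in> carrier M \<Longrightarrow> y \<in> carrier M \<Longrightarrow> a \<odot>\<^bsub>M\<^esub> (x \<ominus>\<^bsub>M\<^esub> y) = a \<odot>\<^bsub>M\<^esub> x \<ominus>\<^bsub>M\<^esub> a \<odot>\<^bsub>M\<^esub> y"
  by (simp add: a_minus_def lsmult_r_distr lsmult_uminus)

end

text \<open>Finitely supported functions from \<open>S\<close>, extended by zero outside \<open>S\<close> so that equality is equality of functions.\<close>
definition free_module :: "('a, 'x) ring_scheme \<Rightarrow> 'b set \<Rightarrow> ('a, 'b \<Rightarrow> 'a) module"
  where "free_module A S =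
    \<lparr>carrier = {f. (\<forall>b\<in>S. f b \<in> carrier A) \<and> (\<forall>b. b \<notin> S \<longrightarrow> f b = \<zero>\<^bsub>A\<^esub>) \<and> finite {b. f b \<noteq> \<zero>\<^bsub>A\<^esub>}},
     monoid.mult = undefined, one = undefined, ring.zero = (\<lambda>_. \<zero>\<^bsub>A\<^esub>),
     ring.add = (\<lambda>f g b. f b \<oplus>\<^bsub>A\<^esub> g b), smult = (\<lambda>a f b. a \<otimes>\<^bsub>A\<^esub> f b)\<rparr>"

definition basis_vec :: "('a, 'x) ring_scheme \<Rightarrow> 'b \<Rightarrow> 'b \<Rightarrow> 'a"
  where "basis_vec A b = (\<lambda>c. if c = b then \<one>\<^bsub>A\<^esub> else \<zero>\<^bsub>A\<^esub>)"

definition lin_ext :: "('a, 'x) ring_scheme \<Rightarrow> ('a, 'm, 'y) module_scheme \<Rightarrow> ('b \<Rightarrow> 'm) \<Rightarrow> ('b \<Rightarrow> 'a) \<Rightarrow> 'm"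
  where "lin_ext A L \<theta> f = (\<Oplus>\<^bsub>L\<^esub>b\<in>{b. f b \<noteq> \<zero>\<^bsub>A\<^esub>}. f b \<odot>\<^bsub>L\<^esub> \<theta> b)"

lemma free_module_simps [simp]:
  "\<zero>\<^bsub>free_module A S\<^esub> = (\<lambda>_. \<zero>\<^bsub>A\<^esub>)"
  "f \<oplus>\<^bsub>free_module A S\<^esub> g = (\<lambda>b. f b \<oplus>\<^bsub>A\<^esub> g b)"
  "a \<odot>\<^bsub>free_module A S\<^esub> f = (\<lambda>b. a \<otimes>\<^bsub>A\<^esub> f b)"
  by (simp_all add: free_module_def)

lemma free_module_support:
  assumes "f \<in> carrier (free_module A S)"
  shows "finite {b. f b \<noteq> \<zero>\<^bsub>A\<^esub>}" "{b. f b \<noteq> \<zero>\<^bsub>A\<^esub>} \<subseteq> S"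
  using assms by (auto simp: free_module_def)

context ring begin

lemma free_module_closed: "f \<in> carrier (free_module R S) \<Longrightarrow> f b \<in> carrier R"
  by (cases "b \<in> S") (auto simp: free_module_def)

lemma mem_free_module:
  "f \<in> carrier (free_module R S) \<longleftrightarrow>
    (\<forall>b. f b \<in> carrier R) \<and> (\<forall>b. b \<notin> S \<longrightarrow> f b = \<zero>) \<and> finite {b. f b \<noteq> \<zero>}"
  by (auto simp: free_module_closed) (auto simp: free_module_def)

lemma basis_vec_closed: "b \<in> S \<Longrightarrow> basis_vec R b \<in> carrier (free_module R S)"
  by (auto simp: free_module_def basis_vec_def)

lemma left_module_free_module: "left_module R (free_module R S)"
proof -
  let ?F = "free_module R S"
  have add: "f \<oplus>\<^bsub>?F\<^esub> g \<in> carrier ?F" if "f \<in> carrier ?F" "g \<in> carrier ?F" for f g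
  proof -
    have "{b. f b \<oplus> g b \<noteq> \<zero>} \<subseteq> {b. f b \<noteq> \<zero>} \<union> {b. g b \<noteq> \<zero>}" by auto
    then show ?thesis using that finite_subset by (auto simp: mem_free_module)
  qed
  have smult: "a \<odot>\<^bsub>?F\<^esub> f \<in> carrier ?F" if "a \<in> carrier R" "f \<in> carrier ?F" for a f
  proof -
    have "{b. a \<otimes> f b \<noteq> \<zero>} \<subseteq> {b. f b \<noteq> \<zero>}" using that(1) by auto
    then show ?thesis using that finite_subset by (auto simp: mem_free_module)
  qed
  have "abelian_group ?F"
  proof (rule abelian_groupI)
    fix f assume "f \<in> carrier ?F"
    then show "\<exists>g\<in>carrier ?F. g \<oplus>\<^bsub>?F\<^esub> f = \<zero>\<^bsub>?F\<^esub>"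
      by (intro bexI[OF _ smult[of "\<ominus> \<one>" f]])
        (auto simp: mem_free_module l_minus l_neg)
  qed (use add in \<open>auto simp: mem_free_module a_ac\<close>)
  then show ?thesis
    by (intro left_module.intro left_module_axioms.intro ring_axioms smult)
      (auto simp: mem_free_module l_distr r_distr m_assoc)
qed

lemma free_module_add_closed:
  "f \<in> carrier (free_module R S) \<Longrightarrow> g \<in> carrier (free_module R S) \<Longrightarrow> (\<lambda>b. f b \<oplus> g b) \<in> carrier (free_module R S)"
  using abelian_monoid.a_closed[OF abelian_group.axioms(1)[OF left_module.axioms(2)[OF left_module_free_module]], of f S g] by simp

lemma free_module_smult_closed:
  "a \<in> carrier R \<Longrightarrow> f \<in> carrier (free_module R S) \<Longrightarrow> (\<lambda>b. a \<otimes> f b) \<in> carrier (free_module R S)"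
  using left_module.lsmult_closed[OF left_module_free_module, of a f S] by simp

lemma free_module_zero_closed: "(\<lambda>_. \<zero>) \<in> carrier (free_module R S)"
  by (simp add: mem_free_module)

end

lemma mod_homD:
  assumes "h \<in> mod_hom A M N"
  shows "x \<in> carrier M \<Longrightarrow> h x \<in> carrier N"
    "x \<in> carrier M \<Longrightarrow> y \<in> carrier M \<Longrightarrow> h (x \<oplus>\<^bsub>M\<^esub> y) = h x \<oplus>\<^bsub>N\<^esub> h y"
    "a \<in> carrier A \<Longrightarrow> x \<in> carrier M \<Longrightarrow> h (a \<odot>\<^bsub>M\<^esub> x) = a \<odot>\<^bsub>N\<^esub> h x"
  using assms by (auto simp: mod_hom_def)

lemma mod_homI:
  assumes "\<And>x. x \<in> carrier M \<Longrightarrow> h x \<in> carrier N"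
    "\<And>x y. x \<in> carrier M \<Longrightarrow> y \<in> carrier M \<Longrightarrow> h (x \<oplus>\<^bsub>M\<^esub> y) = h x \<oplus>\<^bsub>N\<^esub> h y"
    "\<And>a x. a \<in> carrier A \<Longrightarrow> x \<in> carrier M \<Longrightarrow> h (a \<odot>\<^bsub>M\<^esub> x) = a \<odot>\<^bsub>N\<^esub> h x"
  shows "h \<in> mod_hom A M N"
  using assms by (auto simp: mod_hom_def)

lemma mod_hom_comp: "g \<in> mod_hom A M N \<Longrightarrow> h \<in> mod_hom A N L \<Longrightarrow> (\<lambda>x. h (g x)) \<in> mod_hom A M L"
  by (rule mod_homI) (simp_all add: mod_homD)

lemma mod_hom_id: "(\<lambda>x. x) \<in> mod_hom A M M"
  by (rule mod_homI) simp_all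

context left_module begin

lemma additive_zero_uminus:
  assumes "\<And>x. x \<in> carrier M \<Longrightarrow> h x \<in> carrier N" "abelian_group N"
    "\<And>x y. x \<in> carrier M \<Longrightarrow> y \<in> carrier M \<Longrightarrow> h (x \<oplus>\<^bsub>M\<^esub> y) = h x \<oplus>\<^bsub>N\<^esub> h y"
  shows "h \<zero>\<^bsub>M\<^esub> = \<zero>\<^bsub>N\<^esub>" "x \<in> carrier M \<Longrightarrow> h (\<ominus>\<^bsub>M\<^esub> x) = \<ominus>\<^bsub>N\<^esub> h x"
proof -
  interpret N: abelian_group N by fact
  show 0: "h \<zero>\<^bsub>M\<^esub> = \<zero>\<^bsub>N\<^esub>"
    using assms(3)[of "\<zero>\<^bsub>M\<^esub>" "\<zero>\<^bsub>M\<^esub>"] assms(1)[of "\<zero>\<^bsub>M\<^esub>"] N.add.l_cancel_one' by simp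
  show "h (\<ominus>\<^bsub>M\<^esub> x) = \<ominus>\<^bsub>N\<^esub> h x" if "x \<in> carrier M"
    using that assms(3)[of "\<ominus>\<^bsub>M\<^esub> x" x]
    by (intro N.minus_equality[symmetric]) (simp_all add: assms(1) M.l_neg 0)
qed

lemma mod_hom_zero_minus:
  assumes "h \<in> mod_hom A M N" "left_module A N"
  shows "h \<zero>\<^bsub>M\<^esub> = \<zero>\<^bsub>N\<^esub>"
    "x \<in> carrier M \<Longrightarrow> h (\<ominus>\<^bsub>M\<^esub> x) = \<ominus>\<^bsub>N\<^esub> h x"
    "x \<in> carrier M \<Longrightarrow> y \<in> carrier M \<Longrightarrow> h (x \<ominus>\<^bsub>M\<^esub> y) = h x \<ominus>\<^bsub>N\<^esub> h y"
proof -
  note ab = left_module.axioms(2)[OF assms(2)]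
  note * = additive_zero_uminus[where h = h and N = N, OF mod_homD(1)[OF assms(1)] ab mod_homD(2)[OF assms(1)]]
  show "h \<zero>\<^bsub>M\<^esub> = \<zero>\<^bsub>N\<^esub>" by (rule *(1)) simp_all
  show **: "h (\<ominus>\<^bsub>M\<^esub> x) = \<ominus>\<^bsub>N\<^esub> h x" if "x \<in> carrier M" for x using that by (rule *(2)[rotated 3]) simp_all
  show "x \<in> carrier M \<Longrightarrow> y \<in> carrier M \<Longrightarrow> h (x \<ominus>\<^bsub>M\<^esub> y) = h x \<ominus>\<^bsub>N\<^esub> h y"
    by (simp add: a_minus_def mod_homD[OF assms(1)] **)
qed

lemma mod_hom_add:
  assumes "left_module A N" "g \<in> mod_hom A N M" "h \<in> mod_hom A N M"
  shows "(\<lambda>x. g x \<oplus>\<^bsub>M\<^esub> h x) \<in> mod_hom A N M"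
  by (rule mod_homI) (simp_all add: mod_homD[OF assms(2)] mod_homD[OF assms(3)] M.a_ac lsmult_r_distr)

text \<open>Multiplication by a scalar is a homomorphism only for central scalars; the elements of \<open>R\<close> act through these.\<close>
lemma mod_hom_central:
  assumes "c \<in> carrier A" "\<And>a. a \<in> carrier A \<Longrightarrow> c \<otimes>\<^bsub>A\<^esub> a = a \<otimes>\<^bsub>A\<^esub> c" "g \<in> mod_hom A N M"
  shows "(\<lambda>x. c \<odot>\<^bsub>M\<^esub> g x) \<in> mod_hom A N M"
  by (rule mod_homI)
    (simp_all add: mod_homD[OF assms(3)] assms(1,2) lsmult_closed lsmult_r_distr flip: lsmult_assoc)

lemma mod_hom_minus:
  assumes "left_module A N" "g \<in> mod_hom A N M" "h \<in> mod_hom A N M"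
  shows "(\<lambda>x. g x \<ominus>\<^bsub>M\<^esub> h x) \<in> mod_hom A N M"
  by (rule mod_homI)
    (simp_all add: mod_homD[OF assms(2)] mod_homD[OF assms(3)] a_minus_def M.a_ac
       M.minus_add lsmult_r_distr lsmult_uminus)

lemma finsum_mem:
  assumes "finite T" "\<And>b. b \<in> T \<Longrightarrow> f b \<in> P" "P \<subseteq> carrier M" "\<zero>\<^bsub>M\<^esub> \<in> P"
    "\<And>x y. x \<in> P \<Longrightarrow> y \<in> P \<Longrightarrow> x \<oplus>\<^bsub>M\<^esub> y \<in> P"
  shows "(\<Oplus>\<^bsub>M\<^esub>b\<in>T. f b) \<in> P"
  using assms(1,2)
proof (induction T)
  case (insert b T)
  then show ?case by (subst M.finsum_insert) (use insert assms(3-5) in auto)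
qed (simp add: assms)

lemma additive_finsum:
  assumes "\<And>x. x \<in> carrier M \<Longrightarrow> h x \<in> carrier N" "abelian_group N"
    "\<And>x y. x \<in> carrier M \<Longrightarrow> y \<in> carrier M \<Longrightarrow> h (x \<oplus>\<^bsub>M\<^esub> y) = h x \<oplus>\<^bsub>N\<^esub> h y"
    "finite T" "f \<in> T \<rightarrow> carrier M"
  shows "h (\<Oplus>\<^bsub>M\<^esub>b\<in>T. f b) = (\<Oplus>\<^bsub>N\<^esub>b\<in>T. h (f b))"
proof -
  interpret N: abelian_group N by fact
  from assms(4,5) show ?thesis
  proof (induction T)
    case empty
    then show ?case using additive_zero_uminus(1)[OF assms(1-3)] by simp
  next
    case (insert b T)
    then have "h (f b \<oplus>\<^bsub>M\<^esub> (\<Oplus>\<^bsub>M\<^esub>b\<in>T. f b)) = h (f b) \<oplus>\<^bsub>N\<^esub> (\<Oplus>\<^bsub>N\<^esub>b\<in>T. h (f b))"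
      by (subst assms(3)) (auto intro: M.finsum_closed)
    then show ?case using insert assms(1)
      by (subst M.finsum_insert; (subst N.finsum_insert)?) auto
  qed
qed

lemma lsmult_finsum:
  assumes "finite T" "a \<in> carrier A" "f \<in> T \<rightarrow> carrier M"
  shows "a \<odot>\<^bsub>M\<^esub> (\<Oplus>\<^bsub>M\<^esub>b\<in>T. f b) = (\<Oplus>\<^bsub>M\<^esub>b\<in>T. a \<odot>\<^bsub>M\<^esub> f b)"
  by (rule additive_finsum[where h = "\<lambda>x. a \<odot>\<^bsub>M\<^esub> x"]) (use assms in \<open>auto simp: lsmult_closed lsmult_r_distr intro: M.abelian_group_axioms\<close>)

lemma lin_ext_superset:
  assumes "finite T" "T \<subseteq> S" "{b. f b \<noteq> \<zero>\<^bsub>A\<^esub>} \<subseteq> T" "\<And>b. f b \<in> carrier A" "\<And>b. b \<in> S \<Longrightarrow> \<theta> b \<in> carrier M"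
  shows "lin_ext A M \<theta> f = (\<Oplus>\<^bsub>M\<^esub>b\<in>T. f b \<odot>\<^bsub>M\<^esub> \<theta> b)"
  unfolding lin_ext_def
  by (rule M.add.finprod_mono_neutral_cong_left) (use assms in \<open>auto simp: lsmult_closed zero_lsmult\<close>)

lemma lin_ext_closed:
  assumes "f \<in> carrier (free_module A S)" "\<And>b. b \<in> S \<Longrightarrow> \<theta> b \<in> carrier M"
  shows "lin_ext A M \<theta> f \<in> carrier M"
  unfolding lin_ext_def
  using assms free_module_support[OF assms(1)] A.free_module_closed[OF assms(1)]
  by (auto intro!: M.finsum_closed lsmult_closed)

lemma lin_ext_mem:
  assumes "f \<in> carrier (free_module A S)" "P \<subseteq> carrier M" "\<zero>\<^bsub>M\<^esub> \<in> P"
    "\<And>x y. x \<in> P \<Longrightarrow> y \<in> P \<Longrightarrow> x \<oplus>\<^bsub>M\<^esub> y \<in> P"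
    "\<And>b. b \<in> S \<Longrightarrow> f b \<noteq> \<zero>\<^bsub>A\<^esub> \<Longrightarrow> f b \<odot>\<^bsub>M\<^esub> \<theta> b \<in> P"
  shows "lin_ext A M \<theta> f \<in> P"
  unfolding lin_ext_def
  by (rule finsum_mem) (use assms free_module_support[OF assms(1)] in auto)

lemma lin_ext_mod_hom:
  assumes \<theta>: "\<And>b. b \<in> S \<Longrightarrow> \<theta> b \<in> carrier M"
  shows "lin_ext A M \<theta> \<in> mod_hom A (free_module A S) M"
proof (rule mod_homI)
  let ?F = "free_module A S"
  show "lin_ext A M \<theta> f \<in> carrier M" if "f \<in> carrier ?F" for f
    using that \<theta> by (rule lin_ext_closed)
  fix f assume f: "f \<in> carrier ?F"
  note F = free_module_support A.free_module_closed
  show "lin_ext A M \<theta> (f \<oplus>\<^bsub>?F\<^esub> g) = lin_ext A M \<theta> f \<oplus>\<^bsub>M\<^esub> lin_ext A M \<theta> g" if g: "g \<in> carrier ?F" for g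
  proof -
    let ?T = "{b. f b \<noteq> \<zero>\<^bsub>A\<^esub>} \<union> {b. g b \<noteq> \<zero>\<^bsub>A\<^esub>}"
    have T: "finite ?T" "?T \<subseteq> S" using F[OF f] F[OF g] by auto
    have "lin_ext A M \<theta> (f \<oplus>\<^bsub>?F\<^esub> g) = (\<Oplus>\<^bsub>M\<^esub>b\<in>?T. (f b \<oplus>\<^bsub>A\<^esub> g b) \<odot>\<^bsub>M\<^esub> \<theta> b)"
      by (subst lin_ext_superset[OF T]) (use F[OF f] F[OF g] \<theta> in auto)
    also have "\<dots> = (\<Oplus>\<^bsub>M\<^esub>b\<in>?T. f b \<odot>\<^bsub>M\<^esub> \<theta> b \<oplus>\<^bsub>M\<^esub> g b \<odot>\<^bsub>M\<^esub> \<theta> b)"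
      by (rule M.finsum_cong') (use T F[OF f] F[OF g] \<theta> in \<open>auto simp: lsmult_l_distr lsmult_closed subset_iff\<close>)
    also have "\<dots> = (\<Oplus>\<^bsub>M\<^esub>b\<in>?T. f b \<odot>\<^bsub>M\<^esub> \<theta> b) \<oplus>\<^bsub>M\<^esub> (\<Oplus>\<^bsub>M\<^esub>b\<in>?T. g b \<odot>\<^bsub>M\<^esub> \<theta> b)"
      by (rule M.finsum_addf) (use T F[OF f] F[OF g] \<theta> in \<open>auto intro!: lsmult_closed\<close>)
    also have "\<dots> = lin_ext A M \<theta> f \<oplus>\<^bsub>M\<^esub> lin_ext A M \<theta> g"
      using lin_ext_superset[OF T, of f \<theta>] lin_ext_superset[OF T, of g \<theta>] F[OF f] F[OF g] \<theta> by auto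
    finally show ?thesis .
  qed
  show "lin_ext A M \<theta> (a \<odot>\<^bsub>?F\<^esub> f) = a \<odot>\<^bsub>M\<^esub> lin_ext A M \<theta> f" if a: "a \<in> carrier A" for a
  proof -
    let ?T = "{b. f b \<noteq> \<zero>\<^bsub>A\<^esub>}"
    have T: "finite ?T" "?T \<subseteq> S" using F[OF f] by auto
    have "lin_ext A M \<theta> (a \<odot>\<^bsub>?F\<^esub> f) = (\<Oplus>\<^bsub>M\<^esub>b\<in>?T. (a \<otimes>\<^bsub>A\<^esub> f b) \<odot>\<^bsub>M\<^esub> \<theta> b)"
      by (subst lin_ext_superset[OF T]) (use F[OF f] \<theta> a in auto)
    also have "\<dots> = (\<Oplus>\<^bsub>M\<^esub>b\<in>?T. a \<odot>\<^bsub>M\<^esub> (f b \<odot>\<^bsub>M\<^esub> \<theta> b))"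
      by (rule M.finsum_cong') (use T F[OF f] \<theta> a in \<open>auto simp: lsmult_assoc lsmult_closed subset_iff\<close>)
    also have "\<dots> = a \<odot>\<^bsub>M\<^esub> lin_ext A M \<theta> f"
      unfolding lin_ext_def by (rule lsmult_finsum[symmetric]) (use T F[OF f] \<theta> a in \<open>auto intro!: lsmult_closed\<close>)
    finally show ?thesis .
  qed
qed

lemma lin_ext_basis_vec:
  assumes "\<theta> b \<in> carrier M"
  shows "lin_ext A M \<theta> (basis_vec A b) = \<theta> b"
  by (subst lin_ext_superset[of "{b}" "{b}"])
    (use assms in \<open>auto simp: basis_vec_def lsmult_closed lsmult_one\<close>)

lemma lin_ext_cong:
  assumes "f \<in> carrier (free_module A S)" "\<And>b. b \<in> S \<Longrightarrow> f b \<noteq> \<zero>\<^bsub>A\<^esub> \<Longrightarrow> \<theta> b = \<eta> b" "\<And>b. b \<in> S \<Longrightarrow> \<eta> b \<in> carrier M"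
  shows "lin_ext A M \<theta> f = lin_ext A M \<eta> f"
  unfolding lin_ext_def
  by (rule M.finsum_cong')
    (use assms free_module_support[OF assms(1)] A.free_module_closed[OF assms(1)] in \<open>auto intro!: lsmult_closed\<close>)

lemma mod_hom_lin_ext:
  assumes h: "h \<in> mod_hom A M N" and N: "left_module A N"
    and f: "f \<in> carrier (free_module A S)" and \<theta>: "\<And>b. b \<in> S \<Longrightarrow> \<theta> b \<in> carrier M"
  shows "h (lin_ext A M \<theta> f) = lin_ext A N (\<lambda>b. h (\<theta> b)) f"
proof -
  interpret N: left_module A N by fact
  note F = free_module_support[OF f] A.free_module_closed[OF f]
  have "h (lin_ext A M \<theta> f) = (\<Oplus>\<^bsub>N\<^esub>b\<in>{b. f b \<noteq> \<zero>\<^bsub>A\<^esub>}. h (f b \<odot>\<^bsub>M\<^esub> \<theta> b))"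
    unfolding lin_ext_def
    by (rule additive_finsum[where h = h and N = N, OF mod_homD(1)[OF h] N.M.abelian_group_axioms mod_homD(2)[OF h]])
      (use F \<theta> in \<open>auto intro!: lsmult_closed\<close>)
  also have "\<dots> = lin_ext A N (\<lambda>b. h (\<theta> b)) f"
    unfolding lin_ext_def
    by (rule N.M.finsum_cong') (use F \<theta> in \<open>auto simp: mod_homD[OF h] subset_iff intro!: N.lsmult_closed\<close>)
  finally show ?thesis .
qed

end

lemma (in ring) lin_ext_basis:
  assumes f: "f \<in> carrier (free_module R S)"
  shows "lin_ext R (free_module R S) (basis_vec R) f = f"
proof
  fix c
  interpret F: left_module R "free_module R S" by (rule left_module_free_module)
  note F = free_module_support[OF f] free_module_closed[OF f]
  have "lin_ext R (free_module R S) (basis_vec R) f c = (\<Oplus>b\<in>{b. f b \<noteq> \<zero>}. (f b \<odot>\<^bsub>free_module R S\<^esub> basis_vec R b) c)"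
    unfolding lin_ext_def
    by (rule F.additive_finsum[where h = "\<lambda>f. f c"])
      (use F in \<open>auto simp: free_module_closed basis_vec_closed free_module_smult_closed intro: abelian_group_axioms\<close>)
  also have "\<dots> = (\<Oplus>b\<in>{b. f b \<noteq> \<zero>}. if c = b then f b else \<zero>)"
    by (rule finsum_cong') (use F in \<open>auto simp: basis_vec_def\<close>)
  also have "\<dots> = f c"
  proof (cases "f c = \<zero>")
    case True
    then have "(\<Oplus>b\<in>{b. f b \<noteq> \<zero>}. if c = b then f b else \<zero>) = (\<Oplus>b\<in>{b. f b \<noteq> \<zero>}. \<zero>)"
      by (intro finsum_cong') auto
    then show ?thesis using True by simp
  next
    case False
    then show ?thesis using F add.finprod_singleton[of c "{b. f b \<noteq> \<zero>}" f] by simp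
  qed
  finally show "lin_ext R (free_module R S) (basis_vec R) f c = f c" .
qed

lemma (in left_module) mod_hom_eq_lin_ext:
  assumes "h \<in> mod_hom A (free_module A S) M" "f \<in> carrier (free_module A S)"
  shows "h f = lin_ext A M (\<lambda>b. h (basis_vec A b)) f"
proof -
  interpret F: left_module A "free_module A S" by (rule A.left_module_free_module)
  show ?thesis
    using F.mod_hom_lin_ext[OF assms(1) left_module_axioms assms(2), of "basis_vec A", OF A.basis_vec_closed]
      A.lin_ext_basis[OF assms(2)] by simp
qed

lemma (in left_module) mod_hom_free_mem:
  assumes "h \<in> mod_hom A (free_module A S) M" "f \<in> carrier (free_module A S)"
    "P \<subseteq> carrier M" "\<zero>\<^bsub>M\<^esub> \<in> P" "\<And>x y. x \<in> P \<Longrightarrow> y \<in> P \<Longrightarrow> x \<oplus>\<^bsub>M\<^esub> y \<in> P"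
    "\<And>a x. a \<in> carrier A \<Longrightarrow> x \<in> P \<Longrightarrow> a \<odot>\<^bsub>M\<^esub> x \<in> P"
    "\<And>b. b \<in> S \<Longrightarrow> h (basis_vec A b) \<in> P"
  shows "h f \<in> P"
  unfolding mod_hom_eq_lin_ext[OF assms(1,2)]
  by (rule lin_ext_mem[OF assms(2-5)]) (use assms A.free_module_closed[OF assms(2)] in auto)

declare free_module_simps [simp del]

abbreviation self_module :: "('a, 'x) ring_scheme \<Rightarrow> ('a, 'a) module"
  where "self_module A \<equiv> algebra_via A (\<lambda>a. a)"

lemma self_module_simps [simp]:
  "carrier (self_module A) = carrier A" "x \<oplus>\<^bsub>self_module A\<^esub> y = x \<oplus>\<^bsub>A\<^esub> y"
  "x \<odot>\<^bsub>self_module A\<^esub> y = x \<otimes>\<^bsub>A\<^esub> y" "\<zero>\<^bsub>self_module A\<^esub> = \<zero>\<^bsub>A\<^esub>"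
  by (simp_all add: algebra_via_def)

lemma (in ring) left_module_self: "left_module R (self_module R)"
proof -
  have "abelian_group (self_module R)"
    by (rule abelian_groupI) (auto simp: a_ac intro: bexI[of _ "\<ominus> _"] l_neg)
  then show ?thesis
    by (intro left_module.intro left_module_axioms.intro ring_axioms)
      (auto simp: l_distr r_distr m_assoc)
qed

text \<open>
  Restriction of scalars along a ring homomorphism; unlike \<^const>\<open>restrict_scalars\<close>, the
  homomorphism need not be the structure map of an algebra.
\<close>
definition pullback_module :: "('a \<Rightarrow> 'c) \<Rightarrow> ('c, 'm, 'y) module_scheme \<Rightarrow> ('a, 'm) module"
  where "pullback_module \<iota> L =
    \<lparr>carrier = carrier L, monoid.mult = undefined, one = undefined, ring.zero = \<zero>\<^bsub>L\<^esub>, ring.add = ring.add L,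
     smult = (\<lambda>a. smult L (\<iota> a))\<rparr>"

lemma pullback_module_simps [simp]:
  "carrier (pullback_module \<iota> L) = carrier L" "x \<oplus>\<^bsub>pullback_module \<iota> L\<^esub> y = x \<oplus>\<^bsub>L\<^esub> y"
  "a \<odot>\<^bsub>pullback_module \<iota> L\<^esub> x = \<iota> a \<odot>\<^bsub>L\<^esub> x" "\<zero>\<^bsub>pullback_module \<iota> L\<^esub> = \<zero>\<^bsub>L\<^esub>"
  by (simp_all add: pullback_module_def)

lemma left_module_pullback:
  assumes "ring A" "\<iota> \<in> ring_hom A C" "left_module C L"
  shows "left_module A (pullback_module \<iota> L)"
proof -
  interpret L: left_module C L by fact
  interpret A: ring A by fact
  note h = ring_hom_closed[OF assms(2)] ring_hom_add[OF assms(2)] ring_hom_mult[OF assms(2)] ring_hom_one[OF assms(2)]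
  have "abelian_group (pullback_module \<iota> L)"
    by (rule abelian_groupI) (auto simp: L.M.a_ac intro: bexI[of _ "\<ominus>\<^bsub>L\<^esub> _"] L.M.l_neg)
  then show ?thesis
    by (intro left_module.intro left_module_axioms.intro assms(1))
      (auto simp: h L.lsmult_closed L.lsmult_l_distr L.lsmult_r_distr L.lsmult_assoc L.lsmult_one)
qed

lemma mod_hom_pullback:
  assumes "h \<in> mod_hom C L L'" "\<iota> \<in> ring_hom A C"
  shows "h \<in> mod_hom A (pullback_module \<iota> L) (pullback_module \<iota> L')"
  by (rule mod_homI) (simp_all add: mod_homD[OF assms(1)] ring_hom_closed[OF assms(2)])

lemma (in left_module) mod_hom_finsum:
  assumes N: "left_module A N" and T: "finite T" "\<And>y. y \<in> T \<Longrightarrow> h y \<in> mod_hom A N M"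
  shows "(\<lambda>f. \<Oplus>\<^bsub>M\<^esub>y\<in>T. h y f) \<in> mod_hom A N M"
proof (rule mod_homI)
  interpret N: left_module A N by fact
  note h = mod_homD[OF T(2)]
  show "(\<Oplus>\<^bsub>M\<^esub>y\<in>T. h y f) \<in> carrier M" if "f \<in> carrier N" for f
    using that h(1) by (intro M.finsum_closed) auto
  show "(\<Oplus>\<^bsub>M\<^esub>y\<in>T. h y (f \<oplus>\<^bsub>N\<^esub> g)) = (\<Oplus>\<^bsub>M\<^esub>y\<in>T. h y f) \<oplus>\<^bsub>M\<^esub> (\<Oplus>\<^bsub>M\<^esub>y\<in>T. h y g)"
    if "f \<in> carrier N" "g \<in> carrier N" for f g
  proof -
    have "(\<Oplus>\<^bsub>M\<^esub>y\<in>T. h y (f \<oplus>\<^bsub>N\<^esub> g)) = (\<Oplus>\<^bsub>M\<^esub>y\<in>T. h y f \<oplus>\<^bsub>M\<^esub> h y g)"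
      using that h by (intro M.finsum_cong') auto
    then show ?thesis using that h by (simp add: M.finsum_addf Pi_iff)
  qed
  show "(\<Oplus>\<^bsub>M\<^esub>y\<in>T. h y (a \<odot>\<^bsub>N\<^esub> f)) = a \<odot>\<^bsub>M\<^esub> (\<Oplus>\<^bsub>M\<^esub>y\<in>T. h y f)" if "a \<in> carrier A" "f \<in> carrier N" for a f
  proof -
    have "(\<Oplus>\<^bsub>M\<^esub>y\<in>T. h y (a \<odot>\<^bsub>N\<^esub> f)) = (\<Oplus>\<^bsub>M\<^esub>y\<in>T. a \<odot>\<^bsub>M\<^esub> h y f)"
      using that h by (intro M.finsum_cong') (auto intro: lsmult_closed)
    then show ?thesis using that h(1) lsmult_finsum[OF T(1), of a "\<lambda>y. h y f"] by (simp add: Pi_iff)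
  qed
qed

section \<open>The equational criterion for flatness\<close>

definition presentation :: "('a, 'x) ring_scheme \<Rightarrow> ('a, 'b, 'z) module_scheme \<Rightarrow> ('b \<Rightarrow> 'a) \<Rightarrow> 'b"
  where "presentation A B = lin_ext A B (\<lambda>b. b)"

abbreviation free_cover :: "('a, 'x) ring_scheme \<Rightarrow> ('a, 'b, 'z) module_scheme \<Rightarrow> ('a, 'b \<Rightarrow> 'a) module"
  where "free_cover A B \<equiv> free_module A (carrier B)"

text \<open>
  With \<open>\<Sigma> = {1}\<close>, \<open>I = 0\<close> and \<open>P = 0\<close> this is the equational criterion in matrix form: a relation
  \<open>\<Sum> a\<^sub>i b\<^sub>i = 0\<close>, that is, an element \<open>q\<close> of the kernel of the presentation, is a consequence of relations
  \<open>\<Sum> a\<^sub>i d\<^sub>i\<^sub>j = 0\<close> in \<open>A\<close>, where \<open>b\<^sub>i = \<Sum> d\<^sub>i\<^sub>j y\<^sub>j\<close>; the endomorphism \<open>\<theta>\<close> is the matrix \<open>d\<close>. The general form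
  asks for this modulo the ideal \<open>I\<close> and the submodule \<open>P\<close>, and up to a factor \<open>\<sigma>\<close> from \<open>\<Sigma>\<close>.
\<close>
definition equational_mod :: "('a, 'x) ring_scheme \<Rightarrow> ('a, 'b, 'z) module_scheme \<Rightarrow>
    'a set \<Rightarrow> 'a set \<Rightarrow> 'b set \<Rightarrow> bool"
  where "equational_mod A B \<Sigma> I P \<longleftrightarrow>
    (\<forall>q\<in>carrier (free_cover A B). presentation A B q \<in> P \<longrightarrow>
      (\<exists>\<sigma>\<in>\<Sigma>. \<exists>\<theta>\<in>mod_hom A (free_cover A B) (free_cover A B).
        (\<forall>f\<in>carrier (free_cover A B).
          presentation A B (\<theta> f) \<ominus>\<^bsub>B\<^esub> \<sigma> \<odot>\<^bsub>B\<^esub> presentation A B f \<in> P) \<and>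
        (\<forall>b. \<theta> q b \<in> I)))"

abbreviation equational :: "('a, 'x) ring_scheme \<Rightarrow> ('a, 'b, 'z) module_scheme \<Rightarrow> bool"
  where "equational A B \<equiv> equational_mod A B {\<one>\<^bsub>A\<^esub>} {\<zero>\<^bsub>A\<^esub>} {\<zero>\<^bsub>B\<^esub>}"

text \<open>
  With \<open>N\<close> the right ideal generated by the coefficients of \<open>q\<close>, and \<open>Q\<close> the kernel of the
  presentation, this is the subgroup \<open>NQ\<close> of the free module.
\<close>
definition syzygy_multiples :: "('a, 'x) ring_scheme \<Rightarrow> ('a, 'b, 'z) module_scheme \<Rightarrow> ('b \<Rightarrow> 'a) \<Rightarrow> ('b \<Rightarrow> 'a) set"
  where "syzygy_multiples A B q =
    {G q |G. G \<in> mod_hom A (free_cover A B) (free_cover A B) \<and>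
       (\<forall>f\<in>carrier (free_cover A B). presentation A B (G f) = \<zero>\<^bsub>B\<^esub>)}"

context left_module begin

lemma presentation_hom: "presentation A M \<in> mod_hom A (free_cover A M) M"
  unfolding presentation_def by (rule lin_ext_mod_hom)

lemma presentation_basis_vec: "b \<in> carrier M \<Longrightarrow> presentation A M (basis_vec A b) = b"
  unfolding presentation_def by (rule lin_ext_basis_vec)

lemma presentation_closed: "f \<in> carrier (free_cover A M) \<Longrightarrow> presentation A M f \<in> carrier M"
  by (rule mod_homD(1)[OF presentation_hom])

lemma minus_eq_zero_iff:
  assumes "x \<in> carrier M" "y \<in> carrier M"
  shows "x \<ominus>\<^bsub>M\<^esub> y = \<zero>\<^bsub>M\<^esub> \<longleftrightarrow> x = y"
  using assms by (metis M.minus_equality M.minus_minus M.r_neg M.a_inv_closed a_minus_def)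

lemma equationalD:
  assumes "equational A M" "q \<in> carrier (free_cover A M)" "presentation A M q = \<zero>\<^bsub>M\<^esub>"
  obtains \<theta> where "\<theta> \<in> mod_hom A (free_cover A M) (free_cover A M)"
    "\<And>f. f \<in> carrier (free_cover A M) \<Longrightarrow> presentation A M (\<theta> f) = presentation A M f"
    "\<theta> q = \<zero>\<^bsub>free_cover A M\<^esub>"
proof -
  obtain \<theta> where \<theta>: "\<theta> \<in> mod_hom A (free_cover A M) (free_cover A M)"
    "\<And>f. f \<in> carrier (free_cover A M) \<Longrightarrow>
      presentation A M (\<theta> f) \<ominus>\<^bsub>M\<^esub> \<one>\<^bsub>A\<^esub> \<odot>\<^bsub>M\<^esub> presentation A M f = \<zero>\<^bsub>M\<^esub>"
    "\<And>b. \<theta> q b = \<zero>\<^bsub>A\<^esub>"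
    using assms unfolding equational_mod_def by fastforce
  show thesis
    by (rule that[OF \<theta>(1)])
      (use \<theta>(2,3) in \<open>auto simp: lsmult_one presentation_closed minus_eq_zero_iff mod_homD[OF \<theta>(1)] free_module_simps\<close>)
qed

lemma equationalI_endo:
  assumes "\<And>q. q \<in> carrier (free_cover A M) \<Longrightarrow> presentation A M q = \<zero>\<^bsub>M\<^esub> \<Longrightarrow>
    \<exists>\<theta>\<in>mod_hom A (free_cover A M) (free_cover A M).
      (\<forall>f\<in>carrier (free_cover A M). presentation A M (\<theta> f) = presentation A M f) \<and> \<theta> q = \<zero>\<^bsub>free_cover A M\<^esub>"
  shows "equational A M"
  unfolding equational_mod_def
proof (intro ballI impI)
  fix q assume q: "q \<in> carrier (free_cover A M)" "presentation A M q \<in> {\<zero>\<^bsub>M\<^esub>}"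
  then obtain \<theta> where \<theta>: "\<theta> \<in> mod_hom A (free_cover A M) (free_cover A M)"
    "\<And>f. f \<in> carrier (free_cover A M) \<Longrightarrow> presentation A M (\<theta> f) = presentation A M f"
    "\<theta> q = \<zero>\<^bsub>free_cover A M\<^esub>"
    using assms[of q] by auto
  show "\<exists>\<sigma>\<in>{\<one>\<^bsub>A\<^esub>}. \<exists>\<theta>\<in>mod_hom A (free_cover A M) (free_cover A M).
      (\<forall>f\<in>carrier (free_cover A M). presentation A M (\<theta> f) \<ominus>\<^bsub>M\<^esub> \<sigma> \<odot>\<^bsub>M\<^esub> presentation A M f \<in> {\<zero>\<^bsub>M\<^esub>}) \<and>
      (\<forall>b. \<theta> q b \<in> {\<zero>\<^bsub>A\<^esub>})"
    by (intro bexI[of _ "\<one>\<^bsub>A\<^esub>"] bexI[OF _ \<theta>(1)] conjI ballI allI)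
      (use \<theta>(2,3) in \<open>simp_all add: lsmult_one presentation_closed minus_eq_zero_iff free_module_simps\<close>)
qed

interpretation F: left_module A "free_cover A M" by (rule A.left_module_free_module)

text \<open>If \<open>q = G q\<close> with \<open>G\<close> taking values in the kernel of the presentation, then \<open>\<theta> = 1 - G\<close> kills \<open>q\<close>.\<close>
lemma equationalI:
  assumes "\<And>q. q \<in> carrier (free_cover A M) \<Longrightarrow> presentation A M q = \<zero>\<^bsub>M\<^esub> \<Longrightarrow> q \<in> syzygy_multiples A M q"
  shows "equational A M"
proof (rule equationalI_endo)
  fix q assume q: "q \<in> carrier (free_cover A M)" "presentation A M q = \<zero>\<^bsub>M\<^esub>"
  obtain G where G: "G \<in> mod_hom A (free_cover A M) (free_cover A M)"
    "\<And>f. f \<in> carrier (free_cover A M) \<Longrightarrow> presentation A M (G f) = \<zero>\<^bsub>M\<^esub>" "G q = q"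
    using assms[OF q] unfolding syzygy_multiples_def by fastforce
  let ?\<theta> = "\<lambda>f. f \<ominus>\<^bsub>free_cover A M\<^esub> G f"
  have \<theta>: "?\<theta> \<in> mod_hom A (free_cover A M) (free_cover A M)"
    by (rule F.mod_hom_minus[OF F.left_module_axioms mod_hom_id G(1)])
  have "presentation A M (?\<theta> f) = presentation A M f" if "f \<in> carrier (free_cover A M)" for f
    using that by (simp add: F.mod_hom_zero_minus(3)[OF presentation_hom left_module_axioms]
      mod_homD(1)[OF G(1)] G(2)) (simp add: a_minus_def presentation_closed)
  moreover have "?\<theta> q = \<zero>\<^bsub>free_cover A M\<^esub>"
    unfolding G(3) a_minus_def using q(1) by (rule F.M.r_neg)
  ultimately show "\<exists>\<theta>\<in>mod_hom A (free_cover A M) (free_cover A M).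
      (\<forall>f\<in>carrier (free_cover A M). presentation A M (\<theta> f) = presentation A M f) \<and> \<theta> q = \<zero>\<^bsub>free_cover A M\<^esub>"
    by (intro bexI[OF _ \<theta>] conjI ballI)
qed

lemma syzygy_multiples_zero: "\<zero>\<^bsub>free_cover A M\<^esub> \<in> syzygy_multiples A M q"
proof -
  have "(\<lambda>f. \<zero>\<^bsub>free_cover A M\<^esub>) \<in> mod_hom A (free_cover A M) (free_cover A M)"
    by (rule mod_homI) (simp_all add: F.lsmult_zero)
  then show ?thesis
    unfolding syzygy_multiples_def
    using F.mod_hom_zero_minus(1)[OF presentation_hom left_module_axioms]
    by (intro CollectI exI[of _ "\<lambda>f. \<zero>\<^bsub>free_cover A M\<^esub>"]) simp
qed

lemma syzygy_multiples_add:
  assumes "x \<in> syzygy_multiples A M q" "y \<in> syzygy_multiples A M q"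
  shows "x \<oplus>\<^bsub>free_cover A M\<^esub> y \<in> syzygy_multiples A M q"
proof -
  obtain G G' where G: "G \<in> mod_hom A (free_cover A M) (free_cover A M)"
     "\<And>f. f \<in> carrier (free_cover A M) \<Longrightarrow> presentation A M (G f) = \<zero>\<^bsub>M\<^esub>" "x = G q"
     "G' \<in> mod_hom A (free_cover A M) (free_cover A M)"
     "\<And>f. f \<in> carrier (free_cover A M) \<Longrightarrow> presentation A M (G' f) = \<zero>\<^bsub>M\<^esub>" "y = G' q"
    using assms unfolding syzygy_multiples_def by blast
  have "presentation A M (G f \<oplus>\<^bsub>free_cover A M\<^esub> G' f) = \<zero>\<^bsub>M\<^esub>" if "f \<in> carrier (free_cover A M)" for f
    using that G by (simp add: mod_homD(2)[OF presentation_hom] mod_homD(1))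
  then show ?thesis
    using F.mod_hom_add[OF F.left_module_axioms G(1,4)] G(3,6)
    unfolding syzygy_multiples_def by (intro CollectI exI[of _ "\<lambda>f. G f \<oplus>\<^bsub>free_cover A M\<^esub> G' f"]) simp
qed

lemma syzygy_multiples_central:
  assumes c: "c \<in> carrier A" "\<And>a. a \<in> carrier A \<Longrightarrow> c \<otimes>\<^bsub>A\<^esub> a = a \<otimes>\<^bsub>A\<^esub> c"
    and x: "x \<in> syzygy_multiples A M q"
  shows "c \<odot>\<^bsub>free_cover A M\<^esub> x \<in> syzygy_multiples A M q"
proof -
  obtain G where G: "G \<in> mod_hom A (free_cover A M) (free_cover A M)"
    "\<And>f. f \<in> carrier (free_cover A M) \<Longrightarrow> presentation A M (G f) = \<zero>\<^bsub>M\<^esub>" "x = G q"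
    using x unfolding syzygy_multiples_def by blast
  have "presentation A M (c \<odot>\<^bsub>free_cover A M\<^esub> G f) = \<zero>\<^bsub>M\<^esub>" if "f \<in> carrier (free_cover A M)" for f
    using that G mod_homD(1)[OF G(1)] c(1) by (simp add: mod_homD(3)[OF presentation_hom] lsmult_zero)
  then show ?thesis
    using F.mod_hom_central[OF c G(1)] G(3)
    unfolding syzygy_multiples_def by (intro CollectI exI[of _ "\<lambda>f. c \<odot>\<^bsub>free_cover A M\<^esub> G f"]) simp
qed

lemma syzygy_multiples_uminus:
  assumes "x \<in> syzygy_multiples A M q" "q \<in> carrier (free_cover A M)"
  shows "\<ominus>\<^bsub>free_cover A M\<^esub> x \<in> syzygy_multiples A M q"
proof -
  have "x \<in> carrier (free_cover A M)"
    using assms mod_homD(1) unfolding syzygy_multiples_def by fastforce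
  then have "(\<ominus>\<^bsub>A\<^esub> \<one>\<^bsub>A\<^esub>) \<odot>\<^bsub>free_cover A M\<^esub> x = \<ominus>\<^bsub>free_cover A M\<^esub> x"
    by (simp add: F.uminus_lsmult F.lsmult_one)
  then show ?thesis
    using syzygy_multiples_central[OF _ _ assms(1), of "\<ominus>\<^bsub>A\<^esub> \<one>\<^bsub>A\<^esub>"] by (simp add: A.l_minus A.r_minus)
qed

end

text \<open>The data modulo which relations are considered in \<^const>\<open>equational_mod\<close>: scalars, a two-sided ideal and a submodule.\<close>
locale scaled_ideal = left_module A M
  for A :: "('a, 'x) ring_scheme" (structure) and M :: "('a, 'm, 'y) module_scheme" (structure) +
  fixes \<Sigma> :: "'a set" and I :: "'a set" and P :: "'m set"
  assumes scalars: "\<Sigma> \<subseteq> carrier A" "\<one>\<^bsub>A\<^esub> \<in> \<Sigma>" "\<And>s t. s \<in> \<Sigma> \<Longrightarrow> t \<in> \<Sigma> \<Longrightarrow> s \<otimes>\<^bsub>A\<^esub> t \<in> \<Sigma>"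
    and ideal: "I \<subseteq> carrier A" "\<zero>\<^bsub>A\<^esub> \<in> I" "\<And>x y. x \<in> I \<Longrightarrow> y \<in> I \<Longrightarrow> x \<oplus>\<^bsub>A\<^esub> y \<in> I"
      "\<And>a x. a \<in> carrier A \<Longrightarrow> x \<in> I \<Longrightarrow> a \<otimes>\<^bsub>A\<^esub> x \<in> I" "\<And>a x. a \<in> carrier A \<Longrightarrow> x \<in> I \<Longrightarrow> x \<otimes>\<^bsub>A\<^esub> a \<in> I"
    and sub: "P \<subseteq> carrier M" "\<zero>\<^bsub>M\<^esub> \<in> P" "\<And>x y. x \<in> P \<Longrightarrow> y \<in> P \<Longrightarrow> x \<oplus>\<^bsub>M\<^esub> y \<in> P"
      "\<And>a x. a \<in> carrier A \<Longrightarrow> x \<in> P \<Longrightarrow> a \<odot>\<^bsub>M\<^esub> x \<in> P"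
begin

text \<open>The ideal absorbs multiplication on the right, which is how the matrix of a homomorphism acts on coefficients.\<close>
lemma mod_hom_coefficients_ideal:
  assumes "\<theta> \<in> mod_hom A (free_module A S) (free_module A T)" "f \<in> carrier (free_module A S)" "\<And>b. f b \<in> I"
  shows "\<theta> f c \<in> I"
proof -
  interpret F: left_module A "free_module A T" by (rule A.left_module_free_module)
  have "lin_ext A (free_module A T) (\<lambda>b. \<theta> (basis_vec A b)) f \<in> {g \<in> carrier (free_module A T). \<forall>c. g c \<in> I}"
  proof (rule F.lin_ext_mem[OF assms(2)])
    fix b assume b: "b \<in> S"
    have \<theta>b: "\<theta> (basis_vec A b) \<in> carrier (free_module A T)"
      by (rule mod_homD(1)[OF assms(1) A.basis_vec_closed[OF b]])
    show "f b \<odot>\<^bsub>free_module A T\<^esub> \<theta> (basis_vec A b) \<in> {g \<in> carrier (free_module A T). \<forall>c. g c \<in> I}"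
      using assms(3) subsetD[OF ideal(1) assms(3)[of b]] \<theta>b ideal(5)[OF A.free_module_closed[OF \<theta>b]]
      by (simp add: free_module_simps A.free_module_smult_closed)
  qed (use ideal in \<open>auto simp: A.free_module_add_closed A.free_module_zero_closed free_module_simps\<close>)
  then show ?thesis unfolding F.mod_hom_eq_lin_ext[OF assms(1,2)] by simp
qed

text \<open>
  Finitely many relations can be killed at once: an endomorphism that works for some of them sends
  the next one to another relation, to which the criterion applies again, and one composes.
\<close>
lemma equational_mod_finite:
  assumes eq: "equational_mod A M \<Sigma> I P"
    and Y: "finite Y" "Y \<subseteq> carrier (free_cover A M)" "\<And>q. q \<in> Y \<Longrightarrow> presentation A M q \<in> P"
  shows "\<exists>\<sigma>\<in>\<Sigma>. \<exists>\<theta>\<in>mod_hom A (free_cover A M) (free_cover A M).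
    (\<forall>f\<in>carrier (free_cover A M). presentation A M (\<theta> f) \<ominus>\<^bsub>M\<^esub> \<sigma> \<odot>\<^bsub>M\<^esub> presentation A M f \<in> P) \<and>
    (\<forall>q\<in>Y. \<forall>b. \<theta> q b \<in> I)"
  using Y
proof (induction Y)
  case empty
  show ?case
    by (rule bexI[OF _ scalars(2)], rule bexI[OF _ mod_hom_id])
      (auto simp: lsmult_one presentation_closed a_minus_def M.r_neg sub)
next
  case (insert x Y)
  let ?p = "presentation A M" and ?F = "free_cover A M"
  obtain \<sigma> \<theta> where \<theta>: "\<sigma> \<in> \<Sigma>" "\<theta> \<in> mod_hom A ?F ?F"
    "\<And>f. f \<in> carrier ?F \<Longrightarrow> ?p (\<theta> f) \<ominus>\<^bsub>M\<^esub> \<sigma> \<odot>\<^bsub>M\<^esub> ?p f \<in> P" "\<And>q b. q \<in> Y \<Longrightarrow> \<theta> q b \<in> I"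
    using insert by fastforce
  have x: "x \<in> carrier ?F" "?p x \<in> P" using insert by auto
  note c = presentation_closed mod_homD(1)[OF \<theta>(2)] subsetD[OF scalars(1) \<theta>(1)] lsmult_closed
  have "?p (\<theta> x) = (?p (\<theta> x) \<ominus>\<^bsub>M\<^esub> \<sigma> \<odot>\<^bsub>M\<^esub> ?p x) \<oplus>\<^bsub>M\<^esub> \<sigma> \<odot>\<^bsub>M\<^esub> ?p x"
    using x by (simp add: c a_minus_def M.a_assoc M.l_neg)
  then have "?p (\<theta> x) \<in> P" using sub(3,4) \<theta>(3) x c(3) by metis
  then obtain \<sigma>' \<theta>' where \<theta>': "\<sigma>' \<in> \<Sigma>" "\<theta>' \<in> mod_hom A ?F ?F"
    "\<And>f. f \<in> carrier ?F \<Longrightarrow> ?p (\<theta>' f) \<ominus>\<^bsub>M\<^esub> \<sigma>' \<odot>\<^bsub>M\<^esub> ?p f \<in> P" "\<And>b. \<theta>' (\<theta> x) b \<in> I"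
    using eq x(1) c(2) unfolding equational_mod_def by meson
  note c' = c mod_homD(1)[OF \<theta>'(2)] subsetD[OF scalars(1) \<theta>'(1)]
  show ?case
  proof (rule bexI[OF _ scalars(3)[OF \<theta>'(1) \<theta>(1)]], rule bexI[OF _ mod_hom_comp[OF \<theta>(2) \<theta>'(2)]], intro conjI ballI allI)
    fix f assume f: "f \<in> carrier ?F"
    have "?p (\<theta>' (\<theta> f)) \<ominus>\<^bsub>M\<^esub> (\<sigma>' \<otimes>\<^bsub>A\<^esub> \<sigma>) \<odot>\<^bsub>M\<^esub> ?p f =
        (?p (\<theta>' (\<theta> f)) \<ominus>\<^bsub>M\<^esub> \<sigma>' \<odot>\<^bsub>M\<^esub> ?p (\<theta> f)) \<oplus>\<^bsub>M\<^esub> \<sigma>' \<odot>\<^bsub>M\<^esub> (?p (\<theta> f) \<ominus>\<^bsub>M\<^esub> \<sigma> \<odot>\<^bsub>M\<^esub> ?p f)"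
      using f by (simp add: c' lsmult_assoc lsmult_minus)
        (simp add: a_minus_def c' M.a_assoc M.r_neg1)
    then show "?p (\<theta>' (\<theta> f)) \<ominus>\<^bsub>M\<^esub> (\<sigma>' \<otimes>\<^bsub>A\<^esub> \<sigma>) \<odot>\<^bsub>M\<^esub> ?p f \<in> P"
      using sub(3,4) \<theta>'(3) \<theta>(3) f c' by simp
  next
    fix q b assume q: "q \<in> insert x Y"
    show "\<theta>' (\<theta> q) b \<in> I"
    proof (cases "q = x")
      case False
      then show ?thesis
        by (intro mod_hom_coefficients_ideal[OF \<theta>'(2)]) (use q insert.prems \<theta>(4) c(2) in auto)
    qed (use \<theta>'(4) in simp)
  qed
qed

end

text \<open>The instance belonging to the criterion for exact relations.\<close>
lemma (in left_module) scaled_ideal_zero: "scaled_ideal A M {\<one>\<^bsub>A\<^esub>} {\<zero>\<^bsub>A\<^esub>} {\<zero>\<^bsub>M\<^esub>}"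
  by unfold_locales (auto simp: lsmult_zero zero_lsmult)

text \<open>An additive extension of \<open>f\<close> to formal sums over \<open>S\<close>, used to test whether a formal sum is zero in a tensor product.\<close>
definition additive_ext :: "('g, 'x) ring_scheme \<Rightarrow> ('p \<Rightarrow> 'g) \<Rightarrow> 'p set \<Rightarrow> ('p \<Rightarrow>\<^sub>0 int) \<Rightarrow> 'g"
  where "additive_ext G f S =
    (SOME h. h \<in> hom (free_Abelian_group S) (add_monoid G) \<and> (\<forall>x\<in>S. h (frag_of x) = f x))"

lemma additive_ext:
  assumes G: "abelian_group G" and f: "\<And>x. x \<in> S \<Longrightarrow> f x \<in> carrier G"
  shows "Poly_Mapping.keys u \<subseteq> S \<Longrightarrow> additive_ext G f S u \<in> carrier G"
    "x \<in> S \<Longrightarrow> additive_ext G f S (frag_of x) = f x"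
    "additive_ext G f S 0 = \<zero>\<^bsub>G\<^esub>"
    "Poly_Mapping.keys u \<subseteq> S \<Longrightarrow> Poly_Mapping.keys v \<subseteq> S \<Longrightarrow>
      additive_ext G f S (u + v) = additive_ext G f S u \<oplus>\<^bsub>G\<^esub> additive_ext G f S v"
    "Poly_Mapping.keys u \<subseteq> S \<Longrightarrow> additive_ext G f S (- u) = \<ominus>\<^bsub>G\<^esub> additive_ext G f S u"
    "Poly_Mapping.keys u \<subseteq> S \<Longrightarrow> Poly_Mapping.keys v \<subseteq> S \<Longrightarrow>
      additive_ext G f S (u - v) = additive_ext G f S u \<ominus>\<^bsub>G\<^esub> additive_ext G f S v"
proof -
  interpret abelian_group G by fact
  let ?h = "additive_ext G f S"
  have "\<exists>h. h \<in> hom (free_Abelian_group S) (add_monoid G) \<and> (\<forall>x\<in>S. h (frag_of x) = f x)"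
  proof -
    obtain h where "h \<in> hom (free_Abelian_group S) (add_monoid G)" "\<And>x. x \<in> S \<Longrightarrow> h (frag_of x) = f x"
      by (rule comm_group.free_Abelian_group_universal[OF a_comm_group, of f S]) (use f in auto)
    then show ?thesis by blast
  qed
  from someI_ex[OF this, folded additive_ext_def]
  have h: "?h \<in> hom (free_Abelian_group S) (add_monoid G)" "\<And>x. x \<in> S \<Longrightarrow> ?h (frag_of x) = f x" by auto
  show "x \<in> S \<Longrightarrow> ?h (frag_of x) = f x" by (rule h)
  show c: "?h u \<in> carrier G" if "Poly_Mapping.keys u \<subseteq> S" for u
    using h(1) that by (auto simp: hom_def)
  show a: "?h (u + v) = ?h u \<oplus>\<^bsub>G\<^esub> ?h v" if "Poly_Mapping.keys u \<subseteq> S" "Poly_Mapping.keys v \<subseteq> S" for u v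
    using h(1) that by (auto simp: hom_def)
  show z: "?h 0 = \<zero>\<^bsub>G\<^esub>" using a[of 0 0] c[of 0] add.l_cancel_one' by simp
  show m: "?h (- u) = \<ominus>\<^bsub>G\<^esub> ?h u" if "Poly_Mapping.keys u \<subseteq> S" for u
    by (rule minus_equality[symmetric]) (use a[of "- u" u] c[of u] c[of "- u"] that z in auto)
  show "?h (u - v) = ?h u \<ominus>\<^bsub>G\<^esub> ?h v" if "Poly_Mapping.keys u \<subseteq> S" "Poly_Mapping.keys v \<subseteq> S"
    using a[of u "- v"] m[of v] that by (simp add: a_minus_def)
qed

lemma tensor_rel_sum:
  assumes "right_module A M" "left_module A N" "\<And>c. c \<in> T \<Longrightarrow> u c \<in> tensor_rel A M N"
  shows "(\<Sum>c\<in>T. u c) \<in> tensor_rel A M N"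
  using assms(3) by (induction T rule: infinite_finite_induct)
    (auto simp: tensor_rel_props(1,2)[OF assms(1,2)])

lemma tensor_rel_zero_right:
  assumes M: "right_module A M" and N: "left_module A N" and x: "x \<in> carrier M"
  shows "frag_of (x, \<zero>\<^bsub>N\<^esub>) \<in> tensor_rel A M N"
proof -
  interpret N: left_module A N by fact
  note g = tensor_rel_props[OF M N]
  show ?thesis
    using g(3)[OF g(6)[OF tensor_gensI(2)[of x M "\<zero>\<^bsub>N\<^esub>" N "\<zero>\<^bsub>N\<^esub>" A]]] x by simp
qed

lemma tensor_rel_finsum_right:
  assumes M: "right_module A M" and N: "left_module A N" and x: "x \<in> carrier M"
    and T: "finite T" "\<And>c. c \<in> T \<Longrightarrow> y c \<in> carrier N"
  shows "frag_of (x, \<Oplus>\<^bsub>N\<^esub>c\<in>T. y c) - (\<Sum>c\<in>T. frag_of (x, y c)) \<in> tensor_rel A M N"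
  using T
proof (induction T)
  interpret N: left_module A N by fact
  note g = tensor_rel_props[OF M N]
  {
    case empty
    then show ?case using tensor_rel_zero_right[OF M N x] by simp
  next
    case (insert c T)
    have s: "(\<Oplus>\<^bsub>N\<^esub>c\<in>insert c T. y c) = y c \<oplus>\<^bsub>N\<^esub> (\<Oplus>\<^bsub>N\<^esub>c\<in>T. y c)"
      using insert by (subst N.M.finsum_insert) auto
    have "frag_of (x, y c \<oplus>\<^bsub>N\<^esub> (\<Oplus>\<^bsub>N\<^esub>c\<in>T. y c)) - frag_of (x, y c) - frag_of (x, \<Oplus>\<^bsub>N\<^esub>c\<in>T. y c) \<in> tensor_rel A M N"
      by (rule g(6)[OF tensor_gensI(2)]) (use x insert in \<open>auto intro: N.M.finsum_closed\<close>)
    from g(2)[OF this insert.IH] show ?case unfolding s using insert by (simp add: algebra_simps)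
  }
qed

lemma tensor_rel_middle:
  assumes M: "right_module A M" and N: "left_module A N"
    and "a \<in> carrier A" "x \<in> carrier M" "y \<in> carrier N"
  shows "frag_of (x, a \<odot>\<^bsub>N\<^esub> y) - frag_of (a \<odot>\<^bsub>M\<^esub> x, y) \<in> tensor_rel A M N"
  using tensor_rel_props(3)[OF M N tensor_rel_props(6)[OF M N tensor_gensI(3)[OF assms(3-5)]]] by simp

lemma keys_diff_subset:
  "Poly_Mapping.keys u \<subseteq> S \<Longrightarrow> Poly_Mapping.keys v \<subseteq> S \<Longrightarrow> Poly_Mapping.keys (u - v) \<subseteq> S"
  using keys_diff[of u v] by blast

text \<open>
  Let \<open>I\<close> be the right ideal generated by the coefficients of \<open>q\<close>. The formal sum \<open>\<Sum> q\<^sub>b \<otimes> b\<close> is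
  zero in \<open>A \<otimes> B = B\<close>, hence, by flatness, in \<open>I \<otimes> B\<close>. The map that sends \<open>x \<otimes> b\<close> to \<open>x\<close> times the basis vector of
  \<open>b\<close> takes all tensor relations into \<^const>\<open>syzygy_multiples\<close>, and the formal sum to \<open>q\<close>.
\<close>
lemma flat_imp_equational:
  fixes A :: "('a, 'x) ring_scheme" and B :: "('a, 'b, 'z) module_scheme"
  assumes flat: "flat A B"
  shows "equational A B"
proof -
  have B: "left_module A B" using flat by (simp add: flat_def)
  interpret B: left_module A B by fact
  let ?F = "free_cover A B" and ?p = "presentation A B"
  interpret F: left_module A ?F by (rule B.A.left_module_free_module)
  interpret AA: left_module A "self_module A" by (rule B.A.left_module_self)
  show ?thesis
  proof (rule B.equationalI)
    fix q assume q: "q \<in> carrier ?F" "?p q = \<zero>\<^bsub>B\<^esub>"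
    \<comment> \<open>The right ideal generated by the coefficients of \<open>q\<close>, as the set of values of linear forms at \<open>q\<close>.\<close>
    define I where "I = {\<phi> q |\<phi>. \<phi> \<in> mod_hom A ?F (self_module A)}"
    have I_sub: "I \<subseteq> carrier A" unfolding I_def using mod_homD(1) q(1) by fastforce
    have I_add: "x \<oplus>\<^bsub>A\<^esub> y \<in> I" if xy: "x \<in> I" "y \<in> I" for x y
    proof -
      obtain \<phi> \<psi> where *: "\<phi> \<in> mod_hom A ?F (self_module A)" "\<psi> \<in> mod_hom A ?F (self_module A)" "x = \<phi> q" "y = \<psi> q"
        using xy unfolding I_def by blast
      show ?thesis unfolding I_def using AA.mod_hom_add[OF F.left_module_axioms *(1,2)] *(3,4)
        by (intro CollectI exI[of _ "\<lambda>f. \<phi> f \<oplus>\<^bsub>A\<^esub> \<psi> f"]) simp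
    qed
    have I_mult: "x \<otimes>\<^bsub>A\<^esub> a \<in> I" if xy: "x \<in> I" and a: "a \<in> carrier A" for x a
    proof -
      obtain \<phi> where *: "\<phi> \<in> mod_hom A ?F (self_module A)" "x = \<phi> q" using xy unfolding I_def by blast
      have "(\<lambda>f. \<phi> f \<otimes>\<^bsub>A\<^esub> a) \<in> mod_hom A ?F (self_module A)"
        by (rule mod_homI) (use a mod_homD[OF *(1)] in \<open>auto simp: B.A.l_distr B.A.m_assoc\<close>)
      then show ?thesis unfolding I_def using *(2) by auto
    qed
    have qI: "q b \<in> I" for b
    proof -
      have "(\<lambda>f. f b) \<in> mod_hom A ?F (self_module A)"
        by (rule mod_homI) (auto simp: B.A.free_module_closed free_module_simps)
      then show ?thesis unfolding I_def by auto
    qed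
    have I0: "\<zero>\<^bsub>A\<^esub> \<in> I" using I_mult[OF qI B.A.zero_closed] subsetD[OF I_sub qI] by simp
    define N where "N = \<lparr>carrier = carrier A, monoid.mult = monoid.mult A, one = \<one>\<^bsub>A\<^esub>, ring.zero = \<zero>\<^bsub>A\<^esub>,
      ring.add = ring.add A, smult = (\<lambda>a x. x \<otimes>\<^bsub>A\<^esub> a)\<rparr>"
    define J where "J = N\<lparr>carrier := I\<rparr>"
    have N: "right_module A N"
    proof -
      have "abelian_group N"
        by (rule abelian_groupI) (auto simp: N_def B.A.a_ac intro: bexI[of _ "\<ominus>\<^bsub>A\<^esub> _"] B.A.l_neg)
      then show ?thesis
        by (intro right_module.intro right_module_axioms.intro B.A.ring_axioms)
          (auto simp: N_def B.A.l_distr B.A.r_distr B.A.m_assoc)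
    qed
    have J: "right_module A J"
    proof -
      have "abelian_group J"
      proof (rule abelian_groupI)
        fix x assume "x \<in> carrier J"
        then have x: "x \<in> I" "x \<in> carrier A" using I_sub by (auto simp: J_def)
        show "\<exists>y\<in>carrier J. y \<oplus>\<^bsub>J\<^esub> x = \<zero>\<^bsub>J\<^esub>"
          by (rule bexI[of _ "\<ominus>\<^bsub>A\<^esub> x"])
            (use x I_mult[OF x(1), of "\<ominus>\<^bsub>A\<^esub> \<one>\<^bsub>A\<^esub>"] in \<open>simp_all add: J_def N_def B.A.r_minus B.A.l_neg\<close>)
      qed (use I_sub I_add I0 in \<open>auto simp: J_def N_def B.A.a_ac subset_iff\<close>)
      then show ?thesis
        using I_sub I_mult
        by (intro right_module.intro right_module_axioms.intro B.A.ring_axioms)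
          (auto simp: N_def J_def B.A.l_distr B.A.r_distr B.A.m_assoc subset_iff)
    qed
    have incl: "(\<lambda>x. x) \<in> mod_hom A J N"
      by (rule mod_homI) (use I_sub in \<open>auto simp: J_def N_def\<close>)
    have Jc: "carrier J = I" "carrier N = carrier A" by (simp_all add: J_def N_def)
    have Jadd: "x \<oplus>\<^bsub>J\<^esub> y = x \<oplus>\<^bsub>A\<^esub> y" and Jsmult: "a \<odot>\<^bsub>J\<^esub> x = x \<otimes>\<^bsub>A\<^esub> a" for x y a
      by (simp_all add: J_def N_def)
    note F = free_module_support[OF q(1)] B.A.free_module_closed[OF q(1)]
    let ?T = "{b. q b \<noteq> \<zero>\<^bsub>A\<^esub>}"
    \<comment> \<open>In \<open>A \<otimes> B\<close> this sum collapses to \<open>1 \<otimes> \<Sum> q\<^sub>b b\<close>.\<close>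
    define u where "u = (\<Sum>b\<in>?T. frag_of (q b, b))"
    have u_keys: "Poly_Mapping.keys u \<subseteq> I \<times> carrier B"
      unfolding u_def using F(2) qI by (force dest!: subsetD[OF keys_sum])
    have "u \<in> tensor_rel A N B"
    proof -
      note g = tensor_rel_props[OF N B]
      have "frag_of (\<one>\<^bsub>A\<^esub>, \<Oplus>\<^bsub>B\<^esub>b\<in>?T. q b \<odot>\<^bsub>B\<^esub> b) - (\<Sum>b\<in>?T. frag_of (\<one>\<^bsub>A\<^esub>, q b \<odot>\<^bsub>B\<^esub> b)) \<in> tensor_rel A N B"
        by (rule tensor_rel_finsum_right[OF N B _ F(1)]) (use F(2,3) in \<open>auto simp: N_def B.lsmult_closed\<close>)
      moreover have "(\<Oplus>\<^bsub>B\<^esub>b\<in>?T. q b \<odot>\<^bsub>B\<^esub> b) = \<zero>\<^bsub>B\<^esub>" using q(2) by (simp add: presentation_def lin_ext_def)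
      moreover have "frag_of (\<one>\<^bsub>A\<^esub>, \<zero>\<^bsub>B\<^esub>) \<in> tensor_rel A N B"
        by (rule tensor_rel_zero_right[OF N B]) (simp add: N_def)
      ultimately have 1: "(\<Sum>b\<in>?T. frag_of (\<one>\<^bsub>A\<^esub>, q b \<odot>\<^bsub>B\<^esub> b)) \<in> tensor_rel A N B"
        using g(4) by fastforce
      have "(\<Sum>b\<in>?T. frag_of (\<one>\<^bsub>A\<^esub>, q b \<odot>\<^bsub>B\<^esub> b) - frag_of (q b \<odot>\<^bsub>N\<^esub> \<one>\<^bsub>A\<^esub>, b)) \<in> tensor_rel A N B"
        by (rule tensor_rel_sum[OF N B], rule tensor_rel_middle[OF N B]) (use F in \<open>auto simp: Jc\<close>)
      also have "(\<Sum>b\<in>?T. frag_of (\<one>\<^bsub>A\<^esub>, q b \<odot>\<^bsub>B\<^esub> b) - frag_of (q b \<odot>\<^bsub>N\<^esub> \<one>\<^bsub>A\<^esub>, b)) =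
          (\<Sum>b\<in>?T. frag_of (\<one>\<^bsub>A\<^esub>, q b \<odot>\<^bsub>B\<^esub> b)) - u"
        unfolding u_def sum_subtractf using F(3) by (simp add: N_def)
      finally show ?thesis using g(4)[OF 1] by fastforce
    qed
    then have u_rel: "u \<in> tensor_rel A J B"
      using flat_tensor_map_inj[OF flat J N incl] u_keys
      unfolding inj_on_tensor_map_iff[OF J N B incl] by (auto simp: frag_extend_frag_of case_prod_unfold Jc)
    define h where "h = additive_ext ?F (\<lambda>(x, b). x \<odot>\<^bsub>?F\<^esub> basis_vec A b) (carrier J \<times> carrier B)"
    have xb: "x \<odot>\<^bsub>?F\<^esub> basis_vec A b \<in> carrier ?F" if "x \<in> carrier J" "b \<in> carrier B" for x b
      using that I_sub Jc B.A.basis_vec_closed by (intro F.lsmult_closed) auto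
    have h: "Poly_Mapping.keys u \<subseteq> carrier J \<times> carrier B \<Longrightarrow> h u \<in> carrier ?F"
      "x \<in> carrier J \<Longrightarrow> b \<in> carrier B \<Longrightarrow> h (frag_of (x, b)) = x \<odot>\<^bsub>?F\<^esub> basis_vec A b"
      "h 0 = \<zero>\<^bsub>?F\<^esub>"
      "Poly_Mapping.keys u \<subseteq> carrier J \<times> carrier B \<Longrightarrow> Poly_Mapping.keys v \<subseteq> carrier J \<times> carrier B \<Longrightarrow>
        h (u + v) = h u \<oplus>\<^bsub>?F\<^esub> h v"
      "Poly_Mapping.keys u \<subseteq> carrier J \<times> carrier B \<Longrightarrow> h (- u) = \<ominus>\<^bsub>?F\<^esub> h u"
      "Poly_Mapping.keys u \<subseteq> carrier J \<times> carrier B \<Longrightarrow> Poly_Mapping.keys v \<subseteq> carrier J \<times> carrier B \<Longrightarrow>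
        h (u - v) = h u \<ominus>\<^bsub>?F\<^esub> h v" for u v x b
      using additive_ext[OF F.M.abelian_group_axioms, of "carrier J \<times> carrier B" "\<lambda>(x, b). x \<odot>\<^bsub>?F\<^esub> basis_vec A b"]
        xb unfolding h_def by fastforce+
    let ?Z = "syzygy_multiples A B q"
    have Z_mult: "x \<odot>\<^bsub>?F\<^esub> g \<in> ?Z" if x: "x \<in> I" and g: "g \<in> carrier ?F" "?p g = \<zero>\<^bsub>B\<^esub>" for x g
    proof -
      obtain \<phi> where \<phi>: "\<phi> \<in> mod_hom A ?F (self_module A)" "x = \<phi> q" using x unfolding I_def by blast
      have "(\<lambda>f. \<phi> f \<odot>\<^bsub>?F\<^esub> g) \<in> mod_hom A ?F ?F"
        by (rule mod_homI)
          (use mod_homD[OF \<phi>(1)] g(1) in \<open>auto simp: F.lsmult_l_distr F.lsmult_assoc F.lsmult_closed\<close>)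
      moreover have "?p (\<phi> f \<odot>\<^bsub>?F\<^esub> g) = \<zero>\<^bsub>B\<^esub>" if "f \<in> carrier ?F" for f
        using that g mod_homD(1)[OF \<phi>(1)] by (simp add: mod_homD(3)[OF B.presentation_hom] B.lsmult_zero)
      ultimately show ?thesis unfolding syzygy_multiples_def using \<phi>(2)
        by (intro CollectI exI[of _ "\<lambda>f. \<phi> f \<odot>\<^bsub>?F\<^esub> g"]) simp
    qed
    have "h v \<in> ?Z" if "v \<in> tensor_rel A J B" for v
      using J B that
    proof (induction rule: tensor_rel_induct)
      case zero
      show ?case using B.syzygy_multiples_zero h(3) by simp
    next
      case (add u v)
      then show ?case using B.syzygy_multiples_add h(4) tensor_rel_props(5)[OF J B] by simp
    next
      case (minus u)
      then show ?case using B.syzygy_multiples_uminus[OF _ q(1)] h(5) tensor_rel_props(5)[OF J B] by simp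
    next
      case (gen u)
      note bv = B.A.basis_vec_closed
      from gen show ?case
      proof (cases rule: tensor_gensE)
        case (left x x' y)
        have xA: "x \<in> carrier A" "x' \<in> carrier A" "x \<oplus>\<^bsub>A\<^esub> x' \<in> carrier J" using left I_sub I_add Jc by auto
        have "h u = (x \<oplus>\<^bsub>A\<^esub> x') \<odot>\<^bsub>?F\<^esub> basis_vec A y \<ominus>\<^bsub>?F\<^esub> x \<odot>\<^bsub>?F\<^esub> basis_vec A y \<ominus>\<^bsub>?F\<^esub> x' \<odot>\<^bsub>?F\<^esub> basis_vec A y"
          unfolding left(1) Jadd using left xA by (simp add: h keys_diff_subset)
        also have "\<dots> = \<zero>\<^bsub>?F\<^esub>"
          using left xA bv[of y "carrier B"] F.lsmult_closed[of x "basis_vec A y"] F.lsmult_closed[of x' "basis_vec A y"]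
          by (simp add: F.lsmult_l_distr a_minus_def F.M.a_ac F.M.r_neg F.M.r_neg2)
        finally show ?thesis using B.syzygy_multiples_zero by simp
      next
        case (right x y y')
        have xA: "x \<in> carrier A" using right I_sub Jc by auto
        let ?g = "basis_vec A (y \<oplus>\<^bsub>B\<^esub> y') \<ominus>\<^bsub>?F\<^esub> basis_vec A y \<ominus>\<^bsub>?F\<^esub> basis_vec A y'"
        note bvs = bv[of y "carrier B"] bv[of y' "carrier B"] bv[of "y \<oplus>\<^bsub>B\<^esub> y'" "carrier B"]
        have "h u = x \<odot>\<^bsub>?F\<^esub> ?g"
          unfolding right(1) using right xA bvs
          by (simp add: h keys_diff_subset F.lsmult_minus)
        moreover have "?p ?g = \<zero>\<^bsub>B\<^esub>"
          using right bvs
          by (simp add: F.mod_hom_zero_minus(3)[OF B.presentation_hom B] B.presentation_basis_vec)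
            (simp add: a_minus_def B.M.a_ac B.M.r_neg B.M.r_neg2)
        ultimately show ?thesis using Z_mult[of x ?g] right bvs Jc by simp
      next
        case (middle a x y)
        have xA: "x \<in> carrier A" "x \<otimes>\<^bsub>A\<^esub> a \<in> carrier J" using middle I_sub I_mult Jc by auto
        let ?g = "a \<odot>\<^bsub>?F\<^esub> basis_vec A y \<ominus>\<^bsub>?F\<^esub> basis_vec A (a \<odot>\<^bsub>B\<^esub> y)"
        note bvs = bv[of y "carrier B"] bv[of "a \<odot>\<^bsub>B\<^esub> y" "carrier B"] F.lsmult_closed[of a "basis_vec A y"] B.lsmult_closed[of a y]
        have "h u = x \<odot>\<^bsub>?F\<^esub> ?g"
          unfolding middle(1) Jsmult using middle xA bvs
          by (simp add: h keys_diff_subset F.lsmult_minus F.lsmult_assoc)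
        moreover have "?p ?g = \<zero>\<^bsub>B\<^esub>"
          using middle bvs
          by (simp add: F.mod_hom_zero_minus(3)[OF B.presentation_hom B] mod_homD(3)[OF B.presentation_hom] B.presentation_basis_vec)
            (simp add: a_minus_def B.M.r_neg)
        ultimately show ?thesis using Z_mult[of x ?g] middle bvs Jc by simp
      qed
    qed
    then have "h u \<in> ?Z" using u_rel .
    moreover have "h u = q"
    proof -
      have "h (\<Sum>b\<in>T. frag_of (q b, b)) = (\<Oplus>\<^bsub>?F\<^esub>b\<in>T. q b \<odot>\<^bsub>?F\<^esub> basis_vec A b)" if "finite T" "T \<subseteq> ?T" for T
        using that
      proof (induction T)
        case (insert b T)
        have k: "Poly_Mapping.keys (\<Sum>b\<in>T. frag_of (q b, b)) \<subseteq> carrier J \<times> carrier B"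
          using insert.prems F(2) qI Jc by (force dest!: subsetD[OF keys_sum])
        have b: "b \<in> carrier B" "q b \<in> carrier J" using insert F qI Jc by auto
        show ?case
          using insert F k b xb Jc qI
          by (subst F.M.finsum_insert) (auto simp: h  intro!: xb)
      qed (simp add: h)
      from this[OF F(1) order.refl] show ?thesis
        unfolding u_def using B.A.lin_ext_basis[OF q(1)] by (simp add: lin_ext_def)
    qed
    ultimately show "q \<in> ?Z" by simp
  qed
qed

lemma tensor_rel_zero_left:
  assumes M: "right_module A M" and N: "left_module A N" and y: "y \<in> carrier N"
  shows "frag_of (\<zero>\<^bsub>M\<^esub>, y) \<in> tensor_rel A M N"
proof -
  interpret M: right_module A M by fact
  note g = tensor_rel_props[OF M N]
  show ?thesis
    using g(3)[OF g(6)[OF tensor_gensI(1)[of "\<zero>\<^bsub>M\<^esub>" M "\<zero>\<^bsub>M\<^esub>" y N A]]] y by simp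
qed

text \<open>
  A formal sum that is zero in \<open>N \<otimes> B\<close> uses only finitely many relations of \<open>B\<close>. An endomorphism \<open>\<theta>\<close>
  of the free module that kills these, and is compatible with the presentation, rewrites the sum
  as \<open>\<Sum> x\<^sub>c \<otimes> c\<close> with all \<open>x\<^sub>c\<close> equal to zero. If the sum comes from a submodule \<open>M\<close>, so do the
  coefficients \<open>x\<^sub>c\<close>, which are then zero in \<open>M\<close>, and the rewriting takes place in \<open>M \<otimes> B\<close>.
\<close>
lemma equational_imp_flat:
  fixes A :: "('a, 'x) ring_scheme" and B :: "('a, 'b, 'z) module_scheme"
  assumes B: "left_module A B" and eq: "equational A B"
  shows "flat A B"
proof -
  interpret B: left_module A B by fact
  interpret Z: scaled_ideal A B "{\<one>\<^bsub>A\<^esub>}" "{\<zero>\<^bsub>A\<^esub>}" "{\<zero>\<^bsub>B\<^esub>}" by (rule B.scaled_ideal_zero)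
  let ?F = "free_cover A B" and ?p = "presentation A B"
  interpret F: left_module A ?F by (rule B.A.left_module_free_module)
  note bv = B.A.basis_vec_closed[of _ "carrier B"]
  \<comment> \<open>The coefficient at \<open>c\<close> after each \<open>b\<close> has been replaced by \<open>\<theta>\<close> of its basis vector.\<close>
  define coord where "coord = (\<lambda>(N :: ('a, 'a list) module) \<theta> (c :: 'b).
    additive_ext N (\<lambda>(x, b). \<theta> (basis_vec A b) c \<odot>\<^bsub>N\<^esub> x) (carrier N \<times> carrier B))"
  have coord: "Poly_Mapping.keys u \<subseteq> carrier N \<times> carrier B \<Longrightarrow> coord N \<theta> c u \<in> carrier N"
    "x \<in> carrier N \<Longrightarrow> b \<in> carrier B \<Longrightarrow> coord N \<theta> c (frag_of (x, b)) = \<theta> (basis_vec A b) c \<odot>\<^bsub>N\<^esub> x"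
    "coord N \<theta> c 0 = \<zero>\<^bsub>N\<^esub>"
    "Poly_Mapping.keys u \<subseteq> carrier N \<times> carrier B \<Longrightarrow> Poly_Mapping.keys v \<subseteq> carrier N \<times> carrier B \<Longrightarrow>
      coord N \<theta> c (u + v) = coord N \<theta> c u \<oplus>\<^bsub>N\<^esub> coord N \<theta> c v"
    "Poly_Mapping.keys u \<subseteq> carrier N \<times> carrier B \<Longrightarrow> coord N \<theta> c (- u) = \<ominus>\<^bsub>N\<^esub> coord N \<theta> c u"
    "Poly_Mapping.keys u \<subseteq> carrier N \<times> carrier B \<Longrightarrow> Poly_Mapping.keys v \<subseteq> carrier N \<times> carrier B \<Longrightarrow>
      coord N \<theta> c (u - v) = coord N \<theta> c u \<ominus>\<^bsub>N\<^esub> coord N \<theta> c v"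
    if N: "right_module A N" and \<theta>: "\<theta> \<in> mod_hom A ?F ?F" for N :: "('a, 'a list) module" and \<theta> c u v x b
  proof -
    interpret N: right_module A N by fact
    have "\<theta> (basis_vec A b) c \<odot>\<^bsub>N\<^esub> x \<in> carrier N" if "x \<in> carrier N" "b \<in> carrier B" for x b
      by (rule N.rsmult_closed[OF B.A.free_module_closed[OF mod_homD(1)[OF \<theta> bv]]]) (use that in auto)
    then have *: "\<And>p. p \<in> carrier N \<times> carrier B \<Longrightarrow> (case p of (x, b) \<Rightarrow> \<theta> (basis_vec A b) c \<odot>\<^bsub>N\<^esub> x) \<in> carrier N"
      by auto
    note ** = additive_ext[of N "carrier N \<times> carrier B" "\<lambda>(x, b). \<theta> (basis_vec A b) c \<odot>\<^bsub>N\<^esub> x",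
      OF N.M.abelian_group_axioms *]
    show "Poly_Mapping.keys u \<subseteq> carrier N \<times> carrier B \<Longrightarrow> coord N \<theta> c u \<in> carrier N"
      "x \<in> carrier N \<Longrightarrow> b \<in> carrier B \<Longrightarrow> coord N \<theta> c (frag_of (x, b)) = \<theta> (basis_vec A b) c \<odot>\<^bsub>N\<^esub> x"
      "coord N \<theta> c 0 = \<zero>\<^bsub>N\<^esub>"
      "Poly_Mapping.keys u \<subseteq> carrier N \<times> carrier B \<Longrightarrow> Poly_Mapping.keys v \<subseteq> carrier N \<times> carrier B \<Longrightarrow>
        coord N \<theta> c (u + v) = coord N \<theta> c u \<oplus>\<^bsub>N\<^esub> coord N \<theta> c v"
      "Poly_Mapping.keys u \<subseteq> carrier N \<times> carrier B \<Longrightarrow> coord N \<theta> c (- u) = \<ominus>\<^bsub>N\<^esub> coord N \<theta> c u"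
      "Poly_Mapping.keys u \<subseteq> carrier N \<times> carrier B \<Longrightarrow> Poly_Mapping.keys v \<subseteq> carrier N \<times> carrier B \<Longrightarrow>
        coord N \<theta> c (u - v) = coord N \<theta> c u \<ominus>\<^bsub>N\<^esub> coord N \<theta> c v"
      unfolding coord_def using **(1,3-6) **(2)[of "(x, b)"] by auto
  qed
  have kill: "\<exists>Y. finite Y \<and> Y \<subseteq> {q \<in> carrier ?F. ?p q = \<zero>\<^bsub>B\<^esub>} \<and>
      (\<forall>\<theta>\<in>mod_hom A ?F ?F. (\<forall>q\<in>Y. \<theta> q = \<zero>\<^bsub>?F\<^esub>) \<longrightarrow> (\<forall>c. coord N \<theta> c v = \<zero>\<^bsub>N\<^esub>))"
      (is "\<exists>Y. ?K Y v")
    if N: "right_module A N" and v: "v \<in> tensor_rel A N B" for N v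
    using N B v
  proof (induction rule: tensor_rel_induct)
    interpret N: right_module A N by fact
    note keys = tensor_rel_props(5)[OF N B]
    {
      case zero
      show ?case by (rule exI[of _ "{}"]) (auto simp: coord(3)[OF N])
    next
      case (add u v)
      then obtain Y Y' where "?K Y u" "?K Y' v" by blast
      then have "?K (Y \<union> Y') (u + v)" using add(1,2)[THEN keys]
        by (simp add: coord(4)[OF N] ball_Un)
      then show ?case by (rule exI)
    next
      case (minus u)
      then obtain Y where "?K Y u" by blast
      then have "?K Y (- u)" using minus(1)[THEN keys] by (simp add: coord(5)[OF N])
      then show ?case by (rule exI)
    next
      case (gen u)
      then show ?case
      proof (cases rule: tensor_gensE)
        case (left x x' y)
        have "coord N \<theta> c u = \<zero>\<^bsub>N\<^esub>" if \<theta>: "\<theta> \<in> mod_hom A ?F ?F" for \<theta> c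
        proof -
          have a: "\<theta> (basis_vec A y) c \<in> carrier A"
            by (rule B.A.free_module_closed[OF mod_homD(1)[OF \<theta> bv]]) (rule left)
          show ?thesis
            unfolding left(1) using left a N.rsmult_closed[OF a]
            by (simp add: coord[OF N \<theta>] keys_diff_subset N.rsmult_r_distr)
              (simp add: a_minus_def N.M.a_ac N.M.r_neg N.M.r_neg2)
        qed
        then show ?thesis by (intro exI[of _ "{}"]) auto
      next
        case (right x y y')
        note bvs = bv[of y] bv[of y'] bv[of "y \<oplus>\<^bsub>B\<^esub> y'"]
        let ?q = "basis_vec A (y \<oplus>\<^bsub>B\<^esub> y') \<ominus>\<^bsub>?F\<^esub> (basis_vec A y \<oplus>\<^bsub>?F\<^esub> basis_vec A y')"
        have q: "?q \<in> carrier ?F" "?p ?q = \<zero>\<^bsub>B\<^esub>"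
          using right bvs by (simp_all add: F.mod_hom_zero_minus(3)[OF B.presentation_hom B]
            mod_homD(2)[OF B.presentation_hom] B.presentation_basis_vec B.minus_eq_zero_iff)
        have "coord N \<theta> c u = \<zero>\<^bsub>N\<^esub>" if \<theta>: "\<theta> \<in> mod_hom A ?F ?F" "\<theta> ?q = \<zero>\<^bsub>?F\<^esub>" for \<theta> c
        proof -
          have "\<theta> (basis_vec A (y \<oplus>\<^bsub>B\<^esub> y')) = \<theta> (basis_vec A y) \<oplus>\<^bsub>?F\<^esub> \<theta> (basis_vec A y')"
            using \<theta>(2) right bvs by (simp add: F.mod_hom_zero_minus(3)[OF \<theta>(1) F.left_module_axioms]
              mod_homD[OF \<theta>(1)] F.minus_eq_zero_iff)
          then have e: "\<theta> (basis_vec A (y \<oplus>\<^bsub>B\<^esub> y')) c = \<theta> (basis_vec A y) c \<oplus>\<^bsub>A\<^esub> \<theta> (basis_vec A y') c"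
            by (simp add: free_module_simps)
          have a: "\<theta> (basis_vec A y) c \<in> carrier A" "\<theta> (basis_vec A y') c \<in> carrier A"
            by (rule B.A.free_module_closed[OF mod_homD(1)[OF \<theta>(1) bv]], rule right)+
          show ?thesis
            unfolding right(1) using right a N.rsmult_closed[OF a(1)] N.rsmult_closed[OF a(2)]
            by (simp add: coord[OF N \<theta>(1)] keys_diff_subset N.rsmult_l_distr e)
              (simp add: a_minus_def N.M.a_ac N.M.r_neg N.M.r_neg2)
        qed
        then show ?thesis by (intro exI[of _ "{?q}"]) (auto simp: q)
      next
        case (middle a x y)
        have ay: "a \<odot>\<^bsub>B\<^esub> y \<in> carrier B" using middle by (simp add: B.lsmult_closed)
        note bvs = bv[of y] bv[OF ay] F.lsmult_closed[of a "basis_vec A y"]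
        let ?q = "basis_vec A (a \<odot>\<^bsub>B\<^esub> y) \<ominus>\<^bsub>?F\<^esub> a \<odot>\<^bsub>?F\<^esub> basis_vec A y"
        have q: "?q \<in> carrier ?F" "?p ?q = \<zero>\<^bsub>B\<^esub>"
          using middle bvs ay by (simp_all add: F.mod_hom_zero_minus(3)[OF B.presentation_hom B]
            mod_homD(3)[OF B.presentation_hom] B.presentation_basis_vec B.minus_eq_zero_iff)
        have "coord N \<theta> c u = \<zero>\<^bsub>N\<^esub>" if \<theta>: "\<theta> \<in> mod_hom A ?F ?F" "\<theta> ?q = \<zero>\<^bsub>?F\<^esub>" for \<theta> c
        proof -
          have "\<theta> (basis_vec A (a \<odot>\<^bsub>B\<^esub> y)) = a \<odot>\<^bsub>?F\<^esub> \<theta> (basis_vec A y)"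
            using \<theta>(2) middle bvs F.lsmult_closed[of a "\<theta> (basis_vec A y)"]
            by (simp add: F.mod_hom_zero_minus(3)[OF \<theta>(1) F.left_module_axioms]
              mod_homD[OF \<theta>(1)] F.minus_eq_zero_iff)
          then have e: "\<theta> (basis_vec A (a \<odot>\<^bsub>B\<^esub> y)) c = a \<otimes>\<^bsub>A\<^esub> \<theta> (basis_vec A y) c"
            by (simp add: free_module_simps)
          have b: "\<theta> (basis_vec A y) c \<in> carrier A"
            by (rule B.A.free_module_closed[OF mod_homD(1)[OF \<theta>(1) bv]]) (rule middle)
          show ?thesis
            unfolding middle(1) using middle b ay N.rsmult_closed[of a x]
            by (simp add: coord[OF N \<theta>(1)] keys_diff_subset N.rsmult_assoc e)
              (simp add: a_minus_def N.M.r_neg N.rsmult_closed)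
        qed
        then show ?thesis by (intro exI[of _ "{?q}"]) (auto simp: q)
      qed
    }
  qed
  \<comment> \<open>Up to tensor relations, a formal sum is determined by these coefficients.\<close>
  have expand: "w - (\<Sum>c\<in>T. frag_of (coord M \<theta> c w, c)) \<in> tensor_rel A M B"
    if M: "right_module A M" and \<theta>: "\<theta> \<in> mod_hom A ?F ?F"
      "\<And>f. f \<in> carrier ?F \<Longrightarrow> ?p (\<theta> f) = ?p f"
      and S0: "S0 \<subseteq> carrier B" and T: "finite T" "T \<subseteq> carrier B"
        "\<And>b. b \<in> S0 \<Longrightarrow> {c. \<theta> (basis_vec A b) c \<noteq> \<zero>\<^bsub>A\<^esub>} \<subseteq> T"
      and w: "Poly_Mapping.keys w \<subseteq> carrier M \<times> S0"
    for M w \<theta> S0 T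
  proof -
    interpret M: right_module A M by fact
    note g = tensor_rel_props[OF M B]
    note \<theta>b = mod_homD(1)[OF \<theta>(1) bv]
    have "Poly_Mapping.keys w \<subseteq> carrier M \<times> carrier B \<and> w - (\<Sum>c\<in>T. frag_of (coord M \<theta> c w, c)) \<in> tensor_rel A M B"
      using w
    proof (induction w rule: frag_induction)
      case zero
      have "(\<Sum>c\<in>T. frag_of (\<zero>\<^bsub>M\<^esub>, c)) \<in> tensor_rel A M B"
        by (rule tensor_rel_sum[OF M B], rule tensor_rel_zero_left[OF M B]) (use T in auto)
      then show ?case using g(3) by (simp add: coord(3)[OF M \<theta>(1)])
    next
      case (one z)
      obtain x b where z: "z = (x, b)" "x \<in> carrier M" "b \<in> S0" "b \<in> carrier B" using one S0 by auto
      let ?a = "\<theta> (basis_vec A b)"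
      have a: "?a c \<in> carrier A" for c by (rule B.A.free_module_closed[OF \<theta>b[OF z(4)]])
      have "b = ?p ?a" using \<theta>(2)[OF bv[OF z(4)]] z(4) by (simp add: B.presentation_basis_vec)
      also have "\<dots> = (\<Oplus>\<^bsub>B\<^esub>c\<in>T. ?a c \<odot>\<^bsub>B\<^esub> c)"
        unfolding presentation_def by (rule B.lin_ext_superset[OF T(1,2) T(3)[OF z(3)]]) (simp_all add: a)
      finally have "frag_of (x, b) - (\<Sum>c\<in>T. frag_of (x, ?a c \<odot>\<^bsub>B\<^esub> c)) \<in> tensor_rel A M B"
        using tensor_rel_finsum_right[OF M B z(2) T(1), of "\<lambda>c. ?a c \<odot>\<^bsub>B\<^esub> c"] T(2) a B.lsmult_closed by auto
      moreover have "(\<Sum>c\<in>T. frag_of (x, ?a c \<odot>\<^bsub>B\<^esub> c) - frag_of (?a c \<odot>\<^bsub>M\<^esub> x, c)) \<in> tensor_rel A M B"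
        by (rule tensor_rel_sum[OF M B], rule tensor_rel_middle[OF M B a z(2)]) (use T in auto)
      ultimately have "frag_of (x, b) - (\<Sum>c\<in>T. frag_of (?a c \<odot>\<^bsub>M\<^esub> x, c)) \<in> tensor_rel A M B"
        using g(2) unfolding sum_subtractf by fastforce
      then show ?case using z by (simp add: coord(2)[OF M \<theta>(1)])
    next
      case (diff u v)
      let ?s = "\<lambda>u. \<Sum>c\<in>T. frag_of (coord M \<theta> c u, c)"
      have "(\<Sum>c\<in>T. frag_of (coord M \<theta> c (u - v), c) - (frag_of (coord M \<theta> c u, c) - frag_of (coord M \<theta> c v, c)))
          \<in> tensor_rel A M B"
      proof (rule tensor_rel_sum[OF M B])
        fix c assume c: "c \<in> T"
        let ?u = "coord M \<theta> c u" and ?v = "coord M \<theta> c v"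
        have uv: "?u \<in> carrier M" "?v \<in> carrier M" using diff coord(1)[OF M \<theta>(1)] by auto
        have "frag_of ((?u \<ominus>\<^bsub>M\<^esub> ?v) \<oplus>\<^bsub>M\<^esub> ?v, c) - frag_of (?u \<ominus>\<^bsub>M\<^esub> ?v, c) - frag_of (?v, c) \<in> tensor_rel A M B"
          by (rule g(6)[OF tensor_gensI(1)]) (use uv c T in auto)
        moreover have "(?u \<ominus>\<^bsub>M\<^esub> ?v) \<oplus>\<^bsub>M\<^esub> ?v = ?u" using uv by (simp add: a_minus_def M.M.a_assoc M.M.l_neg)
        moreover have "coord M \<theta> c (u - v) = ?u \<ominus>\<^bsub>M\<^esub> ?v" using diff by (simp add: coord(6)[OF M \<theta>(1)])
        ultimately show "frag_of (coord M \<theta> c (u - v), c) - (frag_of (?u, c) - frag_of (?v, c)) \<in> tensor_rel A M B"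
          using g(3) by (fastforce simp: algebra_simps)
      qed
      then have s: "?s (u - v) - (?s u - ?s v) \<in> tensor_rel A M B" by (simp add: sum_subtractf)
      have "(u - ?s u) - (v - ?s v) - (?s (u - v) - (?s u - ?s v)) \<in> tensor_rel A M B"
        by (rule g(4)[OF g(4) s]) (use diff in auto)
      then show ?case using diff by (simp add: keys_diff_subset algebra_simps)
    qed
    then show ?thesis by blast
  qed
  show ?thesis
    unfolding flat_def
  proof (intro conjI B allI impI)
    fix M N :: "('a, 'a list) module" and f
    assume M: "right_module A M" and N: "right_module A N" and f: "f \<in> mod_hom A M N"
      and inj: "inj_on f (carrier M)"
    interpret M: right_module A M by fact
    interpret N: right_module A N by fact
    have f0: "f \<zero>\<^bsub>M\<^esub> = \<zero>\<^bsub>N\<^esub>"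
      using mod_homD(2)[OF f M.M.zero_closed M.M.zero_closed] mod_homD(1)[OF f M.M.zero_closed]
        N.M.add.l_cancel_one' by simp
    show "inj_on (tensor_map A N B f) (carrier (tensor A M B))"
      unfolding inj_on_tensor_map_iff[OF M N B f]
    proof (intro allI impI)
      fix u assume u: "Poly_Mapping.keys u \<subseteq> carrier M \<times> carrier B"
        "frag_extend (\<lambda>(x, b). frag_of (f x, b)) u \<in> tensor_rel A N B"
      let ?f = "frag_extend (\<lambda>(x, b). frag_of (f x, b))"
      obtain Y where Y: "finite Y" "Y \<subseteq> {q \<in> carrier ?F. ?p q = \<zero>\<^bsub>B\<^esub>}"
        "\<forall>\<theta>\<in>mod_hom A ?F ?F. (\<forall>q\<in>Y. \<theta> q = \<zero>\<^bsub>?F\<^esub>) \<longrightarrow> (\<forall>c. coord N \<theta> c (?f u) = \<zero>\<^bsub>N\<^esub>)"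
        using kill[OF N u(2)] by (elim exE conjE) rule
      obtain \<theta> where \<theta>: "\<theta> \<in> mod_hom A ?F ?F" "\<And>g. g \<in> carrier ?F \<Longrightarrow> ?p (\<theta> g) = ?p g"
        "\<forall>q\<in>Y. \<theta> q = \<zero>\<^bsub>?F\<^esub>"
      proof -
        obtain \<theta> where \<theta>: "\<theta> \<in> mod_hom A ?F ?F"
          "\<And>g. g \<in> carrier ?F \<Longrightarrow> ?p (\<theta> g) \<ominus>\<^bsub>B\<^esub> \<one>\<^bsub>A\<^esub> \<odot>\<^bsub>B\<^esub> ?p g = \<zero>\<^bsub>B\<^esub>" "\<And>q b. q \<in> Y \<Longrightarrow> \<theta> q b = \<zero>\<^bsub>A\<^esub>"
          using Z.equational_mod_finite[OF eq Y(1)] Y(2) by fastforce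
        show thesis
          by (rule that[OF \<theta>(1)])
            (use \<theta>(2,3) in \<open>auto simp: B.lsmult_one B.presentation_closed B.minus_eq_zero_iff mod_homD[OF \<theta>(1)] free_module_simps\<close>)
      qed
      have "Poly_Mapping.keys (?f u) \<subseteq> carrier N \<times> carrier B \<and> Poly_Mapping.keys u \<subseteq> carrier M \<times> carrier B \<and>
        coord N \<theta> c (?f u) = f (coord M \<theta> c u)" for c
        using u(1)
      proof (induction u rule: frag_induction)
        case zero
        show ?case by (simp add: f0 coord(3)[OF M \<theta>(1)] coord(3)[OF N \<theta>(1)])
      next
        case (one z)
        obtain x b where z: "z = (x, b)" "x \<in> carrier M" "b \<in> carrier B" using one by auto
        have a: "\<theta> (basis_vec A b) c \<in> carrier A"
          by (rule B.A.free_module_closed[OF mod_homD(1)[OF \<theta>(1) bv[OF z(3)]]])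
        show ?case using z a by (simp add: coord(2)[OF M \<theta>(1)] coord(2)[OF N \<theta>(1)] mod_homD[OF f])
      next
        case (diff u v)
        have m: "f (x \<ominus>\<^bsub>M\<^esub> y) = f x \<ominus>\<^bsub>N\<^esub> f y" if "x \<in> carrier M" "y \<in> carrier M" for x y
        proof -
          have "f (x \<ominus>\<^bsub>M\<^esub> y) \<oplus>\<^bsub>N\<^esub> f y = f x"
            using that by (simp flip: mod_homD(2)[OF f] add: a_minus_def M.M.a_assoc M.M.l_neg)
          then show ?thesis
            using that mod_homD(1)[OF f] by (metis M.M.minus_closed N.M.add.inv_solve_right' a_minus_def N.M.minus_eq)
        qed
        show ?case using diff
          by (auto simp: frag_extend_diff keys_diff_subset coord[OF N \<theta>(1)] coord[OF M \<theta>(1)] m)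
      qed
      then have "f (coord M \<theta> c u) = f \<zero>\<^bsub>M\<^esub>" for c using Y(3)[rule_format, OF \<theta>(1)] \<theta>(3) f0 by simp
      then have *: "coord M \<theta> c u = \<zero>\<^bsub>M\<^esub>" for c
        by (rule inj_onD[OF inj]) (simp_all add: coord(1)[OF M \<theta>(1) u(1)])
      define T where "T = (\<Union>b\<in>snd ` Poly_Mapping.keys u. {c. \<theta> (basis_vec A b) c \<noteq> \<zero>\<^bsub>A\<^esub>})"
      have bB: "b \<in> carrier B" if "b \<in> snd ` Poly_Mapping.keys u" for b using that u(1) by auto
      note supp = free_module_support[OF mod_homD(1)[OF \<theta>(1) bv[OF bB]]]
      have T: "finite T" "T \<subseteq> carrier B" unfolding T_def using supp by auto
      have "u - (\<Sum>c\<in>T. frag_of (coord M \<theta> c u, c)) \<in> tensor_rel A M B"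
      proof (rule expand[OF M \<theta>(1,2) _ T])
        show "Poly_Mapping.keys u \<subseteq> carrier M \<times> (snd ` Poly_Mapping.keys u)" using u(1) by force
      qed (use bB in \<open>auto simp: T_def\<close>)
      then have "u - (\<Sum>c\<in>T. frag_of (\<zero>\<^bsub>M\<^esub>, c)) \<in> tensor_rel A M B" by (simp add: *)
      moreover have "(\<Sum>c\<in>T. frag_of (\<zero>\<^bsub>M\<^esub>, c)) \<in> tensor_rel A M B"
        by (rule tensor_rel_sum[OF M B], rule tensor_rel_zero_left[OF M B]) (use T in auto)
      ultimately show "u \<in> tensor_rel A M B" using tensor_rel_props(2)[OF M B] by fastforce
    qed
  qed
qed

section \<open>Cancelling a central element\<close>

lemma (in left_module) mod_hom_eq_on_support:
  assumes "g \<in> mod_hom A (free_module A S) M" "h \<in> mod_hom A (free_module A S) M"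
    "f \<in> carrier (free_module A S)" "\<And>b. b \<in> S \<Longrightarrow> f b \<noteq> \<zero>\<^bsub>A\<^esub> \<Longrightarrow> g (basis_vec A b) = h (basis_vec A b)"
  shows "g f = h f"
  unfolding mod_hom_eq_lin_ext[OF assms(1,3)] mod_hom_eq_lin_ext[OF assms(2,3)]
  by (rule lin_ext_cong[OF assms(3)]) (use assms(4) mod_homD(1)[OF assms(2) A.basis_vec_closed] in auto)

lemma (in left_module) mod_hom_eq_lin_ext_on_support:
  assumes "h \<in> mod_hom A (free_module A S) M" "f \<in> carrier (free_module A S)"
    "\<And>b. b \<in> S \<Longrightarrow> \<theta> b \<in> carrier M" "\<And>b. b \<in> S \<Longrightarrow> f b \<noteq> \<zero>\<^bsub>A\<^esub> \<Longrightarrow> \<theta> b = h (basis_vec A b)"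
  shows "lin_ext A M \<theta> f = h f"
proof (rule mod_hom_eq_on_support[OF lin_ext_mod_hom assms(1,2)])
  show "lin_ext A M \<theta> (basis_vec A b) = h (basis_vec A b)" if "b \<in> S" "f b \<noteq> \<zero>\<^bsub>A\<^esub>" for b
    unfolding lin_ext_basis_vec[of \<theta> b, OF assms(3)[OF that(1)]] by (rule assms(4)[OF that])
qed (rule assms(3))

lemma (in abelian_group) diff_add_telescope:
  "x \<in> carrier G \<Longrightarrow> y \<in> carrier G \<Longrightarrow> z \<in> carrier G \<Longrightarrow> (x \<ominus> y \<oplus> z) \<oplus> (y \<ominus> z) = x"
  by (simp add: a_minus_def a_ac r_neg r_neg1 r_neg2)

lemma (in abelian_group) diff_diff_telescope:
  "x \<in> carrier G \<Longrightarrow> y \<in> carrier G \<Longrightarrow> z \<in> carrier G \<Longrightarrow> x \<ominus> (x \<ominus> y \<oplus> z) = y \<ominus> z"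
  by (simp add: a_minus_def minus_add a_assoc r_neg2)

text \<open>
  Write \<open>Q\<close> for the kernel of the presentation, and let \<open>p (H q) = G q\<close> with \<open>G\<close> mapping to \<open>Q\<close>. The
  criterion modulo \<open>I\<close> yields \<open>\<theta>\<close> such that \<open>s \<theta>\<close> is divisible by \<open>p\<close> on the finitely many relations
  that occur in \<open>G q\<close>, say \<open>s \<theta> G = p \<phi>\<close>, and agrees with \<open>\<sigma> s\<close> over \<open>B\<close> up to a multiple \<open>p \<epsilon>\<close>. So
  \<open>\<rho> = \<sigma> s - s \<theta> + p \<epsilon>\<close> maps to \<open>Q\<close>, and
  \<open>\<sigma> s H q = \<rho> H q + s \<theta> H q - p \<epsilon> H q = \<rho> H q + (\<phi> - \<epsilon> G) q\<close>, where \<open>p\<close> has been cancelled in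
  \<open>p s \<theta> H q = s \<theta> G q = p \<phi> q\<close>. The map \<open>\<phi> - \<epsilon> G\<close> goes to \<open>Q\<close> as well, because \<open>p\<close> times it is
  \<open>(\<sigma> s - \<rho>) G\<close> and \<open>p\<close> is regular on the module.
\<close>
lemma (in scaled_ideal) syzygy_multiples_cancel:
  assumes eq: "equational_mod A M \<Sigma> I P"
    and central: "\<And>\<sigma> a. \<sigma> \<in> \<Sigma> \<Longrightarrow> a \<in> carrier A \<Longrightarrow> \<sigma> \<otimes>\<^bsub>A\<^esub> a = a \<otimes>\<^bsub>A\<^esub> \<sigma>"
      "\<And>a. a \<in> carrier A \<Longrightarrow> s \<otimes>\<^bsub>A\<^esub> a = a \<otimes>\<^bsub>A\<^esub> s" "\<And>a. a \<in> carrier A \<Longrightarrow> p \<otimes>\<^bsub>A\<^esub> a = a \<otimes>\<^bsub>A\<^esub> p"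
    and s: "s \<in> carrier A" and p: "p \<in> carrier A"
      "\<And>a. a \<in> carrier A \<Longrightarrow> p \<otimes>\<^bsub>A\<^esub> a = \<zero>\<^bsub>A\<^esub> \<Longrightarrow> a = \<zero>\<^bsub>A\<^esub>"
      "\<And>x. x \<in> carrier M \<Longrightarrow> p \<odot>\<^bsub>M\<^esub> x = \<zero>\<^bsub>M\<^esub> \<Longrightarrow> x = \<zero>\<^bsub>M\<^esub>"
    and divides: "\<And>a. a \<in> I \<Longrightarrow> \<exists>a'\<in>carrier A. s \<otimes>\<^bsub>A\<^esub> a = p \<otimes>\<^bsub>A\<^esub> a'"
      "\<And>x. x \<in> P \<Longrightarrow> \<exists>x'\<in>carrier M. s \<odot>\<^bsub>M\<^esub> x = p \<odot>\<^bsub>M\<^esub> x'"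
    and H: "H \<in> mod_hom A (free_cover A M) (free_cover A M)"
    and q: "q \<in> carrier (free_cover A M)" "p \<odot>\<^bsub>free_cover A M\<^esub> H q \<in> syzygy_multiples A M q"
  shows "\<exists>\<sigma>\<in>\<Sigma>. (\<sigma> \<otimes>\<^bsub>A\<^esub> s) \<odot>\<^bsub>free_cover A M\<^esub> H q \<in> syzygy_multiples A M q"
proof -
  let ?F = "free_cover A M" and ?p = "presentation A M"
  interpret F: left_module A ?F by (rule A.left_module_free_module)
  note bv = A.basis_vec_closed[of _ "carrier M"]
  note Fm = F.left_module_axioms
  note pm = F.mod_hom_zero_minus[OF presentation_hom left_module_axioms] mod_homD[OF presentation_hom]
  obtain G where G: "G \<in> mod_hom A ?F ?F" "\<And>f. f \<in> carrier ?F \<Longrightarrow> ?p (G f) = \<zero>\<^bsub>M\<^esub>"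
    "p \<odot>\<^bsub>?F\<^esub> H q = G q"
    using q(2) unfolding syzygy_multiples_def by auto
  let ?supp = "{b. q b \<noteq> \<zero>\<^bsub>A\<^esub>}"
  note supp = free_module_support[OF q(1)]
  have "\<exists>\<sigma>\<in>\<Sigma>. \<exists>\<theta>\<in>mod_hom A ?F ?F. (\<forall>f\<in>carrier ?F. ?p (\<theta> f) \<ominus>\<^bsub>M\<^esub> \<sigma> \<odot>\<^bsub>M\<^esub> ?p f \<in> P) \<and>
      (\<forall>g\<in>(\<lambda>b. G (basis_vec A b)) ` ?supp. \<forall>b. \<theta> g b \<in> I)"
    by (rule equational_mod_finite[OF eq]) (use supp G(2)[OF bv] mod_homD(1)[OF G(1) bv] sub(2) in auto)
  then obtain \<sigma> \<theta> where \<theta>: "\<sigma> \<in> \<Sigma>" "\<theta> \<in> mod_hom A ?F ?F"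
    "\<And>f. f \<in> carrier ?F \<Longrightarrow> ?p (\<theta> f) \<ominus>\<^bsub>M\<^esub> \<sigma> \<odot>\<^bsub>M\<^esub> ?p f \<in> P"
    "\<And>b c. q b \<noteq> \<zero>\<^bsub>A\<^esub> \<Longrightarrow> \<theta> (G (basis_vec A b)) c \<in> I"
    by auto
  have \<sigma>: "\<sigma> \<in> carrier A" using \<theta>(1) scalars(1) by auto
  have regF: "f = g" if "f \<in> carrier ?F" "g \<in> carrier ?F" "p \<odot>\<^bsub>?F\<^esub> f = p \<odot>\<^bsub>?F\<^esub> g" for f g
  proof -
    have "p \<odot>\<^bsub>?F\<^esub> (f \<ominus>\<^bsub>?F\<^esub> g) = \<zero>\<^bsub>?F\<^esub>"
      using that p(1) F.lsmult_closed[OF p(1)] by (simp add: F.lsmult_minus F.minus_eq_zero_iff)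
    then have "(f \<ominus>\<^bsub>?F\<^esub> g) b = \<zero>\<^bsub>A\<^esub>" for b
      using p(2) A.free_module_closed[OF F.M.minus_closed[OF that(1,2)]] by (simp add: free_module_simps fun_eq_iff)
    then have "f \<ominus>\<^bsub>?F\<^esub> g = \<zero>\<^bsub>?F\<^esub>" by (simp add: free_module_simps fun_eq_iff)
    then show ?thesis using that by (simp add: F.minus_eq_zero_iff)
  qed
  have divF: "\<exists>g\<in>carrier ?F. s \<odot>\<^bsub>?F\<^esub> f = p \<odot>\<^bsub>?F\<^esub> g" if f: "f \<in> carrier ?F" "\<And>b. f b \<in> I" for f
  proof -
    obtain d where d: "\<And>b. d b \<in> carrier A" "\<And>b. s \<otimes>\<^bsub>A\<^esub> f b = p \<otimes>\<^bsub>A\<^esub> d b"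
      using divides(1)[OF f(2)] by metis
    define g where "g = (\<lambda>b. if f b = \<zero>\<^bsub>A\<^esub> then \<zero>\<^bsub>A\<^esub> else d b)"
    have "{b. g b \<noteq> \<zero>\<^bsub>A\<^esub>} \<subseteq> {b. f b \<noteq> \<zero>\<^bsub>A\<^esub>}" by (auto simp: g_def)
    then have "g \<in> carrier ?F"
      using f(1) d(1) finite_subset unfolding A.mem_free_module by (auto simp: g_def)
    moreover have "s \<odot>\<^bsub>?F\<^esub> f = p \<odot>\<^bsub>?F\<^esub> g"
    proof
      fix b
      show "(s \<odot>\<^bsub>?F\<^esub> f) b = (p \<odot>\<^bsub>?F\<^esub> g) b"
        using d(2)[of b] s p(1) by (auto simp: free_module_simps g_def)
    qed
    ultimately show ?thesis by blast
  qed
  have "\<exists>g\<in>carrier ?F. s \<odot>\<^bsub>?F\<^esub> \<theta> (G (basis_vec A b)) = p \<odot>\<^bsub>?F\<^esub> g" if "b \<in> ?supp" for b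
    by (rule divF) (use that supp \<theta>(4) mod_homD(1)[OF \<theta>(2)] mod_homD(1)[OF G(1) bv] in auto)
  then obtain \<phi>0 where \<phi>0: "\<And>b. b \<in> ?supp \<Longrightarrow> \<phi>0 b \<in> carrier ?F"
    "\<And>b. b \<in> ?supp \<Longrightarrow> s \<odot>\<^bsub>?F\<^esub> \<theta> (G (basis_vec A b)) = p \<odot>\<^bsub>?F\<^esub> \<phi>0 b"
    by metis
  define \<phi> where "\<phi> = lin_ext A ?F (\<lambda>b. if b \<in> ?supp then \<phi>0 b else \<zero>\<^bsub>?F\<^esub>)"
  have \<phi>: "\<phi> \<in> mod_hom A ?F ?F" unfolding \<phi>_def by (rule F.lin_ext_mod_hom) (use \<phi>0 in auto)
  have \<phi>b: "\<phi> (basis_vec A b) = \<phi>0 b" if "b \<in> ?supp" for b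
    unfolding \<phi>_def by (subst F.lin_ext_basis_vec) (use that \<phi>0 in auto)
  have "\<exists>e\<in>carrier M. s \<odot>\<^bsub>M\<^esub> (?p (\<theta> (basis_vec A b)) \<ominus>\<^bsub>M\<^esub> \<sigma> \<odot>\<^bsub>M\<^esub> b) = p \<odot>\<^bsub>M\<^esub> e" if "b \<in> carrier M" for b
    by (rule divides(2)) (use \<theta>(3)[OF bv[OF that]] presentation_basis_vec[OF that] in simp)
  then obtain e where e: "\<And>b. b \<in> carrier M \<Longrightarrow> e b \<in> carrier M"
    "\<And>b. b \<in> carrier M \<Longrightarrow> s \<odot>\<^bsub>M\<^esub> (?p (\<theta> (basis_vec A b)) \<ominus>\<^bsub>M\<^esub> \<sigma> \<odot>\<^bsub>M\<^esub> b) = p \<odot>\<^bsub>M\<^esub> e b"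
    by metis
  define \<epsilon> where "\<epsilon> = lin_ext A ?F (\<lambda>b. basis_vec A (e b))"
  have \<epsilon>: "\<epsilon> \<in> mod_hom A ?F ?F" unfolding \<epsilon>_def by (rule F.lin_ext_mod_hom) (use e bv in auto)
  have \<epsilon>b: "\<epsilon> (basis_vec A b) = basis_vec A (e b)" if "b \<in> carrier M" for b
    unfolding \<epsilon>_def by (rule F.lin_ext_basis_vec) (use that e bv in auto)
  have \<sigma>s: "\<sigma> \<otimes>\<^bsub>A\<^esub> s \<in> carrier A" using \<sigma> s by simp
  have \<sigma>s_central: "\<sigma> \<otimes>\<^bsub>A\<^esub> s \<otimes>\<^bsub>A\<^esub> a = a \<otimes>\<^bsub>A\<^esub> (\<sigma> \<otimes>\<^bsub>A\<^esub> s)" if a: "a \<in> carrier A" for a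
  proof -
    have "\<sigma> \<otimes>\<^bsub>A\<^esub> s \<otimes>\<^bsub>A\<^esub> a = \<sigma> \<otimes>\<^bsub>A\<^esub> (a \<otimes>\<^bsub>A\<^esub> s)" using \<sigma> s a by (simp add: A.m_assoc central(2)[OF a])
    also have "\<dots> = (a \<otimes>\<^bsub>A\<^esub> \<sigma>) \<otimes>\<^bsub>A\<^esub> s" using \<sigma> s a by (simp add: central(1)[OF \<theta>(1) a] flip: A.m_assoc)
    finally show ?thesis using \<sigma> s a by (simp add: A.m_assoc)
  qed
  define \<rho> where "\<rho> = (\<lambda>f. (\<sigma> \<otimes>\<^bsub>A\<^esub> s) \<odot>\<^bsub>?F\<^esub> f \<ominus>\<^bsub>?F\<^esub> s \<odot>\<^bsub>?F\<^esub> \<theta> f \<oplus>\<^bsub>?F\<^esub> p \<odot>\<^bsub>?F\<^esub> \<epsilon> f)"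
  note c = mod_homD(1)[OF \<theta>(2)] mod_homD(1)[OF \<epsilon>] mod_homD(1)[OF \<phi>] mod_homD(1)[OF G(1)] mod_homD(1)[OF H]
    F.lsmult_closed[OF s] F.lsmult_closed[OF p(1)] F.lsmult_closed[OF \<sigma>s] presentation_closed
    lsmult_closed[OF s] lsmult_closed[OF p(1)] lsmult_closed[OF \<sigma>s] lsmult_closed[OF \<sigma>]
  have \<rho>: "\<rho> \<in> mod_hom A ?F ?F"
    unfolding \<rho>_def
    by (rule F.mod_hom_add[OF Fm F.mod_hom_minus[OF Fm F.mod_hom_central[OF \<sigma>s \<sigma>s_central mod_hom_id]
        F.mod_hom_central[OF s central(2) \<theta>(2)]] F.mod_hom_central[OF p(1) central(3) \<epsilon>]])
  have p\<rho>: "?p (\<rho> f) = \<zero>\<^bsub>M\<^esub>" if f: "f \<in> carrier ?F" for f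
  proof -
    have "?p (\<rho> f) \<in> {\<zero>\<^bsub>M\<^esub>}"
    proof (rule mod_hom_free_mem[OF mod_hom_comp[OF \<rho> presentation_hom] f])
      fix b assume b: "b \<in> carrier M"
      note bb = bv[OF b]
      have "?p (\<rho> (basis_vec A b)) = (\<sigma> \<otimes>\<^bsub>A\<^esub> s) \<odot>\<^bsub>M\<^esub> b \<ominus>\<^bsub>M\<^esub> s \<odot>\<^bsub>M\<^esub> ?p (\<theta> (basis_vec A b)) \<oplus>\<^bsub>M\<^esub> p \<odot>\<^bsub>M\<^esub> e b"
        unfolding \<rho>_def using bb b e(1)[OF b] \<sigma>s s p(1)
        by (simp add: pm c \<epsilon>b bv presentation_basis_vec)
      also have "p \<odot>\<^bsub>M\<^esub> e b = s \<odot>\<^bsub>M\<^esub> ?p (\<theta> (basis_vec A b)) \<ominus>\<^bsub>M\<^esub> (\<sigma> \<otimes>\<^bsub>A\<^esub> s) \<odot>\<^bsub>M\<^esub> b"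
        unfolding e(2)[OF b, symmetric] central(1)[OF \<theta>(1) s] using bb b s \<sigma>
        by (simp add: lsmult_minus c lsmult_assoc)
      finally show "?p (\<rho> (basis_vec A b)) \<in> {\<zero>\<^bsub>M\<^esub>}"
        using bb b by (simp add: c a_minus_def M.a_ac M.r_neg M.r_neg1 M.r_neg2)
    qed (auto simp: lsmult_zero)
    then show ?thesis by simp
  qed
  let ?G = "\<lambda>f. \<rho> (H f) \<oplus>\<^bsub>?F\<^esub> (\<phi> f \<ominus>\<^bsub>?F\<^esub> \<epsilon> (G f))"
  have G': "?G \<in> mod_hom A ?F ?F"
    by (rule F.mod_hom_add[OF Fm mod_hom_comp[OF H \<rho>] F.mod_hom_minus[OF Fm \<phi> mod_hom_comp[OF G(1) \<epsilon>]]])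
  have pG: "?p (?G (basis_vec A b)) = \<zero>\<^bsub>M\<^esub>" if b: "b \<in> ?supp" for b
  proof -
    have bb: "basis_vec A b \<in> carrier ?F" using b supp by (intro bv) auto
    let ?g = "G (basis_vec A b)"
    have "p \<odot>\<^bsub>?F\<^esub> (\<phi>0 b \<ominus>\<^bsub>?F\<^esub> \<epsilon> ?g) = s \<odot>\<^bsub>?F\<^esub> \<theta> ?g \<ominus>\<^bsub>?F\<^esub> p \<odot>\<^bsub>?F\<^esub> \<epsilon> ?g"
      using \<phi>0[OF b] bb p(1) by (simp add: F.lsmult_minus c)
    also have "\<dots> = (\<sigma> \<otimes>\<^bsub>A\<^esub> s) \<odot>\<^bsub>?F\<^esub> ?g \<ominus>\<^bsub>?F\<^esub> \<rho> ?g"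
      unfolding \<rho>_def by (rule F.M.diff_diff_telescope[symmetric]) (use bb in \<open>simp_all add: c\<close>)
    finally have "?p (p \<odot>\<^bsub>?F\<^esub> (\<phi>0 b \<ominus>\<^bsub>?F\<^esub> \<epsilon> ?g)) = ?p ((\<sigma> \<otimes>\<^bsub>A\<^esub> s) \<odot>\<^bsub>?F\<^esub> ?g \<ominus>\<^bsub>?F\<^esub> \<rho> ?g)" by simp
    then have "p \<odot>\<^bsub>M\<^esub> ?p (\<phi>0 b \<ominus>\<^bsub>?F\<^esub> \<epsilon> ?g) = \<zero>\<^bsub>M\<^esub>"
      using bb p(1) \<sigma>s \<phi>0[OF b] mod_homD(1)[OF \<rho>]
      by (simp add: pm(3-) c p\<rho> G(2) lsmult_zero minus_eq_zero_iff[THEN iffD2])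
    then have "?p (\<phi>0 b \<ominus>\<^bsub>?F\<^esub> \<epsilon> ?g) = \<zero>\<^bsub>M\<^esub>"
      by (rule p(3)[rotated]) (use bb \<phi>0[OF b] in \<open>simp add: c\<close>)
    then show ?thesis
      using bb \<phi>0[OF b] mod_homD(1)[OF \<rho>] by (simp add: \<phi>b[OF b] pm(5) c p\<rho>)
  qed
  \<comment> \<open>The identities for \<open>\<phi>\<close> hold on the support of \<open>q\<close> only, so the map is cut off outside it.\<close>
  define G0 where "G0 = lin_ext A ?F (\<lambda>b. if b \<in> ?supp then ?G (basis_vec A b) else \<zero>\<^bsub>?F\<^esub>)"
  have G0c: "(if b \<in> ?supp then ?G (basis_vec A b) else \<zero>\<^bsub>?F\<^esub>) \<in> carrier ?F" if "b \<in> carrier M" for b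
    using mod_homD(1)[OF G' bv[OF that]] by auto
  have G0: "G0 \<in> mod_hom A ?F ?F" unfolding G0_def by (rule F.lin_ext_mod_hom) (rule G0c)
  have pG0: "?p (G0 f) = \<zero>\<^bsub>M\<^esub>" if f: "f \<in> carrier ?F" for f
  proof -
    have "?p (G0 f) \<in> {\<zero>\<^bsub>M\<^esub>}"
    proof (rule mod_hom_free_mem[OF mod_hom_comp[OF G0 presentation_hom] f])
      fix b assume b: "b \<in> carrier M"
      have "G0 (basis_vec A b) = (if b \<in> ?supp then ?G (basis_vec A b) else \<zero>\<^bsub>?F\<^esub>)"
        unfolding G0_def by (rule F.lin_ext_basis_vec) (rule G0c[OF b])
      then show "?p (G0 (basis_vec A b)) \<in> {\<zero>\<^bsub>M\<^esub>}" using pG[of b] pm(1) by auto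
    qed (auto simp: lsmult_zero)
    then show ?thesis by simp
  qed
  have "G0 q = ?G q"
    unfolding G0_def
  proof (rule F.mod_hom_eq_lin_ext_on_support[OF G' q(1)])
    show "(if b \<in> ?supp then ?G (basis_vec A b) else \<zero>\<^bsub>?F\<^esub>) = ?G (basis_vec A b)" if "q b \<noteq> \<zero>\<^bsub>A\<^esub>" for b
      using that by simp
  qed (rule G0c)
  also have "\<phi> q = s \<odot>\<^bsub>?F\<^esub> \<theta> (H q)"
  proof (rule regF)
    have "p \<odot>\<^bsub>?F\<^esub> \<phi> q = s \<odot>\<^bsub>?F\<^esub> \<theta> (G q)"
      by (rule F.mod_hom_eq_on_support[OF F.mod_hom_central[OF p(1) central(3) \<phi>]
          F.mod_hom_central[OF s central(2) mod_hom_comp[OF G(1) \<theta>(2)]] q(1)])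
        (use \<phi>0(2) \<phi>b in auto)
    also have "\<dots> = p \<odot>\<^bsub>?F\<^esub> (s \<odot>\<^bsub>?F\<^esub> \<theta> (H q))"
      unfolding G(3)[symmetric] using q(1) p(1) s central(2)[OF p(1)]
      by (simp add: c mod_homD(3)[OF \<theta>(2)] flip: F.lsmult_assoc)
    finally show "p \<odot>\<^bsub>?F\<^esub> \<phi> q = p \<odot>\<^bsub>?F\<^esub> (s \<odot>\<^bsub>?F\<^esub> \<theta> (H q))" .
  qed (use q(1) in \<open>simp_all add: c\<close>)
  also have "\<epsilon> (G q) = p \<odot>\<^bsub>?F\<^esub> \<epsilon> (H q)"
    unfolding G(3)[symmetric] using q(1) p(1) by (simp add: c mod_homD(3)[OF \<epsilon>])
  also have "\<rho> (H q) \<oplus>\<^bsub>?F\<^esub> (s \<odot>\<^bsub>?F\<^esub> \<theta> (H q) \<ominus>\<^bsub>?F\<^esub> p \<odot>\<^bsub>?F\<^esub> \<epsilon> (H q)) = (\<sigma> \<otimes>\<^bsub>A\<^esub> s) \<odot>\<^bsub>?F\<^esub> H q"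
    unfolding \<rho>_def by (rule F.M.diff_add_telescope) (use q(1) in \<open>simp_all add: c\<close>)
  finally have "(\<sigma> \<otimes>\<^bsub>A\<^esub> s) \<odot>\<^bsub>?F\<^esub> H q = G0 q" by simp
  then have "(\<sigma> \<otimes>\<^bsub>A\<^esub> s) \<odot>\<^bsub>?F\<^esub> H q \<in> syzygy_multiples A M q"
    unfolding syzygy_multiples_def using G0 pG0 by blast
  then show ?thesis using \<theta>(1) by blast
qed

section \<open>Relations over a ring of fractions of a quotient\<close>

text \<open>
  The pair \<open>(A', B')\<close> is the localization of \<open>(A/I, B/P)\<close> at the central elements \<open>\<Sigma>\<close>. These are the
  properties of the base change to a residue field by which relations are transferred.
\<close>
locale residue_extension = scaled_ideal A B \<Sigma> I P + E: left_module A' B'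
  for A :: "('a, 'x) ring_scheme" and B :: "('a, 'b, 'y) module_scheme" and \<Sigma> I P
    and A' :: "('c, 'u) ring_scheme" and B' :: "('c, 'd, 'v) module_scheme" +
  fixes \<iota> :: "'a \<Rightarrow> 'c" and \<kappa> :: "'b \<Rightarrow> 'd"
  assumes iota: "\<iota> \<in> ring_hom A A'"
    and kappa: "\<kappa> \<in> mod_hom A B (pullback_module \<iota> B')"
    and iota_zero_iff: "a \<in> carrier A \<Longrightarrow> \<iota> a = \<zero>\<^bsub>A'\<^esub> \<longleftrightarrow> (\<exists>s\<in>\<Sigma>. s \<otimes>\<^bsub>A\<^esub> a \<in> I)"
    and kappa_zero_iff: "b \<in> carrier B \<Longrightarrow> \<kappa> b = \<zero>\<^bsub>B'\<^esub> \<longleftrightarrow> (\<exists>s\<in>\<Sigma>. s \<odot>\<^bsub>B\<^esub> b \<in> P)"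
    and iota_fraction: "\<alpha> \<in> carrier A' \<Longrightarrow> \<exists>s\<in>\<Sigma>. \<exists>a\<in>carrier A. \<iota> s \<otimes>\<^bsub>A'\<^esub> \<alpha> = \<iota> a"
    and kappa_fraction: "\<beta> \<in> carrier B' \<Longrightarrow> \<exists>s\<in>\<Sigma>. \<exists>b\<in>carrier B. \<iota> s \<odot>\<^bsub>B'\<^esub> \<beta> = \<kappa> b"
    and central: "s \<in> \<Sigma> \<Longrightarrow> a \<in> carrier A \<Longrightarrow> s \<otimes>\<^bsub>A\<^esub> a = a \<otimes>\<^bsub>A\<^esub> s"
    and iota_central: "s \<in> \<Sigma> \<Longrightarrow> \<alpha> \<in> carrier A' \<Longrightarrow> \<iota> s \<otimes>\<^bsub>A'\<^esub> \<alpha> = \<alpha> \<otimes>\<^bsub>A'\<^esub> \<iota> s"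
    and iota_unit: "s \<in> \<Sigma> \<Longrightarrow> \<exists>v\<in>carrier A'. v \<otimes>\<^bsub>A'\<^esub> \<iota> s = \<one>\<^bsub>A'\<^esub>"
    and sub_presented: "x \<in> P \<Longrightarrow>
      \<exists>g\<in>carrier (free_cover A B). (\<forall>b. g b \<in> I) \<and> presentation A B g = x"
begin

abbreviation "F \<equiv> free_cover A B"
abbreviation "F' \<equiv> free_cover A' B'"

sublocale F: left_module A F by (rule A.left_module_free_module)
sublocale F': left_module A' F' by (rule E.A.left_module_free_module)

lemmas iotaD = ring_hom_closed[OF iota] ring_hom_add[OF iota] ring_hom_mult[OF iota] ring_hom_one[OF iota]

lemma kappaD:
  "b \<in> carrier B \<Longrightarrow> \<kappa> b \<in> carrier B'"
  "b \<in> carrier B \<Longrightarrow> c \<in> carrier B \<Longrightarrow> \<kappa> (b \<oplus>\<^bsub>B\<^esub> c) = \<kappa> b \<oplus>\<^bsub>B'\<^esub> \<kappa> c"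
  "a \<in> carrier A \<Longrightarrow> b \<in> carrier B \<Longrightarrow> \<kappa> (a \<odot>\<^bsub>B\<^esub> b) = \<iota> a \<odot>\<^bsub>B'\<^esub> \<kappa> b"
  using mod_homD[OF kappa] by simp_all

lemma scalar_closed: "s \<in> \<Sigma> \<Longrightarrow> s \<in> carrier A"
  using scalars(1) by auto

lemma scalar_cancel:
  assumes s: "s \<in> \<Sigma>" and f: "f \<in> carrier F'" "\<iota> s \<odot>\<^bsub>F'\<^esub> f = \<zero>\<^bsub>F'\<^esub>"
  shows "f = \<zero>\<^bsub>F'\<^esub>"
proof -
  obtain v where v: "v \<in> carrier A'" "v \<otimes>\<^bsub>A'\<^esub> \<iota> s = \<one>\<^bsub>A'\<^esub>" using iota_unit[OF s] by blast
  have "f = (v \<otimes>\<^bsub>A'\<^esub> \<iota> s) \<odot>\<^bsub>F'\<^esub> f" using v f(1) by (simp add: F'.lsmult_one)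
  also have "\<dots> = v \<odot>\<^bsub>F'\<^esub> (\<iota> s \<odot>\<^bsub>F'\<^esub> f)"
    using v(1) f(1) s by (intro F'.lsmult_assoc) (simp_all add: iotaD scalar_closed)
  finally show ?thesis using v(1) f(2) by (simp add: F'.lsmult_zero)
qed

text \<open>The factors commute, so any of them can be moved next to the object that it was chosen for.\<close>
lemma common_scalar:
  assumes "finite T" "\<And>x. x \<in> T \<Longrightarrow> \<exists>s\<in>\<Sigma>. \<Phi> x s"
    "\<And>x s t. x \<in> T \<Longrightarrow> s \<in> \<Sigma> \<Longrightarrow> t \<in> \<Sigma> \<Longrightarrow> \<Phi> x s \<Longrightarrow> \<Phi> x (t \<otimes>\<^bsub>A\<^esub> s)"
  shows "\<exists>s\<in>\<Sigma>. \<forall>x\<in>T. \<Phi> x s"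
  using assms
proof (induction T)
  case (insert y T)
  then obtain s t where s: "s \<in> \<Sigma>" "\<forall>x\<in>T. \<Phi> x s" and t: "t \<in> \<Sigma>" "\<Phi> y t" by (metis insert_iff)
  have "t \<otimes>\<^bsub>A\<^esub> s = s \<otimes>\<^bsub>A\<^esub> t" by (rule central[OF t(1) scalar_closed[OF s(1)]])
  moreover have "\<Phi> x (t \<otimes>\<^bsub>A\<^esub> s)" if "x \<in> T" for x using insert.prems(2)[of x s t] s t that by simp
  moreover have "\<Phi> y (s \<otimes>\<^bsub>A\<^esub> t)" using insert.prems(2)[of y t s] s t by simp
  ultimately have "\<forall>x\<in>insert y T. \<Phi> x (t \<otimes>\<^bsub>A\<^esub> s)" by simp
  then show ?case using scalars(3)[OF t(1) s(1)] by blast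
qed (use scalars(2) in blast)

lemma common_denominators:
  assumes T: "finite T" "T \<subseteq> carrier A'" and U: "finite U" "U \<subseteq> carrier B'"
  obtains t d z where "t \<in> \<Sigma>" "\<And>\<alpha>. \<alpha> \<in> T \<Longrightarrow> d \<alpha> \<in> carrier A" "\<And>\<alpha>. \<alpha> \<in> T \<Longrightarrow> \<iota> (d \<alpha>) = \<iota> t \<otimes>\<^bsub>A'\<^esub> \<alpha>"
    "\<And>y. y \<in> U \<Longrightarrow> z y \<in> carrier B" "\<And>y. y \<in> U \<Longrightarrow> \<kappa> (z y) = \<iota> t \<odot>\<^bsub>B'\<^esub> y"
proof -
  define \<Phi> where "\<Phi> = (\<lambda>\<alpha> s. \<exists>a\<in>carrier A. \<iota> a = \<iota> s \<otimes>\<^bsub>A'\<^esub> \<alpha>)"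
  define \<Psi> where "\<Psi> = (\<lambda>y s. \<exists>b\<in>carrier B. \<kappa> b = \<iota> s \<odot>\<^bsub>B'\<^esub> y)"
  have \<Phi>: "\<Phi> \<alpha> (t \<otimes>\<^bsub>A\<^esub> s)" if "\<alpha> \<in> carrier A'" "s \<in> \<Sigma>" "t \<in> \<Sigma>" "\<Phi> \<alpha> s" for \<alpha> s t
  proof -
    obtain a where "a \<in> carrier A" "\<iota> a = \<iota> s \<otimes>\<^bsub>A'\<^esub> \<alpha>" using \<open>\<Phi> \<alpha> s\<close> unfolding \<Phi>_def by blast
    then show ?thesis unfolding \<Phi>_def using that
      by (intro bexI[of _ "t \<otimes>\<^bsub>A\<^esub> a"]) (simp_all add: iotaD scalar_closed E.A.m_assoc)
  qed
  have \<Psi>: "\<Psi> y (t \<otimes>\<^bsub>A\<^esub> s)" if "y \<in> carrier B'" "s \<in> \<Sigma>" "t \<in> \<Sigma>" "\<Psi> y s" for y s t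
  proof -
    obtain b where "b \<in> carrier B" "\<kappa> b = \<iota> s \<odot>\<^bsub>B'\<^esub> y" using \<open>\<Psi> y s\<close> unfolding \<Psi>_def by blast
    then show ?thesis unfolding \<Psi>_def using that
      by (intro bexI[of _ "t \<odot>\<^bsub>B\<^esub> b"]) (simp_all add: iotaD kappaD scalar_closed E.lsmult_assoc lsmult_closed)
  qed
  have "\<exists>s\<in>\<Sigma>. \<Phi> \<alpha> s" if "\<alpha> \<in> carrier A'" for \<alpha>
    using iota_fraction[OF that] unfolding \<Phi>_def by (elim bexE) (intro bexI, rule sym)
  then obtain s where s: "s \<in> \<Sigma>" "\<forall>\<alpha>\<in>T. \<Phi> \<alpha> s"
    using common_scalar[OF T(1), of \<Phi>] \<Phi> T(2) by blast
  have "\<exists>s\<in>\<Sigma>. \<Psi> y s" if "y \<in> carrier B'" for y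
    using kappa_fraction[OF that] unfolding \<Psi>_def by (elim bexE) (intro bexI, rule sym)
  then obtain t where t: "t \<in> \<Sigma>" "\<forall>y\<in>U. \<Psi> y t"
    using common_scalar[OF U(1), of \<Psi>] \<Psi> U(2) by blast
  have ts: "t \<otimes>\<^bsub>A\<^esub> s = s \<otimes>\<^bsub>A\<^esub> t" by (rule central[OF t(1) scalar_closed[OF s(1)]])
  have "\<forall>\<alpha>\<in>T. \<Phi> \<alpha> (t \<otimes>\<^bsub>A\<^esub> s)" using \<Phi> T(2) s t(1) by blast
  then obtain d where d: "\<And>\<alpha>. \<alpha> \<in> T \<Longrightarrow> d \<alpha> \<in> carrier A" "\<And>\<alpha>. \<alpha> \<in> T \<Longrightarrow> \<iota> (d \<alpha>) = \<iota> (t \<otimes>\<^bsub>A\<^esub> s) \<otimes>\<^bsub>A'\<^esub> \<alpha>"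
    unfolding \<Phi>_def by metis
  have "\<forall>y\<in>U. \<Psi> y (t \<otimes>\<^bsub>A\<^esub> s)" unfolding ts using \<Psi> U(2) s(1) t by blast
  then obtain z where z: "\<And>y. y \<in> U \<Longrightarrow> z y \<in> carrier B" "\<And>y. y \<in> U \<Longrightarrow> \<kappa> (z y) = \<iota> (t \<otimes>\<^bsub>A\<^esub> s) \<odot>\<^bsub>B'\<^esub> y"
    unfolding \<Psi>_def by metis
  show thesis by (rule that[OF scalars(3)[OF t(1) s(1)] d z])
qed

text \<open>The map of free covers induced by \<open>\<iota>\<close> and \<open>\<kappa>\<close>; distinct basis vectors may get the same image.\<close>
definition push :: "('b \<Rightarrow> 'a) \<Rightarrow> ('d \<Rightarrow> 'c)"
  where "push = lin_ext A (pullback_module \<iota> F') (\<lambda>b. basis_vec A' (\<kappa> b))"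

sublocale F'_pb: left_module A "pullback_module \<iota> F'"
  by (rule left_module_pullback[OF A.ring_axioms iota F'.left_module_axioms])

sublocale B'_pb: left_module A "pullback_module \<iota> B'"
  by (rule left_module_pullback[OF A.ring_axioms iota E.left_module_axioms])

lemma basis_kappa: "b \<in> carrier B \<Longrightarrow> basis_vec A' (\<kappa> b) \<in> carrier F'"
  by (intro E.A.basis_vec_closed kappaD)

lemma push_hom: "push \<in> mod_hom A F (pullback_module \<iota> F')"
  unfolding push_def by (rule F'_pb.lin_ext_mod_hom) (simp add: basis_kappa)

lemma push_basis_vec: "b \<in> carrier B \<Longrightarrow> push (basis_vec A b) = basis_vec A' (\<kappa> b)"
  unfolding push_def by (rule F'_pb.lin_ext_basis_vec) (simp add: basis_kappa)

lemma pushD: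
  "f \<in> carrier F \<Longrightarrow> push f \<in> carrier F'"
  "f \<in> carrier F \<Longrightarrow> g \<in> carrier F \<Longrightarrow> push (f \<oplus>\<^bsub>F\<^esub> g) = push f \<oplus>\<^bsub>F'\<^esub> push g"
  "a \<in> carrier A \<Longrightarrow> f \<in> carrier F \<Longrightarrow> push (a \<odot>\<^bsub>F\<^esub> f) = \<iota> a \<odot>\<^bsub>F'\<^esub> push f"
  using mod_homD[OF push_hom] by simp_all

lemma presentation_push:
  assumes "f \<in> carrier F"
  shows "presentation A' B' (push f) = \<kappa> (presentation A B f)"
proof (rule B'_pb.mod_hom_eq_on_support[OF _ _ assms])
  show "(\<lambda>f. presentation A' B' (push f)) \<in> mod_hom A F (pullback_module \<iota> B')"
    by (rule mod_hom_comp[OF push_hom mod_hom_pullback[OF E.presentation_hom iota]])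
  show "(\<lambda>f. \<kappa> (presentation A B f)) \<in> mod_hom A F (pullback_module \<iota> B')"
    by (rule mod_hom_comp[OF presentation_hom kappa])
qed (simp add: push_basis_vec E.presentation_basis_vec presentation_basis_vec kappaD)

lemma iota_ideal: "a \<in> I \<Longrightarrow> \<iota> a = \<zero>\<^bsub>A'\<^esub>"
  using iota_zero_iff[of a] bexI[OF _ scalars(2), of "\<lambda>s. s \<otimes>\<^bsub>A\<^esub> a \<in> I"]
    subsetD[OF ideal(1), of a] by simp

lemma kappa_sub: "x \<in> P \<Longrightarrow> \<kappa> x = \<zero>\<^bsub>B'\<^esub>"
  using kappa_zero_iff[of x] bexI[OF _ scalars(2), of "\<lambda>s. s \<odot>\<^bsub>B\<^esub> x \<in> P"] lsmult_one[of x]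
    subsetD[OF sub(1), of x] by simp

lemma push_ideal:
  assumes "f \<in> carrier F" "\<And>b. f b \<in> I"
  shows "push f = \<zero>\<^bsub>F'\<^esub>"
proof -
  have "push f \<in> {\<zero>\<^bsub>F'\<^esub>}"
    unfolding push_def by (rule F'_pb.lin_ext_mem[OF assms(1)])
      (simp_all add: iota_ideal[OF assms(2)] F'.zero_lsmult basis_kappa)
  then show ?thesis by simp
qed

text \<open>
  A lift of the combination \<open>\<Sum> f\<^sub>y y\<close> to \<open>B\<close>. The common denominator is squared, because coefficients and
  module elements have both been multiplied by it.
\<close>

lemma kappa_presentation_sum:
  assumes T: "finite T" "T \<subseteq> carrier B'" and t: "t \<in> \<Sigma>" and f: "\<And>y. f y \<in> carrier A'"
    and d: "\<And>y. y \<in> T \<Longrightarrow> d y \<in> carrier A" "\<And>y. y \<in> T \<Longrightarrow> \<iota> (d y) = \<iota> t \<otimes>\<^bsub>A'\<^esub> f y"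
    and z: "\<And>y. y \<in> T \<Longrightarrow> z y \<in> carrier B" "\<And>y. y \<in> T \<Longrightarrow> \<kappa> (z y) = \<iota> t \<odot>\<^bsub>B'\<^esub> y"
  shows "\<kappa> (presentation A B (\<Oplus>\<^bsub>F\<^esub>y\<in>T. d y \<odot>\<^bsub>F\<^esub> basis_vec A (z y))) =
    \<iota> (t \<otimes>\<^bsub>A\<^esub> t) \<odot>\<^bsub>B'\<^esub> (\<Oplus>\<^bsub>B'\<^esub>y\<in>T. f y \<odot>\<^bsub>B'\<^esub> y)"
proof -
  note tA = scalar_closed[OF t]
  have c: "d y \<odot>\<^bsub>F\<^esub> basis_vec A (z y) \<in> carrier F" if "y \<in> T" for y
    using that d(1) z(1) by (intro F.lsmult_closed A.basis_vec_closed)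
  let ?h = "\<lambda>f. \<kappa> (presentation A B f)"
  have h: "?h \<in> mod_hom A F (pullback_module \<iota> B')" by (rule mod_hom_comp[OF presentation_hom kappa])
  have "?h (\<Oplus>\<^bsub>F\<^esub>y\<in>T. d y \<odot>\<^bsub>F\<^esub> basis_vec A (z y)) = (\<Oplus>\<^bsub>B'\<^esub>y\<in>T. ?h (d y \<odot>\<^bsub>F\<^esub> basis_vec A (z y)))"
    by (rule F.additive_finsum[where h = ?h])
      (use mod_homD[OF h] T(1) c in \<open>auto intro: E.M.abelian_group_axioms\<close>)
  also have "\<dots> = (\<Oplus>\<^bsub>B'\<^esub>y\<in>T. \<iota> (t \<otimes>\<^bsub>A\<^esub> t) \<odot>\<^bsub>B'\<^esub> (f y \<odot>\<^bsub>B'\<^esub> y))"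
  proof (rule E.M.finsum_cong')
    fix y assume y: "y \<in> T"
    then have yB: "y \<in> carrier B'" using T(2) by auto
    have "?h (d y \<odot>\<^bsub>F\<^esub> basis_vec A (z y)) = (\<iota> t \<otimes>\<^bsub>A'\<^esub> f y) \<odot>\<^bsub>B'\<^esub> (\<iota> t \<odot>\<^bsub>B'\<^esub> y)"
      using mod_homD(3)[OF h d(1)[OF y] A.basis_vec_closed[OF z(1)[OF y]]] y
      by (simp add: presentation_basis_vec z d)
    also have "\<dots> = (\<iota> t \<otimes>\<^bsub>A'\<^esub> (f y \<otimes>\<^bsub>A'\<^esub> \<iota> t)) \<odot>\<^bsub>B'\<^esub> y"
      using yB f tA by (simp add: E.lsmult_assoc iotaD E.lsmult_closed)
    also have "\<dots> = \<iota> (t \<otimes>\<^bsub>A\<^esub> t) \<odot>\<^bsub>B'\<^esub> (f y \<odot>\<^bsub>B'\<^esub> y)"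
      unfolding iota_central[OF t f, symmetric]
      using yB f[of y] tA by (simp add: E.lsmult_assoc iotaD E.lsmult_closed)
    finally show "?h (d y \<odot>\<^bsub>F\<^esub> basis_vec A (z y)) = \<iota> (t \<otimes>\<^bsub>A\<^esub> t) \<odot>\<^bsub>B'\<^esub> (f y \<odot>\<^bsub>B'\<^esub> y)" .
  qed (use T f tA in \<open>auto intro!: E.lsmult_closed simp: iotaD\<close>)
  also have "\<dots> = \<iota> (t \<otimes>\<^bsub>A\<^esub> t) \<odot>\<^bsub>B'\<^esub> (\<Oplus>\<^bsub>B'\<^esub>y\<in>T. f y \<odot>\<^bsub>B'\<^esub> y)"
    by (rule E.lsmult_finsum[symmetric]) (use T f tA in \<open>auto intro!: E.lsmult_closed simp: iotaD\<close>)
  finally show ?thesis .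
qed

end

context residue_extension begin

text \<open>
  A relation over \<open>A'\<close> becomes, after multiplication by a common denominator, the image of some
  \<open>f\<^sub>0\<close> whose value \<open>b\<close> in \<open>B\<close> satisfies \<open>w b \<in> P\<close> for some \<open>w \<in> \<Sigma>\<close>. Subtracting from \<open>w f\<^sub>0\<close> an element
  with coefficients in \<open>I\<close> turns it into an exact relation. An endomorphism that kills the
  latter kills the former after extension, because coefficients in \<open>I\<close> vanish there; dividing
  by the denominator gives the endomorphism over \<open>A'\<close>.
\<close>
lemma equational_extension:
  assumes eq: "equational A B"
  shows "equational A' B'"
proof (rule E.equationalI_endo)
  fix q' assume q': "q' \<in> carrier F'" "presentation A' B' q' = \<zero>\<^bsub>B'\<^esub>"
  let ?J = "{y. q' y \<noteq> \<zero>\<^bsub>A'\<^esub>}"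
  note J = free_module_support[OF q'(1)]
  note qA = E.A.free_module_closed[OF q'(1)]
  obtain t d z where t: "t \<in> \<Sigma>"
    and d: "\<And>\<alpha>. \<alpha> \<in> q' ` ?J \<Longrightarrow> d \<alpha> \<in> carrier A" "\<And>\<alpha>. \<alpha> \<in> q' ` ?J \<Longrightarrow> \<iota> (d \<alpha>) = \<iota> t \<otimes>\<^bsub>A'\<^esub> \<alpha>"
    and z: "\<And>y. y \<in> ?J \<Longrightarrow> z y \<in> carrier B" "\<And>y. y \<in> ?J \<Longrightarrow> \<kappa> (z y) = \<iota> t \<odot>\<^bsub>B'\<^esub> y"
    by (rule common_denominators[of "q' ` ?J" ?J]) (use J qA in auto)
  have tA: "t \<in> carrier A" "\<iota> t \<in> carrier A'" using scalar_closed[OF t] iotaD(1) by auto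
  define f0 where "f0 = (\<Oplus>\<^bsub>F\<^esub>y\<in>?J. d (q' y) \<odot>\<^bsub>F\<^esub> basis_vec A (z y))"
  have f0c: "d (q' y) \<odot>\<^bsub>F\<^esub> basis_vec A (z y) \<in> carrier F" if "y \<in> ?J" for y
    using that d(1)[of "q' y"] z(1)[of y] by (intro F.lsmult_closed A.basis_vec_closed) auto
  have f0: "f0 \<in> carrier F" unfolding f0_def using f0c by (intro F.M.finsum_closed) auto
  have "\<kappa> (presentation A B f0) = \<iota> (t \<otimes>\<^bsub>A\<^esub> t) \<odot>\<^bsub>B'\<^esub> presentation A' B' q'"
    unfolding f0_def presentation_def[of A' B'] lin_ext_def[of A']
    by (rule kappa_presentation_sum[OF J t qA]) (use d z in auto)
  also have "\<dots> = \<zero>\<^bsub>B'\<^esub>" using q'(2) tA(1) by (simp add: E.lsmult_zero iotaD)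
  finally obtain w where w: "w \<in> \<Sigma>" "w \<odot>\<^bsub>B\<^esub> presentation A B f0 \<in> P"
    using kappa_zero_iff[OF presentation_closed[OF f0]] by blast
  note wA = scalar_closed[OF w(1)]
  obtain g where g: "g \<in> carrier F" "\<And>b. g b \<in> I" "presentation A B g = w \<odot>\<^bsub>B\<^esub> presentation A B f0"
    using sub_presented[OF w(2)] by blast
  let ?q = "w \<odot>\<^bsub>F\<^esub> f0 \<ominus>\<^bsub>F\<^esub> g"
  have wf0: "w \<odot>\<^bsub>F\<^esub> f0 \<in> carrier F" using wA f0 by (rule F.lsmult_closed)
  have q: "?q \<in> carrier F" "presentation A B ?q = \<zero>\<^bsub>B\<^esub>"
    using wA f0 wf0 g by (simp_all add: F.mod_hom_zero_minus(3)[OF presentation_hom left_module_axioms]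
      mod_homD(3)[OF presentation_hom] minus_eq_zero_iff lsmult_closed presentation_closed)
  obtain \<theta> where \<theta>: "\<theta> \<in> mod_hom A F F"
    "\<And>f. f \<in> carrier F \<Longrightarrow> presentation A B (\<theta> f) = presentation A B f" "\<theta> ?q = \<zero>\<^bsub>F\<^esub>"
    by (rule equationalD[OF eq q]) (rule that)
  note \<theta>c = mod_homD(1)[OF \<theta>(1)]
  have "w \<odot>\<^bsub>F\<^esub> \<theta> f0 = \<theta> g"
    using \<theta>(3) wf0 f0 g(1) wA F.lsmult_closed[OF wA \<theta>c[OF f0]]
    by (simp add: F.mod_hom_zero_minus(3)[OF \<theta>(1) F.left_module_axioms] mod_homD(3)[OF \<theta>(1)] F.minus_eq_zero_iff \<theta>c)
  then have "\<iota> w \<odot>\<^bsub>F'\<^esub> push (\<theta> f0) = push (\<theta> g)"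
    using pushD(3)[OF wA \<theta>c[OF f0]] by simp
  also have "\<dots> = \<zero>\<^bsub>F'\<^esub>"
    by (rule push_ideal[OF \<theta>c[OF g(1)]]) (rule mod_hom_coefficients_ideal[OF \<theta>(1) g(1,2)])
  finally have push0: "push (\<theta> f0) = \<zero>\<^bsub>F'\<^esub>"
    by (rule scalar_cancel[OF w(1) pushD(1)[OF \<theta>c[OF f0]]])
  obtain v where v: "v \<in> carrier A'" "v \<otimes>\<^bsub>A'\<^esub> \<iota> t = \<one>\<^bsub>A'\<^esub>" using iota_unit[OF t] by blast
  define \<theta>0 where "\<theta>0 = (\<lambda>y. if y \<in> ?J then v \<odot>\<^bsub>F'\<^esub> push (\<theta> (basis_vec A (z y))) else basis_vec A' y)"
  have pc: "push (\<theta> (basis_vec A (z y))) \<in> carrier F'" if "y \<in> ?J" for y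
    by (rule pushD(1)[OF \<theta>c[OF A.basis_vec_closed[OF z(1)[OF that]]]])
  have \<theta>0c: "\<theta>0 y \<in> carrier F'" if "y \<in> carrier B'" for y
  proof (cases "y \<in> ?J")
    case True
    then show ?thesis unfolding \<theta>0_def using F'.lsmult_closed[OF v(1) pc[OF True]] by simp
  next
    case False
    then show ?thesis unfolding \<theta>0_def using E.A.basis_vec_closed[OF that] by simp
  qed
  have p\<theta>0: "presentation A' B' (\<theta>0 y) = y" if y: "y \<in> carrier B'" for y
  proof (cases "y \<in> ?J")
    case True
    note bz = A.basis_vec_closed[OF z(1)[OF True]]
    have "presentation A' B' (\<theta>0 y) = v \<odot>\<^bsub>B'\<^esub> \<kappa> (z y)"
      using True mod_homD(3)[OF E.presentation_hom v(1) pc[OF True]] presentation_push[OF \<theta>c[OF bz]]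
        \<theta>(2)[OF bz] presentation_basis_vec[OF z(1)[OF True]]
      by (simp add: \<theta>0_def)
    also have "\<dots> = (v \<otimes>\<^bsub>A'\<^esub> \<iota> t) \<odot>\<^bsub>B'\<^esub> y" using z(2)[OF True] v(1) tA(2) y by (simp add: E.lsmult_assoc)
    finally show ?thesis using v(2) y by (simp add: E.lsmult_one)
  next
    case False
    then show ?thesis using y by (simp add: \<theta>0_def E.presentation_basis_vec)
  qed
  let ?\<theta> = "lin_ext A' F' \<theta>0"
  have \<theta>': "?\<theta> \<in> mod_hom A' F' F'" by (rule F'.lin_ext_mod_hom[OF \<theta>0c])
  have "presentation A' B' (?\<theta> f) = presentation A' B' f" if f: "f \<in> carrier F'" for f
    by (rule E.mod_hom_eq_on_support[OF mod_hom_comp[OF \<theta>' E.presentation_hom] E.presentation_hom f])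
      (simp add: F'.lin_ext_basis_vec \<theta>0c p\<theta>0 E.presentation_basis_vec)
  moreover
  note \<theta>q = mod_homD(1)[OF \<theta>' q'(1)]
  have "?\<theta> q' = \<zero>\<^bsub>F'\<^esub>"
  proof (rule scalar_cancel[OF t \<theta>q], rule scalar_cancel[OF t])
    have 1: "q' y \<odot>\<^bsub>F'\<^esub> \<theta>0 y \<in> carrier F'" if "y \<in> ?J" for y
      using that J qA \<theta>0c by (intro F'.lsmult_closed) auto
    have "\<iota> t \<odot>\<^bsub>F'\<^esub> (\<iota> t \<odot>\<^bsub>F'\<^esub> ?\<theta> q') = (\<iota> t \<otimes>\<^bsub>A'\<^esub> \<iota> t) \<odot>\<^bsub>F'\<^esub> ?\<theta> q'"
      using tA \<theta>q by (simp add: F'.lsmult_assoc)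
    also have "\<dots> = (\<Oplus>\<^bsub>F'\<^esub>y\<in>?J. (\<iota> t \<otimes>\<^bsub>A'\<^esub> \<iota> t) \<odot>\<^bsub>F'\<^esub> (q' y \<odot>\<^bsub>F'\<^esub> \<theta>0 y))"
      unfolding lin_ext_def by (rule F'.lsmult_finsum) (use J tA 1 in auto)
    also have "\<dots> = (\<Oplus>\<^bsub>F'\<^esub>y\<in>?J. push (\<theta> (d (q' y) \<odot>\<^bsub>F\<^esub> basis_vec A (z y))))"
    proof (rule F'.M.finsum_cong')
      fix y assume y: "y \<in> ?J"
      note bz = A.basis_vec_closed[OF z(1)[OF y]]
      have yB: "y \<in> carrier B'" using y J by auto
      have "(\<iota> t \<otimes>\<^bsub>A'\<^esub> \<iota> t) \<odot>\<^bsub>F'\<^esub> (q' y \<odot>\<^bsub>F'\<^esub> \<theta>0 y) = (\<iota> t \<otimes>\<^bsub>A'\<^esub> (\<iota> t \<otimes>\<^bsub>A'\<^esub> q' y)) \<odot>\<^bsub>F'\<^esub> \<theta>0 y"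
        using tA qA[of y] \<theta>0c[OF yB] by (simp add: E.A.m_assoc flip: F'.lsmult_assoc)
      also have "\<dots> = ((\<iota> t \<otimes>\<^bsub>A'\<^esub> q' y) \<otimes>\<^bsub>A'\<^esub> \<iota> t) \<odot>\<^bsub>F'\<^esub> \<theta>0 y"
        using iota_central[OF t E.A.m_closed[OF tA(2) qA[of y]]] by simp
      also have "\<dots> = \<iota> (d (q' y)) \<odot>\<^bsub>F'\<^esub> (\<iota> t \<odot>\<^bsub>F'\<^esub> \<theta>0 y)"
        using tA qA[of y] \<theta>0c[OF yB] d(2)[of "q' y"] y by (simp add: F'.lsmult_assoc)
      also have "\<iota> t \<odot>\<^bsub>F'\<^esub> \<theta>0 y = (\<iota> t \<otimes>\<^bsub>A'\<^esub> v) \<odot>\<^bsub>F'\<^esub> push (\<theta> (basis_vec A (z y)))"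
        using y tA(2) v(1) pc[OF y] by (simp add: \<theta>0_def F'.lsmult_assoc)
      also have "\<dots> = push (\<theta> (basis_vec A (z y)))"
        unfolding iota_central[OF t v(1)] v(2) by (rule F'.lsmult_one[OF pc[OF y]])
      finally show "(\<iota> t \<otimes>\<^bsub>A'\<^esub> \<iota> t) \<odot>\<^bsub>F'\<^esub> (q' y \<odot>\<^bsub>F'\<^esub> \<theta>0 y) = push (\<theta> (d (q' y) \<odot>\<^bsub>F\<^esub> basis_vec A (z y)))"
        using d(1)[of "q' y"] y bz by (simp add: mod_homD(3)[OF \<theta>(1)] pushD(3) \<theta>c)
    qed (use pushD(1)[OF \<theta>c[OF f0c]] in auto)
    also have "\<dots> = push (\<theta> f0)"
      unfolding f0_def
      by (rule F.additive_finsum[where h = "\<lambda>f. push (\<theta> f)", symmetric])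
        (use J(1) f0c in \<open>auto simp: mod_homD[OF \<theta>(1)] pushD intro: F'.M.abelian_group_axioms\<close>)
    finally show "\<iota> t \<odot>\<^bsub>F'\<^esub> (\<iota> t \<odot>\<^bsub>F'\<^esub> ?\<theta> q') = \<zero>\<^bsub>F'\<^esub>" using push0 by simp
  qed (use tA \<theta>q in \<open>intro F'.lsmult_closed\<close>)
  ultimately show "\<exists>\<theta>\<in>mod_hom A' F' F'. (\<forall>f\<in>carrier F'. presentation A' B' (\<theta> f) = presentation A' B' f) \<and> \<theta> q' = \<zero>\<^bsub>F'\<^esub>"
    using \<theta>' by blast
qed

text \<open>
  The image of \<open>q\<close> over \<open>A'\<close> is an exact relation, killed by some \<open>\<theta>'\<close>. Only the rows of \<open>\<theta>'\<close> at the
  support of \<open>q\<close> matter; they have finitely many entries, which are lifted to \<open>A\<close> with a common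
  denominator. The resulting \<open>\<theta>\<^sub>0\<close> has the required properties up to elements of \<open>A\<close> and \<open>B\<close> that
  vanish over \<open>A'\<close>; a further factor from \<open>\<Sigma>\<close> moves these into \<open>I\<close> and \<open>P\<close>.
\<close>
lemma equational_mod_contraction:
  assumes eq: "equational A' B'"
  shows "equational_mod A B \<Sigma> I P"
  unfolding equational_mod_def
proof (intro ballI impI)
  fix q assume q: "q \<in> carrier F" "presentation A B q \<in> P"
  interpret AA: left_module A "self_module A" by (rule A.left_module_self)
  interpret A'pb: left_module A "pullback_module \<iota> (self_module A')"
    by (rule left_module_pullback[OF A.ring_axioms iota E.A.left_module_self])
  let ?J = "{b. q b \<noteq> \<zero>\<^bsub>A\<^esub>}"
  note J = free_module_support[OF q(1)]
  have "presentation A' B' (push q) = \<zero>\<^bsub>B'\<^esub>" using kappa_sub[OF q(2)] presentation_push[OF q(1)] by simp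
  then obtain \<theta>' where \<theta>': "\<theta>' \<in> mod_hom A' F' F'"
    "\<And>f. f \<in> carrier F' \<Longrightarrow> presentation A' B' (\<theta>' f) = presentation A' B' f" "\<theta>' (push q) = \<zero>\<^bsub>F'\<^esub>"
    using E.equationalD[OF eq pushD(1)[OF q(1)]] by blast
  define row where "row = (\<lambda>b. \<theta>' (basis_vec A' (\<kappa> b)))"
  have row: "row b \<in> carrier F'" if "b \<in> carrier B" for b
    unfolding row_def by (rule mod_homD(1)[OF \<theta>'(1) basis_kappa[OF that]])
  have prow: "presentation A' B' (row b) = \<kappa> b" if "b \<in> carrier B" for b
    unfolding row_def using \<theta>'(2)[OF basis_kappa[OF that]] kappaD(1)[OF that] by (simp add: E.presentation_basis_vec)
  define U where "U = (\<Union>b\<in>?J. {y. row b y \<noteq> \<zero>\<^bsub>A'\<^esub>})"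
  have U: "finite U" "U \<subseteq> carrier B'" unfolding U_def using free_module_support[OF row] J by auto
  have rowA: "row b y \<in> carrier A'" if "b \<in> ?J" for b y
    using E.A.free_module_closed[OF row] that J by auto
  obtain t d z where t: "t \<in> \<Sigma>"
    and d: "\<And>\<alpha>. \<alpha> \<in> (\<lambda>(b, y). row b y) ` (?J \<times> U) \<Longrightarrow> d \<alpha> \<in> carrier A"
      "\<And>\<alpha>. \<alpha> \<in> (\<lambda>(b, y). row b y) ` (?J \<times> U) \<Longrightarrow> \<iota> (d \<alpha>) = \<iota> t \<otimes>\<^bsub>A'\<^esub> \<alpha>"
    and z: "\<And>y. y \<in> U \<Longrightarrow> z y \<in> carrier B" "\<And>y. y \<in> U \<Longrightarrow> \<kappa> (z y) = \<iota> t \<odot>\<^bsub>B'\<^esub> y"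
    by (rule common_denominators[of "(\<lambda>(b, y). row b y) ` (?J \<times> U)" U]) (use J U rowA in auto)
  have tA: "t \<in> carrier A" "\<iota> t \<in> carrier A'" using scalar_closed[OF t] iotaD(1) by auto
  have d': "d (row b y) \<in> carrier A" "\<iota> (d (row b y)) = \<iota> t \<otimes>\<^bsub>A'\<^esub> row b y" if "b \<in> ?J" "y \<in> U" for b y
  proof -
    have "row b y \<in> (\<lambda>(b, y). row b y) ` (?J \<times> U)" using that by force
    then show "d (row b y) \<in> carrier A" "\<iota> (d (row b y)) = \<iota> t \<otimes>\<^bsub>A'\<^esub> row b y" using d by simp_all
  qed
  have bz: "basis_vec A (z y) \<in> carrier F" if "y \<in> U" for y by (rule A.basis_vec_closed[OF z(1)[OF that]])
  \<comment> \<open>The columns of the lifted matrix, as linear forms; this makes \<open>\<theta>\<^sub>0\<close> linear without exchanging sums.\<close>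
  define D where "D = (\<lambda>y. lin_ext A (self_module A) (\<lambda>b. if b \<in> ?J then d (row b y) else \<zero>\<^bsub>A\<^esub>))"
  have D: "D y \<in> mod_hom A F (self_module A)" if "y \<in> U" for y
    unfolding D_def by (rule AA.lin_ext_mod_hom) (use that d'(1) in auto)
  have Db: "D y (basis_vec A b) = d (row b y)" if "b \<in> ?J" "y \<in> U" for b y
    unfolding D_def by (subst AA.lin_ext_basis_vec) (use that d'(1) in auto)
  note DA = mod_homD(1)[OF D, simplified]
  define \<theta>0 where "\<theta>0 = (\<lambda>f. \<Oplus>\<^bsub>F\<^esub>y\<in>U. D y f \<odot>\<^bsub>F\<^esub> basis_vec A (z y))"
  have \<theta>0: "\<theta>0 \<in> mod_hom A F F"
    unfolding \<theta>0_def
  proof (rule F.mod_hom_finsum[OF F.left_module_axioms U(1)], rule mod_homI)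
    fix y f g a assume y: "y \<in> U" and f: "f \<in> carrier F"
    show "D y f \<odot>\<^bsub>F\<^esub> basis_vec A (z y) \<in> carrier F" by (rule F.lsmult_closed[OF DA[OF y f] bz[OF y]])
    show "D y (f \<oplus>\<^bsub>F\<^esub> g) \<odot>\<^bsub>F\<^esub> basis_vec A (z y) = D y f \<odot>\<^bsub>F\<^esub> basis_vec A (z y) \<oplus>\<^bsub>F\<^esub> D y g \<odot>\<^bsub>F\<^esub> basis_vec A (z y)"
      if "g \<in> carrier F"
      using mod_homD(2)[OF D[OF y] f that] F.lsmult_l_distr[OF DA[OF y f] DA[OF y that] bz[OF y]] by simp
    show "D y (a \<odot>\<^bsub>F\<^esub> f) \<odot>\<^bsub>F\<^esub> basis_vec A (z y) = a \<odot>\<^bsub>F\<^esub> (D y f \<odot>\<^bsub>F\<^esub> basis_vec A (z y))" if "a \<in> carrier A"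
      using mod_homD(3)[OF D[OF y] that f] F.lsmult_assoc[OF that DA[OF y f] bz[OF y]] by simp
  qed
  have iota_D: "\<iota> (D y q) = \<zero>\<^bsub>A'\<^esub>" if y: "y \<in> U" for y
  proof -
    have scaled: "(\<lambda>f. \<iota> t \<otimes>\<^bsub>A'\<^esub> \<theta>' (push f) y) \<in> mod_hom A F (pullback_module \<iota> (self_module A'))"
    proof (rule mod_homI)
      fix f g a assume f: "f \<in> carrier F"
      note c = E.A.free_module_closed[OF mod_homD(1)[OF \<theta>'(1) pushD(1)]]
      show "\<iota> t \<otimes>\<^bsub>A'\<^esub> \<theta>' (push f) y \<in> carrier (pullback_module \<iota> (self_module A'))" using tA c[OF f] by simp
      show "\<iota> t \<otimes>\<^bsub>A'\<^esub> \<theta>' (push (f \<oplus>\<^bsub>F\<^esub> g)) y = \<iota> t \<otimes>\<^bsub>A'\<^esub> \<theta>' (push f) y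
          \<oplus>\<^bsub>pullback_module \<iota> (self_module A')\<^esub> \<iota> t \<otimes>\<^bsub>A'\<^esub> \<theta>' (push g) y" if g: "g \<in> carrier F"
        using tA c[OF f, of y] c[OF g, of y] f g
        by (simp add: pushD(2) mod_homD(2)[OF \<theta>'(1)] pushD(1))
           (simp add: free_module_simps E.A.r_distr)
      show "\<iota> t \<otimes>\<^bsub>A'\<^esub> \<theta>' (push (a \<odot>\<^bsub>F\<^esub> f)) y = a \<odot>\<^bsub>pullback_module \<iota> (self_module A')\<^esub> (\<iota> t \<otimes>\<^bsub>A'\<^esub> \<theta>' (push f) y)"
        if a: "a \<in> carrier A"
      proof -
        have "\<theta>' (push (a \<odot>\<^bsub>F\<^esub> f)) y = \<iota> a \<otimes>\<^bsub>A'\<^esub> \<theta>' (push f) y"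
          using pushD(3)[OF a f] mod_homD(3)[OF \<theta>'(1) iotaD(1)[OF a] pushD(1)[OF f]] by (simp add: free_module_simps)
        moreover have "\<iota> t \<otimes>\<^bsub>A'\<^esub> (\<iota> a \<otimes>\<^bsub>A'\<^esub> \<theta>' (push f) y) = \<iota> a \<otimes>\<^bsub>A'\<^esub> (\<iota> t \<otimes>\<^bsub>A'\<^esub> \<theta>' (push f) y)"
          using tA(2) iotaD(1)[OF a] c[OF f, of y] iota_central[OF t iotaD(1)[OF a]] by (metis E.A.m_assoc)
        ultimately show ?thesis by simp
      qed
    qed
    have lifted: "(\<lambda>f. \<iota> (D y f)) \<in> mod_hom A F (pullback_module \<iota> (self_module A'))"
      by (rule mod_homI) (use mod_homD[OF D[OF y]] iotaD in simp_all)
    have "\<iota> (D y q) = \<iota> t \<otimes>\<^bsub>A'\<^esub> \<theta>' (push q) y"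
    proof (rule A'pb.mod_hom_eq_on_support[OF lifted scaled q(1)])
      fix b assume b: "b \<in> carrier B" "q b \<noteq> \<zero>\<^bsub>A\<^esub>"
      then show "\<iota> (D y (basis_vec A b)) = \<iota> t \<otimes>\<^bsub>A'\<^esub> \<theta>' (push (basis_vec A b)) y"
        using Db[of b y] d'(2)[of b y] y by (simp add: push_basis_vec row_def)
    qed
    then show ?thesis using \<theta>'(3) tA by (simp add: free_module_simps)
  qed
  have "\<exists>w\<in>\<Sigma>. \<forall>y\<in>U. w \<otimes>\<^bsub>A\<^esub> D y q \<in> I"
  proof (rule common_scalar[OF U(1)])
    show "\<exists>s\<in>\<Sigma>. s \<otimes>\<^bsub>A\<^esub> D y q \<in> I" if "y \<in> U" for y
      using iota_zero_iff[OF DA[OF that q(1)]] iota_D[OF that] by simp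
    show "(v \<otimes>\<^bsub>A\<^esub> s) \<otimes>\<^bsub>A\<^esub> D y q \<in> I" if "y \<in> U" "s \<in> \<Sigma>" "v \<in> \<Sigma>" "s \<otimes>\<^bsub>A\<^esub> D y q \<in> I" for y s v
      using ideal(4)[OF scalar_closed[OF that(3)] that(4)] that DA[OF that(1) q(1)] by (simp add: A.m_assoc scalar_closed)
  qed
  then obtain w1 where w1: "w1 \<in> \<Sigma>" "\<And>y. y \<in> U \<Longrightarrow> w1 \<otimes>\<^bsub>A\<^esub> D y q \<in> I" by blast
  let ?e = "\<lambda>b. presentation A B (\<theta>0 (basis_vec A b)) \<ominus>\<^bsub>B\<^esub> (t \<otimes>\<^bsub>A\<^esub> t) \<odot>\<^bsub>B\<^esub> b"
  have ec: "?e b \<in> carrier B" "presentation A B (\<theta>0 (basis_vec A b)) \<in> carrier B" "(t \<otimes>\<^bsub>A\<^esub> t) \<odot>\<^bsub>B\<^esub> b \<in> carrier B"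
    if "b \<in> carrier B" for b
    using that tA presentation_closed[OF mod_homD(1)[OF \<theta>0 A.basis_vec_closed[OF that]]]
    by (simp_all add: lsmult_closed)
  have e: "\<exists>s\<in>\<Sigma>. s \<odot>\<^bsub>B\<^esub> ?e b \<in> P" if b: "b \<in> ?J" for b
  proof -
    have bB: "b \<in> carrier B" using b J by auto
    have "\<theta>0 (basis_vec A b) = (\<Oplus>\<^bsub>F\<^esub>y\<in>U. d (row b y) \<odot>\<^bsub>F\<^esub> basis_vec A (z y))"
      unfolding \<theta>0_def
      by (rule F.M.finsum_cong') (use Db b d'(1) bz in \<open>auto intro!: F.lsmult_closed\<close>)
    then have "\<kappa> (presentation A B (\<theta>0 (basis_vec A b))) =
        \<iota> (t \<otimes>\<^bsub>A\<^esub> t) \<odot>\<^bsub>B'\<^esub> (\<Oplus>\<^bsub>B'\<^esub>y\<in>U. row b y \<odot>\<^bsub>B'\<^esub> y)"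
      using kappa_presentation_sum[OF U t rowA[OF b], where d = "\<lambda>y. d (row b y)" and z = z] d' b z by simp
    also have "(\<Oplus>\<^bsub>B'\<^esub>y\<in>U. row b y \<odot>\<^bsub>B'\<^esub> y) = presentation A' B' (row b)"
      unfolding presentation_def
      by (rule E.lin_ext_superset[OF U, symmetric]) (use b rowA in \<open>auto simp: U_def\<close>)
    finally have "\<kappa> (presentation A B (\<theta>0 (basis_vec A b))) = \<kappa> ((t \<otimes>\<^bsub>A\<^esub> t) \<odot>\<^bsub>B\<^esub> b)"
      using tA bB by (simp add: prow kappaD)
    then have "\<kappa> (?e b) = \<zero>\<^bsub>B'\<^esub>"
      using mod_hom_zero_minus(3)[OF kappa B'_pb.left_module_axioms ec(2,3)[OF bB]]
        B'_pb.minus_eq_zero_iff kappaD(1) ec[OF bB] by simp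
    then show ?thesis using kappa_zero_iff[OF ec(1)[OF bB]] by simp
  qed
  have "\<exists>w\<in>\<Sigma>. \<forall>b\<in>?J. w \<odot>\<^bsub>B\<^esub> ?e b \<in> P"
  proof (rule common_scalar[OF J(1) e])
    show "(v \<otimes>\<^bsub>A\<^esub> s) \<odot>\<^bsub>B\<^esub> ?e b \<in> P" if "b \<in> ?J" "s \<in> \<Sigma>" "v \<in> \<Sigma>" "s \<odot>\<^bsub>B\<^esub> ?e b \<in> P" for b s v
      using sub(4)[OF scalar_closed[OF that(3)] that(4)] that ec(1)[of b] J by (auto simp: lsmult_assoc scalar_closed)
  qed
  then obtain w2 where w2: "w2 \<in> \<Sigma>" "\<And>b. b \<in> ?J \<Longrightarrow> w2 \<odot>\<^bsub>B\<^esub> ?e b \<in> P" by blast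
  define w where "w = w1 \<otimes>\<^bsub>A\<^esub> w2"
  have w: "w \<in> \<Sigma>" unfolding w_def by (rule scalars(3)[OF w1(1) w2(1)])
  note wA = scalar_closed[OF w]
  note w12 = scalar_closed[OF w1(1)] scalar_closed[OF w2(1)]
  have wD: "w \<otimes>\<^bsub>A\<^esub> D y q \<in> I" if "y \<in> U" for y
    using ideal(4)[OF w12(2) w1(2)[OF that]] w12 DA[OF that q(1)]
    unfolding w_def central[OF w1(1) w12(2)] by (simp add: A.m_assoc)
  have we: "w \<odot>\<^bsub>B\<^esub> ?e b \<in> P" if "b \<in> ?J" for b
    using sub(4)[OF w12(1) w2(2)[OF that]] w12 ec(1)[of b] that J unfolding w_def by (auto simp: lsmult_assoc)
  define \<sigma> where "\<sigma> = w \<otimes>\<^bsub>A\<^esub> (t \<otimes>\<^bsub>A\<^esub> t)"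
  have \<sigma>: "\<sigma> \<in> \<Sigma>" unfolding \<sigma>_def by (intro scalars(3) w t)
  note \<sigma>A = scalar_closed[OF \<sigma>]
  \<comment> \<open>Outside the support of \<open>q\<close>, multiplication by \<open>\<sigma>\<close> satisfies the congruence and does not affect the value at \<open>q\<close>.\<close>
  define \<theta>1 where "\<theta>1 = (\<lambda>b. if b \<in> ?J then w \<odot>\<^bsub>F\<^esub> \<theta>0 (basis_vec A b) else \<sigma> \<odot>\<^bsub>F\<^esub> basis_vec A b)"
  have w\<theta>0: "(\<lambda>f. w \<odot>\<^bsub>F\<^esub> \<theta>0 f) \<in> mod_hom A F F"
    by (rule F.mod_hom_central[OF wA central[OF w] \<theta>0])
  have \<theta>1: "\<theta>1 b \<in> carrier F" if "b \<in> carrier B" for b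
    using mod_homD(1)[OF w\<theta>0 A.basis_vec_closed[OF that]] F.lsmult_closed[OF \<sigma>A A.basis_vec_closed[OF that]]
    by (simp add: \<theta>1_def)
  let ?\<theta> = "lin_ext A F \<theta>1"
  have \<theta>: "?\<theta> \<in> mod_hom A F F" by (rule F.lin_ext_mod_hom[OF \<theta>1])
  have approx: "presentation A B (?\<theta> f) \<ominus>\<^bsub>B\<^esub> \<sigma> \<odot>\<^bsub>B\<^esub> presentation A B f \<in> P" if f: "f \<in> carrier F" for f
  proof (rule mod_hom_free_mem[OF _ f sub(1-4)])
    show "(\<lambda>f. presentation A B (?\<theta> f) \<ominus>\<^bsub>B\<^esub> \<sigma> \<odot>\<^bsub>B\<^esub> presentation A B f) \<in> mod_hom A F B"
      by (rule mod_hom_minus[OF F.left_module_axioms mod_hom_comp[OF \<theta> presentation_hom]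
          mod_hom_central[OF \<sigma>A central[OF \<sigma>] presentation_hom]])
    fix b assume b: "b \<in> carrier B"
    note bb = A.basis_vec_closed[OF b]
    have \<theta>b: "?\<theta> (basis_vec A b) = \<theta>1 b" by (rule F.lin_ext_basis_vec[of \<theta>1 b, OF \<theta>1[OF b]])
    show "presentation A B (?\<theta> (basis_vec A b)) \<ominus>\<^bsub>B\<^esub> \<sigma> \<odot>\<^bsub>B\<^esub> presentation A B (basis_vec A b) \<in> P"
    proof (cases "b \<in> ?J")
      case True
      have "w \<odot>\<^bsub>B\<^esub> ?e b = presentation A B (?\<theta> (basis_vec A b)) \<ominus>\<^bsub>B\<^esub> \<sigma> \<odot>\<^bsub>B\<^esub> presentation A B (basis_vec A b)"
        unfolding \<theta>b using True wA tA ec[OF b] mod_homD(3)[OF presentation_hom wA mod_homD(1)[OF \<theta>0 bb]]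
        by (simp add: lsmult_minus presentation_basis_vec[OF b] \<theta>1_def \<sigma>_def lsmult_assoc b)
      then show ?thesis using we[OF True] by simp
    next
      case False
      then have "presentation A B (?\<theta> (basis_vec A b)) = \<sigma> \<odot>\<^bsub>B\<^esub> b"
        unfolding \<theta>b using mod_homD(3)[OF presentation_hom \<sigma>A bb]
        by (simp add: presentation_basis_vec[OF b] \<theta>1_def)
      then show ?thesis using sub(2) b \<sigma>A by (simp add: presentation_basis_vec a_minus_def M.r_neg lsmult_closed)
    qed
  qed
  have "?\<theta> q = w \<odot>\<^bsub>F\<^esub> \<theta>0 q"
    by (rule F.mod_hom_eq_lin_ext_on_support[OF w\<theta>0 q(1) \<theta>1]) (simp_all add: \<theta>1_def)
  also have "\<dots> = (\<Oplus>\<^bsub>F\<^esub>y\<in>U. w \<odot>\<^bsub>F\<^esub> (D y q \<odot>\<^bsub>F\<^esub> basis_vec A (z y)))"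
    unfolding \<theta>0_def by (rule F.lsmult_finsum[OF U(1) wA]) (use DA[OF _ q(1)] bz in \<open>auto intro!: F.lsmult_closed\<close>)
  also have "\<dots> \<in> {f \<in> carrier F. \<forall>b. f b \<in> I}"
  proof (rule F.finsum_mem[OF U(1)])
    fix y assume y: "y \<in> U"
    have "w \<odot>\<^bsub>F\<^esub> (D y q \<odot>\<^bsub>F\<^esub> basis_vec A (z y)) = (w \<otimes>\<^bsub>A\<^esub> D y q) \<odot>\<^bsub>F\<^esub> basis_vec A (z y)"
      using wA DA[OF y q(1)] bz[OF y] by (simp add: F.lsmult_assoc)
    moreover have "(w \<otimes>\<^bsub>A\<^esub> D y q) \<odot>\<^bsub>F\<^esub> basis_vec A (z y) \<in> carrier F"
      using wA DA[OF y q(1)] bz[OF y] by (intro F.lsmult_closed) auto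
    moreover have "((w \<otimes>\<^bsub>A\<^esub> D y q) \<odot>\<^bsub>F\<^esub> basis_vec A (z y)) b \<in> I" for b
      using ideal(5)[OF A.free_module_closed[OF bz[OF y]] wD[OF y]] by (simp add: free_module_simps)
    ultimately show "w \<odot>\<^bsub>F\<^esub> (D y q \<odot>\<^bsub>F\<^esub> basis_vec A (z y)) \<in> {f \<in> carrier F. \<forall>b. f b \<in> I}" by simp
  qed (use ideal(2,3) in \<open>auto simp: free_module_simps A.free_module_add_closed A.free_module_zero_closed\<close>)
  finally show "\<exists>\<sigma>\<in>\<Sigma>. \<exists>\<theta>\<in>mod_hom A F F.
      (\<forall>f\<in>carrier F. presentation A B (\<theta> f) \<ominus>\<^bsub>B\<^esub> \<sigma> \<odot>\<^bsub>B\<^esub> presentation A B f \<in> P) \<and> (\<forall>b. \<theta> q b \<in> I)"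
    using \<sigma> \<theta> approx by blast
qed

end

section \<open>Tensor products with a residue field\<close>

lemma (in abelian_group) add_diff_diff_cancel:
  assumes "x \<in> carrier G" "y \<in> carrier G"
  shows "x \<oplus> y \<ominus> x \<ominus> y = \<zero>"
proof -
  have "x \<oplus> y \<ominus> x \<ominus> y = (x \<oplus> y) \<oplus> \<ominus> (x \<oplus> y)"
    using assms by (simp only: a_minus_def minus_add a_assoc a_closed a_inv_closed)
  then show ?thesis using assms by (simp add: r_neg)
qed

inductive_set ideal_times :: "'r set \<Rightarrow> ('r, 'm, 'y) module_scheme \<Rightarrow> 'm set"
  for J :: "'r set" and M :: "('r, 'm, 'y) module_scheme" where
  zero: "\<zero>\<^bsub>M\<^esub> \<in> ideal_times J M"
| step: "r \<in> J \<Longrightarrow> m \<in> carrier M \<Longrightarrow> x \<in> ideal_times J M \<Longrightarrow> r \<odot>\<^bsub>M\<^esub> m \<oplus>\<^bsub>M\<^esub> x \<in> ideal_times J M"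

lemma ideal_times_closed:
  assumes "left_module R M" "J \<subseteq> carrier R" "x \<in> ideal_times J M"
  shows "x \<in> carrier M"
proof -
  interpret left_module R M by fact
  show ?thesis using assms(3) by induction (use assms(2) in \<open>auto simp: lsmult_closed\<close>)
qed

lemma ideal_times_add:
  assumes "left_module R M" "J \<subseteq> carrier R" "x \<in> ideal_times J M" "y \<in> ideal_times J M"
  shows "x \<oplus>\<^bsub>M\<^esub> y \<in> ideal_times J M"
proof -
  interpret left_module R M by fact
  note c = ideal_times_closed[OF assms(1,2)]
  show ?thesis using assms(3)
  proof induction
    case zero
    then show ?case using c[OF assms(4)] assms(4) by simp
  next
    case (step r m x)
    then have "r \<odot>\<^bsub>M\<^esub> m \<oplus>\<^bsub>M\<^esub> x \<oplus>\<^bsub>M\<^esub> y = r \<odot>\<^bsub>M\<^esub> m \<oplus>\<^bsub>M\<^esub> (x \<oplus>\<^bsub>M\<^esub> y)"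
      using c[OF assms(4)] c assms(2) by (intro M.a_assoc) (auto simp: lsmult_closed)
    then show ?case using ideal_times.step[OF step(1,2,4)] by simp
  qed
qed

lemma ideal_times_smult:
  assumes "left_module R M" "J \<subseteq> carrier R" "r \<in> J" "m \<in> carrier M"
  shows "r \<odot>\<^bsub>M\<^esub> m \<in> ideal_times J M"
proof -
  interpret left_module R M by fact
  show ?thesis using ideal_times.step[OF assms(3,4) ideal_times.zero] assms by (auto simp: lsmult_closed subset_iff)
qed

lemma ideal_times_hom:
  assumes "left_module R M" "left_module R N" "J \<subseteq> carrier R" "f \<in> mod_hom R M N" "x \<in> ideal_times J M"
  shows "f x \<in> ideal_times J N"
proof -
  interpret left_module R M by fact
  show ?thesis using assms(5)
  proof induction
    case zero
    then show ?case using mod_hom_zero_minus(1)[OF assms(4,2)] ideal_times.zero[of N J] by simp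
  next
    case (step r m x)
    then have "f (r \<odot>\<^bsub>M\<^esub> m \<oplus>\<^bsub>M\<^esub> x) = r \<odot>\<^bsub>N\<^esub> f m \<oplus>\<^bsub>N\<^esub> f x"
      using assms(3) ideal_times_closed[OF assms(1,3)] mod_homD[OF assms(4)] by (auto simp: lsmult_closed subset_iff)
    then show ?case using ideal_times.step[OF step(1) mod_homD(1)[OF assms(4) step(2)] step(4)] by simp
  qed
qed

lemma mod_hom_smult:
  assumes "module R M" "r \<in> carrier R"
  shows "(\<lambda>x. r \<odot>\<^bsub>M\<^esub> x) \<in> mod_hom R M M"
proof -
  interpret module R M by fact
  show ?thesis
    by (rule mod_homI) (use assms(2) in \<open>auto simp: smult_r_distr R.m_comm simp flip: smult_assoc1\<close>)
qed

lemma ideal_times_zero_ideal: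
  assumes "left_module R M" "x \<in> ideal_times {\<zero>\<^bsub>R\<^esub>} M"
  shows "x = \<zero>\<^bsub>M\<^esub>"
proof -
  interpret left_module R M by fact
  show ?thesis using assms(2) by induction (auto simp: zero_lsmult)
qed

text \<open>
  Up to isomorphism, \<open>k\<close> is the fraction field of \<open>R/p\<close>. For \<open>p = 0\<close> this is the fraction field of
  \<open>R\<close>, and for a maximal ideal \<open>p\<close> it is \<open>R/p\<close>, so both kinds of fields in the theorem are covered.
\<close>
locale residue_field_at =
  fixes R :: "('r, 'x) ring_scheme" and k :: "('k, 'z) ring_scheme" and \<phi> :: "'r \<Rightarrow> 'k" and p :: "'r set"
  assumes cring: "cring R" and field: "field k" and hom: "\<phi> \<in> ring_hom R k" and prime: "primeideal p R"
    and kernel: "r \<in> carrier R \<Longrightarrow> \<phi> r = \<zero>\<^bsub>k\<^esub> \<longleftrightarrow> r \<in> p"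
    and fraction: "x \<in> carrier k \<Longrightarrow> \<exists>s\<in>carrier R - p. \<exists>r\<in>carrier R. \<phi> s \<otimes>\<^bsub>k\<^esub> x = \<phi> r"
begin

sublocale R: cring R by (rule cring)
sublocale k: field k by (rule field)
sublocale \<phi>: ring_hom_cring R k \<phi> by unfold_locales (rule hom)
sublocale p: primeideal p R by (rule prime)

abbreviation "K \<equiv> algebra_via k \<phi>"

lemma module_K: "module R K"
  by (rule module_algebra_via[OF cring k.is_cring hom])

lemma K_simps [simp]: "carrier K = carrier k" "x \<oplus>\<^bsub>K\<^esub> y = x \<oplus>\<^bsub>k\<^esub> y" "r \<odot>\<^bsub>K\<^esub> x = \<phi> r \<otimes>\<^bsub>k\<^esub> x" "\<zero>\<^bsub>K\<^esub> = \<zero>\<^bsub>k\<^esub>"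
  by (simp_all add: algebra_via_def)

abbreviation (input) "S \<equiv> carrier R - p"

lemma one_notin: "\<one>\<^bsub>R\<^esub> \<in> S"
  using p.one_imp_carrier p.I_notcarr by auto

lemma mult_notin: "s \<in> S \<Longrightarrow> t \<in> S \<Longrightarrow> s \<otimes>\<^bsub>R\<^esub> t \<in> S"
  using p.I_prime by auto

lemma inv_phi:
  assumes "s \<in> S"
  shows "inv\<^bsub>k\<^esub> \<phi> s \<in> carrier k" "\<phi> s \<otimes>\<^bsub>k\<^esub> inv\<^bsub>k\<^esub> \<phi> s = \<one>\<^bsub>k\<^esub>" "inv\<^bsub>k\<^esub> \<phi> s \<otimes>\<^bsub>k\<^esub> \<phi> s = \<one>\<^bsub>k\<^esub>"
proof -
  have "\<phi> s \<in> Units k" using assms kernel[of s] by (auto simp: k.field_Units)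
  then show "inv\<^bsub>k\<^esub> \<phi> s \<in> carrier k" "\<phi> s \<otimes>\<^bsub>k\<^esub> inv\<^bsub>k\<^esub> \<phi> s = \<one>\<^bsub>k\<^esub>" "inv\<^bsub>k\<^esub> \<phi> s \<otimes>\<^bsub>k\<^esub> \<phi> s = \<one>\<^bsub>k\<^esub>"
    by auto
qed

context
  fixes M :: "('r, 'm, 'y) module_scheme"
  assumes M: "module R M"
begin

interpretation M: module R M by (rule M)

lemmas MK = module_left_right(2)[OF M] module_left_right(1)[OF module_K]
lemmas M_left = module_left_right(1)[OF M]
lemmas rel = tensor_rel_props[OF MK]

lemma tensor_rel_smult:
  assumes "r \<in> carrier R" "m \<in> carrier M" "x \<in> carrier k"
  shows "frag_of (r \<odot>\<^bsub>M\<^esub> m, x) - frag_of (m, \<phi> r \<otimes>\<^bsub>k\<^esub> x) \<in> tensor_rel R M K"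
  using rel(6)[OF tensor_gensI(3)[of r R m M x K]] assms by simp

lemma tensor_rel_scalar_inverse:
  assumes "s \<in> S" "t \<in> S" "m \<in> carrier M"
  shows "frag_of (t \<odot>\<^bsub>M\<^esub> m, inv\<^bsub>k\<^esub> \<phi> (s \<otimes>\<^bsub>R\<^esub> t)) - frag_of (m, inv\<^bsub>k\<^esub> \<phi> s) \<in> tensor_rel R M K"
proof -
  note st = mult_notin[OF assms(1,2)]
  have c: "\<phi> s \<in> carrier k" "\<phi> t \<in> carrier k" using assms by auto
  have "\<phi> t \<otimes>\<^bsub>k\<^esub> inv\<^bsub>k\<^esub> \<phi> (s \<otimes>\<^bsub>R\<^esub> t) = (inv\<^bsub>k\<^esub> \<phi> s \<otimes>\<^bsub>k\<^esub> \<phi> s) \<otimes>\<^bsub>k\<^esub> (\<phi> t \<otimes>\<^bsub>k\<^esub> inv\<^bsub>k\<^esub> \<phi> (s \<otimes>\<^bsub>R\<^esub> t))"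
    using inv_phi[OF assms(1)] inv_phi(1)[OF st] c by simp
  also have "\<dots> = inv\<^bsub>k\<^esub> \<phi> s \<otimes>\<^bsub>k\<^esub> (\<phi> (s \<otimes>\<^bsub>R\<^esub> t) \<otimes>\<^bsub>k\<^esub> inv\<^bsub>k\<^esub> \<phi> (s \<otimes>\<^bsub>R\<^esub> t))"
    using inv_phi(1)[OF assms(1)] inv_phi(1)[OF st] c assms by (simp add: k.m_assoc)
  finally have "\<phi> t \<otimes>\<^bsub>k\<^esub> inv\<^bsub>k\<^esub> \<phi> (s \<otimes>\<^bsub>R\<^esub> t) = inv\<^bsub>k\<^esub> \<phi> s" using inv_phi[OF st] inv_phi(1)[OF assms(1)] by simp
  then show ?thesis using tensor_rel_smult[of t m "inv\<^bsub>k\<^esub> \<phi> (s \<otimes>\<^bsub>R\<^esub> t)"] assms inv_phi(1)[OF st] by simp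
qed

text \<open>A pure tensor \<open>m \<otimes> r/s\<close> equals \<open>r m \<otimes> 1/s\<close>, and sums are brought to a common denominator.\<close>
lemma tensor_common_denominator:
  assumes "Poly_Mapping.keys u \<subseteq> carrier M \<times> carrier k"
  shows "\<exists>s\<in>S. \<exists>m\<in>carrier M. u - frag_of (m, inv\<^bsub>k\<^esub> \<phi> s) \<in> tensor_rel R M K"
  using assms
proof (induction u rule: frag_induction)
  case zero
  have "frag_of (\<zero>\<^bsub>M\<^esub>, inv\<^bsub>k\<^esub> \<phi> \<one>\<^bsub>R\<^esub>) \<in> tensor_rel R M K"
    by (rule tensor_rel_zero_left[OF MK]) (use inv_phi(1)[OF one_notin] in simp)
  then show ?case using rel(3) one_notin by (intro bexI[of _ "\<one>\<^bsub>R\<^esub>"] bexI[of _ "\<zero>\<^bsub>M\<^esub>"]) auto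
next
  case (one z)
  then obtain m x where z: "z = (m, x)" "m \<in> carrier M" "x \<in> carrier k" by auto
  obtain s r where s: "s \<in> S" "r \<in> carrier R" "\<phi> s \<otimes>\<^bsub>k\<^esub> x = \<phi> r" using fraction[OF z(3)] by blast
  have "\<phi> r \<otimes>\<^bsub>k\<^esub> inv\<^bsub>k\<^esub> \<phi> s = (\<phi> s \<otimes>\<^bsub>k\<^esub> inv\<^bsub>k\<^esub> \<phi> s) \<otimes>\<^bsub>k\<^esub> x"
    unfolding s(3)[symmetric] using inv_phi(1)[OF s(1)] z(3) s(1) k.m_comm k.m_assoc by (simp add: k.m_ac)
  then have "\<phi> r \<otimes>\<^bsub>k\<^esub> inv\<^bsub>k\<^esub> \<phi> s = x" using inv_phi[OF s(1)] z(3) by simp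
  then have "frag_of (m, x) - frag_of (r \<odot>\<^bsub>M\<^esub> m, inv\<^bsub>k\<^esub> \<phi> s) \<in> tensor_rel R M K"
    using rel(3)[OF tensor_rel_smult[OF s(2) z(2) inv_phi(1)[OF s(1)]]] by simp
  then show ?case unfolding z(1) using s z(2) by (intro bexI[OF _ s(1)] bexI[of _ "r \<odot>\<^bsub>M\<^esub> m"]) auto
next
  case (diff u v)
  then obtain s m t n where s: "s \<in> S" "m \<in> carrier M" "u - frag_of (m, inv\<^bsub>k\<^esub> \<phi> s) \<in> tensor_rel R M K"
    and t: "t \<in> S" "n \<in> carrier M" "v - frag_of (n, inv\<^bsub>k\<^esub> \<phi> t) \<in> tensor_rel R M K"
    by blast
  let ?i = "inv\<^bsub>k\<^esub> \<phi> (s \<otimes>\<^bsub>R\<^esub> t)" and ?m = "t \<odot>\<^bsub>M\<^esub> m" and ?n = "s \<odot>\<^bsub>M\<^esub> n"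
  note st = mult_notin[OF s(1) t(1)]
  have mn: "?m \<in> carrier M" "?n \<in> carrier M" "?m \<ominus>\<^bsub>M\<^esub> ?n \<in> carrier M" using s t by auto
  have c: "s \<otimes>\<^bsub>R\<^esub> t = t \<otimes>\<^bsub>R\<^esub> s" using s t by (auto simp: R.m_comm)
  have 1: "frag_of (?m, ?i) - frag_of (m, inv\<^bsub>k\<^esub> \<phi> s) \<in> tensor_rel R M K"
    by (rule tensor_rel_scalar_inverse[OF s(1) t(1) s(2)])
  have 2: "frag_of (?n, ?i) - frag_of (n, inv\<^bsub>k\<^esub> \<phi> t) \<in> tensor_rel R M K"
    unfolding c by (rule tensor_rel_scalar_inverse[OF t(1) s(1) t(2)])
  have "?m \<ominus>\<^bsub>M\<^esub> ?n \<oplus>\<^bsub>M\<^esub> ?n = ?m" using mn by (simp add: a_minus_def M.a_assoc M.l_neg)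
  then have 3: "frag_of (?m, ?i) - frag_of (?m \<ominus>\<^bsub>M\<^esub> ?n, ?i) - frag_of (?n, ?i) \<in> tensor_rel R M K"
    using rel(6)[OF tensor_gensI(1)[OF mn(3,2), of ?i K R]] inv_phi(1)[OF st] by simp
  have "((u - frag_of (m, inv\<^bsub>k\<^esub> \<phi> s)) - (v - frag_of (n, inv\<^bsub>k\<^esub> \<phi> t))) -
      ((frag_of (?m, ?i) - frag_of (m, inv\<^bsub>k\<^esub> \<phi> s)) - (frag_of (?n, ?i) - frag_of (n, inv\<^bsub>k\<^esub> \<phi> t))) +
      (frag_of (?m, ?i) - frag_of (?m \<ominus>\<^bsub>M\<^esub> ?n, ?i) - frag_of (?n, ?i)) \<in> tensor_rel R M K"
    by (rule rel(2)[OF rel(4)[OF rel(4)[OF s(3) t(3)] rel(4)[OF 1 2]] 3])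
  then have "(u - v) - frag_of (?m \<ominus>\<^bsub>M\<^esub> ?n, ?i) \<in> tensor_rel R M K" by (simp add: algebra_simps)
  then show ?case using st mn(3) by blast
qed

lemma ideal_times_tensor_rel:
  assumes "m \<in> ideal_times p M" "x \<in> carrier k"
  shows "frag_of (m, x) \<in> tensor_rel R M K"
  using assms(1)
proof induction
  case zero
  show ?case by (rule tensor_rel_zero_left[OF MK]) (use assms(2) in simp)
next
  case (step r m y)
  have r: "r \<in> carrier R" "\<phi> r = \<zero>\<^bsub>k\<^esub>" using step(1) p.a_subset kernel by auto
  have y: "y \<in> carrier M" by (rule ideal_times_closed[OF M_left p.a_subset step(3)])
  have rm: "r \<odot>\<^bsub>M\<^esub> m \<in> carrier M" using r step by simp
  have 1: "frag_of (r \<odot>\<^bsub>M\<^esub> m, x) - frag_of (m, \<zero>\<^bsub>K\<^esub>) \<in> tensor_rel R M K"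
    using tensor_rel_smult[OF r(1) step(2) assms(2)] r(2) assms(2) by simp
  have 2: "frag_of (r \<odot>\<^bsub>M\<^esub> m \<oplus>\<^bsub>M\<^esub> y, x) - frag_of (r \<odot>\<^bsub>M\<^esub> m, x) - frag_of (y, x) \<in> tensor_rel R M K"
    using rel(6)[OF tensor_gensI(1)[OF rm y, of x K R]] assms(2) by simp
  have "(frag_of (r \<odot>\<^bsub>M\<^esub> m \<oplus>\<^bsub>M\<^esub> y, x) - frag_of (r \<odot>\<^bsub>M\<^esub> m, x) - frag_of (y, x)) +
     (frag_of (r \<odot>\<^bsub>M\<^esub> m, x) - frag_of (m, \<zero>\<^bsub>K\<^esub>)) + frag_of (m, \<zero>\<^bsub>K\<^esub>) + frag_of (y, x) \<in> tensor_rel R M K"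
    by (rule rel(2)[OF rel(2)[OF rel(2)[OF 2 1] tensor_rel_zero_right[OF MK step(2)]] step(4)])
  then show ?case by simp
qed

text \<open>
  For \<open>t \<in> R\<close>, let \<open>num t x\<close> be a representative of \<open>t x\<close> in \<open>R\<close> whenever \<open>t x\<close> lies in the image of \<open>R\<close>.
  Multiplication by a suitable \<open>s \<notin> p\<close> makes this the case for all \<open>x\<close> that occur in a given tensor
  relation, and then the additive map with \<open>m \<otimes> x \<mapsto> num (t s) x m\<close> sends the relation into \<open>pM\<close>, for
  every \<open>t\<close>, because two representatives differ by an element of \<open>p\<close>. Quantifying over all multiples \<open>t s\<close> of
  \<open>s\<close> allows one to pass to common multiples when relations are added.
\<close>
lemma tensor_rel_imp_ideal_times:
  assumes m: "m \<in> carrier M" and mrel: "frag_of (m, \<one>\<^bsub>k\<^esub>) \<in> tensor_rel R M K"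
  shows "\<exists>s\<in>S. s \<odot>\<^bsub>M\<^esub> m \<in> ideal_times p M"
proof -
  \<comment> \<open>The default zero keeps \<open>num\<close> inside \<open>R\<close>, so that \<open>tot\<close> is defined on all formal sums.\<close>
  define num where "num = (\<lambda>t x. if \<exists>r\<in>carrier R. \<phi> r = \<phi> t \<otimes>\<^bsub>k\<^esub> x
    then SOME r. r \<in> carrier R \<and> \<phi> r = \<phi> t \<otimes>\<^bsub>k\<^esub> x else \<zero>\<^bsub>R\<^esub>)"
  have num_phi: "num t x \<in> carrier R \<and> \<phi> (num t x) = \<phi> t \<otimes>\<^bsub>k\<^esub> x" if "\<exists>r\<in>carrier R. \<phi> r = \<phi> t \<otimes>\<^bsub>k\<^esub> x" for t x
    using that someI_ex[of "\<lambda>r. r \<in> carrier R \<and> \<phi> r = \<phi> t \<otimes>\<^bsub>k\<^esub> x"] unfolding num_def by auto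
  have num: "num t x \<in> carrier R" for t x
  proof (cases "\<exists>r\<in>carrier R. \<phi> r = \<phi> t \<otimes>\<^bsub>k\<^esub> x")
    case False
    then show ?thesis unfolding num_def by simp
  qed (use num_phi in blast)
  have num_multiple: "\<phi> (num (t \<otimes>\<^bsub>R\<^esub> (s \<otimes>\<^bsub>R\<^esub> w)) x) = \<phi> (t \<otimes>\<^bsub>R\<^esub> (s \<otimes>\<^bsub>R\<^esub> w)) \<otimes>\<^bsub>k\<^esub> x"
    if "t \<in> carrier R" "s \<in> carrier R" "w \<in> carrier R" "x \<in> carrier k" "\<exists>r\<in>carrier R. \<phi> s \<otimes>\<^bsub>k\<^esub> x = \<phi> r" for t s w x
  proof -
    obtain r where r: "r \<in> carrier R" "\<phi> s \<otimes>\<^bsub>k\<^esub> x = \<phi> r" using \<open>\<exists>r\<in>carrier R. _\<close> by blast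
    have "\<phi> (t \<otimes>\<^bsub>R\<^esub> (s \<otimes>\<^bsub>R\<^esub> w)) \<otimes>\<^bsub>k\<^esub> x = \<phi> (t \<otimes>\<^bsub>R\<^esub> w) \<otimes>\<^bsub>k\<^esub> (\<phi> s \<otimes>\<^bsub>k\<^esub> x)"
      using that by (simp add: k.m_ac)
    also have "\<dots> = \<phi> (t \<otimes>\<^bsub>R\<^esub> w \<otimes>\<^bsub>R\<^esub> r)" unfolding r(2) using that r by simp
    finally show ?thesis using num_phi[of "t \<otimes>\<^bsub>R\<^esub> (s \<otimes>\<^bsub>R\<^esub> w)" x] that r(1) by (metis R.m_closed)
  qed
  have coeff: "r \<odot>\<^bsub>M\<^esub> n \<in> ideal_times p M" if "r \<in> carrier R" "\<phi> r = \<zero>\<^bsub>k\<^esub>" "n \<in> carrier M" for r n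
    by (rule ideal_times_smult[OF M_left p.a_subset]) (use that kernel in auto)
  define tot where "tot = (\<lambda>t. additive_ext M (\<lambda>(n, x). num t x \<odot>\<^bsub>M\<^esub> n) (carrier M \<times> carrier k))"
  have tot: "Poly_Mapping.keys u \<subseteq> carrier M \<times> carrier k \<Longrightarrow> tot t u \<in> carrier M"
    "n \<in> carrier M \<Longrightarrow> x \<in> carrier k \<Longrightarrow> tot t (frag_of (n, x)) = num t x \<odot>\<^bsub>M\<^esub> n"
    "tot t 0 = \<zero>\<^bsub>M\<^esub>"
    "Poly_Mapping.keys u \<subseteq> carrier M \<times> carrier k \<Longrightarrow> Poly_Mapping.keys v \<subseteq> carrier M \<times> carrier k \<Longrightarrow>
      tot t (u + v) = tot t u \<oplus>\<^bsub>M\<^esub> tot t v"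
    "Poly_Mapping.keys u \<subseteq> carrier M \<times> carrier k \<Longrightarrow> tot t (- u) = \<ominus>\<^bsub>M\<^esub> tot t u"
    "Poly_Mapping.keys u \<subseteq> carrier M \<times> carrier k \<Longrightarrow> Poly_Mapping.keys v \<subseteq> carrier M \<times> carrier k \<Longrightarrow>
      tot t (u - v) = tot t u \<ominus>\<^bsub>M\<^esub> tot t v" for t u v n x
  proof -
    have *: "\<And>q. q \<in> carrier M \<times> carrier k \<Longrightarrow> (case q of (n, x) \<Rightarrow> num t x \<odot>\<^bsub>M\<^esub> n) \<in> carrier M"
      using num by auto
    note ext = additive_ext[of M "carrier M \<times> carrier k" "\<lambda>(n, x). num t x \<odot>\<^bsub>M\<^esub> n", OF M.abelian_group_axioms *]
    show "Poly_Mapping.keys u \<subseteq> carrier M \<times> carrier k \<Longrightarrow> tot t u \<in> carrier M"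
      "n \<in> carrier M \<Longrightarrow> x \<in> carrier k \<Longrightarrow> tot t (frag_of (n, x)) = num t x \<odot>\<^bsub>M\<^esub> n"
      "tot t 0 = \<zero>\<^bsub>M\<^esub>"
      "Poly_Mapping.keys u \<subseteq> carrier M \<times> carrier k \<Longrightarrow> Poly_Mapping.keys v \<subseteq> carrier M \<times> carrier k \<Longrightarrow>
        tot t (u + v) = tot t u \<oplus>\<^bsub>M\<^esub> tot t v"
      "Poly_Mapping.keys u \<subseteq> carrier M \<times> carrier k \<Longrightarrow> tot t (- u) = \<ominus>\<^bsub>M\<^esub> tot t u"
      "Poly_Mapping.keys u \<subseteq> carrier M \<times> carrier k \<Longrightarrow> Poly_Mapping.keys v \<subseteq> carrier M \<times> carrier k \<Longrightarrow>
        tot t (u - v) = tot t u \<ominus>\<^bsub>M\<^esub> tot t v"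
      unfolding tot_def using ext(1,3-6) ext(2)[of "(n, x)"] by auto
  qed
  have "\<exists>s\<in>S. \<forall>t\<in>carrier R. tot (t \<otimes>\<^bsub>R\<^esub> s) u \<in> ideal_times p M" if "u \<in> tensor_rel R M K" for u
    using MK that
  proof (induction rule: tensor_rel_induct)
    case zero
    then show ?case using one_notin tot(3) by (intro bexI[of _ "\<one>\<^bsub>R\<^esub>"]) (auto intro: ideal_times.zero)
  next
    case (minus u)
    then obtain s where s: "s \<in> S" "\<forall>t\<in>carrier R. tot (t \<otimes>\<^bsub>R\<^esub> s) u \<in> ideal_times p M" by blast
    have "\<ominus>\<^bsub>M\<^esub> y \<in> ideal_times p M" if "y \<in> ideal_times p M" for y
      using ideal_times_hom[OF M_left M_left p.a_subset mod_hom_smult[OF M, of "\<ominus>\<^bsub>R\<^esub> \<one>\<^bsub>R\<^esub>"] that]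
        ideal_times_closed[OF M_left p.a_subset that] by (simp add: M.smult_l_minus)
    then show ?case using s tot(5) rel(5)[OF minus(1)] by (intro bexI[OF _ s(1)]) auto
  next
    case (add u v)
    then obtain s w where s: "s \<in> S" "\<forall>t\<in>carrier R. tot (t \<otimes>\<^bsub>R\<^esub> s) u \<in> ideal_times p M"
      and w: "w \<in> S" "\<forall>t\<in>carrier R. tot (t \<otimes>\<^bsub>R\<^esub> w) v \<in> ideal_times p M" by blast
    have "tot (t \<otimes>\<^bsub>R\<^esub> (s \<otimes>\<^bsub>R\<^esub> w)) (u + v) \<in> ideal_times p M" if t: "t \<in> carrier R" for t
    proof -
      have "t \<otimes>\<^bsub>R\<^esub> (s \<otimes>\<^bsub>R\<^esub> w) = (t \<otimes>\<^bsub>R\<^esub> w) \<otimes>\<^bsub>R\<^esub> s" "t \<otimes>\<^bsub>R\<^esub> (s \<otimes>\<^bsub>R\<^esub> w) = (t \<otimes>\<^bsub>R\<^esub> s) \<otimes>\<^bsub>R\<^esub> w"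
        using s w t by (auto simp: R.m_ac)
      then have "tot (t \<otimes>\<^bsub>R\<^esub> (s \<otimes>\<^bsub>R\<^esub> w)) u \<in> ideal_times p M" "tot (t \<otimes>\<^bsub>R\<^esub> (s \<otimes>\<^bsub>R\<^esub> w)) v \<in> ideal_times p M"
        using s w t by (metis DiffD1 R.m_closed)+
      then show ?thesis
        using ideal_times_add[OF M_left p.a_subset] tot(4) rel(5)[OF add(1)] rel(5)[OF add(2)] by simp
    qed
    then show ?case using mult_notin[OF s(1) w(1)] by blast
  next
    case (gen u)
    then show ?case
    proof (cases rule: tensor_gensE)
      case (left n n' x)
      have "tot t u = \<zero>\<^bsub>M\<^esub>" for t
        unfolding left(1) using left num[of t x]
        by (simp add: tot keys_diff_subset M.smult_r_distr)
          (simp add: a_minus_def M.a_ac M.r_neg M.r_neg2)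
      then show ?thesis using one_notin ideal_times.zero[of M p] by (intro bexI[OF _ one_notin]) simp
    next
      case (right n x y)
      have xy: "x \<in> carrier k" "y \<in> carrier k" using right by auto
      obtain s w where s: "s \<in> S" "\<exists>r\<in>carrier R. \<phi> s \<otimes>\<^bsub>k\<^esub> x = \<phi> r" and w: "w \<in> S" "\<exists>r\<in>carrier R. \<phi> w \<otimes>\<^bsub>k\<^esub> y = \<phi> r"
        using fraction[OF xy(1)] fraction[OF xy(2)] by blast
      obtain a b where ab: "a \<in> carrier R" "\<phi> s \<otimes>\<^bsub>k\<^esub> x = \<phi> a" "b \<in> carrier R" "\<phi> w \<otimes>\<^bsub>k\<^esub> y = \<phi> b" using s(2) w(2) by blast
      have sw: "s \<in> carrier R" "w \<in> carrier R" using s w by auto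
      have sum: "\<exists>r\<in>carrier R. \<phi> (s \<otimes>\<^bsub>R\<^esub> w) \<otimes>\<^bsub>k\<^esub> (x \<oplus>\<^bsub>k\<^esub> y) = \<phi> r"
      proof (rule bexI)
        have "\<phi> (s \<otimes>\<^bsub>R\<^esub> w) \<otimes>\<^bsub>k\<^esub> (x \<oplus>\<^bsub>k\<^esub> y) = \<phi> w \<otimes>\<^bsub>k\<^esub> (\<phi> s \<otimes>\<^bsub>k\<^esub> x) \<oplus>\<^bsub>k\<^esub> \<phi> s \<otimes>\<^bsub>k\<^esub> (\<phi> w \<otimes>\<^bsub>k\<^esub> y)"
          using sw xy by (simp add: k.r_distr k.m_ac)
        then show "\<phi> (s \<otimes>\<^bsub>R\<^esub> w) \<otimes>\<^bsub>k\<^esub> (x \<oplus>\<^bsub>k\<^esub> y) = \<phi> (w \<otimes>\<^bsub>R\<^esub> a \<oplus>\<^bsub>R\<^esub> s \<otimes>\<^bsub>R\<^esub> b)" unfolding ab using sw ab by simp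
      qed (use sw ab in simp)
      have "tot (t \<otimes>\<^bsub>R\<^esub> (s \<otimes>\<^bsub>R\<^esub> w)) u \<in> ideal_times p M" if t: "t \<in> carrier R" for t
      proof -
        let ?t = "t \<otimes>\<^bsub>R\<^esub> (s \<otimes>\<^bsub>R\<^esub> w)"
        have 1: "\<phi> (num ?t x) = \<phi> ?t \<otimes>\<^bsub>k\<^esub> x" by (rule num_multiple[OF t sw xy(1) s(2)])
        have 2: "\<phi> (num ?t y) = \<phi> ?t \<otimes>\<^bsub>k\<^esub> y" using num_multiple[OF t sw(2,1) xy(2) w(2)] sw by (simp add: R.m_comm)
        have 3: "\<phi> (num ?t (x \<oplus>\<^bsub>k\<^esub> y)) = \<phi> ?t \<otimes>\<^bsub>k\<^esub> (x \<oplus>\<^bsub>k\<^esub> y)"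
          using num_multiple[OF t R.m_closed[OF sw] R.one_closed k.a_closed[OF xy] sum] sw by simp
        have "tot ?t u = (num ?t (x \<oplus>\<^bsub>k\<^esub> y) \<ominus>\<^bsub>R\<^esub> num ?t x \<ominus>\<^bsub>R\<^esub> num ?t y) \<odot>\<^bsub>M\<^esub> n"
          unfolding right(1) using right num
          by (simp add: tot keys_diff_subset a_minus_def M.smult_l_distr M.smult_l_minus)
        moreover have "\<phi> (num ?t (x \<oplus>\<^bsub>k\<^esub> y) \<ominus>\<^bsub>R\<^esub> num ?t x \<ominus>\<^bsub>R\<^esub> num ?t y) = \<zero>\<^bsub>k\<^esub>"
        proof -
          have c: "\<phi> ?t \<in> carrier k" using t sw by simp
          have "\<phi> (num ?t (x \<oplus>\<^bsub>k\<^esub> y) \<ominus>\<^bsub>R\<^esub> num ?t x \<ominus>\<^bsub>R\<^esub> num ?t y) =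
              \<phi> ?t \<otimes>\<^bsub>k\<^esub> (x \<oplus>\<^bsub>k\<^esub> y) \<ominus>\<^bsub>k\<^esub> \<phi> ?t \<otimes>\<^bsub>k\<^esub> x \<ominus>\<^bsub>k\<^esub> \<phi> ?t \<otimes>\<^bsub>k\<^esub> y"
            unfolding 1[symmetric] 2[symmetric] 3[symmetric] using num by (simp add: a_minus_def)
          also have "\<phi> ?t \<otimes>\<^bsub>k\<^esub> (x \<oplus>\<^bsub>k\<^esub> y) = \<phi> ?t \<otimes>\<^bsub>k\<^esub> x \<oplus>\<^bsub>k\<^esub> \<phi> ?t \<otimes>\<^bsub>k\<^esub> y" by (rule k.r_distr[OF xy c])
          finally show ?thesis using k.add_diff_diff_cancel[OF k.m_closed[OF c xy(1)] k.m_closed[OF c xy(2)]] by simp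
        qed
        ultimately show ?thesis using coeff[of _ n] num right(2) by simp
      qed
      then show ?thesis using mult_notin[OF s(1) w(1)] by blast
    next
      case (middle a n x)
      have x: "x \<in> carrier k" using middle by auto
      obtain s where s: "s \<in> S" "\<exists>r\<in>carrier R. \<phi> s \<otimes>\<^bsub>k\<^esub> x = \<phi> r" using fraction[OF x] by blast
      then obtain b where b: "b \<in> carrier R" "\<phi> s \<otimes>\<^bsub>k\<^esub> x = \<phi> b" by blast
      have sR: "s \<in> carrier R" using s by auto
      have ax: "\<exists>r\<in>carrier R. \<phi> s \<otimes>\<^bsub>k\<^esub> (\<phi> a \<otimes>\<^bsub>k\<^esub> x) = \<phi> r"
      proof (rule bexI)
        have "\<phi> s \<otimes>\<^bsub>k\<^esub> (\<phi> a \<otimes>\<^bsub>k\<^esub> x) = \<phi> a \<otimes>\<^bsub>k\<^esub> (\<phi> s \<otimes>\<^bsub>k\<^esub> x)" using sR x middle by (simp add: k.m_ac)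
        then show "\<phi> s \<otimes>\<^bsub>k\<^esub> (\<phi> a \<otimes>\<^bsub>k\<^esub> x) = \<phi> (a \<otimes>\<^bsub>R\<^esub> b)" unfolding b using middle b by simp
      qed (use middle b in simp)
      have "tot (t \<otimes>\<^bsub>R\<^esub> s) u \<in> ideal_times p M" if t: "t \<in> carrier R" for t
      proof -
        let ?t = "t \<otimes>\<^bsub>R\<^esub> s"
        have 1: "\<phi> (num ?t x) = \<phi> ?t \<otimes>\<^bsub>k\<^esub> x" using num_multiple[OF t sR R.one_closed x s(2)] sR by simp
        have 2: "\<phi> (num ?t (\<phi> a \<otimes>\<^bsub>k\<^esub> x)) = \<phi> ?t \<otimes>\<^bsub>k\<^esub> (\<phi> a \<otimes>\<^bsub>k\<^esub> x)"
          using num_multiple[OF t sR R.one_closed _ ax] sR x middle by simp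
        have "tot ?t u = (num ?t x \<otimes>\<^bsub>R\<^esub> a \<ominus>\<^bsub>R\<^esub> num ?t (\<phi> a \<otimes>\<^bsub>k\<^esub> x)) \<odot>\<^bsub>M\<^esub> n"
          unfolding middle(1) using middle num
          by (simp add: tot keys_diff_subset a_minus_def M.smult_l_distr M.smult_l_minus M.smult_assoc1)
        moreover have "\<phi> (num ?t x \<otimes>\<^bsub>R\<^esub> a \<ominus>\<^bsub>R\<^esub> num ?t (\<phi> a \<otimes>\<^bsub>k\<^esub> x)) = \<zero>\<^bsub>k\<^esub>"
        proof -
          have c: "\<phi> ?t \<in> carrier k" "\<phi> a \<in> carrier k" using t sR middle by simp_all
          have "\<phi> (num ?t x \<otimes>\<^bsub>R\<^esub> a \<ominus>\<^bsub>R\<^esub> num ?t (\<phi> a \<otimes>\<^bsub>k\<^esub> x)) =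
              \<phi> ?t \<otimes>\<^bsub>k\<^esub> x \<otimes>\<^bsub>k\<^esub> \<phi> a \<ominus>\<^bsub>k\<^esub> \<phi> ?t \<otimes>\<^bsub>k\<^esub> (\<phi> a \<otimes>\<^bsub>k\<^esub> x)"
            unfolding 1[symmetric] 2[symmetric] using num middle by (simp add: a_minus_def)
          also have "\<phi> ?t \<otimes>\<^bsub>k\<^esub> x \<otimes>\<^bsub>k\<^esub> \<phi> a = \<phi> ?t \<otimes>\<^bsub>k\<^esub> (\<phi> a \<otimes>\<^bsub>k\<^esub> x)" using c x by (simp only: k.m_assoc k.m_comm[of x])
          finally show ?thesis using c x by (simp add: a_minus_def k.r_neg)
        qed
        ultimately show ?thesis using coeff[of _ n] num middle by simp
      qed
      then show ?thesis using s(1) by blast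
    qed
  qed
  then obtain s where s: "s \<in> S" "\<And>t. t \<in> carrier R \<Longrightarrow> tot (t \<otimes>\<^bsub>R\<^esub> s) (frag_of (m, \<one>\<^bsub>k\<^esub>)) \<in> ideal_times p M"
    using mrel by blast
  have sR: "s \<in> carrier R" using s(1) by auto
  have in1: "num s \<one>\<^bsub>k\<^esub> \<odot>\<^bsub>M\<^esub> m \<in> ideal_times p M" using s(2)[OF R.one_closed] sR m by (simp add: tot)
  have "\<phi> (num s \<one>\<^bsub>k\<^esub>) = \<phi> s" using num_phi[of s "\<one>\<^bsub>k\<^esub>"] sR by auto
  then have in2: "(s \<ominus>\<^bsub>R\<^esub> num s \<one>\<^bsub>k\<^esub>) \<odot>\<^bsub>M\<^esub> m \<in> ideal_times p M"
    using sR num m by (intro coeff) (simp_all add: a_minus_def k.r_neg)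
  have "(s \<ominus>\<^bsub>R\<^esub> num s \<one>\<^bsub>k\<^esub>) \<odot>\<^bsub>M\<^esub> m \<oplus>\<^bsub>M\<^esub> num s \<one>\<^bsub>k\<^esub> \<odot>\<^bsub>M\<^esub> m = s \<odot>\<^bsub>M\<^esub> m"
    using sR num m by (simp add: a_minus_def R.a_assoc R.l_neg flip: M.smult_l_distr)
  then show ?thesis using ideal_times_add[OF M_left p.a_subset in2 in1] s(1) by auto
qed

lemma tensor_rel_one_iff:
  assumes m: "m \<in> carrier M"
  shows "frag_of (m, \<one>\<^bsub>k\<^esub>) \<in> tensor_rel R M K \<longleftrightarrow> (\<exists>s\<in>S. s \<odot>\<^bsub>M\<^esub> m \<in> ideal_times p M)"
proof
  assume "\<exists>s\<in>S. s \<odot>\<^bsub>M\<^esub> m \<in> ideal_times p M"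
  then obtain s where s: "s \<in> S" "s \<odot>\<^bsub>M\<^esub> m \<in> ideal_times p M" by blast
  have "frag_of (s \<odot>\<^bsub>M\<^esub> m, inv\<^bsub>k\<^esub> \<phi> s) - frag_of (m, \<one>\<^bsub>k\<^esub>) \<in> tensor_rel R M K"
    using tensor_rel_smult[of s m "inv\<^bsub>k\<^esub> \<phi> s"] s(1) m inv_phi[OF s(1)] by simp
  then show "frag_of (m, \<one>\<^bsub>k\<^esub>) \<in> tensor_rel R M K"
    using rel(4)[OF ideal_times_tensor_rel[OF s(2) inv_phi(1)[OF s(1)]]] by fastforce
qed (rule tensor_rel_imp_ideal_times[OF m])

end

end

lemma bilin_mod_hom:
  assumes "bilin R M N L \<mu>"
  shows "b \<in> carrier N \<Longrightarrow> (\<lambda>a. \<mu> a b) \<in> mod_hom R M L"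
    "a \<in> carrier M \<Longrightarrow> \<mu> a \<in> mod_hom R N L"
  by (auto simp: mod_hom_def bilinD[OF assms])

lemma restrict_scalars_simps [simp]:
  "carrier (restrict_scalars A B) = carrier B" "x \<oplus>\<^bsub>restrict_scalars A B\<^esub> y = x \<oplus>\<^bsub>B\<^esub> y"
  "\<zero>\<^bsub>restrict_scalars A B\<^esub> = \<zero>\<^bsub>B\<^esub>" "r \<odot>\<^bsub>restrict_scalars A B\<^esub> x = (r \<odot>\<^bsub>A\<^esub> \<one>\<^bsub>A\<^esub>) \<odot>\<^bsub>B\<^esub> x"
  by (simp_all add: restrict_scalars_def)

lemma (in assoc_algebra) smult_one_central:
  assumes "r \<in> carrier R" "a \<in> carrier A"
  shows "(r \<odot>\<^bsub>A\<^esub> \<one>\<^bsub>A\<^esub>) \<otimes>\<^bsub>A\<^esub> a = r \<odot>\<^bsub>A\<^esub> a" "a \<otimes>\<^bsub>A\<^esub> (r \<odot>\<^bsub>A\<^esub> \<one>\<^bsub>A\<^esub>) = r \<odot>\<^bsub>A\<^esub> a"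
  using assms by (simp_all add: smult_mult_left smult_mult_right)

lemma (in assoc_algebra) smult_one_mult:
  assumes "r \<in> carrier R" "s \<in> carrier R"
  shows "(r \<odot>\<^bsub>A\<^esub> \<one>\<^bsub>A\<^esub>) \<otimes>\<^bsub>A\<^esub> (s \<odot>\<^bsub>A\<^esub> \<one>\<^bsub>A\<^esub>) = (r \<otimes>\<^bsub>R\<^esub> s) \<odot>\<^bsub>A\<^esub> \<one>\<^bsub>A\<^esub>"
  using assms by (simp add: smult_one_central(1) smult_assoc1)

context residue_field_at begin

context
  fixes A :: "('r, 'a, 'y) module_scheme" and B :: "('a, 'b, 'w) module_scheme"
  assumes A: "assoc_algebra R A" and B: "left_module A B"
begin

interpretation A: assoc_algebra R A by (rule A)
interpretation B: left_module A B by (rule B)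

abbreviation (input) "BR \<equiv> restrict_scalars A B"

lemmas BR = module_restrict_scalars(1)[OF A B]
lemmas bilin_AA = bilin_algebra[OF A]
lemmas bilin_AB = module_restrict_scalars(2)[OF A B]
lemmas left_A = module_left_right(1)[OF A.module_axioms]
lemmas left_BR = module_left_right(1)[OF BR]

abbreviation (input) "scalars_at \<equiv> (\<lambda>s. s \<odot>\<^bsub>A\<^esub> \<one>\<^bsub>A\<^esub>) ` S"

lemma scaled_ideal_prime: "scaled_ideal A B scalars_at (ideal_times p A) (ideal_times p BR)"
proof (intro scaled_ideal.intro scaled_ideal_axioms.intro B)
  show "scalars_at \<subseteq> carrier A" by auto
  show "\<one>\<^bsub>A\<^esub> \<in> scalars_at" using one_notin by (intro image_eqI[of _ _ "\<one>\<^bsub>R\<^esub>"]) auto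
  show "s \<otimes>\<^bsub>A\<^esub> t \<in> scalars_at" if "s \<in> scalars_at" "t \<in> scalars_at" for s t
    using that mult_notin by (auto simp: A.smult_one_mult intro!: imageI)
  show "ideal_times p A \<subseteq> carrier A" using ideal_times_closed[OF left_A p.a_subset] by auto
  show "ideal_times p BR \<subseteq> carrier B" using ideal_times_closed[OF left_BR p.a_subset] by auto
  show "\<zero>\<^bsub>A\<^esub> \<in> ideal_times p A" by (rule ideal_times.zero)
  show "\<zero>\<^bsub>B\<^esub> \<in> ideal_times p BR" using ideal_times.zero[of BR p] by simp
  show "x \<oplus>\<^bsub>A\<^esub> y \<in> ideal_times p A" if "x \<in> ideal_times p A" "y \<in> ideal_times p A" for x y
    by (rule ideal_times_add[OF left_A p.a_subset that])
  show "x \<oplus>\<^bsub>B\<^esub> y \<in> ideal_times p BR" if "x \<in> ideal_times p BR" "y \<in> ideal_times p BR" for x y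
    using ideal_times_add[OF left_BR p.a_subset that] by simp
  show "a \<otimes>\<^bsub>A\<^esub> x \<in> ideal_times p A" "x \<otimes>\<^bsub>A\<^esub> a \<in> ideal_times p A" if "a \<in> carrier A" "x \<in> ideal_times p A" for a x
    by (rule ideal_times_hom[OF left_A left_A p.a_subset bilin_mod_hom(2)[OF bilin_AA that(1)] that(2)],
        rule ideal_times_hom[OF left_A left_A p.a_subset bilin_mod_hom(1)[OF bilin_AA that(1)] that(2)])
  show "a \<odot>\<^bsub>B\<^esub> x \<in> ideal_times p BR" if "a \<in> carrier A" "x \<in> ideal_times p BR" for a x
    by (rule ideal_times_hom[OF left_BR left_BR p.a_subset bilin_mod_hom(2)[OF bilin_AB that(1)] that(2)])
qed

abbreviation (input) "A\<^sub>k \<equiv> base_change_ring R A k \<phi>"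
abbreviation (input) "B\<^sub>k \<equiv> base_change_module R A B k \<phi>"
abbreviation (input) "clA \<equiv> tensor_class R A K"
abbreviation (input) "clB \<equiv> tensor_class R BR K"

lemmas relA = MK[OF A.module_axioms]
lemmas relB = MK[OF BR]

lemma base_change_simps:
  "carrier A\<^sub>k = clA ` {u. Poly_Mapping.keys u \<subseteq> carrier A \<times> carrier k}"
  "\<zero>\<^bsub>A\<^sub>k\<^esub> = clA 0" "\<one>\<^bsub>A\<^sub>k\<^esub> = clA (frag_of (\<one>\<^bsub>A\<^esub>, \<one>\<^bsub>k\<^esub>))" "clA u \<oplus>\<^bsub>A\<^sub>k\<^esub> clA v = clA (u + v)"
  "carrier B\<^sub>k = clB ` {u. Poly_Mapping.keys u \<subseteq> carrier B \<times> carrier k}"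
  "\<zero>\<^bsub>B\<^sub>k\<^esub> = clB 0" "clB u' \<oplus>\<^bsub>B\<^sub>k\<^esub> clB v' = clB (u' + v')"
  by (simp_all add: base_change_ring_def base_change_module_def Let_def carrier_tensor tensor_one
      tensor_mult_class[OF relA] tensor_mult_class[OF relB])

lemma base_change_mult:
  assumes "Poly_Mapping.keys u \<subseteq> carrier A \<times> carrier k"
  shows "Poly_Mapping.keys v \<subseteq> carrier A \<times> carrier k \<Longrightarrow>
      clA u \<otimes>\<^bsub>A\<^sub>k\<^esub> clA v = clA (biadditive_ext (monoid.mult A) (monoid.mult k) u v)"
    "Poly_Mapping.keys w \<subseteq> carrier B \<times> carrier k \<Longrightarrow>
      clA u \<odot>\<^bsub>B\<^sub>k\<^esub> clB w = clB (biadditive_ext (smult B) (monoid.mult k) u w)"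
  using tensor_product_class[OF A.module_axioms A.module_axioms module_K bilin_AA bilin_algebra_via[OF cring k.is_cring hom], of u v]
    tensor_product_class[OF A.module_axioms BR module_K bilin_AB bilin_algebra_via[OF cring k.is_cring hom], of u w]
    assms
  by (simp_all add: base_change_ring_def base_change_module_def Let_def)

lemma base_change_mult_pure:
  assumes "a \<in> carrier A" "x \<in> carrier k" "y \<in> carrier k"
  shows "a' \<in> carrier A \<Longrightarrow> clA (frag_of (a, x)) \<otimes>\<^bsub>A\<^sub>k\<^esub> clA (frag_of (a', y)) = clA (frag_of (a \<otimes>\<^bsub>A\<^esub> a', x \<otimes>\<^bsub>k\<^esub> y))"
    "b \<in> carrier B \<Longrightarrow> clA (frag_of (a, x)) \<odot>\<^bsub>B\<^sub>k\<^esub> clB (frag_of (b, y)) = clB (frag_of (a \<odot>\<^bsub>B\<^esub> b, x \<otimes>\<^bsub>k\<^esub> y))"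
  using assms base_change_mult[of "frag_of (a, x)"] by (simp_all add: biadditive_ext_def)

text \<open>Applied to the denominators \<open>s \<otimes> 1\<close>, where \<open>s\<close> comes from \<open>R\<close>.\<close>
lemma base_change_central:
  assumes c: "c \<in> carrier A" "\<And>a. a \<in> carrier A \<Longrightarrow> c \<otimes>\<^bsub>A\<^esub> a = a \<otimes>\<^bsub>A\<^esub> c" and x: "x \<in> carrier k"
    and \<alpha>: "\<alpha> \<in> carrier A\<^sub>k"
  shows "clA (frag_of (c, x)) \<otimes>\<^bsub>A\<^sub>k\<^esub> \<alpha> = \<alpha> \<otimes>\<^bsub>A\<^sub>k\<^esub> clA (frag_of (c, x))"
proof -
  obtain u where u: "\<alpha> = clA u" "Poly_Mapping.keys u \<subseteq> carrier A \<times> carrier k"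
    using \<alpha> unfolding base_change_simps by auto
  have "biadditive_ext (monoid.mult A) (monoid.mult k) (frag_of (c, x)) u =
      biadditive_ext (monoid.mult A) (monoid.mult k) u (frag_of (c, x))"
    unfolding biadditive_ext_def
    by (simp add: case_prod_unfold) (rule frag_extend_cong, use u(2) c x in \<open>auto simp: k.m_comm\<close>)
  then show ?thesis using u c(1) x by (simp add: base_change_mult)
qed

lemma tensor_class_denominator:
  assumes "module R M" "s \<in> S" "m \<in> carrier M"
  shows "tensor_class R M K (frag_of (s \<odot>\<^bsub>M\<^esub> m, inv\<^bsub>k\<^esub> \<phi> s)) = tensor_class R M K (frag_of (m, \<one>\<^bsub>k\<^esub>))"
  unfolding tensor_class_eq_iff[OF MK[OF assms(1)]]
  using tensor_rel_smult[OF assms(1), of s m "inv\<^bsub>k\<^esub> \<phi> s"] assms inv_phi[OF assms(2)] by simp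

lemma tensor_class_add:
  assumes "module R M" "m \<in> carrier M" "n \<in> carrier M"
  shows "tensor_class R M K (frag_of (m \<oplus>\<^bsub>M\<^esub> n, \<one>\<^bsub>k\<^esub>)) = tensor_class R M K (frag_of (m, \<one>\<^bsub>k\<^esub>) + frag_of (n, \<one>\<^bsub>k\<^esub>))"
  unfolding tensor_class_eq_iff[OF MK[OF assms(1)]]
  using rel(6)[OF assms(1) tensor_gensI(1)[OF assms(2,3), of "\<one>\<^bsub>k\<^esub>" K R]] by (simp add: algebra_simps)

text \<open>The elements of \<open>R\<close> outside \<open>p\<close> act on \<open>A\<^sub>k\<close> as central units, and every element is a fraction with such a denominator.\<close>
lemma residue_extension_base_change:
  "residue_extension A B scalars_at (ideal_times p A) (ideal_times p BR) A\<^sub>k B\<^sub>k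
     (\<lambda>a. clA (frag_of (a, \<one>\<^bsub>k\<^esub>))) (\<lambda>b. clB (frag_of (b, \<one>\<^bsub>k\<^esub>)))"
proof -
  interpret S: scaled_ideal A B scalars_at "ideal_times p A" "ideal_times p BR" by (rule scaled_ideal_prime)
  interpret E: left_module A\<^sub>k B\<^sub>k by (rule left_module_base_change_module[OF A k.is_cring hom B])
  interpret F: left_module A "free_cover A B" by (rule A.left_module_free_module)
  show ?thesis
  proof unfold_locales
    show "(\<lambda>a. clA (frag_of (a, \<one>\<^bsub>k\<^esub>))) \<in> ring_hom A A\<^sub>k"
      by (rule ring_hom_memI)
        (auto simp: base_change_simps base_change_mult_pure tensor_class_add[OF A.module_axioms] intro!: imageI)
    show "(\<lambda>b. clB (frag_of (b, \<one>\<^bsub>k\<^esub>))) \<in> mod_hom A B (pullback_module (\<lambda>a. clA (frag_of (a, \<one>\<^bsub>k\<^esub>))) B\<^sub>k)"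
    proof (rule mod_homI)
      show "clB (frag_of (b \<oplus>\<^bsub>B\<^esub> c, \<one>\<^bsub>k\<^esub>)) =
          clB (frag_of (b, \<one>\<^bsub>k\<^esub>)) \<oplus>\<^bsub>pullback_module (\<lambda>a. clA (frag_of (a, \<one>\<^bsub>k\<^esub>))) B\<^sub>k\<^esub> clB (frag_of (c, \<one>\<^bsub>k\<^esub>))"
        if "b \<in> carrier B" "c \<in> carrier B" for b c
        using tensor_class_add[OF BR, of b c] that by (simp add: base_change_simps)
    qed (auto simp: base_change_simps base_change_mult_pure intro!: imageI)
    show "clA (frag_of (a, \<one>\<^bsub>k\<^esub>)) = \<zero>\<^bsub>A\<^sub>k\<^esub> \<longleftrightarrow> (\<exists>s\<in>scalars_at. s \<otimes>\<^bsub>A\<^esub> a \<in> ideal_times p A)" if "a \<in> carrier A" for a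
      using tensor_rel_one_iff[OF A.module_axioms that] that
      by (simp add: base_change_simps tensor_class_eq_iff[OF relA] A.smult_one_central)
    show "clB (frag_of (b, \<one>\<^bsub>k\<^esub>)) = \<zero>\<^bsub>B\<^sub>k\<^esub> \<longleftrightarrow> (\<exists>s\<in>scalars_at. s \<odot>\<^bsub>B\<^esub> b \<in> ideal_times p BR)" if "b \<in> carrier B" for b
      using tensor_rel_one_iff[OF BR, of b] that
      by (simp add: base_change_simps tensor_class_eq_iff[OF relB])
    show "\<exists>s\<in>scalars_at. \<exists>a\<in>carrier A. clA (frag_of (s, \<one>\<^bsub>k\<^esub>)) \<otimes>\<^bsub>A\<^sub>k\<^esub> \<alpha> = clA (frag_of (a, \<one>\<^bsub>k\<^esub>))" if \<alpha>: "\<alpha> \<in> carrier A\<^sub>k" for \<alpha>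
    proof -
      obtain u where u: "\<alpha> = clA u" "Poly_Mapping.keys u \<subseteq> carrier A \<times> carrier k"
        using \<alpha> unfolding base_change_simps by auto
      obtain s m where s: "s \<in> S" "m \<in> carrier A" "u - frag_of (m, inv\<^bsub>k\<^esub> \<phi> s) \<in> tensor_rel R A K"
        using tensor_common_denominator[OF A.module_axioms u(2)] by blast
      have "\<alpha> = clA (frag_of (m, inv\<^bsub>k\<^esub> \<phi> s))" using s(3) u(1) by (simp add: tensor_class_eq_iff[OF relA])
      then have "clA (frag_of (s \<odot>\<^bsub>A\<^esub> \<one>\<^bsub>A\<^esub>, \<one>\<^bsub>k\<^esub>)) \<otimes>\<^bsub>A\<^sub>k\<^esub> \<alpha> = clA (frag_of (m, \<one>\<^bsub>k\<^esub>))"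
        using s inv_phi[OF s(1)] tensor_class_denominator[OF A.module_axioms s(1,2)]
        by (simp add: base_change_mult_pure A.smult_one_central)
      then show ?thesis using s(1,2) by blast
    qed
    show "\<exists>s\<in>scalars_at. \<exists>b\<in>carrier B. clA (frag_of (s, \<one>\<^bsub>k\<^esub>)) \<odot>\<^bsub>B\<^sub>k\<^esub> \<beta> = clB (frag_of (b, \<one>\<^bsub>k\<^esub>))" if \<beta>: "\<beta> \<in> carrier B\<^sub>k" for \<beta>
    proof -
      obtain u where u: "\<beta> = clB u" "Poly_Mapping.keys u \<subseteq> carrier BR \<times> carrier k"
        using \<beta> unfolding base_change_simps by auto
      obtain s m where s: "s \<in> S" "m \<in> carrier B" "u - frag_of (m, inv\<^bsub>k\<^esub> \<phi> s) \<in> tensor_rel R BR K"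
        using tensor_common_denominator[OF BR u(2)] by auto
      have "\<beta> = clB (frag_of (m, inv\<^bsub>k\<^esub> \<phi> s))" using s(3) u(1) by (simp add: tensor_class_eq_iff[OF relB])
      then have "clA (frag_of (s \<odot>\<^bsub>A\<^esub> \<one>\<^bsub>A\<^esub>, \<one>\<^bsub>k\<^esub>)) \<odot>\<^bsub>B\<^sub>k\<^esub> \<beta> = clB (frag_of (m, \<one>\<^bsub>k\<^esub>))"
        using s inv_phi[OF s(1)] tensor_class_denominator[OF BR s(1), of m]
        by (simp add: base_change_mult_pure)
      then show ?thesis using s(1,2) by blast
    qed
    fix s assume "s \<in> scalars_at"
    then obtain r where r: "s = r \<odot>\<^bsub>A\<^esub> \<one>\<^bsub>A\<^esub>" "r \<in> S" by blast
    show "s \<otimes>\<^bsub>A\<^esub> a = a \<otimes>\<^bsub>A\<^esub> s" if "a \<in> carrier A" for a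
      using r that by (simp add: A.smult_one_central)
    show "clA (frag_of (s, \<one>\<^bsub>k\<^esub>)) \<otimes>\<^bsub>A\<^sub>k\<^esub> \<alpha> = \<alpha> \<otimes>\<^bsub>A\<^sub>k\<^esub> clA (frag_of (s, \<one>\<^bsub>k\<^esub>))" if "\<alpha> \<in> carrier A\<^sub>k" for \<alpha>
      by (rule base_change_central) (use r that in \<open>simp_all add: A.smult_one_central\<close>)
    show "\<exists>v\<in>carrier A\<^sub>k. v \<otimes>\<^bsub>A\<^sub>k\<^esub> clA (frag_of (s, \<one>\<^bsub>k\<^esub>)) = \<one>\<^bsub>A\<^sub>k\<^esub>"
    proof (rule bexI)
      show "clA (frag_of (\<one>\<^bsub>A\<^esub>, inv\<^bsub>k\<^esub> \<phi> r)) \<otimes>\<^bsub>A\<^sub>k\<^esub> clA (frag_of (s, \<one>\<^bsub>k\<^esub>)) = \<one>\<^bsub>A\<^sub>k\<^esub>"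
        using r inv_phi[OF r(2)] tensor_class_denominator[OF A.module_axioms r(2), of "\<one>\<^bsub>A\<^esub>"]
        by (simp add: base_change_mult_pure base_change_simps)
      show "clA (frag_of (\<one>\<^bsub>A\<^esub>, inv\<^bsub>k\<^esub> \<phi> r)) \<in> carrier A\<^sub>k"
        using inv_phi[OF r(2)] by (auto simp: base_change_simps intro!: imageI)
    qed
  next
    fix x assume "x \<in> ideal_times p BR"
    then show "\<exists>g\<in>carrier (free_cover A B). (\<forall>b. g b \<in> ideal_times p A) \<and> presentation A B g = x"
    proof induction
      case zero
      show ?case
        by (rule bexI[of _ "\<zero>\<^bsub>free_cover A B\<^esub>"])
          (use F.mod_hom_zero_minus(1)[OF B.presentation_hom B] in \<open>simp_all add: free_module_simps S.ideal(2) A.free_module_zero_closed\<close>)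
    next
      case (step r m x)
      then obtain g where g: "g \<in> carrier (free_cover A B)" "\<And>b. g b \<in> ideal_times p A" "presentation A B g = x" by blast
      have m: "m \<in> carrier B" and r: "r \<in> carrier R" using step p.a_subset by auto
      let ?r = "r \<odot>\<^bsub>A\<^esub> \<one>\<^bsub>A\<^esub>"
      have rI: "?r \<in> ideal_times p A" by (rule ideal_times_smult[OF left_A p.a_subset step(1)]) simp
      note bm = A.basis_vec_closed[OF m]
      have rb: "?r \<odot>\<^bsub>free_cover A B\<^esub> basis_vec A m \<in> carrier (free_cover A B)"
        using r by (intro F.lsmult_closed bm) simp
      let ?g = "?r \<odot>\<^bsub>free_cover A B\<^esub> basis_vec A m \<oplus>\<^bsub>free_cover A B\<^esub> g"
      have "?g b \<in> ideal_times p A" for b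
        using S.ideal(3)[OF S.ideal(5)[OF A.free_module_closed[OF bm] rI] g(2)] by (simp add: free_module_simps)
      moreover have "presentation A B ?g = ?r \<odot>\<^bsub>B\<^esub> m \<oplus>\<^bsub>B\<^esub> x"
        using mod_homD(2)[OF B.presentation_hom rb g(1)] mod_homD(3)[OF B.presentation_hom _ bm, of ?r] r
        by (simp add: g(3) B.presentation_basis_vec m)
      moreover have "?g \<in> carrier (free_cover A B)" by (rule F.M.a_closed[OF rb g(1)])
      ultimately show ?case by (intro bexI[of _ ?g]) simp_all
    qed
  qed
qed

end

end

section \<open>Noetherian and Dedekind rings\<close>

lemma (in cring) ideal_setI:
  assumes "I \<subseteq> carrier R" "\<zero> \<in> I" "\<And>x y. x \<in> I \<Longrightarrow> y \<in> I \<Longrightarrow> x \<oplus> y \<in> I"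
    "\<And>r x. r \<in> carrier R \<Longrightarrow> x \<in> I \<Longrightarrow> r \<otimes> x \<in> I"
  shows "ideal I R"
proof (rule idealI[OF ring_axioms])
  show "subgroup I (add_monoid R)"
  proof
    fix x assume x: "x \<in> I"
    then have "x \<in> carrier R" using assms(1) by auto
    then have "\<ominus> x = (\<ominus> \<one>) \<otimes> x" by (simp add: l_minus)
    then show "inv\<^bsub>add_monoid R\<^esub> x \<in> I" using assms(4)[OF _ x, of "\<ominus> \<one>"] by (simp flip: a_inv_def)
  qed (use assms in auto)
  show "x \<otimes> a \<in> I" "a \<otimes> x \<in> I" if "a \<in> I" "x \<in> carrier R" for a x
    using that assms(4)[OF that(2,1)] m_comm[of a x] assms(1) by auto
qed

lemma (in noetherian_ring) exists_maximal_in_family: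
  assumes "C \<noteq> {}" "\<And>I. I \<in> C \<Longrightarrow> ideal I R"
  shows "\<exists>P\<in>C. \<forall>I\<in>C. P \<subseteq> I \<longrightarrow> I = P"
proof (rule subset_Zorn_nonempty[OF assms(1)])
  fix D assume D: "D \<noteq> {}" "subset.chain C D"
  then have "subset.chain {I. ideal I R} D" using assms(2) unfolding pred_on.chain_def by auto
  then have "\<Union>D \<in> D" by (rule ideal_chain_is_trivial[OF D(1)])
  then show "\<Union>D \<in> C" using D(2) unfolding pred_on.chain_def by auto
qed

text \<open>
  The argument behind the existence of associated primes: if \<open>a b\<close> lies in a maximal member \<open>P\<close> of the
  family and \<open>b\<close> does not, then the colon ideal \<open>(P : b)\<close> is a member containing \<open>P\<close>, so it equals \<open>P\<close>, and it
  contains \<open>a\<close>.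
\<close>
lemma (in noetherian_domain) exists_prime_in_colon_closed_family:
  assumes "C \<noteq> {}" "\<And>I. I \<in> C \<Longrightarrow> ideal I R" "\<And>I. I \<in> C \<Longrightarrow> I \<noteq> carrier R"
    and colon: "\<And>I x. I \<in> C \<Longrightarrow> x \<in> carrier R \<Longrightarrow> x \<notin> I \<Longrightarrow> {r \<in> carrier R. r \<otimes> x \<in> I} \<in> C"
  obtains P where "P \<in> C" "primeideal P R"
proof -
  obtain P where P: "P \<in> C" "\<And>I. I \<in> C \<Longrightarrow> P \<subseteq> I \<Longrightarrow> I = P"
    using exists_maximal_in_family[OF assms(1,2)] by auto
  interpret P: ideal P R by (rule assms(2)[OF P(1)])
  have "primeideal P R"
  proof (rule primeidealI[OF P.is_ideal is_cring])
    show "carrier R \<noteq> P" using assms(3)[OF P(1)] by simp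
    fix a b assume ab: "a \<in> carrier R" "b \<in> carrier R" "a \<otimes> b \<in> P"
    show "a \<in> P \<or> b \<in> P"
    proof (cases "b \<in> P")
      case False
      have "P \<subseteq> {r \<in> carrier R. r \<otimes> b \<in> P}" using P.a_subset P.I_r_closed ab(2) by auto
      then have "{r \<in> carrier R. r \<otimes> b \<in> P} = P" using P(2) colon[OF P(1) ab(2) False] by blast
      then show ?thesis using ab by blast
    qed simp
  qed
  then show thesis using that P(1) by blast
qed

text \<open>The ideal generated by \<open>t\<^sub>0, \<dots>, t\<^sub>n\<^sub>-\<^sub>1\<close>, in a form that displays its elements as linear combinations.\<close>
fun (in ring) span_ideal :: "(nat \<Rightarrow> 'a) \<Rightarrow> nat \<Rightarrow> 'a set" where
  "span_ideal t 0 = {\<zero>}"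
| "span_ideal t (Suc n) = {r \<otimes> t n \<oplus> x |r x. r \<in> carrier R \<and> x \<in> span_ideal t n}"

lemma (in ring) span_ideal_SucI:
  "r \<in> carrier R \<Longrightarrow> x \<in> span_ideal t n \<Longrightarrow> r \<otimes> t n \<oplus> x \<in> span_ideal t (Suc n)"
  by auto

lemma (in cring) ideal_span_ideal:
  assumes "\<And>n. t n \<in> carrier R"
  shows "ideal (span_ideal t n) R" "span_ideal t n \<subseteq> span_ideal t (Suc n)" "t n \<in> span_ideal t (Suc n)"
proof -
  show id: "ideal (span_ideal t n) R" for n
  proof (induction n)
    case 0
    show ?case by (simp add: zeroideal)
  next
    case (Suc n)
    interpret I: ideal "span_ideal t n" R by (rule Suc)
    show ?case
    proof (rule ideal_setI)
      show "span_ideal t (Suc n) \<subseteq> carrier R" using assms I.Icarr by auto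
      show "\<zero> \<in> span_ideal t (Suc n)" using span_ideal_SucI[OF zero_closed I.zero_closed] assms by simp
    next
      fix y z assume "y \<in> span_ideal t (Suc n)" "z \<in> span_ideal t (Suc n)"
      then obtain r x r' x' where *: "y = r \<otimes> t n \<oplus> x" "z = r' \<otimes> t n \<oplus> x'" "r \<in> carrier R" "r' \<in> carrier R"
        "x \<in> span_ideal t n" "x' \<in> span_ideal t n" by auto
      then have "y \<oplus> z = (r \<oplus> r') \<otimes> t n \<oplus> (x \<oplus> x')" using assms I.Icarr by (simp add: l_distr a_ac)
      then show "y \<oplus> z \<in> span_ideal t (Suc n)" using span_ideal_SucI[OF _ I.a_closed[OF *(5,6)], where r = "r \<oplus> r'"] * by simp
    next
      fix s y assume s: "s \<in> carrier R" "y \<in> span_ideal t (Suc n)"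
      then obtain r x where *: "y = r \<otimes> t n \<oplus> x" "r \<in> carrier R" "x \<in> span_ideal t n" by auto
      then have "s \<otimes> y = (s \<otimes> r) \<otimes> t n \<oplus> s \<otimes> x" using assms I.Icarr s by (simp add: r_distr m_assoc)
      then show "s \<otimes> y \<in> span_ideal t (Suc n)" using span_ideal_SucI[OF _ I.I_l_closed[OF *(3) s(1)], where r = "s \<otimes> r"] * s by simp
    qed
  qed
  interpret I: ideal "span_ideal t n" R by (rule id)
  show "span_ideal t n \<subseteq> span_ideal t (Suc n)"
  proof
    fix x assume "x \<in> span_ideal t n"
    then show "x \<in> span_ideal t (Suc n)" using span_ideal_SucI[OF zero_closed, where x = x and t = t and n = n] assms[of n] I.Icarr[of x] by simp
  qed
  show "t n \<in> span_ideal t (Suc n)" using span_ideal_SucI[OF one_closed I.zero_closed] assms[of n] by simp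
qed

text \<open>
  The elements \<open>t\<^sub>n = (c/a)\<^sup>n t\<^sub>0\<close> all lie in \<open>R\<close>. The ideals generated by their initial segments become
  stationary, so some \<open>t\<^sub>n\<close> is a combination of the preceding ones. Division by \<open>t\<^sub>0\<close> turns this into an
  equation of integral dependence for \<open>c/a\<close>.
\<close>
lemma (in noetherian_domain) integral_of_stable_sequence:
  assumes ic: "integrally_closed R"
    and a: "a \<in> carrier R" "a \<noteq> \<zero>" and c: "c \<in> carrier R"
    and t: "t 0 \<noteq> \<zero>" "\<And>n. t n \<in> carrier R" "\<And>n. c \<otimes> t n = a \<otimes> t (Suc n)"
  shows "\<exists>r\<in>carrier R. c = a \<otimes> r"
proof -
  let ?K = "fraction_field R" and ?\<phi> = "to_fraction_field R"
  interpret K: field ?K by (rule field_fraction_field)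
  interpret h: ring_hom_cring R ?K ?\<phi> by unfold_locales (rule to_fraction_field_hom)
  define y where "y = fraction R c a"
  have y: "y \<in> carrier ?K" unfolding y_def carrier_fraction_field using a c by blast
  have yt: "y \<otimes>\<^bsub>?K\<^esub> ?\<phi> (t n) = ?\<phi> (t (Suc n))" for n
    unfolding y_def to_fraction_field_def
    using a c t(2)[of n] t(2)[of "Suc n"] t(3)[of n]
    by (subst mult_fraction_field) (auto simp: frac_eq_iff m_comm)
  have pow: "y [^]\<^bsub>?K\<^esub> n \<otimes>\<^bsub>?K\<^esub> ?\<phi> (t 0) = ?\<phi> (t n)" for n :: nat
  proof (induction n)
    case (Suc n)
    have "y [^]\<^bsub>?K\<^esub> Suc n \<otimes>\<^bsub>?K\<^esub> ?\<phi> (t 0) = y \<otimes>\<^bsub>?K\<^esub> (y [^]\<^bsub>?K\<^esub> n \<otimes>\<^bsub>?K\<^esub> ?\<phi> (t 0))"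
      using y t(2)[of 0] by (simp add: K.m_ac)
    then show ?case unfolding Suc yt .
  qed (use t(2)[of 0] in simp)
  define C where "C = range (span_ideal t)"
  note sp = ideal_span_ideal[of t, OF t(2)]
  have "subset.chain {I. ideal I R} C"
  proof -
    have "span_ideal t m \<subseteq> span_ideal t n" if "m \<le> n" for m n
      using that by (rule lift_Suc_mono_le[of "span_ideal t", OF sp(2)])
    then have "span_ideal t m \<subseteq> span_ideal t n \<or> span_ideal t n \<subseteq> span_ideal t m" for m n
      using nat_le_linear by blast
    then show ?thesis unfolding pred_on.chain_def C_def using sp(1) by auto
  qed
  then have "\<Union>C \<in> C" by (rule ideal_chain_is_trivial[rotated]) (auto simp: C_def)
  then obtain n where n: "\<Union>C = span_ideal t n" by (auto simp: C_def)
  have "span_ideal t (Suc n) \<in> C" unfolding C_def by (rule rangeI)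
  then have tn: "t n \<in> span_ideal t n" using sp(3)[of n] n by blast
  \<comment> \<open>The coefficients are taken with the opposite sign, ready to be the lower terms of a monic polynomial.\<close>
  have comb: "\<exists>cs. set cs \<subseteq> ?\<phi> ` carrier R \<and> length cs = m \<and> ?\<phi> x \<oplus>\<^bsub>?K\<^esub> K.eval cs y \<otimes>\<^bsub>?K\<^esub> ?\<phi> (t 0) = \<zero>\<^bsub>?K\<^esub>"
    if "x \<in> span_ideal t m" for x m
    using that
  proof (induction m arbitrary: x)
    case 0
    then show ?case using t(2)[of 0] by (intro exI[of _ "[]"]) simp
  next
    case (Suc m)
    then obtain r x' where x: "x = r \<otimes> t m \<oplus> x'" "r \<in> carrier R" "x' \<in> span_ideal t m" by auto
    then obtain cs where cs: "set cs \<subseteq> ?\<phi> ` carrier R" "length cs = m"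
      "?\<phi> x' \<oplus>\<^bsub>?K\<^esub> K.eval cs y \<otimes>\<^bsub>?K\<^esub> ?\<phi> (t 0) = \<zero>\<^bsub>?K\<^esub>" using Suc.IH by blast
    have x': "x' \<in> carrier R" using ideal.Icarr[OF sp(1) x(3)] .
    have e: "K.eval cs y \<in> carrier ?K" using cs(1) y by (intro K.eval_in_carrier) auto
    let ?r = "?\<phi> r" and ?a = "?\<phi> (t 0)"
    have c: "?r \<in> carrier ?K" "?a \<in> carrier ?K" "?\<phi> (t m) \<in> carrier ?K" "?\<phi> x' \<in> carrier ?K" "y [^]\<^bsub>?K\<^esub> m \<in> carrier ?K"
      using x x' t(2) y by auto
    have ev: "K.eval (?\<phi> (\<ominus> r) # cs) y \<otimes>\<^bsub>?K\<^esub> ?a =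
        \<ominus>\<^bsub>?K\<^esub> (?r \<otimes>\<^bsub>?K\<^esub> ?\<phi> (t m)) \<oplus>\<^bsub>?K\<^esub> K.eval cs y \<otimes>\<^bsub>?K\<^esub> ?a"
      using c e cs(2) x(2) by (simp add: K.l_distr K.l_minus K.m_assoc pow)
    have hx: "?\<phi> x = ?r \<otimes>\<^bsub>?K\<^esub> ?\<phi> (t m) \<oplus>\<^bsub>?K\<^esub> ?\<phi> x'" using x x' t(2)[of m] by simp
    have "?\<phi> x \<oplus>\<^bsub>?K\<^esub> K.eval (?\<phi> (\<ominus> r) # cs) y \<otimes>\<^bsub>?K\<^esub> ?a =
        (?r \<otimes>\<^bsub>?K\<^esub> ?\<phi> (t m) \<oplus>\<^bsub>?K\<^esub> \<ominus>\<^bsub>?K\<^esub> (?r \<otimes>\<^bsub>?K\<^esub> ?\<phi> (t m))) \<oplus>\<^bsub>?K\<^esub>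
        (?\<phi> x' \<oplus>\<^bsub>?K\<^esub> K.eval cs y \<otimes>\<^bsub>?K\<^esub> ?a)"
      unfolding ev hx using c e by (simp add: K.a_ac)
    also have "\<dots> = \<zero>\<^bsub>?K\<^esub>" unfolding cs(3) using c by (simp add: K.r_neg)
    finally have "?\<phi> x \<oplus>\<^bsub>?K\<^esub> K.eval (?\<phi> (\<ominus> r) # cs) y \<otimes>\<^bsub>?K\<^esub> ?a = \<zero>\<^bsub>?K\<^esub>" .
    moreover have "set (?\<phi> (\<ominus> r) # cs) \<subseteq> ?\<phi> ` carrier R"
      using cs(1) x(2) imageI[of "\<ominus> r" "carrier R" ?\<phi>] by (simp del: h.hom_a_inv)
    ultimately show ?case using cs(2) by (intro exI[of _ "?\<phi> (\<ominus> r) # cs"] conjI) simp_all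
  qed
  obtain cs where cs: "set cs \<subseteq> ?\<phi> ` carrier R" "length cs = n"
    "?\<phi> (t n) \<oplus>\<^bsub>?K\<^esub> K.eval cs y \<otimes>\<^bsub>?K\<^esub> ?\<phi> (t 0) = \<zero>\<^bsub>?K\<^esub>" using comb[OF tn] by blast
  have e: "K.eval cs y \<in> carrier ?K" using cs(1) y by (intro K.eval_in_carrier) auto
  let ?p = "\<one>\<^bsub>?K\<^esub> # cs"
  have t0: "?\<phi> (t 0) \<in> carrier ?K" "?\<phi> (t 0) \<noteq> \<zero>\<^bsub>?K\<^esub>"
    using t(1) t(2)[of 0] inj_onD[OF inj_to_fraction_field, of "t 0" \<zero>] h.hom_zero by auto
  have "K.eval ?p y \<otimes>\<^bsub>?K\<^esub> ?\<phi> (t 0) = ?\<phi> (t n) \<oplus>\<^bsub>?K\<^esub> K.eval cs y \<otimes>\<^bsub>?K\<^esub> ?\<phi> (t 0)"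
    using e y t0 cs(2) by (simp add: K.l_distr pow)
  then have "K.eval ?p y \<otimes>\<^bsub>?K\<^esub> ?\<phi> (t 0) = \<zero>\<^bsub>?K\<^esub>" using cs(3) by simp
  moreover have "K.eval ?p y \<in> carrier ?K" using e y by simp
  ultimately have "K.eval ?p y = \<zero>\<^bsub>?K\<^esub>" using t0 K.integral by blast
  moreover have "\<one>\<^bsub>?K\<^esub> \<in> ?\<phi> ` carrier R" using h.hom_one by (intro image_eqI[of _ _ \<one>]) auto
  then have "polynomial\<^bsub>?K\<^esub> (?\<phi> ` carrier R) ?p" using cs(1) by (simp add: polynomial_def)
  ultimately have "y \<in> ?\<phi> ` carrier R"
    using ic[unfolded integrally_closed_def, rule_format, OF y, of ?p] by simp
  then obtain r where r: "r \<in> carrier R" "fraction R c a = fraction R r \<one>" unfolding y_def to_fraction_field_def by blast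
  then have "c = a \<otimes> r" using a c r by (simp add: frac_eq_iff m_comm[of a r])
  with r(1) show ?thesis by blast
qed

text \<open>
  In other words, the localization at \<open>m\<close> has a principal maximal ideal, generated by \<open>\<pi>\<close>. Choose \<open>a \<noteq> 0\<close>
  in \<open>m\<close>. Since \<open>m\<close> is the only prime ideal of the localization that contains \<open>a\<close>, it is associated to
  \<open>R/aR\<close> there: there is \<open>c \<notin> aR\<close> with \<open>c m \<subseteq> aR\<close>. So \<open>y = c/a\<close> maps \<open>m\<close> to \<open>R\<close>, but not to \<open>m\<close>, as \<open>y\<close> would
  otherwise be integral over \<open>R\<close>, and hence in \<open>R\<close>. Take \<open>\<pi> \<in> m\<close> with \<open>s = y \<pi> \<notin> m\<close>; for \<open>t \<in> m\<close> one
  has \<open>s t = \<pi> (y t)\<close>.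
\<close>
lemma (in noetherian_domain) maximal_ideal_locally_principal:
  assumes ded: "dedekind_ring R" and m: "maximalideal m R" "m \<noteq> {\<zero>}"
  shows "\<exists>\<pi>\<in>m. \<exists>s\<in>carrier R - m. \<pi> \<noteq> \<zero> \<and> (\<forall>t\<in>m. \<exists>u\<in>carrier R. s \<otimes> t = \<pi> \<otimes> u)"
proof -
  interpret m: maximalideal m R by (rule m(1))
  interpret mp: primeideal m R by (rule maximalideal_prime[OF m(1)])
  let ?S = "carrier R - m"
  have S_mult: "s \<otimes> t \<in> ?S" if "s \<in> ?S" "t \<in> ?S" for s t using that mp.I_prime by auto
  have S_one: "\<one> \<in> ?S" using m.one_imp_carrier m.I_notcarr by auto
  obtain a where a: "a \<in> m" "a \<noteq> \<zero>" using m(2) m.zero_closed by blast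
  have aR: "a \<in> carrier R" using a m.Icarr by blast
  \<comment> \<open>The contraction to \<open>R\<close> of the ideal generated by \<open>a\<close> in the localization.\<close>
  define I where "I = {x \<in> carrier R. \<exists>s\<in>?S. \<exists>u\<in>carrier R. s \<otimes> x = a \<otimes> u}"
  have I_ideal: "ideal I R"
  proof (rule ideal_setI)
    show "\<zero> \<in> I" unfolding I_def using S_one aR by (auto intro!: bexI[of _ \<one>] bexI[of _ \<zero>])
  next
    fix x y assume "x \<in> I" "y \<in> I"
    then obtain s u s' u' where *: "x \<in> carrier R" "y \<in> carrier R" "s \<in> ?S" "s' \<in> ?S" "u \<in> carrier R" "u' \<in> carrier R"
      "s \<otimes> x = a \<otimes> u" "s' \<otimes> y = a \<otimes> u'" unfolding I_def by blast
    have "(s \<otimes> s') \<otimes> (x \<oplus> y) = s' \<otimes> (s \<otimes> x) \<oplus> s \<otimes> (s' \<otimes> y)" using *(1-6) by (simp add: r_distr m_ac)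
    also have "\<dots> = a \<otimes> (s' \<otimes> u \<oplus> s \<otimes> u')" unfolding *(7,8) using *(1-6) aR by (simp add: r_distr m_ac)
    finally show "x \<oplus> y \<in> I"
      unfolding I_def using * S_mult[OF *(3,4)] by (intro CollectI conjI bexI[of _ "s \<otimes> s'"] bexI[of _ "s' \<otimes> u \<oplus> s \<otimes> u'"]) auto
  next
    fix r x assume r: "r \<in> carrier R" and "x \<in> I"
    then obtain s u where *: "x \<in> carrier R" "s \<in> ?S" "u \<in> carrier R" "s \<otimes> x = a \<otimes> u" unfolding I_def by blast
    have "s \<otimes> (r \<otimes> x) = r \<otimes> (s \<otimes> x)" using *(1-3) r by (simp add: m_ac)
    also have "\<dots> = a \<otimes> (r \<otimes> u)" unfolding *(4) using *(1-3) r aR by (simp add: m_ac)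
    finally show "r \<otimes> x \<in> I" unfolding I_def using * r by (intro CollectI conjI bexI[OF _ *(2)] bexI[of _ "r \<otimes> u"]) auto
  qed (auto simp: I_def)
  interpret I: ideal I R by (rule I_ideal)
  have one_I: "\<one> \<notin> I"
  proof
    assume "\<one> \<in> I"
    then obtain s u where "s \<in> ?S" "u \<in> carrier R" "s = a \<otimes> u" unfolding I_def by auto
    then show False using m.I_r_closed[OF a(1)] by auto
  qed
  define C where "C = {{r \<in> carrier R. r \<otimes> b \<in> I} |b. b \<in> carrier R \<and> b \<notin> I}"
  obtain P where P: "P \<in> C" "primeideal P R"
  proof (rule exists_prime_in_colon_closed_family[of C])
    show "C \<noteq> {}" unfolding C_def using one_I by auto
    show "J \<noteq> carrier R" if J: "J \<in> C" for J
    proof -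
      obtain b where "J = {r \<in> carrier R. r \<otimes> b \<in> I}" "b \<in> carrier R" "b \<notin> I" using J unfolding C_def by blast
      then have "\<one> \<notin> J" by simp
      then show ?thesis by auto
    qed
    show "ideal J R" if J: "J \<in> C" for J
    proof -
      obtain b where b: "J = {r \<in> carrier R. r \<otimes> b \<in> I}" "b \<in> carrier R" using J unfolding C_def by blast
      show ?thesis unfolding b(1)
        by (rule ideal_setI) (use b(2) I.zero_closed I.a_closed I.I_l_closed in \<open>auto simp: l_distr m_assoc\<close>)
    qed
    show "{r \<in> carrier R. r \<otimes> x \<in> J} \<in> C" if J: "J \<in> C" and x: "x \<in> carrier R" "x \<notin> J" for J x
    proof -
      obtain b where b: "J = {r \<in> carrier R. r \<otimes> b \<in> I}" "b \<in> carrier R" using J unfolding C_def by blast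
      have "{r \<in> carrier R. r \<otimes> x \<in> J} = {r \<in> carrier R. r \<otimes> (x \<otimes> b) \<in> I}" using b x by (auto simp: m_assoc)
      moreover have "x \<otimes> b \<notin> I" using b x by auto
      ultimately show ?thesis unfolding C_def using b x by blast
    qed
  qed
  obtain b where b: "P = {r \<in> carrier R. r \<otimes> b \<in> I}" "b \<in> carrier R" "b \<notin> I" using P(1) unfolding C_def by blast
  have "a \<otimes> b \<in> I" unfolding I_def using aR b(2)
    by (intro CollectI conjI bexI[OF _ S_one] bexI[OF _ b(2)]) simp_all
  then have aP: "a \<in> P" unfolding b(1) using aR by simp
  then have "P \<noteq> {\<zero>}" using a(2) by auto
  then have Pmax: "maximalideal P R" using ded P(2) by (simp add: dedekind_ring_def)
  have "P \<subseteq> m"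
  proof
    fix r assume r: "r \<in> P"
    show "r \<in> m"
    proof (rule ccontr)
      assume "r \<notin> m"
      then have rS: "r \<in> ?S" using r b(1) by auto
      obtain s u where *: "s \<in> ?S" "u \<in> carrier R" "s \<otimes> (r \<otimes> b) = a \<otimes> u" using r b(1) unfolding I_def by auto
      have "(s \<otimes> r) \<otimes> b = a \<otimes> u" using * b(2) rS by (simp add: m_assoc)
      then have "b \<in> I" unfolding I_def using b(2) *(2) S_mult[OF *(1) rS] by blast
      then show False using b(3) by simp
    qed
  qed
  then have Pm: "P = m" using maximalideal.I_maximal[OF Pmax m.is_ideal] m.a_subset m.I_notcarr by auto
  obtain T where T: "T \<subseteq> carrier R" "finite T" "m = Idl T" using finetely_gen[OF m.is_ideal] by blast
  have Tm: "T \<subseteq> m" using genideal_self[OF T(1)] T(3) by simp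
  have gen: "\<exists>s\<in>?S. \<exists>u\<in>carrier R. s \<otimes> (x \<otimes> b) = a \<otimes> u" if "x \<in> m" for x
    using that b(1) Pm unfolding I_def by auto
  \<comment> \<open>Since \<open>m\<close> is finitely generated, one denominator serves all its elements.\<close>
  have "\<exists>s\<in>?S. \<forall>x\<in>T. \<exists>u\<in>carrier R. s \<otimes> (x \<otimes> b) = a \<otimes> u"
    using T(2) Tm
  proof (induction T)
    case empty
    then show ?case using S_one by blast
  next
    case (insert x T)
    then obtain s where s: "s \<in> ?S" "\<And>x. x \<in> T \<Longrightarrow> \<exists>u\<in>carrier R. s \<otimes> (x \<otimes> b) = a \<otimes> u" by auto
    obtain w v where w: "w \<in> ?S" "v \<in> carrier R" "w \<otimes> (x \<otimes> b) = a \<otimes> v" using gen[of x] insert.prems by auto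
    have "\<exists>u\<in>carrier R. (s \<otimes> w) \<otimes> (z \<otimes> b) = a \<otimes> u" if z: "z \<in> insert x T" for z
    proof -
      have zR: "z \<in> carrier R" using z insert.prems m.Icarr by auto
      show ?thesis
      proof (cases "z = x")
        case True
        have "(s \<otimes> w) \<otimes> (z \<otimes> b) = s \<otimes> (w \<otimes> (x \<otimes> b))" using True s(1) w(1,2) zR b(2) by (simp add: m_assoc)
        also have "\<dots> = a \<otimes> (s \<otimes> v)" unfolding w(3) using s(1) w(1,2) aR by (simp add: m_ac)
        finally show ?thesis using s(1) w(2) by blast
      next
        case False
        then obtain u where u: "u \<in> carrier R" "s \<otimes> (z \<otimes> b) = a \<otimes> u" using s(2) z by blast
        have "(s \<otimes> w) \<otimes> (z \<otimes> b) = w \<otimes> (s \<otimes> (z \<otimes> b))" using s(1) w(1,2) zR b(2) by (simp add: m_ac)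
        also have "\<dots> = a \<otimes> (w \<otimes> u)" unfolding u(2) using u(1) w(1,2) aR by (simp add: m_ac)
        finally show ?thesis using w(1) u(1) by blast
      qed
    qed
    then show ?case using S_mult[OF s(1) w(1)] by blast
  qed
  then obtain s0 where s0: "s0 \<in> ?S" "\<And>x. x \<in> T \<Longrightarrow> \<exists>u\<in>carrier R. s0 \<otimes> (x \<otimes> b) = a \<otimes> u" by blast
  define c where "c = s0 \<otimes> b"
  have cR: "c \<in> carrier R" unfolding c_def using s0 b by simp
  have c_not: "c \<noteq> a \<otimes> u" if "u \<in> carrier R" for u
    using that s0(1) b(2,3) unfolding c_def I_def by auto
  define J where "J = {x \<in> carrier R. \<exists>u\<in>carrier R. c \<otimes> x = a \<otimes> u}"
  have "ideal J R"
  proof (rule ideal_setI)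
    show "\<zero> \<in> J" unfolding J_def using aR cR by (auto intro!: bexI[of _ \<zero>])
  next
    fix x y assume "x \<in> J" "y \<in> J"
    then obtain u v where "x \<in> carrier R" "y \<in> carrier R" "u \<in> carrier R" "v \<in> carrier R" "c \<otimes> x = a \<otimes> u" "c \<otimes> y = a \<otimes> v"
      unfolding J_def by blast
    then show "x \<oplus> y \<in> J" unfolding J_def using aR cR by (auto simp: r_distr intro!: bexI[of _ "u \<oplus> v"])
  next
    fix r x assume r: "r \<in> carrier R" and "x \<in> J"
    then obtain u where u: "x \<in> carrier R" "u \<in> carrier R" "c \<otimes> x = a \<otimes> u" unfolding J_def by blast
    have "c \<otimes> (r \<otimes> x) = r \<otimes> (c \<otimes> x)" using r u(1,2) cR by (simp add: m_ac)
    also have "\<dots> = a \<otimes> (r \<otimes> u)" unfolding u(3) using r u(1,2) aR by (simp add: m_ac)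
    finally show "r \<otimes> x \<in> J" unfolding J_def using r u by blast
  qed (auto simp: J_def)
  moreover have "T \<subseteq> J"
  proof
    fix x assume x: "x \<in> T"
    then obtain u where u: "u \<in> carrier R" "s0 \<otimes> (x \<otimes> b) = a \<otimes> u" using s0(2) by blast
    have "c \<otimes> x = s0 \<otimes> (x \<otimes> b)" unfolding c_def using x T(1) s0(1) b(2) by (auto simp: m_ac subset_iff)
    then show "x \<in> J" unfolding J_def using u x T(1) by auto
  qed
  ultimately have mJ: "m \<subseteq> J" unfolding T(3) by (rule genideal_minimal)
  have "\<exists>x\<in>m. \<exists>u\<in>?S. c \<otimes> x = a \<otimes> u"
  proof (rule ccontr)
    assume neg: "\<not> ?thesis"
    have "\<forall>x\<in>m. \<exists>u\<in>m. c \<otimes> x = a \<otimes> u" using mJ neg unfolding J_def by blast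
    then obtain f where f: "\<And>x. x \<in> m \<Longrightarrow> f x \<in> m" "\<And>x. x \<in> m \<Longrightarrow> c \<otimes> x = a \<otimes> f x" by metis
    define t where "t = (\<lambda>n. (f ^^ n) a)"
    have t: "t n \<in> m" for n unfolding t_def by (induction n) (use a f in auto)
    have "\<exists>r\<in>carrier R. c = a \<otimes> r"
    proof (rule integral_of_stable_sequence[OF _ aR a(2) cR])
      show "integrally_closed R" using ded by (simp add: dedekind_ring_def)
      show "t 0 \<noteq> \<zero>" using a by (simp add: t_def)
      show "t n \<in> carrier R" for n using t m.Icarr by blast
      show "c \<otimes> t n = a \<otimes> t (Suc n)" for n using f(2)[OF t] by (simp add: t_def)
    qed
    then show False using c_not by blast
  qed
  then obtain \<pi> s where \<pi>: "\<pi> \<in> m" "s \<in> ?S" "c \<otimes> \<pi> = a \<otimes> s" by blast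
  have R: "\<pi> \<in> carrier R" "s \<in> carrier R" using \<pi> m.Icarr by auto
  have "\<pi> \<noteq> \<zero>"
  proof
    assume "\<pi> = \<zero>"
    then have "a \<otimes> s = \<zero>" using \<pi>(3) cR by simp
    then have "s = \<zero>" using integral[of a s] a(2) aR R by blast
    then show False using \<pi>(2) m.zero_closed by auto
  qed
  moreover have "\<exists>u\<in>carrier R. s \<otimes> t = \<pi> \<otimes> u" if t: "t \<in> m" for t
  proof -
    obtain u where u: "u \<in> carrier R" "c \<otimes> t = a \<otimes> u" using mJ t unfolding J_def by blast
    have tR: "t \<in> carrier R" using t m.Icarr by blast
    have "a \<otimes> (s \<otimes> t) = (a \<otimes> s) \<otimes> t" using aR R tR by (simp add: m_assoc)
    also have "\<dots> = \<pi> \<otimes> (c \<otimes> t)" unfolding \<pi>(3)[symmetric] using cR R tR by (simp add: m_ac)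
    also have "\<dots> = a \<otimes> (\<pi> \<otimes> u)" unfolding u(2) using aR R u(1) by (simp add: m_ac)
    finally have "s \<otimes> t = \<pi> \<otimes> u" using m_lcancel[OF a(2) aR] R tR u(1) by simp
    then show ?thesis using u(1) by blast
  qed
  ultimately show ?thesis using \<pi>(1,2) by blast
qed

section \<open>Flatness over a Dedekind ring\<close>

text \<open>The relation \<open>r m = 0\<close> follows from relations \<open>r d\<^sub>j = 0\<close> in \<open>R\<close>, where \<open>m = \<Sum> d\<^sub>j y\<^sub>j\<close>; in a domain all \<open>d\<^sub>j\<close> vanish.\<close>
lemma flat_imp_torsion_free:
  assumes R: "domain R" and flat: "flat R M" and r: "r \<in> carrier R" "r \<noteq> \<zero>\<^bsub>R\<^esub>"
    and m: "m \<in> carrier M" "r \<odot>\<^bsub>M\<^esub> m = \<zero>\<^bsub>M\<^esub>"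
  shows "m = \<zero>\<^bsub>M\<^esub>"
proof -
  interpret R: "domain" R by fact
  interpret M: left_module R M using flat by (simp add: flat_def)
  interpret F: left_module R "free_cover R M" by (rule R.left_module_free_module)
  note bm = R.basis_vec_closed[OF m(1)]
  let ?q = "r \<odot>\<^bsub>free_cover R M\<^esub> basis_vec R m"
  have q: "?q \<in> carrier (free_cover R M)" by (rule F.lsmult_closed[OF r(1) bm])
  have "presentation R M ?q = \<zero>\<^bsub>M\<^esub>"
    using mod_homD(3)[OF M.presentation_hom r(1) bm] m by (simp add: M.presentation_basis_vec)
  then obtain \<theta> where \<theta>: "\<theta> \<in> mod_hom R (free_cover R M) (free_cover R M)"
    "\<And>f. f \<in> carrier (free_cover R M) \<Longrightarrow> presentation R M (\<theta> f) = presentation R M f"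
    "\<theta> ?q = \<zero>\<^bsub>free_cover R M\<^esub>"
    using M.equationalD[OF flat_imp_equational[OF flat] q] by blast
  note \<theta>b = mod_homD(1)[OF \<theta>(1) bm]
  have "r \<odot>\<^bsub>free_cover R M\<^esub> \<theta> (basis_vec R m) = \<zero>\<^bsub>free_cover R M\<^esub>"
    using \<theta>(3) mod_homD(3)[OF \<theta>(1) r(1) bm] by simp
  then have "\<theta> (basis_vec R m) b = \<zero>\<^bsub>R\<^esub>" for b
    using R.integral[of r "\<theta> (basis_vec R m) b"] r R.free_module_closed[OF \<theta>b]
    by (auto simp: free_module_simps fun_eq_iff)
  then have "\<theta> (basis_vec R m) = \<zero>\<^bsub>free_cover R M\<^esub>" by (simp add: free_module_simps fun_eq_iff)
  then show ?thesis
    using \<theta>(2)[OF bm] F.mod_hom_zero_minus(1)[OF M.presentation_hom M.left_module_axioms]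
    by (simp add: M.presentation_basis_vec m(1))
qed

lemma ideal_times_divides:
  assumes M: "module R M" and J: "J \<subseteq> carrier R" and \<pi>: "\<pi> \<in> carrier R" and s: "s \<in> carrier R"
    and div: "\<And>t. t \<in> J \<Longrightarrow> \<exists>u\<in>carrier R. s \<otimes>\<^bsub>R\<^esub> t = \<pi> \<otimes>\<^bsub>R\<^esub> u"
    and x: "x \<in> ideal_times J M"
  shows "\<exists>y\<in>carrier M. s \<odot>\<^bsub>M\<^esub> x = \<pi> \<odot>\<^bsub>M\<^esub> y"
proof -
  interpret module R M by fact
  show ?thesis using x
  proof induction
    case zero
    show ?case using \<pi> s by (intro bexI[of _ "\<zero>\<^bsub>M\<^esub>"]) simp_all
  next
    case (step r m x)
    then obtain y u where y: "y \<in> carrier M" "s \<odot>\<^bsub>M\<^esub> x = \<pi> \<odot>\<^bsub>M\<^esub> y" and u: "u \<in> carrier R" "s \<otimes>\<^bsub>R\<^esub> r = \<pi> \<otimes>\<^bsub>R\<^esub> u"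
      using div by blast
    have c: "r \<in> carrier R" "m \<in> carrier M" "x \<in> carrier M"
      using step J ideal_times_closed[OF module_left_right(1)[OF M] J] by auto
    have "s \<odot>\<^bsub>M\<^esub> (r \<odot>\<^bsub>M\<^esub> m \<oplus>\<^bsub>M\<^esub> x) = (s \<otimes>\<^bsub>R\<^esub> r) \<odot>\<^bsub>M\<^esub> m \<oplus>\<^bsub>M\<^esub> s \<odot>\<^bsub>M\<^esub> x"
      using c s by (simp add: smult_r_distr smult_assoc1)
    also have "\<dots> = \<pi> \<odot>\<^bsub>M\<^esub> (u \<odot>\<^bsub>M\<^esub> m \<oplus>\<^bsub>M\<^esub> y)"
      unfolding u(2) y(2) using c \<pi> u(1) y(1) by (simp add: smult_r_distr smult_assoc1)
    finally show ?case using c u(1) y(1) by (intro bexI[of _ "u \<odot>\<^bsub>M\<^esub> m \<oplus>\<^bsub>M\<^esub> y"]) simp_all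
  qed
qed

lemma (in "domain") residue_field_at_fraction_field:
  "residue_field_at R (fraction_field R) (to_fraction_field R) {\<zero>}"
proof (rule residue_field_at.intro)
  show "cring R" "field (fraction_field R)" "to_fraction_field R \<in> ring_hom R (fraction_field R)"
    "primeideal {\<zero>} R"
    by (rule is_cring field_fraction_field to_fraction_field_hom zeroprimeideal)+
  show "to_fraction_field R r = \<zero>\<^bsub>fraction_field R\<^esub> \<longleftrightarrow> r \<in> {\<zero>}" if "r \<in> carrier R" for r
    using that by (simp add: to_fraction_field_def zero_one_fraction_field frac_eq_iff)
  show "\<exists>s\<in>carrier R - {\<zero>}. \<exists>r\<in>carrier R. to_fraction_field R s \<otimes>\<^bsub>fraction_field R\<^esub> x = to_fraction_field R r"
    if x: "x \<in> carrier (fraction_field R)" for x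
  proof -
    obtain a b where ab: "x = fraction R a b" "a \<in> carrier R" "b \<in> carrier R - {\<zero>}"
      using x unfolding carrier_fraction_field by blast
    have "to_fraction_field R b \<otimes>\<^bsub>fraction_field R\<^esub> x = to_fraction_field R a"
      unfolding to_fraction_field_def ab(1) using ab(2,3)
      by (subst mult_fraction_field) (auto simp: frac_eq_iff m_comm)
    then show ?thesis using ab by blast
  qed
qed

lemma (in cring) residue_field_at_quotient:
  assumes "maximalideal m R"
  shows "residue_field_at R (R Quot m) (\<lambda>r. m +> r) m"
proof -
  interpret m: maximalideal m R by fact
  show ?thesis
  proof (rule residue_field_at.intro)
    show "cring R" "field (R Quot m)" "primeideal m R" "(\<lambda>r. m +> r) \<in> ring_hom R (R Quot m)"
      by (rule is_cring m.quotient_is_field[OF is_cring] maximalideal_prime[OF assms] m.rcos_ring_hom)+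
    show "m +> r = \<zero>\<^bsub>R Quot m\<^esub> \<longleftrightarrow> r \<in> m" if "r \<in> carrier R" for r
      using that m.rcos_const_imp_mem[of r] m.a_rcos_const[of r] by (auto simp: FactRing_def)
    show "\<exists>s\<in>carrier R - m. \<exists>r\<in>carrier R. (m +> s) \<otimes>\<^bsub>R Quot m\<^esub> x = m +> r" if x: "x \<in> carrier (R Quot m)" for x
    proof (rule bexI[of _ \<one>])
      obtain r where r: "r \<in> carrier R" "x = m +> r" using x by (auto simp: FactRing_def A_RCOSETS_def')
      have "(m +> \<one>) \<otimes>\<^bsub>R Quot m\<^esub> x = m +> r"
        using ring_hom_mult[OF m.rcos_ring_hom one_closed r(1)] r by simp
      then show "\<exists>r\<in>carrier R. (m +> \<one>) \<otimes>\<^bsub>R Quot m\<^esub> x = m +> r" using r(1) by blast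
    qed (use m.one_imp_carrier m.I_notcarr in auto)
  qed
qed

lemma (in residue_field_at) flat_base_change:
  assumes "assoc_algebra R A" "left_module A B" "flat A B"
  shows "flat (base_change_ring R A k \<phi>) (base_change_module R A B k \<phi>)"
  by (rule equational_imp_flat[OF left_module_base_change_module[OF assms(1) k.is_cring hom assms(2)]
      residue_extension.equational_extension[OF residue_extension_base_change[OF assms(1,2)] flat_imp_equational[OF assms(3)]]])

lemma (in residue_field_at) equational_mod_of_flat_base_change:
  assumes "assoc_algebra R A" "left_module A B"
    "flat (base_change_ring R A k \<phi>) (base_change_module R A B k \<phi>)"
  shows "equational_mod A B ((\<lambda>s. s \<odot>\<^bsub>A\<^esub> \<one>\<^bsub>A\<^esub>) ` (carrier R - p)) (ideal_times p A) (ideal_times p (restrict_scalars A B))"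
  by (rule residue_extension.equational_mod_contraction[OF residue_extension_base_change[OF assms(1,2)]
      flat_imp_equational[OF assms(3)]])

text \<open>
  For a relation \<open>q\<close>, the fraction field yields \<open>r\<^sub>0 \<noteq> 0\<close> such that \<open>r\<^sub>0 q\<close> is a syzygy multiple. If \<open>q\<close> itself is not
  one, some multiple \<open>c q\<close> is not a syzygy multiple and has a prime annihilator \<open>P\<close> modulo the syzygy multiples. As
  \<open>P\<close> contains \<open>r\<^sub>0\<close>, it is maximal. Cancelling a local generator of \<open>P\<close> puts \<open>w s c q\<close>, for some \<open>w\<close> and \<open>s\<close> outside
  \<open>P\<close>, among the syzygy multiples, a contradiction.
\<close>
lemma flat_of_flat_residue_fields:
  fixes R :: "('r, 'x) ring_scheme" and A :: "('r, 'a, 'y) module_scheme" and B :: "('a, 'b, 'z) module_scheme"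
  assumes ded: "dedekind_ring R" and A: "assoc_algebra R A" and B: "left_module A B"
    and flatA: "flat R A" and flatB: "flat R (restrict_scalars A B)"
    and generic: "flat (base_change_ring R A (fraction_field R) (to_fraction_field R))
      (base_change_module R A B (fraction_field R) (to_fraction_field R))"
    and closed: "\<And>\<mm>. maximalideal \<mm> R \<Longrightarrow> flat (base_change_ring R A (R Quot \<mm>) (\<lambda>r. \<mm> +>\<^bsub>R\<^esub> r))
      (base_change_module R A B (R Quot \<mm>) (\<lambda>r. \<mm> +>\<^bsub>R\<^esub> r))"
  shows "flat A B"
proof (rule equational_imp_flat[OF B])
  interpret R: noetherian_domain R using ded by (simp add: dedekind_ring_def)
  interpret A: assoc_algebra R A by fact
  interpret B: left_module A B by fact
  let ?F = "free_cover A B" and ?p = "presentation A B"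
  interpret F: left_module A ?F by (rule A.left_module_free_module)
  \<comment> \<open>The image of \<open>R\<close> in the centre of \<open>A\<close>.\<close>
  define hat where "hat = (\<lambda>r. r \<odot>\<^bsub>A\<^esub> \<one>\<^bsub>A\<^esub>)"
  have hat: "r \<in> carrier R \<Longrightarrow> hat r \<in> carrier A" for r by (simp add: hat_def)
  have hat_central: "hat r \<otimes>\<^bsub>A\<^esub> a = a \<otimes>\<^bsub>A\<^esub> hat r" if "r \<in> carrier R" "a \<in> carrier A" for r a
    using that by (simp add: hat_def A.smult_one_central)
  have hat_mult: "hat (r \<otimes>\<^bsub>R\<^esub> s) = hat r \<otimes>\<^bsub>A\<^esub> hat s" if "r \<in> carrier R" "s \<in> carrier R" for r s
    using that by (simp add: hat_def A.smult_one_mult)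
  have hat_smult: "hat r \<otimes>\<^bsub>A\<^esub> a = r \<odot>\<^bsub>A\<^esub> a" if "r \<in> carrier R" "a \<in> carrier A" for r a
    using that by (simp add: hat_def A.smult_one_central)
  show "equational A B"
  proof (rule B.equationalI)
    fix q assume q: "q \<in> carrier ?F" "?p q = \<zero>\<^bsub>B\<^esub>"
    let ?Z = "syzygy_multiples A B q"
    have hq: "hat r \<odot>\<^bsub>?F\<^esub> q \<in> carrier ?F" if "r \<in> carrier R" for r
      by (rule F.lsmult_closed[OF hat[OF that] q(1)])
    have hmq: "hat (r \<otimes>\<^bsub>R\<^esub> s) \<odot>\<^bsub>?F\<^esub> q = hat r \<odot>\<^bsub>?F\<^esub> (hat s \<odot>\<^bsub>?F\<^esub> q)" if "r \<in> carrier R" "s \<in> carrier R" for r s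
      using that q(1) by (simp add: hat_mult F.lsmult_assoc hat)
    have Zmult: "hat (r \<otimes>\<^bsub>R\<^esub> s) \<odot>\<^bsub>?F\<^esub> q \<in> ?Z" if "r \<in> carrier R" "s \<in> carrier R" "hat s \<odot>\<^bsub>?F\<^esub> q \<in> ?Z" for r s
      unfolding hmq[OF that(1,2)] by (rule B.syzygy_multiples_central[OF hat[OF that(1)] hat_central[OF that(1)] that(3)])
    obtain r0 where r0: "r0 \<in> carrier R" "r0 \<noteq> \<zero>\<^bsub>R\<^esub>" "hat r0 \<odot>\<^bsub>?F\<^esub> q \<in> ?Z"
    proof -
      interpret K: residue_field_at R "fraction_field R" "to_fraction_field R" "{\<zero>\<^bsub>R\<^esub>}"
        by (rule R.residue_field_at_fraction_field)
      note eq = K.equational_mod_of_flat_base_change[OF A B generic, folded hat_def]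
      note zA = ideal_times_zero_ideal[OF module_left_right(1)[OF A.module_axioms]]
      note zB = ideal_times_zero_ideal[OF module_left_right(1)[OF module_restrict_scalars(1)[OF A B]]]
      have "?p q \<in> ideal_times {\<zero>\<^bsub>R\<^esub>} (restrict_scalars A B)"
        using ideal_times.zero[of "restrict_scalars A B" "{\<zero>\<^bsub>R\<^esub>}"] q(2) by simp
      then obtain \<sigma> \<theta> where \<theta>: "\<sigma> \<in> hat ` (carrier R - {\<zero>\<^bsub>R\<^esub>})" "\<theta> \<in> mod_hom A ?F ?F"
        "\<And>f. f \<in> carrier ?F \<Longrightarrow> ?p (\<theta> f) \<ominus>\<^bsub>B\<^esub> \<sigma> \<odot>\<^bsub>B\<^esub> ?p f \<in> ideal_times {\<zero>\<^bsub>R\<^esub>} (restrict_scalars A B)"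
        "\<And>b. \<theta> q b \<in> ideal_times {\<zero>\<^bsub>R\<^esub>} A"
        using eq[unfolded equational_mod_def, rule_format, OF q(1)] by blast
      obtain r where r: "r \<in> carrier R" "r \<noteq> \<zero>\<^bsub>R\<^esub>" "\<sigma> = hat r" using \<theta>(1) by blast
      have p\<theta>: "?p (\<theta> f) = \<sigma> \<odot>\<^bsub>B\<^esub> ?p f" if "f \<in> carrier ?F" for f
        using zB[OF \<theta>(3)[OF that]] that r hat[OF r(1)]
        by (simp add: B.minus_eq_zero_iff B.presentation_closed mod_homD(1)[OF \<theta>(2)] B.lsmult_closed)
      have \<theta>q: "\<theta> q = \<zero>\<^bsub>?F\<^esub>" using zA[OF \<theta>(4)] by (simp add: free_module_simps fun_eq_iff)
      let ?G = "\<lambda>f. hat r \<odot>\<^bsub>?F\<^esub> f \<ominus>\<^bsub>?F\<^esub> \<theta> f"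
      have G: "?G \<in> mod_hom A ?F ?F"
        by (rule F.mod_hom_minus[OF F.left_module_axioms F.mod_hom_central[OF hat[OF r(1)] hat_central[OF r(1)] mod_hom_id] \<theta>(2)])
      have "?p (?G f) = \<zero>\<^bsub>B\<^esub>" if "f \<in> carrier ?F" for f
        using that hat[OF r(1)] by (simp add: F.mod_hom_zero_minus(3)[OF B.presentation_hom B] F.lsmult_closed
          mod_homD(1)[OF \<theta>(2)] p\<theta> r(3) mod_homD(3)[OF B.presentation_hom] B.minus_eq_zero_iff B.lsmult_closed B.presentation_closed)
      moreover have "?G q = hat r \<odot>\<^bsub>?F\<^esub> q" unfolding \<theta>q using hq[OF r(1)] by (simp add: a_minus_def)
      ultimately have "hat r \<odot>\<^bsub>?F\<^esub> q \<in> ?Z" unfolding syzygy_multiples_def using G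
        by (intro CollectI exI[of _ ?G]) simp
      then show thesis using that r(1,2) by blast
    qed
    \<comment> \<open>The annihilator of the class of \<open>c q\<close>.\<close>
    define ann where "ann = (\<lambda>c. {r \<in> carrier R. hat (r \<otimes>\<^bsub>R\<^esub> c) \<odot>\<^bsub>?F\<^esub> q \<in> ?Z})"
    define C where "C = {ann c |c. c \<in> carrier R \<and> hat c \<odot>\<^bsub>?F\<^esub> q \<notin> ?Z}"
    show "q \<in> ?Z"
    proof (rule ccontr)
      assume qZ: "q \<notin> ?Z"
      have hat1: "hat \<one>\<^bsub>R\<^esub> \<odot>\<^bsub>?F\<^esub> q = q" using q(1) by (simp add: hat_def F.lsmult_one)
      obtain P where P: "P \<in> C" "primeideal P R"
      proof (rule R.exists_prime_in_colon_closed_family[of C])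
        show "C \<noteq> {}" unfolding C_def using qZ hat1 R.one_closed by force
        show "J \<noteq> carrier R" if J: "J \<in> C" for J
        proof -
          obtain c where "J = ann c" "c \<in> carrier R" "hat c \<odot>\<^bsub>?F\<^esub> q \<notin> ?Z" using J unfolding C_def by blast
          then have "\<one>\<^bsub>R\<^esub> \<notin> J" by (simp add: ann_def)
          then show ?thesis by auto
        qed
        show "ideal J R" if J: "J \<in> C" for J
        proof -
          obtain c where c: "J = ann c" "c \<in> carrier R" using J unfolding C_def by blast
          show ?thesis unfolding c(1)
          proof (rule R.ideal_setI)
            have "hat (\<zero>\<^bsub>R\<^esub> \<otimes>\<^bsub>R\<^esub> c) \<odot>\<^bsub>?F\<^esub> q = \<zero>\<^bsub>?F\<^esub>" using c(2) q(1) by (simp add: hat_def F.zero_lsmult)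
            then show "\<zero>\<^bsub>R\<^esub> \<in> ann c" unfolding ann_def using B.syzygy_multiples_zero by simp
          next
            fix x y assume "x \<in> ann c" "y \<in> ann c"
            then have xy: "x \<in> carrier R" "y \<in> carrier R" "hat (x \<otimes>\<^bsub>R\<^esub> c) \<odot>\<^bsub>?F\<^esub> q \<in> ?Z" "hat (y \<otimes>\<^bsub>R\<^esub> c) \<odot>\<^bsub>?F\<^esub> q \<in> ?Z"
              by (auto simp: ann_def)
            have "hat ((x \<oplus>\<^bsub>R\<^esub> y) \<otimes>\<^bsub>R\<^esub> c) = hat (x \<otimes>\<^bsub>R\<^esub> c) \<oplus>\<^bsub>A\<^esub> hat (y \<otimes>\<^bsub>R\<^esub> c)"
              using xy(1,2) c(2) by (simp add: hat_def R.l_distr A.smult_l_distr)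
            then have "hat ((x \<oplus>\<^bsub>R\<^esub> y) \<otimes>\<^bsub>R\<^esub> c) \<odot>\<^bsub>?F\<^esub> q = hat (x \<otimes>\<^bsub>R\<^esub> c) \<odot>\<^bsub>?F\<^esub> q \<oplus>\<^bsub>?F\<^esub> hat (y \<otimes>\<^bsub>R\<^esub> c) \<odot>\<^bsub>?F\<^esub> q"
              using F.lsmult_l_distr[OF hat hat q(1), of "x \<otimes>\<^bsub>R\<^esub> c" "y \<otimes>\<^bsub>R\<^esub> c"] xy(1,2) c(2) by simp
            then show "x \<oplus>\<^bsub>R\<^esub> y \<in> ann c" unfolding ann_def using xy B.syzygy_multiples_add[OF xy(3,4)] by simp
          next
            fix r x assume r: "r \<in> carrier R" and x: "x \<in> ann c"
            then show "r \<otimes>\<^bsub>R\<^esub> x \<in> ann c"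
              using Zmult[of r "x \<otimes>\<^bsub>R\<^esub> c"] c(2) by (simp add: ann_def R.m_assoc)
          qed (auto simp: ann_def)
        qed
        show "{r \<in> carrier R. r \<otimes>\<^bsub>R\<^esub> x \<in> J} \<in> C" if J: "J \<in> C" and x: "x \<in> carrier R" "x \<notin> J" for J x
        proof -
          obtain c where c: "J = ann c" "c \<in> carrier R" using J unfolding C_def by blast
          have "{r \<in> carrier R. r \<otimes>\<^bsub>R\<^esub> x \<in> J} = ann (x \<otimes>\<^bsub>R\<^esub> c)" using c x by (auto simp: ann_def R.m_assoc)
          moreover have "hat (x \<otimes>\<^bsub>R\<^esub> c) \<odot>\<^bsub>?F\<^esub> q \<notin> ?Z" using c x by (auto simp: ann_def)
          ultimately show ?thesis unfolding C_def using c x by blast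
        qed
      qed
      obtain c where c: "P = ann c" "c \<in> carrier R" using P(1) unfolding C_def by blast
      have "r0 \<in> P" unfolding c(1) ann_def using r0(1) c(2) Zmult[OF c(2) r0(1,3)] by (simp add: R.m_comm)
      then have "P \<noteq> {\<zero>\<^bsub>R\<^esub>}" using r0(2) by auto
      then have Pmax: "maximalideal P R" using ded P(2) by (simp add: dedekind_ring_def)
      interpret p: residue_field_at R "R Quot P" "\<lambda>r. P +>\<^bsub>R\<^esub> r" P by (rule R.residue_field_at_quotient[OF Pmax])
      obtain \<pi> s where \<pi>: "\<pi> \<in> P" "s \<in> carrier R" "s \<notin> P" "\<pi> \<noteq> \<zero>\<^bsub>R\<^esub>"
        "\<And>t. t \<in> P \<Longrightarrow> \<exists>u\<in>carrier R. s \<otimes>\<^bsub>R\<^esub> t = \<pi> \<otimes>\<^bsub>R\<^esub> u"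
        using R.maximal_ideal_locally_principal[OF ded Pmax \<open>P \<noteq> {\<zero>\<^bsub>R\<^esub>}\<close>] by blast
      have PR: "P \<subseteq> carrier R" unfolding c(1) ann_def by auto
      have \<pi>R: "\<pi> \<in> carrier R" using \<pi>(1) PR by auto
      let ?\<Sigma> = "hat ` (carrier R - P)"
      interpret S: scaled_ideal A B ?\<Sigma> "ideal_times P A" "ideal_times P (restrict_scalars A B)"
        unfolding hat_def by (rule p.scaled_ideal_prime[OF A B])
      have "\<exists>\<sigma>\<in>?\<Sigma>. (\<sigma> \<otimes>\<^bsub>A\<^esub> hat s) \<odot>\<^bsub>?F\<^esub> (hat c \<odot>\<^bsub>?F\<^esub> q) \<in> ?Z"
      proof (rule S.syzygy_multiples_cancel[where p = "hat \<pi>" and s = "hat s" and H = "\<lambda>f. hat c \<odot>\<^bsub>?F\<^esub> f"])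
        show "equational_mod A B ?\<Sigma> (ideal_times P A) (ideal_times P (restrict_scalars A B))"
          unfolding hat_def by (rule p.equational_mod_of_flat_base_change[OF A B closed[OF Pmax]])
        show "\<sigma> \<otimes>\<^bsub>A\<^esub> a = a \<otimes>\<^bsub>A\<^esub> \<sigma>" if "\<sigma> \<in> ?\<Sigma>" "a \<in> carrier A" for \<sigma> a using that hat_central by auto
        show "hat s \<otimes>\<^bsub>A\<^esub> a = a \<otimes>\<^bsub>A\<^esub> hat s" "hat \<pi> \<otimes>\<^bsub>A\<^esub> a = a \<otimes>\<^bsub>A\<^esub> hat \<pi>" if "a \<in> carrier A" for a
          using that hat_central \<pi>(2) \<pi>R by auto
        show "hat s \<in> carrier A" "hat \<pi> \<in> carrier A" using hat \<pi>(2) \<pi>R by auto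
        show "a = \<zero>\<^bsub>A\<^esub>" if "a \<in> carrier A" "hat \<pi> \<otimes>\<^bsub>A\<^esub> a = \<zero>\<^bsub>A\<^esub>" for a
          by (rule flat_imp_torsion_free[OF R.domain_axioms flatA \<pi>R \<pi>(4) that(1)])
            (use that \<pi>R in \<open>simp add: hat_smult\<close>)
        show "x = \<zero>\<^bsub>B\<^esub>" if "x \<in> carrier B" "hat \<pi> \<odot>\<^bsub>B\<^esub> x = \<zero>\<^bsub>B\<^esub>" for x
          using flat_imp_torsion_free[OF R.domain_axioms flatB \<pi>R \<pi>(4), of x] that by (simp add: hat_def)
        show "\<exists>a'\<in>carrier A. hat s \<otimes>\<^bsub>A\<^esub> a = hat \<pi> \<otimes>\<^bsub>A\<^esub> a'" if a: "a \<in> ideal_times P A" for a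
        proof -
          have "a \<in> carrier A" using S.ideal(1) a by blast
          then show ?thesis using ideal_times_divides[OF A.module_axioms PR \<pi>R \<pi>(2) \<pi>(5) a] \<pi>(2) \<pi>R by (auto simp: hat_smult)
        qed
        show "\<exists>x'\<in>carrier B. hat s \<odot>\<^bsub>B\<^esub> x = hat \<pi> \<odot>\<^bsub>B\<^esub> x'" if "x \<in> ideal_times P (restrict_scalars A B)" for x
          using ideal_times_divides[OF module_restrict_scalars(1)[OF A B] PR \<pi>R \<pi>(2) \<pi>(5) that] by (simp add: hat_def)
        show "(\<lambda>f. hat c \<odot>\<^bsub>?F\<^esub> f) \<in> mod_hom A ?F ?F"
          by (rule F.mod_hom_central[OF hat[OF c(2)] hat_central[OF c(2)] mod_hom_id])
        show "hat \<pi> \<odot>\<^bsub>?F\<^esub> (hat c \<odot>\<^bsub>?F\<^esub> q) \<in> ?Z"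
          using \<pi>(1) hmq[OF \<pi>R c(2)] unfolding c(1) ann_def by simp
      qed (rule q(1))
      then obtain w where w: "w \<in> carrier R" "w \<notin> P" "(hat w \<otimes>\<^bsub>A\<^esub> hat s) \<odot>\<^bsub>?F\<^esub> (hat c \<odot>\<^bsub>?F\<^esub> q) \<in> ?Z" by blast
      have "w \<otimes>\<^bsub>R\<^esub> s \<in> P"
        using w \<pi>(2) hmq[of "w \<otimes>\<^bsub>R\<^esub> s" c] c(2) unfolding c(1) ann_def by (simp add: hat_mult)
      then show False using primeideal.I_prime[OF P(2)] w \<pi>(2,3) by blast
    qed
  qed
qed

theorem lemma3p1:
  fixes R :: "('r, 'x) ring_scheme"
    and A :: "('r, 'a, 'y) module_scheme"
    and B :: "('a, 'b, 'z) module_scheme"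
  assumes "dedekind_ring R"
    and "assoc_algebra R A"
    and "left_module A B"
    and "flat R A"
    and "flat R (restrict_scalars A B)"
  shows "flat A B \<longleftrightarrow>
    flat (base_change_ring R A (fraction_field R) (to_fraction_field R))
      (base_change_module R A B (fraction_field R) (to_fraction_field R)) \<and>
    (\<forall>\<mm>. maximalideal \<mm> R \<longrightarrow>
      flat (base_change_ring R A (R Quot \<mm>) (\<lambda>r. \<mm> +>\<^bsub>R\<^esub> r))
        (base_change_module R A B (R Quot \<mm>) (\<lambda>r. \<mm> +>\<^bsub>R\<^esub> r)))"
proof (intro iffI conjI allI impI)
  interpret R: noetherian_domain R using assms(1) by (simp add: dedekind_ring_def)
  {
    assume flat: "flat A B"
    show "flat (base_change_ring R A (fraction_field R) (to_fraction_field R))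
        (base_change_module R A B (fraction_field R) (to_fraction_field R))"
      by (rule residue_field_at.flat_base_change[OF R.residue_field_at_fraction_field assms(2,3) flat])
    show "flat (base_change_ring R A (R Quot \<mm>) (\<lambda>r. \<mm> +>\<^bsub>R\<^esub> r))
        (base_change_module R A B (R Quot \<mm>) (\<lambda>r. \<mm> +>\<^bsub>R\<^esub> r))" if "maximalideal \<mm> R" for \<mm>
      by (rule residue_field_at.flat_base_change[OF R.residue_field_at_quotient[OF that] assms(2,3) flat])
  }
qed (rule flat_of_flat_residue_fields[OF assms], blast+)

end
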